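(* Consider the equation $$X_t=X_0+\int_0^ta(X_s)\,dB_s+\int_0^tb(X_s)\,ds,\qquad t\ge0.$$ Suppose that $a,b:\mathbb{R}\to\mathbb{R}$ are bounded continuous functions which satisfy: 1. $a$ satisfies the $(LT)$ condition; 2. $a(0)=0$, $a(x)\ne0$ for $x\ne0$, and $b(0)\ne0$. Then pathwise uniqueness holds for this equation.
   Context: $(LT)$ condition: a measurable function $a:\mathbb{R}\to\mathbb{R}$ satisfies $(LT)$ if, whenever $V^1$ and $V^2$ are continuous adapted processes of bounded variation on some filtered probability space carrying a Brownian motion $B$, and $X^i$ ($i=1,2$) are adapted solutions of $X^i_t=x_0+\int_0^ta(X^i_s)\,dB_s+V^i_t$, $i=1,2$, then $L^0_t(X^1-X^2)=0$ for all $t\ge0$. Here $L^0(Z)$ is the local time at $0$ of a continuous semimartingale $Z$, given by $\frac12L^0_t(Z)=Z_t^+-Z_0^+-\int_0^t1_{\{Z_s>0\}}\,dZ_s$. Pathwise uniqueness: any two solutions on the same filtered probability space, with the same Brownian motion $B$ and a.s. equal initial values, are indistinguishable. *)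

theory Defs
  imports "HOL-Probability.Probability"
begin

text \<open>
  A process is a function of type \<open>real \<Rightarrow> 'w \<Rightarrow> real\<close>; only its values at times \<open>t \<ge> 0\<close> matter.
  Filtrations are the library's, indexed by the reals, and the \<open>\<sigma>\<close>-algebras at negative times carry
  no information beyond that at time \<open>0\<close>.
\<close>

section \<open>Filtered probability spaces and processes\<close>

text \<open>The filtration satisfies the usual conditions (completeness and right continuity).\<close>

locale filtered_prob_space = prob_space M + filtration "space M" F
  for M :: "'w measure" and F :: "real \<Rightarrow> 'w measure" +
  assumes subalg: "\<And>t. 0 \<le> t \<Longrightarrow> subalgebra M (F t)"
    and complete: "\<And>A N. N \<in> null_sets M \<Longrightarrow> A \<subseteq> N \<Longrightarrow> A \<in> sets (F 0)"
    and right_continuous: "\<And>t. 0 \<le> t \<Longrightarrow> sets (F t) = (\<Inter>u\<in>{t<..}. sets (F u))"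

definition continuous_adapted ::
    "'w measure \<Rightarrow> (real \<Rightarrow> 'w measure) \<Rightarrow> (real \<Rightarrow> 'w \<Rightarrow> real) \<Rightarrow> bool" where
  "continuous_adapted M F X \<longleftrightarrow>
     (\<forall>t\<ge>0. X t \<in> borel_measurable (F t)) \<and>
     (\<forall>\<omega>\<in>space M. continuous_on {0..} (\<lambda>t. X t \<omega>))"

definition progressive :: "(real \<Rightarrow> 'w measure) \<Rightarrow> (real \<Rightarrow> 'w \<Rightarrow> real) \<Rightarrow> bool" where
  "progressive F H \<longleftrightarrow>
     (\<forall>t\<ge>0. (\<lambda>(s, \<omega>). H s \<omega>) \<in> borel_measurable (restrict_space borel {0..t} \<Otimes>\<^sub>M F t))"

definition indistinguishable ::
    "'w measure \<Rightarrow> (real \<Rightarrow> 'w \<Rightarrow> real) \<Rightarrow> (real \<Rightarrow> 'w \<Rightarrow> real) \<Rightarrow> bool" where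
  "indistinguishable M X Y \<longleftrightarrow> (AE \<omega> in M. \<forall>t\<ge>0. X t \<omega> = Y t \<omega>)"

definition brownian_motion ::
    "'w measure \<Rightarrow> (real \<Rightarrow> 'w measure) \<Rightarrow> (real \<Rightarrow> 'w \<Rightarrow> real) \<Rightarrow> bool" where
  "brownian_motion M F B \<longleftrightarrow>
     continuous_adapted M F B \<and> (AE \<omega> in M. B 0 \<omega> = 0) \<and>
     (\<forall>s t. 0 \<le> s \<and> s < t \<longrightarrow>
        distributed M lborel (\<lambda>\<omega>. B t \<omega> - B s \<omega>) (\<lambda>x. ennreal (normal_density 0 (sqrt (t - s)) x)) \<and>
        prob_space.indep_set M (sets (F s))
          {(\<lambda>\<omega>. B t \<omega> - B s \<omega>) -` A \<inter> space M | A. A \<in> sets borel})"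

section \<open>Bounded variation and Stieltjes integrals\<close>

definition total_variation :: "(real \<Rightarrow> real) \<Rightarrow> real \<Rightarrow> ennreal" where
  "total_variation f t =
     (SUP (n, \<tau>) \<in> {(n :: nat, \<tau> :: nat \<Rightarrow> real). mono \<tau> \<and> \<tau> 0 = 0 \<and> \<tau> n = t}.
        \<Sum>i<n. ennreal \<bar>f (\<tau> (Suc i)) - f (\<tau> i)\<bar>)"

definition bounded_variation_process :: "'w measure \<Rightarrow> (real \<Rightarrow> 'w \<Rightarrow> real) \<Rightarrow> bool" where
  "bounded_variation_process M V \<longleftrightarrow>
     (\<forall>\<omega>\<in>space M. \<forall>t\<ge>0. total_variation (\<lambda>s. V s \<omega>) t < \<infinity>)"

text \<open>
  For \<open>f\<close> continuous and of locally bounded variation on \<open>[0, \<infinity>)\<close>, these are the measure \<open>|df|\<close> and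
  the two measures of the Jordan decomposition \<open>df = df\<^sup>+ - df\<^sup>-\<close>. Functions are frozen before time
  \<open>0\<close>, so that \<open>(-\<infinity>, 0]\<close> carries no mass.
\<close>

definition variation_measure :: "(real \<Rightarrow> real) \<Rightarrow> real measure" where
  "variation_measure f = interval_measure (\<lambda>s. enn2real (total_variation f (max 0 s)))"

definition pos_variation_measure :: "(real \<Rightarrow> real) \<Rightarrow> real measure" where
  "pos_variation_measure f =
     interval_measure (\<lambda>s. (enn2real (total_variation f (max 0 s)) + f (max 0 s)) / 2)"

definition neg_variation_measure :: "(real \<Rightarrow> real) \<Rightarrow> real measure" where
  "neg_variation_measure f =
     interval_measure (\<lambda>s. (enn2real (total_variation f (max 0 s)) - f (max 0 s)) / 2)"

definition stieltjes_integral :: "(real \<Rightarrow> real) \<Rightarrow> (real \<Rightarrow> real) \<Rightarrow> real \<Rightarrow> real" where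
  "stieltjes_integral h f t =
     (LINT s:{0..t}|pos_variation_measure f. h s) - (LINT s:{0..t}|neg_variation_measure f. h s)"

section \<open>Martingales and the bracket\<close>

definition martingale ::
    "'w measure \<Rightarrow> (real \<Rightarrow> 'w measure) \<Rightarrow> (real \<Rightarrow> 'w \<Rightarrow> real) \<Rightarrow> bool" where
  "martingale M F X \<longleftrightarrow>
     (\<forall>t\<ge>0. X t \<in> borel_measurable (F t) \<and> integrable M (X t)) \<and>
     (\<forall>s t. 0 \<le> s \<and> s \<le> t \<longrightarrow> (AE \<omega> in M. real_cond_exp M (F s) (X t) \<omega> = X s \<omega>))"

text \<open>
  Library stopping times are real valued; taking \<open>min (\<tau> n) n\<close>, this loses nothing for localizing
  sequences.
\<close>

definition continuous_local_martingale ::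
    "'w measure \<Rightarrow> (real \<Rightarrow> 'w measure) \<Rightarrow> (real \<Rightarrow> 'w \<Rightarrow> real) \<Rightarrow> bool" where
  "continuous_local_martingale M F N \<longleftrightarrow>
     continuous_adapted M F N \<and>
     (\<exists>\<tau> :: nat \<Rightarrow> 'w \<Rightarrow> real.
        (\<forall>n. stopping_time F (\<tau> n)) \<and>
        (\<forall>\<omega>\<in>space M. (\<forall>n. 0 \<le> \<tau> n \<omega>) \<and> incseq (\<lambda>n. \<tau> n \<omega>)) \<and>
        (AE \<omega> in M. filterlim (\<lambda>n. \<tau> n \<omega>) at_top sequentially) \<and>
        (\<forall>n. martingale M F (\<lambda>t \<omega>. N (min t (\<tau> n \<omega>)) \<omega> - N 0 \<omega>)))"

definition is_bracket ::
    "'w measure \<Rightarrow> (real \<Rightarrow> 'w measure) \<Rightarrow> (real \<Rightarrow> 'w \<Rightarrow> real) \<Rightarrow> (real \<Rightarrow> 'w \<Rightarrow> real) \<Rightarrow> bool" where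
  "is_bracket M F N Q \<longleftrightarrow>
     continuous_adapted M F Q \<and>
     (\<forall>\<omega>\<in>space M. Q 0 \<omega> = 0 \<and> mono_on {0..} (\<lambda>t. Q t \<omega>)) \<and>
     continuous_local_martingale M F (\<lambda>t \<omega>. (N t \<omega> - N 0 \<omega>)\<^sup>2 - Q t \<omega>)"

definition bracket_measure :: "(real \<Rightarrow> 'w \<Rightarrow> real) \<Rightarrow> 'w \<Rightarrow> real measure" where
  "bracket_measure Q \<omega> = interval_measure (\<lambda>s. Q (max 0 s) \<omega>)"

section \<open>Stochastic integrals\<close>

text \<open>
  The triple \<open>(n, \<tau>, \<xi>)\<close> stands for the process \<open>\<Sum>i<n. \<xi>\<^sub>i \<cdot> 1\<^bsub>(\<tau>\<^sub>i, \<tau>\<^sub>i\<^sub>+\<^sub>1]\<^esub>\<close> with deterministic times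
  \<open>\<tau>\<^sub>i\<close> and bounded \<open>F\<^bsub>\<tau>\<^sub>i\<^esub>\<close>-measurable \<open>\<xi>\<^sub>i\<close>.
\<close>

type_synonym 'w simple_proc = "nat \<times> (nat \<Rightarrow> real) \<times> (nat \<Rightarrow> 'w \<Rightarrow> real)"

definition simple_process :: "'w measure \<Rightarrow> (real \<Rightarrow> 'w measure) \<Rightarrow> 'w simple_proc \<Rightarrow> bool" where
  "simple_process M F K \<longleftrightarrow> (case K of (n, \<tau>, \<xi>) \<Rightarrow>
     0 \<le> \<tau> 0 \<and> mono \<tau> \<and>
     (\<forall>i<n. \<xi> i \<in> borel_measurable (F (\<tau> i)) \<and> bounded (\<xi> i ` space M)))"

definition simple_value :: "'w simple_proc \<Rightarrow> real \<Rightarrow> 'w \<Rightarrow> real" where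
  "simple_value K t \<omega> = (case K of (n, \<tau>, \<xi>) \<Rightarrow>
     \<Sum>i<n. \<xi> i \<omega> * indicator {\<tau> i<..\<tau> (Suc i)} t)"

definition simple_integral :: "'w simple_proc \<Rightarrow> (real \<Rightarrow> 'w \<Rightarrow> real) \<Rightarrow> real \<Rightarrow> 'w \<Rightarrow> real" where
  "simple_integral K N t \<omega> = (case K of (n, \<tau>, \<xi>) \<Rightarrow>
     \<Sum>i<n. \<xi> i \<omega> * (N (min t (\<tau> (Suc i))) \<omega> - N (min t (\<tau> i)) \<omega>))"

definition tendsto_zero_in_prob :: "'w measure \<Rightarrow> (nat \<Rightarrow> 'w \<Rightarrow> ennreal) \<Rightarrow> bool" where
  "tendsto_zero_in_prob M Y \<longleftrightarrow>
     (\<forall>n. Y n \<in> borel_measurable M) \<and>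
     (\<forall>\<epsilon>>0. (\<lambda>n. measure M {\<omega>\<in>space M. ennreal \<epsilon> < Y n \<omega>}) \<longlonglongrightarrow> 0)"

text \<open>
  \<open>I\<close> is a version of \<open>\<integral> H dN\<close>, as the limit of integrals of simple processes, uniformly on compacts
  in probability. Because the first limit is taken in \<open>[0, \<infinity>]\<close>, it forces \<open>\<integral>\<^sub>0\<^sup>t H\<^sup>2 d\<langle>N\<rangle> < \<infinity>\<close> almost
  surely; conversely this condition suffices for such an \<open>I\<close> to exist, and \<open>I\<close> is then unique up to
  indistinguishability.
\<close>

definition has_local_mart_integral ::
    "'w measure \<Rightarrow> (real \<Rightarrow> 'w measure) \<Rightarrow> (real \<Rightarrow> 'w \<Rightarrow> real) \<Rightarrow> (real \<Rightarrow> 'w \<Rightarrow> real) \<Rightarrow>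
     (real \<Rightarrow> 'w \<Rightarrow> real) \<Rightarrow> bool" where
  "has_local_mart_integral M F N H I \<longleftrightarrow>
     continuous_local_martingale M F N \<and> progressive F H \<and> continuous_adapted M F I \<and>
     (\<exists>Q K. is_bracket M F N Q \<and> (\<forall>n. simple_process M F (K n)) \<and>
        (\<forall>t\<ge>0. tendsto_zero_in_prob M (\<lambda>n \<omega>.
           \<integral>\<^sup>+s\<in>{0..t}. ennreal ((simple_value (K n) s \<omega> - H s \<omega>)\<^sup>2) \<partial>bracket_measure Q \<omega>)) \<and>
        (\<forall>t\<ge>0. tendsto_zero_in_prob M (\<lambda>n \<omega>.
           SUP s\<in>{0..t}. ennreal \<bar>simple_integral (K n) N s \<omega> - I s \<omega>\<bar>)))"

text \<open>\<open>J\<close> is a version of \<open>\<integral> H dZ\<close> for the continuous semimartingale \<open>Z = Z\<^sub>0 + N + A\<close>.\<close>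

definition semimart_decomposition ::
    "'w measure \<Rightarrow> (real \<Rightarrow> 'w measure) \<Rightarrow> (real \<Rightarrow> 'w \<Rightarrow> real) \<Rightarrow> (real \<Rightarrow> 'w \<Rightarrow> real) \<Rightarrow>
     (real \<Rightarrow> 'w \<Rightarrow> real) \<Rightarrow> bool" where
  "semimart_decomposition M F Z N A \<longleftrightarrow>
     continuous_adapted M F Z \<and>
     continuous_local_martingale M F N \<and> (\<forall>\<omega>\<in>space M. N 0 \<omega> = 0) \<and>
     continuous_adapted M F A \<and> bounded_variation_process M A \<and> (\<forall>\<omega>\<in>space M. A 0 \<omega> = 0) \<and>
     indistinguishable M Z (\<lambda>t \<omega>. Z 0 \<omega> + N t \<omega> + A t \<omega>)"

definition has_semimart_integral ::
    "'w measure \<Rightarrow> (real \<Rightarrow> 'w measure) \<Rightarrow> (real \<Rightarrow> 'w \<Rightarrow> real) \<Rightarrow> (real \<Rightarrow> 'w \<Rightarrow> real) \<Rightarrow>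
     (real \<Rightarrow> 'w \<Rightarrow> real) \<Rightarrow> bool" where
  "has_semimart_integral M F Z H J \<longleftrightarrow>
     (\<exists>N A I. semimart_decomposition M F Z N A \<and> has_local_mart_integral M F N H I \<and>
        (AE \<omega> in M. \<forall>t\<ge>0.
           set_integrable (variation_measure (\<lambda>s. A s \<omega>)) {0..t} (\<lambda>s. H s \<omega>)) \<and>
        indistinguishable M J
          (\<lambda>t \<omega>. I t \<omega> + stieltjes_integral (\<lambda>s. H s \<omega>) (\<lambda>s. A s \<omega>) t))"

text \<open>\<open>L\<close> is a version of the local time of \<open>Z\<close> at \<open>0\<close>.\<close>

definition is_local_time_at_zero ::
    "'w measure \<Rightarrow> (real \<Rightarrow> 'w measure) \<Rightarrow> (real \<Rightarrow> 'w \<Rightarrow> real) \<Rightarrow> (real \<Rightarrow> 'w \<Rightarrow> real) \<Rightarrow> bool" where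
  "is_local_time_at_zero M F Z L \<longleftrightarrow>
     (\<exists>J. has_semimart_integral M F Z (\<lambda>s \<omega>. if Z s \<omega> > 0 then 1 else 0) J \<and>
        indistinguishable M (\<lambda>t \<omega>. 1/2 * L t \<omega>) (\<lambda>t \<omega>. max (Z t \<omega>) 0 - max (Z 0 \<omega>) 0 - J t \<omega>))"

section \<open>Equations, the (LT) condition, pathwise uniqueness\<close>

text \<open>\<open>X\<close> is an adapted solution of \<open>X\<^sub>t = \<xi> + \<integral>\<^sub>0\<^sup>t a(X\<^sub>s) dB\<^sub>s + V\<^sub>t\<close>.\<close>

definition solves ::
    "'w measure \<Rightarrow> (real \<Rightarrow> 'w measure) \<Rightarrow> (real \<Rightarrow> 'w \<Rightarrow> real) \<Rightarrow> (real \<Rightarrow> real) \<Rightarrow>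
     ('w \<Rightarrow> real) \<Rightarrow> (real \<Rightarrow> 'w \<Rightarrow> real) \<Rightarrow> (real \<Rightarrow> 'w \<Rightarrow> real) \<Rightarrow> bool" where
  "solves M F B a \<xi> V X \<longleftrightarrow>
     continuous_adapted M F X \<and>
     (\<exists>I. has_local_mart_integral M F B (\<lambda>s \<omega>. a (X s \<omega>)) I \<and>
          indistinguishable M X (\<lambda>t \<omega>. \<xi> \<omega> + I t \<omega> + V t \<omega>))"

text \<open>
  HOL cannot quantify over types inside a formula, so the type \<open>'w\<close> of outcomes is a parameter of the
  following two notions. As local times are unique up to indistinguishability, \<open>L\<^sup>0(X\<^sup>1 - X\<^sup>2) = 0\<close> is
  expressed by the zero process being a version of \<open>L\<^sup>0(X\<^sup>1 - X\<^sup>2)\<close>. No condition on \<open>V\<^sup>i\<close> at time \<open>0\<close> is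
  imposed.
\<close>

definition LT_condition :: "'w itself \<Rightarrow> (real \<Rightarrow> real) \<Rightarrow> bool" where
  "LT_condition (_ :: 'w itself) a \<longleftrightarrow>
     a \<in> borel_measurable borel \<and>
     (\<forall>(M :: 'w measure) F B V1 V2 X1 X2 x0.
        filtered_prob_space M F \<longrightarrow> brownian_motion M F B \<longrightarrow>
        continuous_adapted M F V1 \<longrightarrow> bounded_variation_process M V1 \<longrightarrow>
        continuous_adapted M F V2 \<longrightarrow> bounded_variation_process M V2 \<longrightarrow>
        solves M F B a (\<lambda>_. x0) V1 X1 \<longrightarrow> solves M F B a (\<lambda>_. x0) V2 X2 \<longrightarrow>
        is_local_time_at_zero M F (\<lambda>t \<omega>. X1 t \<omega> - X2 t \<omega>) (\<lambda>t \<omega>. 0))"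

definition sde_solution ::
    "'w measure \<Rightarrow> (real \<Rightarrow> 'w measure) \<Rightarrow> (real \<Rightarrow> 'w \<Rightarrow> real) \<Rightarrow> (real \<Rightarrow> real) \<Rightarrow>
     (real \<Rightarrow> real) \<Rightarrow> (real \<Rightarrow> 'w \<Rightarrow> real) \<Rightarrow> bool" where
  "sde_solution M F B a b X \<longleftrightarrow>
     solves M F B a (X 0) (\<lambda>t \<omega>. LINT s:{0..t}|lborel. b (X s \<omega>)) X"

definition pathwise_uniqueness :: "'w itself \<Rightarrow> (real \<Rightarrow> real) \<Rightarrow> (real \<Rightarrow> real) \<Rightarrow> bool" where
  "pathwise_uniqueness (_ :: 'w itself) a b \<longleftrightarrow>
     (\<forall>(M :: 'w measure) F B X1 X2.
        filtered_prob_space M F \<longrightarrow> brownian_motion M F B \<longrightarrow>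
        sde_solution M F B a b X1 \<longrightarrow> sde_solution M F B a b X2 \<longrightarrow>
        (AE \<omega> in M. X1 0 \<omega> = X2 0 \<omega>) \<longrightarrow>
        indistinguishable M X1 X2)"

end

theory Submission
  imports Defs
begin

text \<open>
  Write \<open>X\<close>, \<open>Y\<close> for two solutions with the same initial value. Since \<open>a\<close> satisfies \<open>(LT)\<close>, Tanaka's formula
  for the difference of two processes with coefficient \<open>a\<close> has no local time term. One such process is
  \<open>0\<close>, as \<open>a(0) = 0\<close>; comparing it with \<open>X\<close> gives \<open>b(0) E[\<integral>\<^sub>0\<^sup>t 1{X = 0} ds] = 0\<close>, so solutions spend no
  time at \<open>0\<close>. Property \<open>(LT)\<close> also makes \<open>X \<or> Y\<close> a solution of the same equation, at least for expectations of smooth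
  functions: this is obtained from Ito's formula for smooth approximations of the maximum.
  Where \<open>a \<noteq> 0\<close> one can solve \<open>a\<^sup>2 F'' / 2 + b F' = k\<close> with \<open>F' \<ge> m > 0\<close>; here \<open>k\<close> is the sign of \<open>b(0)\<close>, and
  \<open>m\<close> and the bounds on \<open>F'\<close> and on the left-hand side do not depend on the neighbourhood \<open>(-e, e)\<close> of \<open>0\<close> in which
  the equation is given up. Hence the expectations of \<open>F(X \<or> Y)\<close> and \<open>F(X)\<close> at the exit time from \<open>[-R, R]\<close>
  differ at most by a multiple of the time spent in \<open>(-e, e)\<close>, which tends to \<open>0\<close> with \<open>e\<close>, while the
  difference is at least \<open>m E[(Y - X)\<^sup>+]\<close>. So \<open>Y \<le> X\<close>, and by symmetry \<open>X = Y\<close>.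
\<close>

section \<open>Integration preliminaries\<close>

text \<open>The stochastic integral and local time are defined existentially: a bracket, a
  semimartingale decomposition and approximating simple processes come with no link to the Brownian
  motion at hand. The constancy of continuous martingales of bounded variation ties them to
  \<open>t\<close>, to the Brownian integral and to the Lebesgue drift; after that only identities
  between expectations are used. The obstacle in the differential equation is that
  \<open>2 / a\<^sup>2\<close> can be unbounded near 0, so that a solution could blow up as the
  neighbourhood shrinks. The choice of \<open>k\<close> excludes this: near 0, where
  \<open>b\<close> keeps the sign of \<open>b 0\<close>, a derivative \<open>F'\<close> above
  \<open>2 / \<bar>b 0\<bar>\<close> is driven down when one moves in the direction of that sign,
  however large the factor is. Away from 0 the factor is bounded and growth is at most exponential.
  In Ito's formula for the smoothed maximum the second derivative of the smoothing produces an
  approximate local time. It is nonnegative, so the bounded weight \<open>F'\<close> does no harm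
  and it suffices that its expectation tends to 0; this comes from comparing the formula for
  \<open>F\<close> the identity with (LT).\<close>

lemma integrable_mult_L2:
 fixes f g :: "'a => real"
 assumes [measurable]: "f \<in> borel_measurable M" "g \<in> borel_measurable M"
  and "integrable M (\<lambda>x. (f x)^2)" "integrable M (\<lambda>x. (g x)^2)"
 shows "integrable M (\<lambda>x. f x * g x)"
proof (rule Bochner_Integration.integrable_bound)
 show "integrable M (\<lambda>x. (f x)^2 + (g x)^2)"
  using assms by simp
 show "AE x in M. norm (f x * g x) \<le> norm ((f x)^2 + (g x)^2)"
 proof (rule AE_I2)
  fix x
  have "0 \<le> (\<bar>f x\<bar> - \<bar>g x\<bar>)^2" by simp
  also have "\<dots> = (f x)^2 + (g x)^2 - 2 * (\<bar>f x\<bar> * \<bar>g x\<bar>)"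
   by (simp add: power2_diff)
  finally have "2 * (\<bar>f x\<bar> * \<bar>g x\<bar>) \<le> (f x)^2 + (g x)^2" by simp
  moreover have "0 \<le> \<bar>f x\<bar> * \<bar>g x\<bar>" by simp
  ultimately have "\<bar>f x\<bar> * \<bar>g x\<bar> \<le> (f x)^2 + (g x)^2" by linarith
  then show "norm (f x * g x) \<le> norm ((f x)^2 + (g x)^2)"
   by (simp add: abs_mult)
 qed
qed measurable

lemma integrable_add_L2:
 fixes f g :: "'a => real"
 assumes [measurable]: "f \<in> borel_measurable M" "g \<in> borel_measurable M"
  and "integrable M (\<lambda>x. (f x)^2)" "integrable M (\<lambda>x. (g x)^2)"
 shows "integrable M (\<lambda>x. (f x + g x)^2)"
proof -
 have "integrable M (\<lambda>x. (f x)^2 + (g x)^2 + 2 * (f x * g x))"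
  using assms integrable_mult_L2[of f M g] by (intro Bochner_Integration.integrable_add) simp_all
 then show ?thesis by (simp add: power2_sum mult.assoc)
qed

lemma integrable_diff_L2:
 fixes f g :: "'a => real"
 assumes [measurable]: "f \<in> borel_measurable M" "g \<in> borel_measurable M"
  and "integrable M (\<lambda>x. (f x)^2)" "integrable M (\<lambda>x. (g x)^2)"
 shows "integrable M (\<lambda>x. (f x - g x)^2)"
 using integrable_add_L2[of f M "\<lambda>x. - g x"] assms by simp

lemma integrable_bounded_mult:
 fixes f g :: "'a => real"
 assumes "integrable M f" and [measurable]: "g \<in> borel_measurable M"
  and "\<And>x. x \<in> space M ==> \<bar>g x\<bar> \<le> c"
 shows "integrable M (\<lambda>x. g x * f x)"
proof (rule Bochner_Integration.integrable_bound)
 show "integrable M (\<lambda>x. c * f x)" using assms by simp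
 show "(\<lambda>x. g x * f x) \<in> borel_measurable M" using assms by simp
 show "AE x in M. norm (g x * f x) \<le> norm (c * f x)"
 proof (rule AE_I2)
  fix x assume "x \<in> space M"
  then have "\<bar>g x\<bar> \<le> \<bar>c\<bar>" using assms(3)[of x] by simp
  then show "norm (g x * f x) \<le> norm (c * f x)"
   by (simp add: abs_mult mult_right_mono)
 qed
qed

text \<open>Weighted arithmetic-geometric mean inequality, from the square of
  \<open>2 * e * \<bar>x\<bar> - \<bar>y\<bar>\<close>. With one factor equal to 1 it trades a first
  power for a small constant and a multiple of the square, or conversely.\<close>

lemma abs_mult_le_weighted:
 fixes x y e :: real assumes "0 < e"
 shows "\<bar>x * y\<bar> \<le> e * x^2 + y^2 / (4 * e)"
proof -
 have "0 \<le> (2 * e * \<bar>x\<bar> - \<bar>y\<bar>)^2 / (4 * e)" using assms by simp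
 also have "(2 * e * \<bar>x\<bar> - \<bar>y\<bar>)^2 = 4 * e^2 * x^2 + y^2 - 4 * e * \<bar>x * y\<bar>"
  by (simp add: power2_diff power_mult_distrib abs_mult)
 also have "(4 * e^2 * x^2 + y^2 - 4 * e * \<bar>x * y\<bar>) / (4 * e) = e * x^2 + y^2 / (4 * e) - \<bar>x * y\<bar>"
  using assms by (simp add: field_simps power2_eq_square)
 finally show ?thesis by simp
qed

section \<open>Convergence in probability under second moment bounds\<close>

context prob_space
begin

notation expectation ("\<E>")

lemma bounded_integrable:
 fixes f :: "'a => real"
 assumes "f \<in> borel_measurable M" "\<And>x. x \<in> space M ==> \<bar>f x\<bar> \<le> c"
 shows "integrable M f"
 using assms by (intro integrable_const_bound[of _ c]) auto

text \<open>Real-valued counterpart of \<open>tendsto_zero_in_prob\<close>, to which the limits in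
  the definition of the integral are transferred.\<close>

definition null_in_prob :: "(nat => 'a => real) => bool" where
 "null_in_prob Y \<longleftrightarrow> (\<forall>n. Y n \<in> borel_measurable M) \<and>
  (\<forall>e>0. (\<lambda>n. prob {w\<in>space M. e < \<bar>Y n w\<bar>}) \<longlonglongrightarrow> 0)"

lemma null_in_prob_le_add:
 assumes U: "null_in_prob U" and V: "null_in_prob V" and W[measurable]: "\<And>n. W n \<in> borel_measurable M"
  and le: "\<And>n w. w \<in> space M ==> \<bar>W n w\<bar> \<le> \<bar>U n w\<bar> + \<bar>V n w\<bar>"
 shows "null_in_prob W"
 unfolding null_in_prob_def
proof (intro conjI allI impI W)
 fix e :: real assume "0 < e"
 then have e: "0 < e / 2" by simp
 have [measurable]: "U n \<in> borel_measurable M" "V n \<in> borel_measurable M" for n using U V by (auto simp: null_in_prob_def)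
 show "(\<lambda>n. prob {w\<in>space M. e < \<bar>W n w\<bar>}) \<longlonglongrightarrow> 0"
 proof (rule tendsto_sandwich[where f="\<lambda>_. 0"])
  show "(\<lambda>n. prob {w\<in>space M. e/2 < \<bar>U n w\<bar>} + prob {w\<in>space M. e/2 < \<bar>V n w\<bar>}) \<longlonglongrightarrow> 0"
   using U V e by (intro tendsto_add_zero) (simp_all only: null_in_prob_def)
  have "prob {w\<in>space M. e < \<bar>W n w\<bar>} \<le> prob ({w\<in>space M. e/2 < \<bar>U n w\<bar>} \<union> {w\<in>space M. e/2 < \<bar>V n w\<bar>})" for n
  proof (rule finite_measure_mono, safe)
   fix w assume "w \<in> space M" "e < \<bar>W n w\<bar>" "\<not> e/2 < \<bar>V n w\<bar>"
   then show "e/2 < \<bar>U n w\<bar>" using le[of w n] by linarith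
  qed auto
  then have "prob {w\<in>space M. e < \<bar>W n w\<bar>} \<le> prob {w\<in>space M. e/2 < \<bar>U n w\<bar>} + prob {w\<in>space M. e/2 < \<bar>V n w\<bar>}" for n
   by (rule order_trans[OF _ measure_Un_le]) auto
  then show "\<forall>\<^sub>F n in sequentially. prob {w\<in>space M. e < \<bar>W n w\<bar>} \<le> prob {w\<in>space M. e/2 < \<bar>U n w\<bar>} + prob {w\<in>space M. e/2 < \<bar>V n w\<bar>}"
   by simp
 qed auto
qed

text \<open>Thresholds are cut down to \<open>min e 1\<close>, so domination is used only where
  \<open>Y n \<le> 1\<close>. This admits a stopped process as \<open>Z n\<close>, which is known to
  agree with the unstopped one only there.\<close>

lemma null_in_prob_ennreal:
 assumes Y: "tendsto_zero_in_prob M Y" and Z: "\<And>n. Z n \<in> borel_measurable M"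
  and le: "\<And>n. AE w in M. Y n w \<le> 1 \<longrightarrow> ennreal \<bar>Z n w\<bar> \<le> Y n w"
 shows "null_in_prob Z"
 unfolding null_in_prob_def
proof (intro conjI allI impI Z)
 fix e :: real assume e: "0 < e"
 have [measurable]: "Y n \<in> borel_measurable M" for n using Y by (simp add: tendsto_zero_in_prob_def)
 show "(\<lambda>n. prob {w\<in>space M. e < \<bar>Z n w\<bar>}) \<longlonglongrightarrow> 0"
 proof (rule tendsto_sandwich[OF _ _ tendsto_const])
  show "(\<lambda>n. prob {w\<in>space M. ennreal (min e 1) < Y n w}) \<longlonglongrightarrow> 0"
   using Y[unfolded tendsto_zero_in_prob_def, THEN conjunct2, rule_format, of "min e 1"] e by simp
  have "AE w in M. e < \<bar>Z n w\<bar> \<longrightarrow> ennreal (min e 1) < Y n w" for n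
   using le[of n]
  proof eventually_elim
   case (elim w)
   have False if "e < \<bar>Z n w\<bar>" and Ye: "Y n w \<le> ennreal (min e 1)"
   proof -
    have "ennreal (min e 1) \<le> ennreal 1" by (intro ennreal_leI) simp
    then have "ennreal \<bar>Z n w\<bar> \<le> ennreal (min e 1)" using elim Ye by (auto intro: order_trans)
    then show False using that(1) e by (simp add: ennreal_le_iff)
   qed
   then show ?case using not_le by blast
  qed
  then have "AE w in M. w \<in> {w\<in>space M. e < \<bar>Z n w\<bar>} \<longrightarrow> w \<in> {w\<in>space M. ennreal (min e 1) < Y n w}" for n
   by simp
  from finite_measure_mono_AE[OF this]
  show "\<forall>\<^sub>F n in sequentially. prob {w\<in>space M. e < \<bar>Z n w\<bar>} \<le> prob {w\<in>space M. ennreal (min e 1) < Y n w}"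
   by simp
 qed simp
qed

lemma null_in_prob_AE:
 assumes Y[measurable]: "\<And>n. Y n \<in> borel_measurable M" and lim: "AE w in M. (\<lambda>n. Y n w) \<longlonglongrightarrow> 0"
 shows "null_in_prob Y"
 unfolding null_in_prob_def
proof (intro conjI allI impI Y)
 fix e :: real assume e: "0 < e"
 have "(\<lambda>n. \<E> (indicat_real {w\<in>space M. e < \<bar>Y n w\<bar>})) \<longlonglongrightarrow> \<E> (\<lambda>_. 0)"
 proof (rule integral_dominated_convergence[where w = "\<lambda>_. 1"])
  show "AE w in M. (\<lambda>n. indicat_real {w\<in>space M. e < \<bar>Y n w\<bar>} w) \<longlonglongrightarrow> 0"
   using lim
  proof eventually_elim
   case (elim w)
   from order_tendstoD(2)[OF tendsto_rabs_zero[OF this] e]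
   have "\<forall>\<^sub>F n in sequentially. indicat_real {w\<in>space M. e < \<bar>Y n w\<bar>} w = 0"
    by eventually_elim (auto simp: indicator_def)
   then show ?case by (rule tendsto_eventually)
  qed
 qed auto
 then show "(\<lambda>n. prob {w\<in>space M. e < \<bar>Y n w\<bar>}) \<longlonglongrightarrow> 0" by simp
qed

text \<open>Bounded second moments give uniform integrability: \<open>\<bar>Y\<bar>\<close> is at
  most \<open>e/3 + d * Y^2\<close> plus \<open>1 / (4 * d)\<close> times the indicator of
  \<open>e/3 < \<bar>Y\<bar>\<close>, and the probability of that event tends to 0.\<close>

lemma expectation_tendsto_zero:
 assumes Y: "null_in_prob Y" and int2: "\<And>n. integrable M (\<lambda>w. (Y n w)^2)"
  and bd: "\<And>n. \<E> (\<lambda>w. (Y n w)^2) \<le> C"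
 shows "(\<lambda>n. \<E> (\<lambda>w. \<bar>Y n w\<bar>)) \<longlonglongrightarrow> 0"
proof (rule order_tendstoI)
 have [measurable]: "Y n \<in> borel_measurable M" for n using Y by (simp add: null_in_prob_def)
 have intY: "integrable M (Y n)" for n
  by (rule square_integrable_imp_integrable[OF _ int2(1)]) simp
 show "\<forall>\<^sub>F n in sequentially. a < \<E> (\<lambda>w. \<bar>Y n w\<bar>)" if "a < 0" for a
  using that by (intro always_eventually allI less_le_trans[OF _ Bochner_Integration.integral_nonneg]) auto
 fix e :: real assume e: "0 < e"
 define d where "d = e / (3 * (\<bar>C\<bar> + 1))"
 have d: "0 < d" using e by (simp add: d_def)
 have "d * C \<le> d * (\<bar>C\<bar> + 1)" using d by (intro mult_left_mono) auto
 also have "\<dots> = e / 3" using abs_ge_zero[of C] by (simp add: d_def divide_simps)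
 finally have dC: "d * C \<le> e / 3" .
 have le: "\<E> (\<lambda>w. \<bar>Y n w\<bar>) \<le> e / 3 + d * C + prob {w\<in>space M. e/3 < \<bar>Y n w\<bar>} / (4 * d)" for n
 proof -
  let ?A = "{w\<in>space M. e/3 < \<bar>Y n w\<bar>}"
  have i: "integrable M (\<lambda>w. d * (Y n w)^2)" "integrable M (\<lambda>w. 1 / (4 * d) * indicat_real ?A w)"
   using int2 by (auto intro!: integrable_real_indicator simp: emeasure_eq_measure simp del: times_divide_eq_left)
  have "\<E> (\<lambda>w. \<bar>Y n w\<bar>) \<le> \<E> (\<lambda>w. e / 3 + d * (Y n w)^2 + 1 / (4 * d) * indicat_real ?A w)"
  proof (rule integral_mono)
   fix w assume w: "w \<in> space M"
   have nn2: "0 \<le> d * (Y n w)^2" using d by simp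
   show "\<bar>Y n w\<bar> \<le> e / 3 + d * (Y n w)^2 + 1 / (4 * d) * indicat_real ?A w"
    using abs_mult_le_weighted[OF d, of "Y n w" 1] w e nn2 by (auto simp: indicator_def)
  qed (use intY i in auto)
  also have "\<dots> = e / 3 + d * \<E> (\<lambda>w. (Y n w)^2) + prob ?A / (4 * d)"
   using i by (simp add: Bochner_Integration.integral_add prob_space del: times_divide_eq_left) simp
  also have "\<dots> \<le> e / 3 + d * C + prob ?A / (4 * d)" using bd[of n] d by simp
  finally show ?thesis .
 qed
 have "(\<lambda>n. prob {w\<in>space M. e/3 < \<bar>Y n w\<bar>}) \<longlonglongrightarrow> 0"
  using Y[unfolded null_in_prob_def, THEN conjunct2, rule_format, of "e/3"] e by simp
 then have "\<forall>\<^sub>F n in sequentially. prob {w\<in>space M. e/3 < \<bar>Y n w\<bar>} < (e/3) * (4*d)"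
  using e d by (intro order_tendstoD) auto
 then show "\<forall>\<^sub>F n in sequentially. \<E> (\<lambda>w. \<bar>Y n w\<bar>) < e"
 proof eventually_elim
  case (elim n)
  then have "prob {w\<in>space M. e/3 < \<bar>Y n w\<bar>} / (4 * d) < e / 3" using d by (simp add: divide_less_eq)
  then show ?case using le[of n] dC by linarith
 qed
qed

text \<open>Truncation at 1 turns convergence in probability into convergence in mean, which has an
  almost surely convergent subsequence; since the limit is 0, the truncation is eventually
  inactive.\<close>

lemma null_in_prob_AE_subseq:
 assumes Y: "null_in_prob Y"
 obtains r :: "nat => nat" where "strict_mono r" "AE w in M. (\<lambda>n. Y (r n) w) \<longlonglongrightarrow> 0"
proof -
 have [measurable]: "Y n \<in> borel_measurable M" for n using Y by (simp add: null_in_prob_def)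
 define U where "U n w = min 1 \<bar>Y n w\<bar>" for n w
 have [measurable]: "U n \<in> borel_measurable M" for n unfolding U_def by measurable
 have Ub: "0 \<le> U n w" "U n w \<le> 1" "(U n w)^2 \<le> 1" for n w by (auto simp: U_def abs_square_le_1)
 have iU: "integrable M (U n)" "integrable M (\<lambda>w. (U n w)^2)" for n
  using Ub by (auto intro!: bounded_integrable[where c=1])
 have "null_in_prob U" by (rule null_in_prob_le_add[OF Y Y]) (auto simp: U_def)
 moreover have "\<E> (\<lambda>w. (U n w)^2) \<le> 1" for n
  using integral_mono[OF iU(2), of "\<lambda>_. 1"] Ub by (simp add: prob_space)
 ultimately have "(\<lambda>n. \<E> (\<lambda>w. \<bar>U n w\<bar>)) \<longlonglongrightarrow> 0" by (rule expectation_tendsto_zero[OF _ iU(2)])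
 then have "(\<lambda>n. \<integral>w. norm (U n w) \<partial>M) \<longlonglongrightarrow> 0" by simp
 from tendsto_L1_AE_subseq[OF iU(1) this] obtain r :: "nat => nat" where r: "strict_mono r" "AE w in M. (\<lambda>n. U (r n) w) \<longlonglongrightarrow> 0"
  by auto
 have "AE w in M. (\<lambda>n. Y (r n) w) \<longlonglongrightarrow> 0"
  using r(2)
 proof eventually_elim
  case (elim w)
  have "\<forall>\<^sub>F n in sequentially. U (r n) w < 1" using elim by (intro order_tendstoD(2)) auto
  then have "\<forall>\<^sub>F n in sequentially. \<bar>Y (r n) w\<bar> = U (r n) w" by eventually_elim (auto simp: U_def)
  then have "(\<lambda>n. \<bar>Y (r n) w\<bar>) \<longlonglongrightarrow> 0" using elim by (simp add: filterlim_cong)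
  then show ?case by (simp add: tendsto_rabs_zero_iff)
 qed
 then show ?thesis using r(1) that by blast
qed

lemma fatou_real:
 fixes Y :: "nat => 'a => real"
 assumes [measurable]: "\<And>n. Y n \<in> borel_measurable M" "Z \<in> borel_measurable M"
  and nn: "\<And>n w. w \<in> space M ==> 0 \<le> Y n w"
  and int: "\<And>n. integrable M (Y n)" and bd: "\<And>n. \<E> (Y n) \<le> C"
  and lim: "AE w in M. (\<lambda>n. Y n w) \<longlonglongrightarrow> Z w"
 shows "integrable M Z" "\<E> Z \<le> C"
proof -
 have Znn: "AE w in M. 0 \<le> Z w"
  using lim AE_space by eventually_elim (use nn in \<open>auto intro: LIMSEQ_le_const\<close>)
 have "(\<integral>\<^sup>+w. ennreal (Z w) \<partial>M) = (\<integral>\<^sup>+w. liminf (\<lambda>n. ennreal (Y n w)) \<partial>M)"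
 proof (rule nn_integral_cong_AE)
  show "AE w in M. ennreal (Z w) = liminf (\<lambda>n. ennreal (Y n w))"
   using lim by eventually_elim (auto intro!: lim_imp_Liminf[symmetric] tendsto_ennrealI)
 qed
 also have "\<dots> \<le> liminf (\<lambda>n. \<integral>\<^sup>+w. ennreal (Y n w) \<partial>M)"
  by (rule nn_integral_liminf) auto
 also have "\<dots> = liminf (\<lambda>n. ennreal (\<E> (Y n)))"
  using nn int by (subst nn_integral_eq_integral) auto
 also have "\<dots> \<le> ennreal C"
 proof -
  have "liminf (\<lambda>n. ennreal (\<E> (Y n))) \<le> liminf (\<lambda>n. ennreal C)"
   using bd by (intro Liminf_mono always_eventually) (auto intro: ennreal_leI)
  then show ?thesis by (simp add: Liminf_const)
 qed
 finally have *: "(\<integral>\<^sup>+w. ennreal (Z w) \<partial>M) \<le> ennreal C" .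
 then have "(\<integral>\<^sup>+w. ennreal (Z w) \<partial>M) < \<infinity>" by (simp add: le_less_trans)
 then show i: "integrable M Z"
  using Znn by (intro integrableI_nonneg) auto
 have C: "0 \<le> C"
 proof -
  have "0 \<le> \<E> (Y 0)" by (rule Bochner_Integration.integral_nonneg) (use nn in auto)
  then show ?thesis using bd[of 0] by simp
 qed
 show "\<E> Z \<le> C"
  using * nn_integral_eq_integral[OF i Znn] C by (simp add: ennreal_le_iff)
qed

text \<open>The passage to the limit used for integrals and stopped values alike. Fatou along an
  almost surely convergent subsequence bounds the second moment of \<open>Z\<close>; then the
  differences have second moment at most \<open>4 * C\<close> and converge to 0 in mean along the
  whole sequence.\<close>

lemma L2_bounded_limit:
 assumes lim: "null_in_prob (\<lambda>n w. Y n w - Z w)"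
  and [measurable]: "\<And>n. Y n \<in> borel_measurable M" "Z \<in> borel_measurable M"
  and int2: "\<And>n. integrable M (\<lambda>w. (Y n w)^2)" and bd: "\<And>n. \<E> (\<lambda>w. (Y n w)^2) \<le> C"
 shows "integrable M (\<lambda>w. (Z w)^2)" "\<E> (\<lambda>w. (Z w)^2) \<le> C"
  "(\<lambda>n. \<E> (Y n)) \<longlonglongrightarrow> \<E> Z"
proof -
 obtain r :: "nat => nat" where "AE w in M. (\<lambda>n. Y (r n) w - Z w) \<longlonglongrightarrow> 0"
  using null_in_prob_AE_subseq[OF lim] by blast
 then have lim2: "AE w in M. (\<lambda>n. (Y (r n) w)^2) \<longlonglongrightarrow> (Z w)^2"
  by eventually_elim (rule tendsto_power[OF LIM_zero_cancel])
 show Z: "integrable M (\<lambda>w. (Z w)^2)" and ZC: "\<E> (\<lambda>w. (Z w)^2) \<le> C"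
  by (rule fatou_real[OF _ _ _ int2 bd lim2]; simp)+
 have i: "integrable M (\<lambda>w. (Y n w - Z w)^2)" for n
  using int2 Z by (intro integrable_diff_L2) auto
 have 1: "(\<lambda>n. \<E> (\<lambda>w. \<bar>Y n w - Z w\<bar>)) \<longlonglongrightarrow> 0"
 proof (rule expectation_tendsto_zero[OF lim i])
  show "\<E> (\<lambda>w. (Y n w - Z w)^2) \<le> 2 * C + 2 * C" for n
  proof -
   have "\<E> (\<lambda>w. (Y n w - Z w)^2) \<le> \<E> (\<lambda>w. 2 * (Y n w)^2 + 2 * (Z w)^2)"
   proof (rule integral_mono)
    fix w
    have "0 \<le> (Y n w + Z w)^2" by simp
    then show "(Y n w - Z w)^2 \<le> 2 * (Y n w)^2 + 2 * (Z w)^2" unfolding power2_diff power2_sum by linarith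
   qed (use i int2 Z in auto)
   also have "\<dots> \<le> 2 * C + 2 * C" using int2 Z bd[of n] ZC by simp
   finally show ?thesis .
  qed
 qed
 have "norm (\<E> (Y n) - \<E> Z) \<le> \<E> (\<lambda>w. \<bar>Y n w - Z w\<bar>)" for n
 proof -
  have "integrable M (Y n)" "integrable M Z"
   by (rule square_integrable_imp_integrable[OF _ int2(1)], simp) (rule square_integrable_imp_integrable[OF _ Z], simp)
  then show ?thesis using integral_abs_bound[of M "\<lambda>w. Y n w - Z w"] by simp
 qed
 then have "(\<lambda>n. \<E> (Y n) - \<E> Z) \<longlonglongrightarrow> 0"
  by (intro Lim_null_comparison[OF always_eventually 1] allI)
 then show "(\<lambda>n. \<E> (Y n)) \<longlonglongrightarrow> \<E> Z" by (simp add: LIM_zero_iff)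
qed

end

section \<open>Brownian increments\<close>

context filtered_prob_space
begin

abbreviation adapted :: "(real => 'w => real) => bool" where
 "adapted \<equiv> continuous_adapted M F"

lemma sets_F_subset: "0 \<le> t ==> sets (F t) \<subseteq> sets M"
 using subalg by (auto simp: subalgebra_def)

lemma measurable_F: "0 \<le> t ==> f \<in> borel_measurable (F t) ==> f \<in> borel_measurable M"
 using measurable_from_subalg[OF subalg] .

lemma measurable_F_mono: "f \<in> borel_measurable (F s) ==> s \<le> t ==> f \<in> borel_measurable (F t)"
 by (rule measurable_from_subalg[of "F t" "F s"]) (auto simp: subalgebra_def space_F sets_F_mono subset_eq
   dest: sets_F_mono[THEN subsetD, rotated])

lemma continuous_adapted_measurable:
 "adapted X ==> 0 \<le> t ==> X t \<in> borel_measurable (F t)"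
 by (simp add: continuous_adapted_def)

lemma continuous_adapted_measurable_M:
 "adapted X ==> 0 \<le> t ==> X t \<in> borel_measurable M"
 by (simp add: continuous_adapted_measurable measurable_F)

lemma continuous_adapted_measurable_le:
 "adapted X ==> 0 \<le> s ==> s \<le> t ==> X s \<in> borel_measurable (F t)"
 using continuous_adapted_measurable measurable_F_mono by blast

end

locale brownian_space = filtered_prob_space +
 fixes B assumes BM: "brownian_motion M F B"
begin

lemma B_adapted: "adapted B"
 using BM by (simp add: brownian_motion_def)

lemma B_meas[measurable]: "0 \<le> t ==> B t \<in> borel_measurable M"
 by (rule continuous_adapted_measurable_M[OF B_adapted])

text \<open>\<open>brownian_motion\<close> states independence for two families of events. Both
  generated \<sigma>-algebras lie inside them, the second one because the preimages of Borel sets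
  under the increment already form a \<sigma>-algebra.\<close>

lemma B_incr_independent:
 assumes s: "0 \<le> s" "s < t" and \<xi>: "\<xi> \<in> borel_measurable (F s)" and g[measurable]: "(g :: real => real) \<in> borel_measurable borel"
 shows "indep_var borel \<xi> borel (\<lambda>w. g (B t w - B s w))"
proof -
 have [measurable]: "\<xi> \<in> borel_measurable M" "B t \<in> borel_measurable M" "B s \<in> borel_measurable M"
  using measurable_F[OF s(1) \<xi>] s by auto
 have ind: "indep_set (sets (F s)) {(\<lambda>w. B t w - B s w) -` A \<inter> space M | A. A \<in> sets borel}"
  using BM s by (auto simp: brownian_motion_def)
 have a: "sigma_sets (space M) {\<xi> -` A \<inter> space M | A. A \<in> sets borel} \<subseteq> sets (F s)"
  using sets.sigma_sets_subset[of "{\<xi> -` A \<inter> space M | A. A \<in> sets borel}" "F s"] measurable_sets[OF \<xi>]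
  by (auto simp: space_F)
 have b: "sigma_sets (space M) {(\<lambda>w. g (B t w - B s w)) -` A \<inter> space M | A. A \<in> sets borel}
   \<subseteq> {(\<lambda>w. B t w - B s w) -` A \<inter> space M | A. A \<in> sets borel}"
 proof -
  have eq: "{(\<lambda>w. B t w - B s w) -` A \<inter> space M | A. A \<in> sets borel}
    = sets (vimage_algebra (space M) (\<lambda>w. B t w - B s w) borel)"
   by (subst sets_vimage_algebra2) auto
  have "{(\<lambda>w. g (B t w - B s w)) -` A \<inter> space M | A. A \<in> sets borel}
    \<subseteq> {(\<lambda>w. B t w - B s w) -` A \<inter> space M | A. A \<in> sets borel}"
  proof safe
   fix A :: "real set" assume "A \<in> sets borel"
   then have "g -` A \<in> sets borel" using measurable_sets[OF g, of A] by simp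
   then show "\<exists>A'. (\<lambda>w. g (B t w - B s w)) -` A \<inter> space M = (\<lambda>w. B t w - B s w) -` A' \<inter> space M \<and> A' \<in> sets borel"
    by (intro exI[of _ "g -` A"]) auto
  qed
  then show ?thesis
   unfolding eq using sets.sigma_sets_subset[of _ "vimage_algebra (space M) (\<lambda>w. B t w - B s w) borel"]
   by simp
 qed
 show ?thesis
  unfolding indep_var_eq
 proof (intro conjI)
  show "indep_set (sigma_sets (space M) {\<xi> -` A \<inter> space M | A. A \<in> sets borel})
    (sigma_sets (space M) {(\<lambda>w. g (B t w - B s w)) -` A \<inter> space M | A. A \<in> sets borel})"
   using ind a b unfolding indep_sets2_eq by (meson subset_eq)
 qed simp_all
qed

lemma B_incr_mult:
 assumes s: "0 \<le> s" "s < t" and \<xi>: "\<xi> \<in> borel_measurable (F s)" and g: "(g :: real => real) \<in> borel_measurable borel"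
  and "integrable M \<xi>" "integrable M (\<lambda>w. g (B t w - B s w) )"
 shows "integrable M (\<lambda>w. \<xi> w * g (B t w - B s w))"
  "\<E> (\<lambda>w. \<xi> w * g (B t w - B s w)) = \<E> \<xi> * \<E> (\<lambda>w. g (B t w - B s w))"
 using indep_var_integrable[OF B_incr_independent[OF s \<xi> g]] indep_var_lebesgue_integral[OF B_incr_independent[OF s \<xi> g]]
  assms by auto

lemma B_incr_distr: "0 \<le> s ==> s < t ==>
  distributed M lborel (\<lambda>w. B t w - B s w) (\<lambda>x. ennreal (normal_density 0 (sqrt (t - s)) x))"
 using BM by (auto simp: brownian_motion_def)

lemma B_incr_integrable:
 assumes "0 \<le> s" "s \<le> t" shows "integrable M (\<lambda>w. (B t w - B s w) ^ k)"
proof (cases "s < t")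
 case True
 then show ?thesis
  using distributed_integrable[OF B_incr_distr[OF assms(1) True], of "\<lambda>x. x ^ k"]
   integrable_normal_moment[of "sqrt (t - s)" 0 k] by simp
next
 case False
 then show ?thesis using assms by simp
qed

lemma B_incr_moments:
 assumes "0 \<le> s" "s \<le> t"
 shows "\<E> (\<lambda>w. B t w - B s w) = 0"
  "\<E> (\<lambda>w. (B t w - B s w)^2) = t - s"
  "\<E> (\<lambda>w. (B t w - B s w)^3) = 0"
  "\<E> (\<lambda>w. (B t w - B s w)^4) = 3 * (t - s)^2"
proof -
 have *: "\<E> (\<lambda>w. B t w - B s w) = 0 \<and>
  \<E> (\<lambda>w. (B t w - B s w)^2) = t - s \<and>
  \<E> (\<lambda>w. (B t w - B s w)^3) = 0 \<and>
  \<E> (\<lambda>w. (B t w - B s w)^4) = 3 * (t - s)^2"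
 proof (cases "s < t")
  case True
  have D: "\<E> (\<lambda>w. (B t w - B s w) ^ k) = (\<integral>x. normal_density 0 (sqrt (t - s)) x * (x - 0) ^ k \<partial>lborel)" for k
   using distributed_integral[OF B_incr_distr[OF assms(1) True], of "\<lambda>x. x ^ k"] by simp
  have p: "0 < sqrt (t - s)" using True by simp
  show ?thesis
  proof (intro conjI)
   show "\<E> (\<lambda>w. B t w - B s w) = 0"
    using D[of "2 * 0 + 1"] integral_normal_moment_odd[OF p, of 0 0] by simp
   show "\<E> (\<lambda>w. (B t w - B s w)^3) = 0"
    using D[of "2 * 1 + 1"] unfolding integral_normal_moment_odd[OF p, of 0 1] by (simp add: eval_nat_numeral)
   show "\<E> (\<lambda>w. (B t w - B s w)^2) = t - s"
    using D[of "2 * 1"] True unfolding integral_normal_moment_even[OF p, of 0 1] by simp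
   show "\<E> (\<lambda>w. (B t w - B s w)^4) = 3 * (t - s)^2"
    using D[of "2 * 2"] True unfolding integral_normal_moment_even[OF p, of 0 2]
    by (simp add: fact_numeral power_divide)
  qed
 next
  case False
  then show ?thesis using assms by simp
 qed
 then show "\<E> (\<lambda>w. B t w - B s w) = 0"
  "\<E> (\<lambda>w. (B t w - B s w)^2) = t - s"
  "\<E> (\<lambda>w. (B t w - B s w)^3) = 0"
  "\<E> (\<lambda>w. (B t w - B s w)^4) = 3 * (t - s)^2" by auto
qed

lemma B_incr_mult_power:
 assumes s: "0 \<le> s" "s \<le> t" and \<xi>: "\<xi> \<in> borel_measurable (F s)" and i: "integrable M \<xi>"
 shows "integrable M (\<lambda>w. \<xi> w * (B t w - B s w) ^ k)"
  "\<E> (\<lambda>w. \<xi> w * (B t w - B s w) ^ k) = \<E> \<xi> * \<E> (\<lambda>w. (B t w - B s w) ^ k)"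
proof -
 have "integrable M (\<lambda>w. \<xi> w * (B t w - B s w) ^ k) \<and>
  \<E> (\<lambda>w. \<xi> w * (B t w - B s w) ^ k) = \<E> \<xi> * \<E> (\<lambda>w. (B t w - B s w) ^ k)"
 proof (cases "s < t")
  case True
  then show ?thesis
   using B_incr_mult[OF s(1) True \<xi>, of "\<lambda>x. x ^ k"] i B_incr_integrable[OF s] by simp
 next
  \<comment> \<open>Then \<open>s = t\<close> and the increment is 0, so only the power
    \<open>k = 0\<close> contributes.\<close>
  case False
  then show ?thesis using assms prob_space by (cases k) auto
 qed
 then show "integrable M (\<lambda>w. \<xi> w * (B t w - B s w) ^ k)"
  "\<E> (\<lambda>w. \<xi> w * (B t w - B s w) ^ k) = \<E> \<xi> * \<E> (\<lambda>w. (B t w - B s w) ^ k)" by auto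
qed

end

section \<open>Integrals of simple processes against Brownian motion\<close>

text \<open>The martingale transform of \<open>\<zeta>\<close> along the grid \<open>u\<close>, that
  is, the discrete stochastic integral against \<open>N\<close>. Simple integrals and stopped values
  are both rewritten in this form.\<close>

definition transform :: "(real => 'a => real) => (nat => 'a => real) => (nat => real) => nat => 'a => real" where
 "transform N \<zeta> u n w = (\<Sum>i<n. \<zeta> i w * (N (u (Suc i)) w - N (u i) w))"

lemma common_bound:
 fixes \<zeta> :: "nat => 'a => real"
 assumes "\<And>i. i < n ==> bounded (\<zeta> i ` S)"
 obtains c where "0 \<le> c" "\<And>i w. i < n ==> w \<in> S ==> \<bar>\<zeta> i w\<bar> \<le> c"
proof -
 have "bounded (\<Union>i\<in>{..<n}. \<zeta> i ` S)" using assms by (intro bounded_UN) auto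
 then obtain c where "\<And>i w. i < n ==> w \<in> S ==> \<bar>\<zeta> i w\<bar> \<le> c" by (auto simp: bounded_iff)
 then show ?thesis by (intro that[of "max 0 c"]) (auto simp: le_max_iff_disj)
qed

lemma transform_0[simp]: "transform N \<zeta> u 0 w = 0"
 by (simp add: transform_def)

lemma transform_Suc: "transform N \<zeta> u (Suc n) w = transform N \<zeta> u n w + \<zeta> n w * (N (u (Suc n)) w - N (u n) w)"
 by (simp add: transform_def)

context filtered_prob_space
begin

lemma transform_measurable:
 assumes N: "adapted N" and u: "0 \<le> u 0" "mono u"
  and \<zeta>: "\<And>i. i < n ==> \<zeta> i \<in> borel_measurable (F (u i))"
 shows "transform N \<zeta> u n \<in> borel_measurable (F (u n))"
proof -
 have u0: "0 \<le> u i" for i using u monoD[OF u(2), of 0 i] by simp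
 show ?thesis
  unfolding transform_def
 proof (intro borel_measurable_sum borel_measurable_times borel_measurable_diff)
  fix i assume i: "i \<in> {..<n}"
  then show "\<zeta> i \<in> borel_measurable (F (u n))"
   using measurable_F_mono[OF \<zeta>[of i]] monoD[OF u(2), of i n] by simp
  show "N (u (Suc i)) \<in> borel_measurable (F (u n))" "N (u i) \<in> borel_measurable (F (u n))"
   using i u0 monoD[OF u(2)] by (auto intro!: continuous_adapted_measurable_le[OF N])
 qed
qed

end

context brownian_space
begin

text \<open>Induction on the last increment \<open>D\<close>: it is independent of the past, its
  first and third moments are 0, and the second and fourth are \<open>d\<close> and
  \<open>3 * d^2\<close>. With \<open>A\<close> the time elapsed before, the fourth moments add up
  to \<open>3 * A^2 + 6 * A * d + 3 * d^2 = 3 * (A + d)^2\<close> times \<open>c^4\<close>, which is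
  why the constant 3 is preserved.\<close>

lemma transform_moments:
 assumes u: "0 \<le> u 0" "mono u"
  and \<zeta>: "\<And>i. i < n ==> \<zeta> i \<in> borel_measurable (F (u i))"
  and bd: "\<And>i w. i < n ==> w \<in> space M ==> \<bar>\<zeta> i w\<bar> \<le> c"
 shows "integrable M (\<lambda>w. (transform B \<zeta> u n w)^4)
  \<and> \<E> (\<lambda>w. (transform B \<zeta> u n w)^4) \<le> 3 * c^4 * (u n - u 0)^2
  \<and> integrable M (\<lambda>w. (transform B \<zeta> u n w)^2)
  \<and> \<E> (\<lambda>w. (transform B \<zeta> u n w)^2) = (\<Sum>i<n. \<E> (\<lambda>w. (\<zeta> i w)^2) * (u (Suc i) - u i))
  \<and> \<E> (\<lambda>w. (transform B \<zeta> u n w)^2) \<le> c^2 * (u n - u 0)"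
 using \<zeta> bd
proof (induction n)
 case 0
 show ?case by simp
next
 case (Suc n)
 let ?T = "transform B \<zeta> u (Suc n)"
 define S where "S = transform B \<zeta> u n"
 define D where "D = (\<lambda>w. B (u (Suc n)) w - B (u n) w)"
 have u0: "0 \<le> u i" for i using u monoD[OF u(2), of 0 i] by simp
 have un: "u n \<le> u (Suc n)" using u by (simp add: monoD)
 have IH: "integrable M (\<lambda>w. (S w)^4)" "\<E> (\<lambda>w. (S w)^4) \<le> 3 * c^4 * (u n - u 0)^2"
  "integrable M (\<lambda>w. (S w)^2)"
  "\<E> (\<lambda>w. (S w)^2) = (\<Sum>i<n. \<E> (\<lambda>w. (\<zeta> i w)^2) * (u (Suc i) - u i))"
  "\<E> (\<lambda>w. (S w)^2) \<le> c^2 * (u n - u 0)"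
  using Suc by (auto simp: S_def)
 have SF: "S \<in> borel_measurable (F (u n))"
  unfolding S_def using Suc.prems by (intro transform_measurable B_adapted u) auto
 have \<zeta>F: "\<zeta> n \<in> borel_measurable (F (u n))" using Suc.prems by simp
 have [measurable]: "S \<in> borel_measurable M" "\<zeta> n \<in> borel_measurable M" "D \<in> borel_measurable M"
  using measurable_F[OF u0] SF \<zeta>F u0 by (auto simp: D_def)
 have \<zeta>b: "\<bar>\<zeta> n w\<bar> \<le> c" if "w \<in> space M" for w using Suc.prems that by simp
 have \<zeta>k: "\<bar>(\<zeta> n w) ^ k\<bar> \<le> c ^ k" if "w \<in> space M" for w k
  using power_mono[OF \<zeta>b[OF that], of k] by (simp add: power_abs)
 have iS: "integrable M (\<lambda>w. (S w) ^ k)" if "k \<le> 4" for k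
 proof (rule Bochner_Integration.integrable_bound)
  show "integrable M (\<lambda>w. 1 + (S w)^4)" using IH by simp
  show "AE w in M. norm (S w ^ k) \<le> norm (1 + (S w)^4)"
  proof (rule AE_I2)
   fix w
   show "norm (S w ^ k) \<le> norm (1 + (S w)^4)"
   proof (cases "\<bar>S w\<bar> \<le> 1")
    case True
    then have "\<bar>S w\<bar> ^ k \<le> 1" by (simp add: power_le_one)
    moreover have "0 \<le> (S w)^4" by (simp add: zero_le_even_power)
    ultimately have "\<bar>S w\<bar> ^ k \<le> 1 + S w ^ 4" by linarith
    then show ?thesis by (simp add: power_abs)
   next
    case False
    then have "\<bar>S w\<bar> ^ k \<le> \<bar>S w\<bar> ^ 4" using that by (intro power_increasing) auto
    then show ?thesis by (simp add: power_abs)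
   qed
  qed
 qed measurable
 have iSz: "integrable M (\<lambda>w. (\<zeta> n w)^j * (S w) ^ k)" if "k \<le> 4" for j k
  using iS[OF that] \<zeta>k by (intro integrable_bounded_mult[where c="c^j"]) auto
 have F1: "(\<lambda>w. (\<zeta> n w)^j * (S w) ^ k) \<in> borel_measurable (F (u n))" for j k
  using SF \<zeta>F by simp
 note P = B_incr_mult_power[OF u0[of n] un F1 iSz]
 define d where "d = u (Suc n) - u n"
 have d0: "0 \<le> d" using un by (simp add: d_def)
 have mom: "\<E> (\<lambda>w. D w ^ 1) = 0" "\<E> (\<lambda>w. D w ^ 2) = d"
  "\<E> (\<lambda>w. D w ^ 3) = 0" "\<E> (\<lambda>w. D w ^ 4) = 3 * d^2"
  using B_incr_moments[OF u0[of n] un] by (simp_all add: D_def d_def)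
 \<comment> \<open>Trivial powers are kept so that every term of the expansion has the shape covered
   by \<open>hb\<close>.\<close>
 have e4: "(?T w)^4 = (\<zeta> n w)^0 * S w ^ 4 * D w ^ 0 + 4 * ((\<zeta> n w)^1 * S w ^ 3 * D w ^ 1)
   + 6 * ((\<zeta> n w)^2 * S w ^ 2 * D w ^ 2) + 4 * ((\<zeta> n w)^3 * S w ^ 1 * D w ^ 3)
   + (\<zeta> n w)^4 * S w ^ 0 * D w ^ 4" for w
  unfolding transform_Suc S_def D_def by (simp add: algebra_simps power_numeral_reduce)
 have e2: "(?T w)^2 = (\<zeta> n w)^0 * S w ^ 2 * D w ^ 0 + 2 * ((\<zeta> n w)^1 * S w ^ 1 * D w ^ 1)
   + (\<zeta> n w)^2 * S w ^ 0 * D w ^ 2" for w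
  unfolding transform_Suc S_def D_def by (simp add: algebra_simps power2_eq_square)
 have hb: "has_bochner_integral M (\<lambda>w. (\<zeta> n w)^j * S w ^ k * D w ^ l)
   (\<E> (\<lambda>w. (\<zeta> n w)^j * S w ^ k) * \<E> (\<lambda>w. D w ^ l))" if "k \<le> 4" for j k l
  using P[OF that, of j l] by (simp add: has_bochner_integral_iff D_def)
 have E4: "has_bochner_integral M (\<lambda>w. (?T w)^4)
   (\<E> (\<lambda>w. S w ^ 4) + 6 * (\<E> (\<lambda>w. (\<zeta> n w)^2 * S w ^ 2) * d) + \<E> (\<lambda>w. (\<zeta> n w)^4) * (3 * d^2))"
 proof -
  have "has_bochner_integral M (\<lambda>w. (?T w)^4)
   (\<E> (\<lambda>w. (\<zeta> n w)^0 * S w ^ 4) * \<E> (\<lambda>w. D w ^ 0)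
    + 4 * (\<E> (\<lambda>w. (\<zeta> n w)^1 * S w ^ 3) * \<E> (\<lambda>w. D w ^ 1))
    + 6 * (\<E> (\<lambda>w. (\<zeta> n w)^2 * S w ^ 2) * \<E> (\<lambda>w. D w ^ 2))
    + 4 * (\<E> (\<lambda>w. (\<zeta> n w)^3 * S w ^ 1) * \<E> (\<lambda>w. D w ^ 3))
    + \<E> (\<lambda>w. (\<zeta> n w)^4 * S w ^ 0) * \<E> (\<lambda>w. D w ^ 4))"
   unfolding e4 by (intro has_bochner_integral_add has_bochner_integral_mult_right hb) auto
  then show ?thesis unfolding mom by (simp add: prob_space)
 qed
 have E2: "has_bochner_integral M (\<lambda>w. (?T w)^2)
   (\<E> (\<lambda>w. S w ^ 2) + \<E> (\<lambda>w. (\<zeta> n w)^2) * d)"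
 proof -
  have "has_bochner_integral M (\<lambda>w. (?T w)^2)
   (\<E> (\<lambda>w. (\<zeta> n w)^0 * S w ^ 2) * \<E> (\<lambda>w. D w ^ 0)
    + 2 * (\<E> (\<lambda>w. (\<zeta> n w)^1 * S w ^ 1) * \<E> (\<lambda>w. D w ^ 1))
    + \<E> (\<lambda>w. (\<zeta> n w)^2 * S w ^ 0) * \<E> (\<lambda>w. D w ^ 2))"
   unfolding e2 by (intro has_bochner_integral_add has_bochner_integral_mult_right hb) auto
  then show ?thesis unfolding mom by (simp add: prob_space)
 qed
 define A where "A = u n - u 0"
 have b1: "\<E> (\<lambda>w. (\<zeta> n w)^2 * S w ^ 2) \<le> c^2 * (c^2 * A)"
 proof -
  have "\<E> (\<lambda>w. (\<zeta> n w)^2 * S w ^ 2) \<le> \<E> (\<lambda>w. c^2 * S w ^ 2)"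
   using iSz[of 2 2] iS[of 2] \<zeta>k[of _ 2] by (intro integral_mono mult_right_mono) auto
  also have "\<dots> \<le> c^2 * (c^2 * A)" unfolding A_def integral_mult_right_zero using IH(5) by (rule mult_left_mono) simp
  finally show ?thesis .
 qed
 have b2: "\<E> (\<lambda>w. (\<zeta> n w)^k) \<le> c^k" for k
 proof -
  have "\<E> (\<lambda>w. (\<zeta> n w)^k) \<le> \<E> (\<lambda>w. c^k)"
   using \<zeta>k[of _ k] iSz[of 0 k] by (intro integral_mono) (auto dest: abs_le_D1)
  then show ?thesis by (simp add: prob_space)
 qed
 have "\<E> (\<lambda>w. (?T w)^4) \<le> 3 * c^4 * A^2 + 6 * (c^2 * (c^2 * A) * d) + c^4 * (3 * d^2)"
  unfolding has_bochner_integral_integral_eq[OF E4]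
  using IH(2) b1 b2[of 4] d0 by (intro add_mono mult_left_mono mult_right_mono) (auto simp: A_def)
 also have "\<dots> = 3 * c^4 * (A + d)^2" by (simp add: power2_eq_square power4_eq_xxxx algebra_simps)
 also have "A + d = u (Suc n) - u 0" by (simp add: A_def d_def)
 finally have 4: "\<E> (\<lambda>w. (?T w)^4) \<le> 3 * c^4 * (u (Suc n) - u 0)^2" .
 have "\<E> (\<lambda>w. (?T w)^2) \<le> c^2 * A + c^2 * d"
  unfolding has_bochner_integral_integral_eq[OF E2]
  using IH(5) b2[of 2] d0 by (intro add_mono mult_right_mono) (auto simp: A_def)
 also have "\<dots> = c^2 * (u (Suc n) - u 0)" by (simp add: A_def d_def algebra_simps)
 finally have 2: "\<E> (\<lambda>w. (?T w)^2) \<le> c^2 * (u (Suc n) - u 0)" .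
 have 3: "\<E> (\<lambda>w. (?T w)^2) = (\<Sum>i<Suc n. \<E> (\<lambda>w. (\<zeta> i w)^2) * (u (Suc i) - u i))"
  unfolding has_bochner_integral_integral_eq[OF E2] using IH(4) by (simp add: d_def)
 show ?case
  using E4 E2 4 2 3 by (auto simp: has_bochner_integral_iff)
qed

text \<open>Lenglart's inequality in discrete form. The coefficients are set to 0 once the running
  bracket exceeds \<open>d\<close>, which is known one step ahead, and Chebyshev applies to the
  truncated sum. The two sums can differ only where the full bracket exceeds
  \<open>d\<close>.\<close>

lemma transform_tail_bound:
 assumes u: "0 \<le> u 0" "mono u"
  and \<zeta>: "\<And>i. i < n ==> \<zeta> i \<in> borel_measurable (F (u i))"
  and bd: "\<And>i. i < n ==> bounded (\<zeta> i ` space M)"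
  and d: "0 \<le> d" and e: "0 < e"
 shows "prob {w\<in>space M. e < \<bar>transform B \<zeta> u n w\<bar>}
  \<le> d / e^2 + prob {w\<in>space M. d < (\<Sum>i<n. (\<zeta> i w)^2 * (u (Suc i) - u i))}"
proof -
 have u0: "0 \<le> u i" for i using u monoD[OF u(2), of 0 i] by simp
 have du: "0 \<le> u (Suc i) - u i" for i using u by (simp add: monoD)
 define G where "G i w = (\<Sum>j<i. (\<zeta> j w)^2 * (u (Suc j) - u j))" for i w
 define \<eta> where "\<eta> i w = (if G (Suc i) w \<le> d then \<zeta> i w else 0)" for i w
 have \<zeta>F: "\<zeta> j \<in> borel_measurable (F (u i))" if "j \<le> i" "j < n" for i j
  using measurable_F_mono[OF \<zeta>[OF that(2)]] monoD[OF u(2) that(1)] .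
 have \<zeta>M[measurable]: "j < n ==> \<zeta> j \<in> borel_measurable M" for j
  using measurable_F[OF u0 \<zeta>] .
 have GF: "G (Suc i) \<in> borel_measurable (F (u i))" if "i < n" for i
  unfolding G_def using that \<zeta>F
  by (intro borel_measurable_sum borel_measurable_times borel_measurable_power) auto
 have \<eta>F: "\<eta> i \<in> borel_measurable (F (u i))" if "i < n" for i
  unfolding \<eta>_def using GF[OF that] \<zeta>[OF that]
  using borel_measurable_le[OF GF[OF that] borel_measurable_const[of d]] by (intro measurable_If) (auto simp: pred_def)
 have GM: "G n \<in> borel_measurable M"
  unfolding G_def using \<zeta>M by (intro borel_measurable_sum borel_measurable_times borel_measurable_power) auto
 obtain c where "0 \<le> c" "\<And>i w. i < n ==> w \<in> space M ==> \<bar>\<zeta> i w\<bar> \<le> c" using common_bound[of n \<zeta> "space M"] bd by metis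
 then have c: "\<bar>\<eta> i w\<bar> \<le> c" if "i < n" "w \<in> space M" for i w using that by (simp add: \<eta>_def)
 \<comment> \<open>The case distinction carries the induction: once the bracket \<open>G\<close> has
   passed \<open>d\<close>, all further coefficients vanish.\<close>
 have small: "(\<Sum>i<m. (\<eta> i w)^2 * (u (Suc i) - u i)) \<le> (if G m w \<le> d then G m w else d)" for m w
 proof (induction m)
  case 0
  show ?case using d by (simp add: G_def)
 next
  case (Suc m)
  have "G m w \<le> G (Suc m) w" using du by (simp add: G_def)
  then show ?case using Suc by (auto simp: \<eta>_def G_def split: if_splits)
 qed
 note tm = transform_moments[of u n \<eta> c, OF u \<eta>F c]
 let ?T = "transform B \<eta> u n"
 have \<eta>M[measurable]: "i < n ==> \<eta> i \<in> borel_measurable M" for i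
  using measurable_F[OF u0 \<eta>F] .
 have TM[measurable]: "transform B \<eta> u n \<in> borel_measurable M" "transform B \<zeta> u n \<in> borel_measurable M"
  using measurable_F[OF u0 transform_measurable[OF B_adapted u]] \<eta>F \<zeta> by auto
 have int\<eta>: "integrable M (\<lambda>w. (\<eta> i w)^2)" if "i < n" for i
  using c[OF that] that by (intro bounded_integrable[where c="c^2"]) (auto simp: abs_le_square_iff[symmetric] intro!: order_trans[OF c abs_ge_self] power2_le_iff_abs_le[THEN iffD2])
 have "\<E> (\<lambda>w. (?T w)^2) = \<E> (\<lambda>w. \<Sum>i<n. (\<eta> i w)^2 * (u (Suc i) - u i))"
  using tm int\<eta> by (subst Bochner_Integration.integral_sum) auto
 also have "\<dots> \<le> \<E> (\<lambda>w. d)"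
 proof (rule integral_mono)
  show "(\<Sum>i<n. (\<eta> i w)^2 * (u (Suc i) - u i)) \<le> d" for w
   using small[of w n] by (auto split: if_splits)
 qed (use int\<eta> in \<open>auto intro!: Bochner_Integration.integrable_sum\<close>)
 finally have E: "\<E> (\<lambda>w. (?T w)^2) \<le> d" by (simp add: prob_space)
 have cheb: "prob {w\<in>space M. e^2 \<le> (?T w)^2} \<le> d / e^2"
 proof -
  have "prob {w\<in>space M. e^2 \<le> (?T w)^2} \<le> \<E> (\<lambda>w. (?T w)^2) / e^2"
   using tm e by (intro integral_Markov_inequality_measure[where A="{}"]) auto
  also have "\<dots> \<le> d / e^2" using E by (simp add: divide_right_mono)
  finally show ?thesis .
 qed
 have sub: "{w\<in>space M. e < \<bar>transform B \<zeta> u n w\<bar>} \<subseteq> {w\<in>space M. e^2 \<le> (?T w)^2} \<union> {w\<in>space M. d < G n w}"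
 proof safe
  fix w assume w: "w \<in> space M" "e < \<bar>transform B \<zeta> u n w\<bar>" "\<not> d < G n w"
  have "\<eta> i w = \<zeta> i w" if "i < n" for i
  proof -
   have "G (Suc i) w \<le> G n w" unfolding G_def using that du by (intro sum_mono2) auto
   then show ?thesis using w by (simp add: \<eta>_def)
  qed
  then have "?T w = transform B \<zeta> u n w" by (simp add: transform_def)
  then show "e^2 \<le> (?T w)^2" using w(2) e by (simp add: abs_le_square_iff[symmetric])
 qed
 have "prob {w\<in>space M. e < \<bar>transform B \<zeta> u n w\<bar>}
   \<le> prob ({w\<in>space M. e^2 \<le> (?T w)^2} \<union> {w\<in>space M. d < G n w})"
  using GM by (intro finite_measure_mono sub) auto
 also have "\<dots> \<le> prob {w\<in>space M. e^2 \<le> (?T w)^2} + prob {w\<in>space M. d < G n w}"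
  using GM by (intro measure_Un_le) auto
 finally show ?thesis using cheb by (simp add: G_def)
qed

text \<open>Only the common part of the two intervals contributes, by independence of increments.
  This lets simple processes with unrelated partitions be multiplied without a common
  refinement.\<close>

lemma B_incr_overlap:
 assumes s1: "0 \<le> s1" "s1 \<le> t1" and s2: "0 \<le> s2" "s2 \<le> t2"
  and \<xi>: "\<xi> \<in> borel_measurable (F s1)" "\<And>w. w \<in> space M ==> \<bar>\<xi> w\<bar> \<le> c"
  and \<zeta>: "\<zeta> \<in> borel_measurable (F s2)" "\<And>w. w \<in> space M ==> \<bar>\<zeta> w\<bar> \<le> d"
 shows "has_bochner_integral M (\<lambda>w. \<xi> w * \<zeta> w * (B t1 w - B s1 w) * (B t2 w - B s2 w))
  (\<E> (\<lambda>w. \<xi> w * \<zeta> w) * max 0 (min t1 t2 - max s1 s2))"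
proof -
 have main: "has_bochner_integral M (\<lambda>w. \<xi> w * \<zeta> w * (B t1 w - B s1 w) * (B t2 w - B s2 w))
  (\<E> (\<lambda>w. \<xi> w * \<zeta> w) * max 0 (min t1 t2 - s2))"
  if s1: "0 \<le> s1" "s1 \<le> t1" and s2: "s1 \<le> s2" "s2 \<le> t2"
  and \<xi>: "\<xi> \<in> borel_measurable (F s1)" "\<And>w. w \<in> space M ==> \<bar>\<xi> w\<bar> \<le> c"
  and \<zeta>: "\<zeta> \<in> borel_measurable (F s2)" "\<And>w. w \<in> space M ==> \<bar>\<zeta> w\<bar> \<le> d"
 for s1 t1 s2 t2 \<xi> \<zeta> c d
 proof -
  have s20: "0 \<le> s2" using that by simp
  have \<xi>2: "\<xi> \<in> borel_measurable (F s2)" using measurable_F_mono[OF \<xi>(1) s2(1)] .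
  \<comment> \<open>\<open>[s2, m]\<close> is the overlap. The first increment is split into a part
    up to \<open>r\<close>, the overlap and a part from \<open>m\<close> to \<open>q\<close>. At
    most one of the two increments reaches beyond \<open>m\<close>, so all products but the square
    over the overlap are 0 or have expectation 0.\<close>
  define m where "m = max s2 (min t1 t2)"
  define r where "r = min t1 s2"
  have m: "s2 \<le> m" "m \<le> t2" and r: "s1 \<le> r" "r \<le> s2" "0 \<le> r" using that by (auto simp: m_def r_def)
  define \<rho> where "\<rho> = (\<lambda>w. \<xi> w * \<zeta> w)"
  have \<rho>: "\<rho> \<in> borel_measurable (F s2)" using \<xi>2 \<zeta> by (simp add: \<rho>_def)
  have \<rho>M[measurable]: "\<rho> \<in> borel_measurable M" using measurable_F[OF s20 \<rho>] .
  have \<rho>b: "\<bar>\<rho> w\<bar> \<le> c * d" if "w \<in> space M" for w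
   using \<xi>(2)[OF that] \<zeta>(2)[OF that] by (auto simp: \<rho>_def abs_mult intro!: mult_mono)
  have i\<rho>: "integrable M \<rho>" by (rule bounded_integrable[OF \<rho>M \<rho>b])
  have a1: "(\<lambda>w. \<rho> w * (B r w - B s1 w)) \<in> borel_measurable (F s2)"
   using \<rho> that r by (intro borel_measurable_times borel_measurable_diff continuous_adapted_measurable_le[OF B_adapted]) auto
  have a2: "integrable M (\<lambda>w. \<rho> w * (B r w - B s1 w))"
   using B_incr_integrable[of s1 r 1] that r \<rho>b by (intro integrable_bounded_mult) auto
  have P1: "has_bochner_integral M (\<lambda>w. \<rho> w * (B r w - B s1 w) * (B t2 w - B s2 w) ^ 1) 0"
   using B_incr_mult_power[OF s20 s2(2) a1 a2, of 1] B_incr_moments(1)[OF s20 s2(2)] by (simp add: has_bochner_integral_iff)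
  have P2: "has_bochner_integral M (\<lambda>w. \<rho> w * (B m w - B s2 w) ^ 2) (\<E> \<rho> * (m - s2))"
   using B_incr_mult_power[OF s20 m(1) \<rho> i\<rho>, of 2] B_incr_moments(2)[OF s20 m(1)] by (simp add: has_bochner_integral_iff)
  have m0: "0 \<le> m" using m s20 by simp
  have b1: "(\<lambda>w. \<rho> w * (B m w - B s2 w)) \<in> borel_measurable (F m)"
   using measurable_F_mono[OF \<rho> m(1)] that m by (intro borel_measurable_times borel_measurable_diff continuous_adapted_measurable_le[OF B_adapted]) auto
  have b2: "integrable M (\<lambda>w. \<rho> w * (B m w - B s2 w))"
   using B_incr_integrable[of s2 m 1] s20 m \<rho>b by (intro integrable_bounded_mult) auto
  have P3: "has_bochner_integral M (\<lambda>w. \<rho> w * (B m w - B s2 w) * (B q w - B m w) ^ 1) 0" if "m \<le> q" for q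
   using B_incr_mult_power[OF m0 that b1 b2, of 1] B_incr_moments(1)[OF m0 that] by (simp add: has_bochner_integral_iff)
  define q where "q = max m t1"
  have "\<xi> w * \<zeta> w * (B t1 w - B s1 w) * (B t2 w - B s2 w) = \<rho> w * (B r w - B s1 w) * (B t2 w - B s2 w) ^ 1 + (\<rho> w * (B m w - B s2 w) ^ 2
     + (\<rho> w * (B m w - B s2 w) * (B t2 w - B m w) ^ 1 + \<rho> w * (B m w - B s2 w) * (B q w - B m w) ^ 1))" for w
  proof -
   have 1: "B t1 w - B s1 w = (B r w - B s1 w) + (B m w - B s2 w) + (B q w - B m w)"
    using that by (auto simp: m_def r_def q_def min_def max_def)
   have 2: "(B q w - B m w) * (B t2 w - B m w) = 0" using s2 by (auto simp: m_def q_def min_def max_def)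
   have "p * (x + y + z) * (y + v) = p * x * (y + v) ^ 1 + (p * y ^ 2 + (p * y * v ^ 1 + p * y * z ^ 1))" if "z * v = 0" for p x y z v :: real
    using that by (auto simp: algebra_simps power2_eq_square)
   from this[OF 2, of "\<rho> w" "B r w - B s1 w" "B m w - B s2 w"] show ?thesis unfolding 1 by (simp add: \<rho>_def)
  qed
  moreover have "\<E> (\<lambda>w. \<xi> w * \<zeta> w) * max 0 (min t1 t2 - s2) = 0 + (\<E> \<rho> * (m - s2) + (0 + 0))"
   by (auto simp: \<rho>_def m_def)
  ultimately show ?thesis using P1 P2 P3[OF m(2)] P3[of q] by (auto simp only: q_def max.cobounded1 intro!: has_bochner_integral_add)
 qed
 show ?thesis
 proof (cases "s1 \<le> s2")
  case True
  then show ?thesis using main[OF s1 True s2(2) \<xi> \<zeta>] by (simp add: max_absorb2)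
 next
  case False
  then have "s2 \<le> s1" by simp
  from main[OF s2 this s1(2) \<zeta> \<xi>] \<open>s2 \<le> s1\<close> show ?thesis
   by (simp add: max_absorb1 min.commute mult.commute mult.left_commute)
 qed
qed

end

section \<open>Optional stopping for square integrable continuous martingales\<close>

context filtered_prob_space
begin

lemma martingale_orthogonal:
 assumes m: "martingale M F m" and st: "0 \<le> s" "s \<le> t" and \<xi>: "\<xi> \<in> borel_measurable (F s)"
  and i: "integrable M (\<lambda>w. \<xi> w * m t w)"
 shows "integrable M (\<lambda>w. \<xi> w * m s w)" "\<E> (\<lambda>w. \<xi> w * m s w) = \<E> (\<lambda>w. \<xi> w * m t w)"
proof -
 interpret sub: finite_measure_subalgebra M "F s"
  using subalg[OF st(1)] by unfold_locales
 have [measurable]: "m t \<in> borel_measurable M" "m s \<in> borel_measurable M" "\<xi> \<in> borel_measurable M"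
  using m st measurable_F[of t "m t"] measurable_F[of s "m s"] measurable_F[OF st(1) \<xi>] by (auto simp: martingale_def)
 have ae: "AE w in M. real_cond_exp M (F s) (m t) w = m s w"
  using m st by (auto simp: martingale_def)
 then have ae: "AE w in M. \<xi> w * real_cond_exp M (F s) (m t) w = \<xi> w * m s w"
  by eventually_elim simp
 have 1: "integrable M (\<lambda>w. \<xi> w * real_cond_exp M (F s) (m t) w)"
  "\<E> (\<lambda>w. \<xi> w * real_cond_exp M (F s) (m t) w) = \<E> (\<lambda>w. \<xi> w * m t w)"
  using sub.real_cond_exp_intg[OF i \<xi>] by auto
 have [measurable]: "real_cond_exp M (F s) (m t) \<in> borel_measurable M" by simp
 show "integrable M (\<lambda>w. \<xi> w * m s w)"
  using 1(1) by (subst integrable_cong_AE[OF _ _ ae, symmetric]) auto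
 show "\<E> (\<lambda>w. \<xi> w * m s w) = \<E> (\<lambda>w. \<xi> w * m t w)"
  using 1(2) by (subst integral_cong_AE[OF _ _ ae, symmetric]) auto
qed

lemma martingaleI:
 assumes "\<And>t. 0 \<le> t ==> m t \<in> borel_measurable (F t)" "\<And>t. 0 \<le> t ==> integrable M (m t)"
  and eq: "\<And>s t A. 0 \<le> s ==> s \<le> t ==> A \<in> sets (F s) ==>
   \<E> (\<lambda>w. indicat_real A w * m t w) = \<E> (\<lambda>w. indicat_real A w * m s w)"
 shows "martingale M F m"
 unfolding martingale_def
proof (intro conjI allI impI; (elim conjE)?)
 fix s t :: real assume st: "0 \<le> s" "s \<le> t"
 interpret sub: finite_measure_subalgebra M "F s"
  using subalg[OF st(1)] by unfold_locales
 show "AE w in M. real_cond_exp M (F s) (m t) w = m s w"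
 proof (rule sub.real_cond_exp_charact)
  show "(\<integral>x\<in>A. m t x \<partial>M) = (\<integral>x\<in>A. m s x \<partial>M)" if "A \<in> sets (F s)" for A
   using eq[OF st that] by (simp add: set_lebesgue_integral_def)
 qed (use assms st in auto)
qed (use assms in auto)

definition L2_martingale :: "(real => 'w => real) => bool" where
 "L2_martingale m \<longleftrightarrow> adapted m \<and> martingale M F m \<and> (\<forall>t\<ge>0. integrable M (\<lambda>w. (m t w)^2))"

lemma martingale_diff:
 assumes "martingale M F X" "martingale M F Y"
 shows "martingale M F (\<lambda>t w. X t w - Y t w)"
 unfolding martingale_def
proof (intro conjI allI impI)
 fix s t :: real assume st: "0 \<le> s \<and> s \<le> t"
 interpret sub: finite_measure_subalgebra M "F s" using subalg[of s] st by unfold_locales auto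
 have ae: "AE w in M. real_cond_exp M (F s) (X t) w = X s w" "AE w in M. real_cond_exp M (F s) (Y t) w = Y s w"
  and i: "integrable M (X t)" "integrable M (Y t)"
  using assms st by (auto simp: martingale_def)
 from sub.real_cond_exp_diff[OF i] ae
 show "AE w in M. real_cond_exp M (F s) (\<lambda>w. X t w - Y t w) w = X s w - Y s w" by eventually_elim simp
qed (use assms in \<open>auto simp: martingale_def intro: borel_measurable_diff\<close>)

lemma L2_martingaleI:
 assumes ad: "adapted m" and sq: "\<And>t. 0 \<le> t ==> integrable M (\<lambda>w. (m t w)^2)"
  and orth: "\<And>s t A. 0 \<le> s ==> s \<le> t ==> A \<in> sets (F s) ==>
   \<E> (\<lambda>w. indicat_real A w * (m t w - m s w)) = 0"
 shows "L2_martingale m"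
proof -
 have i: "integrable M (m t)" if "0 \<le> t" for t
  by (rule square_integrable_imp_integrable[OF continuous_adapted_measurable_M[OF ad that] sq[OF that]])
 have "martingale M F m"
 proof (rule martingaleI)
  fix s t A assume st: "0 \<le> s" "s \<le> t" and A: "A \<in> sets (F s)"
  have AM: "indicat_real A \<in> borel_measurable M" using A sets_F_subset[OF st(1)] by auto
  have "integrable M (\<lambda>w. indicat_real A w * m r w)" if "0 \<le> r" for r
   using i[OF that] indicator_abs_le_1[of A] by (intro integrable_bounded_mult[OF _ AM]) auto
  then show "\<E> (\<lambda>w. indicat_real A w * m t w) = \<E> (\<lambda>w. indicat_real A w * m s w)"
   using orth[OF st A] st by (simp add: right_diff_distrib)
 qed (use ad i in \<open>auto simp: continuous_adapted_def\<close>)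
 then show ?thesis using ad sq by (simp add: L2_martingale_def)
qed

lemma L2_martingale_measurable: "L2_martingale m ==> 0 \<le> t ==> m t \<in> borel_measurable (F t)"
 "L2_martingale m ==> 0 \<le> t ==> m t \<in> borel_measurable M"
 by (auto simp: L2_martingale_def continuous_adapted_measurable continuous_adapted_measurable_M)

lemma L2_martingale_incr:
 assumes m: "L2_martingale m" and st: "0 \<le> s" "s \<le> t" and \<xi>: "\<xi> \<in> borel_measurable (F s)"
  and i: "integrable M (\<lambda>w. (\<xi> w)^2)"
 shows "has_bochner_integral M (\<lambda>w. \<xi> w * (m t w - m s w)) 0"
proof -
 have t: "0 \<le> t" using st by simp
 have [measurable]: "m t \<in> borel_measurable M" "m s \<in> borel_measurable M" "\<xi> \<in> borel_measurable M"
  using L2_martingale_measurable(2)[OF m] st measurable_F[OF st(1) \<xi>] by auto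
 have 1: "integrable M (\<lambda>w. \<xi> w * m t w)"
  using m i t by (intro integrable_mult_L2) (auto simp: L2_martingale_def)
 have "martingale M F m" using m by (simp add: L2_martingale_def)
 note 2 = martingale_orthogonal[OF this st \<xi> 1]
 show ?thesis
  using 1 2 by (simp add: has_bochner_integral_iff right_diff_distrib)
qed

text \<open>Each step is orthogonal to what is known before it. Testing against \<open>\<xi>\<close>
  known at the start of the grid gives the martingale property of simple integrals.\<close>

lemma transform_L2:
 assumes m: "L2_martingale m" and u: "0 \<le> u 0" "mono u"
  and \<zeta>: "\<And>i. i < n ==> \<zeta> i \<in> borel_measurable (F (u i))"
  and bd: "\<And>i w. i < n ==> w \<in> space M ==> \<bar>\<zeta> i w\<bar> \<le> c"
 shows "integrable M (\<lambda>w. (transform m \<zeta> u n w)^2)"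
  "\<And>\<xi> A. \<xi> \<in> borel_measurable (F (u 0)) ==> integrable M (\<lambda>w. (\<xi> w)^2) ==> has_bochner_integral M (\<lambda>w. \<xi> w * transform m \<zeta> u n w) 0"
proof -
 have u0: "0 \<le> u i" for i using u monoD[OF u(2), of 0 i] by simp
 have un: "u i \<le> u (Suc i)" for i using u by (simp add: monoD)
 have mc: "adapted m" using m by (simp add: L2_martingale_def)
 have "integrable M (\<lambda>w. (transform m \<zeta> u n w)^2) \<and>
  (\<forall>\<xi>. \<xi> \<in> borel_measurable (F (u 0)) \<longrightarrow> integrable M (\<lambda>w. (\<xi> w)^2) \<longrightarrow> has_bochner_integral M (\<lambda>w. \<xi> w * transform m \<zeta> u n w) 0)"
  using \<zeta> bd
 proof (induction n)
  case 0
  show ?case by (simp add: has_bochner_integral_zero)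
 next
  case (Suc n)
  have [measurable]: "m (u n) \<in> borel_measurable M" "m (u (Suc n)) \<in> borel_measurable M" "\<zeta> n \<in> borel_measurable M"
   "transform m \<zeta> u n \<in> borel_measurable M"
   using L2_martingale_measurable(2)[OF m u0] measurable_F[OF u0 Suc.prems(1)]
    measurable_F[OF u0 transform_measurable[OF mc u, of n \<zeta>]] Suc.prems(1) by auto
  have d2: "integrable M (\<lambda>w. (m (u (Suc n)) w - m (u n) w)^2)"
   using m u0 by (intro integrable_diff_L2) (auto simp: L2_martingale_def)
  have b2: "\<bar>(\<zeta> n w)^2\<bar> \<le> c^2" if "w \<in> space M" for w
   using power_mono[OF Suc.prems(2)[of n w], of 2] that by simp
  have z2: "integrable M (\<lambda>w. (\<zeta> n w * (m (u (Suc n)) w - m (u n) w))^2)"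
   unfolding power_mult_distrib by (rule integrable_bounded_mult[OF d2 _ b2]) auto
  have IH: "integrable M (\<lambda>w. (transform m \<zeta> u n w)^2)"
   "\<And>\<xi>. \<xi> \<in> borel_measurable (F (u 0)) ==> integrable M (\<lambda>w. (\<xi> w)^2) ==> has_bochner_integral M (\<lambda>w. \<xi> w * transform m \<zeta> u n w) 0"
   using Suc by auto
  have 1: "integrable M (\<lambda>w. (transform m \<zeta> u (Suc n) w)^2)"
   unfolding transform_Suc using z2 IH by (intro integrable_add_L2) auto
  have 2: "has_bochner_integral M (\<lambda>w. \<xi> w * transform m \<zeta> u (Suc n) w) 0"
   if \<xi>: "\<xi> \<in> borel_measurable (F (u 0))" "integrable M (\<lambda>w. (\<xi> w)^2)" for \<xi>
  proof -
   have [measurable]: "\<xi> \<in> borel_measurable M" using measurable_F[OF u(1) \<xi>(1)] .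
   have "(\<lambda>w. \<xi> w * \<zeta> n w) \<in> borel_measurable (F (u n))"
    using measurable_F_mono[OF \<xi>(1) monoD[OF u(2)], of n] Suc.prems(1) by auto
   moreover have "integrable M (\<lambda>w. (\<xi> w * \<zeta> n w)^2)"
    unfolding power_mult_distrib using integrable_bounded_mult[OF \<xi>(2) _ b2] by (auto simp: mult.commute)
   ultimately have "has_bochner_integral M (\<lambda>w. \<xi> w * \<zeta> n w * (m (u (Suc n)) w - m (u n) w)) 0"
    using L2_martingale_incr[OF m u0 un] by blast
   from has_bochner_integral_add[OF IH(2)[OF \<xi>] this] show ?thesis
    by (simp add: transform_Suc algebra_simps)
  qed
  show ?case using 1 2 by auto
 qed
 then show "integrable M (\<lambda>w. (transform m \<zeta> u n w)^2)"
  "\<And>\<xi> A. \<xi> \<in> borel_measurable (F (u 0)) ==> integrable M (\<lambda>w. (\<xi> w)^2) ==> has_bochner_integral M (\<lambda>w. \<xi> w * transform m \<zeta> u n w) 0"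
  by auto
qed

text \<open>Stopping at a discrete stopping time is integration of an indicator \<open>\<kappa>\<close>. The part before and the
 part after are orthogonal, so the second moment can only decrease.\<close>

lemma stopped_transform_moments:
 assumes m: "L2_martingale m" and u: "0 \<le> u 0" "mono u"
  and \<kappa>: "\<And>i. i < n ==> \<kappa> i \<in> borel_measurable (F (u i))" "\<And>i w. \<kappa> i w \<in> {0, 1}"
 defines "S \<equiv> \<lambda>w. m (u 0) w + transform m \<kappa> u n w"
 shows "integrable M (\<lambda>w. (S w)^2)" "\<E> (\<lambda>w. (S w)^2) \<le> \<E> (\<lambda>w. (m (u n) w)^2)"
  "\<E> S = \<E> (m (u 0))"
proof -
 have u0: "0 \<le> u i" for i using u monoD[OF u(2), of 0 i] by simp
 have un: "u i \<le> u (Suc i)" for i using u by (simp add: monoD)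
 have mc: "adapted m" using m by (simp add: L2_martingale_def)
 have \<kappa>b: "\<bar>\<kappa> i w\<bar> \<le> 1" "\<bar>1 - \<kappa> i w\<bar> \<le> 1" for i w using \<kappa>(2)[of i w] by auto
 have \<kappa>1: "\<And>i. i < n ==> (\<lambda>w. 1 - \<kappa> i w) \<in> borel_measurable (F (u i))" using \<kappa>(1) by simp
 define P where "P k w = m (u 0) w + transform m \<kappa> u k w" for k w
 define R where "R = transform m (\<lambda>i w. 1 - \<kappa> i w) u"
 have m0: "m (u 0) \<in> borel_measurable M" "integrable M (\<lambda>w. (m (u 0) w)^2)"
  using L2_martingale_measurable(2)[OF m u(1)] m u by (auto simp: L2_martingale_def)
 have PF: "P k \<in> borel_measurable (F (u k))" "R k \<in> borel_measurable (F (u k))" if "k \<le> n" for k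
  unfolding P_def R_def using that \<kappa>(1) \<kappa>1 monoD[OF u(2), of 0 k]
  by (auto intro!: borel_measurable_add transform_measurable[OF mc u] continuous_adapted_measurable_le[OF mc u(1)])
 have PM: "P k \<in> borel_measurable M" "R k \<in> borel_measurable M" if "k \<le> n" for k
  using measurable_F[OF u0 PF(1)[OF that]] measurable_F[OF u0 PF(2)[OF that]] .
 have tr: "transform m \<kappa> u k \<in> borel_measurable M" if "k \<le> n" for k
  using that \<kappa>(1) by (intro measurable_F[OF u0 transform_measurable[OF mc u]]) auto
 have P2: "integrable M (\<lambda>w. (P k w)^2)" if "k \<le> n" for k
  unfolding P_def using transform_L2(1)[OF m u, of k \<kappa> 1] \<kappa>(1) \<kappa>b m0 tr[OF that] that by (intro integrable_add_L2) auto
 have R2: "integrable M (\<lambda>w. (R k w)^2)" if "k \<le> n" for k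
  unfolding R_def using transform_L2(1)[OF m u, of k "\<lambda>i w. 1 - \<kappa> i w" 1] \<kappa>1 \<kappa>b that by auto
 have PR: "P k w + R k w = m (u k) w" for k w
  by (induction k) (simp_all add: P_def R_def transform_Suc algebra_simps)
 have orth: "has_bochner_integral M (\<lambda>w. P k w * R k w) 0" if "k \<le> n" for k
  using that
 proof (induction k)
  case 0
  show ?case by (simp add: R_def has_bochner_integral_zero)
 next
  case (Suc k)
  let ?D = "\<lambda>w. m (u (Suc k)) w - m (u k) w"
  \<comment> \<open>Since \<open>\<kappa>\<close> is 0 or 1, \<open>P\<close> and \<open>R\<close>
    never move in the same step. The increment of \<open>P * R\<close> is therefore this known
    factor times the increment of \<open>m\<close>, with no quadratic term.\<close>
  let ?\<xi> = "\<lambda>w. P k w * (1 - \<kappa> k w) + \<kappa> k w * R k w"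
  have k: "k < n" "k \<le> n" using Suc by auto
  note [measurable] = PM[OF k(2)] measurable_F[OF u0 \<kappa>(1)[OF k(1)]]
  have "\<bar>(\<kappa> k w)^2\<bar> \<le> 1" "\<bar>(1 - \<kappa> k w)^2\<bar> \<le> 1" for w using \<kappa>(2)[of k w] by auto
  then have "integrable M (\<lambda>w. ((1 - \<kappa> k w) * P k w + \<kappa> k w * R k w)^2)"
   using P2[OF k(2)] R2[OF k(2)]
   by (intro integrable_add_L2) (auto simp: power_mult_distrib intro!: integrable_bounded_mult[where c=1])
  then have "integrable M (\<lambda>w. (?\<xi> w)^2)" by (simp add: mult.commute)
  moreover have "?\<xi> \<in> borel_measurable (F (u k))"
   using PF[OF k(2)] \<kappa>(1)[OF k(1)] by simp
  ultimately have "has_bochner_integral M (\<lambda>w. ?\<xi> w * ?D w) 0"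
   using L2_martingale_incr[OF m u0 un] by blast
  from has_bochner_integral_add[OF Suc.IH[OF k(2)] this]
  have "has_bochner_integral M (\<lambda>w. P k w * R k w + ?\<xi> w * ?D w) 0" by simp
  moreover have "P k w * R k w + ?\<xi> w * ?D w = P (Suc k) w * R (Suc k) w" for w
   using \<kappa>(2)[of k w] by (auto simp: P_def R_def transform_Suc algebra_simps)
  ultimately show ?case by simp
 qed
 have SP: "S = P n" by (auto simp: S_def P_def)
 show "integrable M (\<lambda>w. (S w)^2)" using P2[of n] by (simp add: SP)
 have "has_bochner_integral M (\<lambda>w. (P n w)^2 + (R n w)^2 + 2 * (P n w * R n w))
  (\<E> (\<lambda>w. (P n w)^2) + \<E> (\<lambda>w. (R n w)^2) + 2 * 0)"
  by (intro has_bochner_integral_add has_bochner_integral_mult_right orth)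
   (auto simp: has_bochner_integral_iff P2 R2)
 then have "\<E> (\<lambda>w. (P n w)^2 + (R n w)^2 + 2 * (P n w * R n w))
  = \<E> (\<lambda>w. (P n w)^2) + \<E> (\<lambda>w. (R n w)^2)"
  by (auto dest: has_bochner_integral_integral_eq)
 moreover have "(P n w)^2 + (R n w)^2 + 2 * (P n w * R n w) = (m (u n) w)^2" for w
  unfolding PR[symmetric] by (simp add: power2_sum)
 moreover have "0 \<le> \<E> (\<lambda>w. (R n w)^2)" by simp
 ultimately show "\<E> (\<lambda>w. (S w)^2) \<le> \<E> (\<lambda>w. (m (u n) w)^2)" by (simp add: SP)
 have i0: "integrable M (m (u 0))" by (rule square_integrable_imp_integrable[OF m0])
 have "has_bochner_integral M (\<lambda>w. 1 * transform m \<kappa> u n w) 0"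
  using \<kappa> \<kappa>b by (intro transform_L2(2)[OF m u]) auto
 then have "has_bochner_integral M (\<lambda>w. m (u 0) w + 1 * transform m \<kappa> u n w) (\<E> (m (u 0)) + 0)"
  using i0 by (intro has_bochner_integral_add) (auto simp: has_bochner_integral_iff)
 then show "\<E> S = \<E> (m (u 0))"
  by (simp add: S_def has_bochner_integral_iff)
qed

text \<open>\<open>\<tau>\<close> is only assumed to be an optional time, up to a deterministic horizon \<open>T\<close>; \<open>stop_index T \<tau> n\<close>
 is the index of its upper approximation on the grid of mesh \<open>T / n\<close>.\<close>

definition stop_index :: "real => ('w => real) => nat => 'w => nat" where
 "stop_index T \<tau> n w = (LEAST k. k = n \<or> \<tau> w < k * T / n)"

lemma stop_index_le: "stop_index T \<tau> n w \<le> n"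
 unfolding stop_index_def by (rule Least_le) simp

text \<open>The strict inequality in \<open>stop_index\<close> makes the event that the index
  exceeds \<open>k\<close> the complement of \<open>\<tau> < k * T / n\<close>, hence measurable at
  time \<open>k * T / n\<close> for an optional time.\<close>

lemma stop_index_gr:
 fixes T :: real
 assumes "k < n" "0 \<le> T"
 shows "k < stop_index T \<tau> n w \<longleftrightarrow> k * T / n \<le> \<tau> w"
proof
 assume "k < stop_index T \<tau> n w"
 then have "\<not> (k = n \<or> \<tau> w < k * T / n)" unfolding stop_index_def by (rule not_less_Least)
 then show "k * T / n \<le> \<tau> w" by simp
next
 assume le: "k * T / n \<le> \<tau> w"
 have ex: "stop_index T \<tau> n w = n \<or> \<tau> w < stop_index T \<tau> n w * T / n"
  unfolding stop_index_def by (rule LeastI[of _ n]) simp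
 show "k < stop_index T \<tau> n w"
 proof (rule ccontr)
  assume "\<not> k < stop_index T \<tau> n w"
  then have kk: "stop_index T \<tau> n w \<le> k" by simp
  then have "stop_index T \<tau> n w * T / n \<le> k * T / n" using assms by (intro divide_right_mono mult_right_mono) auto
  then show False using ex le assms kk by auto
 qed
qed

lemma stop_index_approx:
 fixes T :: real
 assumes "0 < n" "0 \<le> \<tau> w" "\<tau> w \<le> T"
 shows "\<tau> w \<le> stop_index T \<tau> n w * T / n" "stop_index T \<tau> n w * T / n \<le> \<tau> w + T / n"
proof -
 let ?k = "stop_index T \<tau> n w"
 have T: "0 \<le> T" using assms by simp
 have "?k = n \<or> \<tau> w < ?k * T / n"
  unfolding stop_index_def by (rule LeastI[of _ n]) simp
 then show "\<tau> w \<le> ?k * T / n" using assms by auto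
 show "?k * T / n \<le> \<tau> w + T / n"
 proof (cases ?k)
  case 0
  then show ?thesis using assms T by simp
 next
  case (Suc j)
  then have "j < n" "j < ?k" using stop_index_le[of T \<tau> n w] by auto
  then have "j * T / n \<le> \<tau> w" using stop_index_gr[OF _ T] by blast
  then show ?thesis by (simp add: Suc add_divide_distrib distrib_right)
 qed
qed

lemma stop_index_tendsto:
 fixes T :: real
 assumes "0 \<le> \<tau> w" "\<tau> w \<le> T"
 shows "(\<lambda>n. stop_index T \<tau> (Suc n) w * T / Suc n) \<longlonglongrightarrow> \<tau> w"
proof (rule tendsto_sandwich)
 show "\<forall>\<^sub>F n in sequentially. \<tau> w \<le> stop_index T \<tau> (Suc n) w * T / Suc n"
  "\<forall>\<^sub>F n in sequentially. stop_index T \<tau> (Suc n) w * T / Suc n \<le> \<tau> w + T / Suc n"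
  using stop_index_approx[OF zero_less_Suc, of \<tau> w T] assms by (auto intro!: always_eventually simp del: of_nat_Suc)
 have "(\<lambda>n. \<tau> w + T * inverse (real (Suc n))) \<longlonglongrightarrow> \<tau> w + T * 0"
  by (intro tendsto_intros LIMSEQ_inverse_real_of_nat)
 then show "(\<lambda>n. \<tau> w + T / Suc n) \<longlonglongrightarrow> \<tau> w" by (simp add: divide_inverse)
qed simp

lemma stop_indicator_measurable:
 fixes T :: real
 assumes T: "0 \<le> T" and nn: "\<And>w. w \<in> space M ==> 0 \<le> \<tau> w"
  and opt: "\<And>s. 0 < s ==> s \<le> T ==> {w\<in>space M. \<tau> w < s} \<in> sets (F s)"
  and i: "i < n"
 shows "(\<lambda>w. if i < stop_index T \<tau> n w then 1 else (0::real)) \<in> borel_measurable (F (i * T / n))"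
proof (intro measurable_If)
 let ?s = "i * T / n"
 have s: "0 \<le> ?s" "?s \<le> T"
 proof -
  show "0 \<le> ?s" using T by simp
  have "real i * T \<le> real n * T" using i T by (intro mult_right_mono) auto
  then show "?s \<le> T" using i by (simp add: divide_le_eq mult.commute)
 qed
 have "{w\<in>space M. \<tau> w < ?s} \<in> sets (F ?s)"
 proof (cases "?s = 0")
  \<comment> \<open>The assumption \<open>opt\<close> covers positive times; at time 0 the event is
    empty.\<close>
  case True
  then have e: "{w\<in>space M. \<tau> w < ?s} = {}" using nn by (auto simp: not_less)
  show ?thesis unfolding e by simp
 next
  case False
  then show ?thesis using s by (intro opt) auto
 qed
 then have "space (F ?s) - {w\<in>space M. \<tau> w < ?s} \<in> sets (F ?s)" by auto
 moreover have "space (F ?s) - {w\<in>space M. \<tau> w < ?s} = {w \<in> space (F ?s). i < stop_index T \<tau> n w}"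
  using stop_index_gr[OF i T] by (auto simp: space_F)
 ultimately show "{w \<in> space (F ?s). i < stop_index T \<tau> n w} \<in> sets (F ?s)"
  by simp
qed auto

text \<open>Stopping at a grid index sums the increments up to that index, so the stopped value is a
  transform with coefficients 0 and 1.\<close>

lemma stopped_eq_transform:
 fixes m :: "real => 'w => real" and T :: real
 shows "m (stop_index T \<tau> n w * T / n) w =
   m 0 w + transform m (\<lambda>i w. if i < stop_index T \<tau> n w then 1 else 0) (\<lambda>i. i * T / n) n w"
proof -
 have "k \<le> n ==> m 0 w + transform m (\<lambda>i w. if i < stop_index T \<tau> n w then 1 else 0) (\<lambda>i. i * T / n) k w
  = m (min k (stop_index T \<tau> n w) * T / n) w" for k
 proof (induction k)
  case (Suc k)
  have c: "min (Suc k) (stop_index T \<tau> n w) = (if k < stop_index T \<tau> n w then Suc k else stop_index T \<tau> n w)"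
   "min k (stop_index T \<tau> n w) = (if k < stop_index T \<tau> n w then k else stop_index T \<tau> n w)"
   by auto
  have "m 0 w + transform m (\<lambda>i w. if i < stop_index T \<tau> n w then 1 else 0) (\<lambda>i. i * T / n) k w
   = m (min k (stop_index T \<tau> n w) * T / n) w" using Suc by simp
  then show ?case unfolding transform_Suc c by (cases "k < stop_index T \<tau> n w") simp_all
 qed simp
 from this[of n] stop_index_le[of T \<tau> n w] show ?thesis by (simp add: min_absorb2)
qed

lemma grid_mono: "0 \<le> (T::real) ==> mono (\<lambda>i. real i * T / real n)"
 by (intro monoI divide_right_mono mult_right_mono) auto

lemma stopped_tendsto:
 fixes T :: real
 assumes m: "adapted m" and w: "w \<in> space M" "0 \<le> \<tau> w" "\<tau> w \<le> T"
 shows "(\<lambda>n. m (stop_index T \<tau> (Suc n) w * T / Suc n) w) \<longlonglongrightarrow> m (\<tau> w) w"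
proof -
 note of_nat_Suc[simp del]
 have c: "continuous_on {0..} (\<lambda>t. m t w)" using m w by (simp add: continuous_adapted_def)
 have "\<forall>\<^sub>F n in sequentially. stop_index T \<tau> (Suc n) w * T / Suc n \<in> {0..}" using w by auto
 from continuous_on_tendsto_compose[OF c stop_index_tendsto[of \<tau> w T] _ this] w show ?thesis by simp
qed

lemma stopped_measurable:
 fixes T :: real
 assumes m: "adapted m"
  and T: "0 \<le> T" and \<tau>: "\<And>w. w \<in> space M ==> 0 \<le> \<tau> w" "\<And>w. w \<in> space M ==> \<tau> w \<le> T"
  and opt: "\<And>s. 0 < s ==> s \<le> T ==> {w\<in>space M. \<tau> w < s} \<in> sets (F s)"
 shows "(\<lambda>w. m (\<tau> w) w) \<in> borel_measurable (F T)"
  "\<And>n. (\<lambda>w. m (stop_index T \<tau> (Suc n) w * T / Suc n) w) \<in> borel_measurable (F T)"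
proof -
 note of_nat_Suc[simp del]
 show *: "(\<lambda>w. m (stop_index T \<tau> (Suc n) w * T / Suc n) w) \<in> borel_measurable (F T)" for n
 proof -
  have "transform m (\<lambda>i w. if i < stop_index T \<tau> (Suc n) w then 1 else 0) (\<lambda>i. i * T / Suc n) (Suc n)
    \<in> borel_measurable (F (Suc n * T / Suc n))"
   using stop_indicator_measurable[OF T \<tau>(1) opt] T by (intro transform_measurable[OF m] grid_mono) auto
  moreover have "m 0 \<in> borel_measurable (F T)" using T by (intro continuous_adapted_measurable_le[OF m]) auto
  ultimately show ?thesis unfolding stopped_eq_transform by simp
 qed
 show "(\<lambda>w. m (\<tau> w) w) \<in> borel_measurable (F T)"
 proof (rule borel_measurable_LIMSEQ_real[where u="\<lambda>n w. m (stop_index T \<tau> (Suc n) w * T / Suc n) w"])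
  show "(\<lambda>n. m (stop_index T \<tau> (Suc n) w * T / Suc n) w) \<longlonglongrightarrow> m (\<tau> w) w" if "w \<in> space (F T)" for w
   using that \<tau> by (intro stopped_tendsto[OF m]) (auto simp: space_F)
 qed (rule *)
qed

text \<open>On the grid, second moments are bounded by that of \<open>m T\<close> and expectations
  equal that of \<open>m 0\<close>. Path continuity makes the stopped grid values converge, and the
  uniform second moment bound carries both facts to the limit.\<close>

theorem optional_stopping:
 fixes T :: real
 assumes m: "L2_martingale m"
  and T: "0 \<le> T" and \<tau>: "\<And>w. w \<in> space M ==> 0 \<le> \<tau> w" "\<And>w. w \<in> space M ==> \<tau> w \<le> T"
  and opt: "\<And>s. 0 < s ==> s \<le> T ==> {w\<in>space M. \<tau> w < s} \<in> sets (F s)"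
 shows "integrable M (\<lambda>w. (m (\<tau> w) w)^2)"
  "\<E> (\<lambda>w. (m (\<tau> w) w)^2) \<le> \<E> (\<lambda>w. (m T w)^2)"
  "\<E> (\<lambda>w. m (\<tau> w) w) = \<E> (m 0)"
proof -
 note of_nat_Suc[simp del]
 have mc: "adapted m" using m by (simp add: L2_martingale_def)
 define Y where "Y n w = m (stop_index T \<tau> (Suc n) w * T / Suc n) w" for n w
 have [measurable]: "Y n \<in> borel_measurable M" "(\<lambda>w. m (\<tau> w) w) \<in> borel_measurable M" for n
  using stopped_measurable[OF mc T \<tau> opt] unfolding Y_def by (auto intro!: measurable_F[OF T])
 have Y: "integrable M (\<lambda>w. (Y n w)^2)" "\<E> (\<lambda>w. (Y n w)^2) \<le> \<E> (\<lambda>w. (m T w)^2)"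
  "\<E> (Y n) = \<E> (m 0)" for n
  using stopped_transform_moments[OF m _ grid_mono[OF T, of "Suc n"], of "Suc n" "\<lambda>i w. if i < stop_index T \<tau> (Suc n) w then 1 else 0"]
   stop_indicator_measurable[OF T \<tau>(1) opt, of _ "Suc n"] T
  unfolding Y_def stopped_eq_transform by auto
 have "null_in_prob (\<lambda>n w. Y n w - m (\<tau> w) w)"
  unfolding Y_def using stopped_measurable[OF mc T \<tau> opt] stopped_tendsto[OF mc, of _ \<tau>] \<tau>
  by (intro null_in_prob_AE) (auto intro!: AE_I2 measurable_F[OF T] simp: LIM_zero_iff)
 note L = L2_bounded_limit[OF this _ _ Y(1,2)]
 show "integrable M (\<lambda>w. (m (\<tau> w) w)^2)" "\<E> (\<lambda>w. (m (\<tau> w) w)^2) \<le> \<E> (\<lambda>w. (m T w)^2)"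
  by (rule L; simp)+
 have "(\<lambda>n. \<E> (Y n)) \<longlonglongrightarrow> \<E> (\<lambda>w. m (\<tau> w) w)" by (rule L) simp_all
 then show "\<E> (\<lambda>w. m (\<tau> w) w) = \<E> (m 0)"
  by (simp add: Y(3) LIMSEQ_const_iff)
qed

text \<open>Optional stopping at a time that switches between \<open>min t \<tau>\<close> and
  \<open>min s \<tau>\<close> according to \<open>A\<close> yields the martingale property tested on
  \<open>A\<close>.\<close>

lemma stopped_L2_martingale:
 assumes m: "L2_martingale m"
  and \<tau>: "\<And>w. w \<in> space M ==> 0 \<le> \<tau> w" and opt: "\<And>s. 0 < s ==> {w\<in>space M. \<tau> w < s} \<in> sets (F s)"
 shows "L2_martingale (\<lambda>t w. m (min t (\<tau> w)) w)"
proof -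
 have mc: "adapted m" using m by (simp add: L2_martingale_def)
 have opt': "{w\<in>space M. min t (\<tau> w) < s} \<in> sets (F s)" if "0 < s" "s \<le> t" for s t
 proof -
  have "{w\<in>space M. min t (\<tau> w) < s} = {w\<in>space M. \<tau> w < s}" using that by auto
  then show ?thesis using opt[OF that(1)] by simp
 qed
 have meas: "(\<lambda>w. m (min t (\<tau> w)) w) \<in> borel_measurable (F t)" if "0 \<le> t" for t
  using \<tau> that by (intro stopped_measurable(1)[OF mc _ _ _ opt']) auto
 have i2: "integrable M (\<lambda>w. (m (min t (\<tau> w)) w)^2)" "\<E> (\<lambda>w. m (min t (\<tau> w)) w) = \<E> (m 0)" if "0 \<le> t" for t
  using \<tau> that by (auto intro!: optional_stopping(1,3)[OF m _ _ _ opt', of t])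
 have i: "integrable M (\<lambda>w. m (min t (\<tau> w)) w)" if "0 \<le> t" for t
  using square_integrable_imp_integrable[OF _ i2(1)[OF that]] measurable_F[OF that meas[OF that]] by simp
 show ?thesis
 proof (rule L2_martingaleI)
  fix s t A assume st: "0 \<le> s" "s \<le> t" and A: "A \<in> sets (F s)"
  have t: "0 \<le> t" using st by simp
  define \<rho> where "\<rho> w = (if w \<in> A then min t (\<tau> w) else min s (\<tau> w))" for w
  have AM[measurable]: "A \<in> sets M" using A sets_F_subset[OF st(1)] by auto
  have "{w\<in>space M. \<rho> w < r} \<in> sets (F r)" if r: "0 < r" "r \<le> t" for r
  proof (cases "r \<le> s")
   case True
   then have "{w\<in>space M. \<rho> w < r} = {w\<in>space M. \<tau> w < r}" using r by (auto simp: \<rho>_def)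
   then show ?thesis using opt[OF r(1)] by simp
  next
   \<comment> \<open>Now \<open>s < r\<close>, so that off \<open>A\<close> the time
     \<open>\<rho>\<close> is certainly below \<open>r\<close>, and \<open>A\<close> itself is known
     at time \<open>r\<close>.\<close>
   case False
   then have "{w\<in>space M. \<rho> w < r} = (A \<inter> {w\<in>space M. \<tau> w < r}) \<union> (space (F r) - A)"
    using r sets.sets_into_space[OF A] by (auto simp: \<rho>_def space_F)
   moreover have "A \<in> sets (F r)" using A sets_F_mono[of s r] False by auto
   ultimately show ?thesis using opt[OF r(1)] by auto
  qed
  then have 1: "integrable M (\<lambda>w. (m (\<rho> w) w)^2)" "\<E> (\<lambda>w. m (\<rho> w) w) = \<E> (m 0)"
   using \<tau> t st by (auto simp: \<rho>_def intro!: optional_stopping(1,3)[OF m t])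
  have mi: "m (\<rho> w) w = indicat_real A w * m (min t (\<tau> w)) w + (m (min s (\<tau> w)) w - indicat_real A w * m (min s (\<tau> w)) w)" for w
   by (simp add: \<rho>_def indicator_def)
  have ii: "integrable M (\<lambda>w. indicat_real A w * m (min r (\<tau> w)) w)" if "0 \<le> r" for r
   using i[OF that] by (intro integrable_bounded_mult[where c=1]) (auto simp: indicator_def)
  have "\<E> (m 0) = \<E> (\<lambda>w. indicat_real A w * m (min t (\<tau> w)) w)
    + (\<E> (\<lambda>w. m (min s (\<tau> w)) w) - \<E> (\<lambda>w. indicat_real A w * m (min s (\<tau> w)) w))"
   using 1(2) unfolding mi using ii[OF t] ii[OF st(1)] i[OF st(1)] by simp
  then show "\<E> (\<lambda>w. indicat_real A w * (m (min t (\<tau> w)) w - m (min s (\<tau> w)) w)) = 0"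
   using i2(2)[OF st(1)] ii[OF t] ii[OF st(1)] by (simp add: right_diff_distrib)
 next
  show "adapted (\<lambda>t w. m (min t (\<tau> w)) w)"
   unfolding continuous_adapted_def
  proof (intro conjI ballI allI impI meas)
   fix w assume w: "w \<in> space M"
   have "continuous_on {0..} (\<lambda>t. m t w)" using mc w by (simp add: continuous_adapted_def)
   then show "continuous_on {0..} (\<lambda>t. m (min t (\<tau> w)) w)"
    using \<tau>[OF w] by (intro continuous_on_compose2[of "{0..}" "\<lambda>t. m t w" "{0..}" "\<lambda>t. min t (\<tau> w)"])
     (auto intro!: continuous_intros)
  qed
 qed (rule i2)
qed

section \<open>Exit times of continuous adapted processes\<close>

definition exit_time :: "(real => 'w => real) => real => real => 'w => real" where
 "exit_time D c T w = Inf (insert T {s\<in>{0..T}. c < D s w})"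

lemma exit_time_bounds:
 assumes "0 \<le> T"
 shows "0 \<le> exit_time D c T w" "exit_time D c T w \<le> T"
proof -
 have "bdd_below (insert T {s\<in>{0..T}. c < D s w})" by (rule bdd_belowI[of _ 0]) (use assms in auto)
 then show "exit_time D c T w \<le> T" unfolding exit_time_def by (intro cInf_lower) auto
 show "0 \<le> exit_time D c T w" unfolding exit_time_def using assms by (intro cInf_greatest) auto
qed

lemma exit_time_less:
 assumes "0 \<le> T" "s \<le> T"
 shows "exit_time D c T w < s \<longleftrightarrow> (\<exists>r. 0 \<le> r \<and> r < s \<and> c < D r w)"
proof -
 have "bdd_below (insert T {s\<in>{0..T}. c < D s w})" by (rule bdd_belowI[of _ 0]) (use assms in auto)
 then have "exit_time D c T w < s \<longleftrightarrow> (\<exists>x\<in>insert T {s\<in>{0..T}. c < D s w}. x < s)"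
  unfolding exit_time_def by (intro cInf_less_iff) auto
 also have "\<dots> \<longleftrightarrow> (\<exists>r. 0 \<le> r \<and> r < s \<and> c < D r w)" using assms by auto
 finally show ?thesis .
qed

lemma before_exit_time:
 assumes "0 \<le> T" "0 \<le> s" "s < exit_time D c T w"
 shows "D s w \<le> c"
proof (rule ccontr)
 assume "\<not> D s w \<le> c"
 moreover have "s < T" using assms exit_time_bounds(2)[OF assms(1), of D c w] by simp
 moreover define r where "r = (s + exit_time D c T w) / 2"
 ultimately have "exit_time D c T w < r"
  using assms exit_time_bounds(2)[OF assms(1), of D c w]
  by (subst exit_time_less) (auto intro!: exI[of _ s])
 then show False using assms by (simp add: r_def)
qed

lemma exit_time_eq:
 assumes "0 \<le> T" "\<And>s. 0 \<le> s ==> s < T ==> D s w \<le> c"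
 shows "exit_time D c T w = T"
proof (rule ccontr)
 assume "exit_time D c T w \<noteq> T"
 then have "exit_time D c T w < T" using exit_time_bounds[OF assms(1), of D c w] by simp
 then show False using assms by (subst (asm) exit_time_less) (auto simp: not_less[symmetric])
qed

text \<open>A strict excess persists on a right neighbourhood by continuity, so rational times
  suffice. The event \<open>exit_time D c T w < s\<close>, with strict inequality, is the form in
  which optional stopping asks for it.\<close>

lemma exit_time_optional:
 assumes D: "adapted D" and T: "0 \<le> T" and s: "0 < s" "s \<le> T"
 shows "{w\<in>space M. exit_time D c T w < s} \<in> sets (F s)"
proof -
 have eq: "{w\<in>space M. exit_time D c T w < s} = (\<Union>r\<in>\<rat> \<inter> {0..<s}. {w\<in>space (F s). c < D r w})"
 proof safe
  fix w assume w: "w \<in> space M" "exit_time D c T w < s"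
  then obtain r where r: "0 \<le> r" "r < s" "c < D r w" using exit_time_less[OF T s(2)] by blast
  have cont: "continuous_on {0..} (\<lambda>t. D t w)" using D w by (simp add: continuous_adapted_def)
  have "\<exists>q\<in>\<rat>. q \<in> {0..<s} \<and> c < D q w"
  proof -
   have "continuous (at r within {0..}) (\<lambda>t. D t w)" using cont r by (simp add: continuous_on_eq_continuous_within)
   then have "((\<lambda>t. D t w) \<longlongrightarrow> D r w) (at r within {0..})" by (simp add: continuous_within)
   then have "((\<lambda>t. D t w) \<longlongrightarrow> D r w) (at_right r)"
    by (rule tendsto_within_subset) (use r in auto)
   then have "\<forall>\<^sub>F t in at_right r. c < D t w" using r by (intro order_tendstoD)
   moreover have "\<forall>\<^sub>F t in at_right r. t < s"
    using eventually_at_right_real[OF r(2)] by (rule eventually_mono) simp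
   ultimately have "\<forall>\<^sub>F t in at_right r. c < D t w \<and> t < s"
    by (rule eventually_conj)
   then obtain b where b: "r < b" "\<And>y. r < y ==> y < b ==> c < D y w \<and> y < s"
    unfolding eventually_at_right_field by auto
   obtain q where "q \<in> \<rat>" "r < q" "q < b" using Rats_dense_in_real[OF b(1)] by auto
   then show ?thesis using b(2)[of q] r by (intro bexI[of _ q]) auto
  qed
  then show "w \<in> (\<Union>r\<in>\<rat> \<inter> {0..<s}. {w\<in>space (F s). c < D r w})" using w by (auto simp: space_F)
 next
  fix w q assume "q \<in> \<rat>" "q \<in> {0..<s}" "w \<in> space (F s)" "c < D q w"
  then show "w \<in> space M" "exit_time D c T w < s"
   using exit_time_less[OF T s(2)] by (auto simp: space_F)
 qed
 have "{w\<in>space (F s). c < D r w} \<in> sets (F s)" if "r \<in> {0..<s}" for r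
  using continuous_adapted_measurable_le[OF D, of r s] that by (intro borel_measurable_less) auto
 then show ?thesis unfolding eq by (intro sets.countable_UN'') (auto intro: countable_rat)
qed

text \<open>The value at a positive exit time is the limit of values just before it; the assumption
  at time 0 covers an immediate exit.\<close>

lemma at_exit_time:
 assumes D: "adapted D" and T: "0 \<le> T" and w: "w \<in> space M" "D 0 w \<le> c"
 shows "D (exit_time D c T w) w \<le> c"
proof (cases "exit_time D c T w = 0")
 case True
 then show ?thesis using w by simp
next
 case False
 let ?e = "exit_time D c T w"
 have e: "0 < ?e" using False exit_time_bounds(1)[OF T, of D c w] by simp
 have cont: "continuous_on {0..} (\<lambda>t. D t w)" using D w by (simp add: continuous_adapted_def)
 have l: "(\<lambda>n. ?e * (1 - inverse (real (Suc n)))) \<longlonglongrightarrow> ?e * (1 - 0)"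
  by (intro tendsto_intros LIMSEQ_inverse_real_of_nat)
 have p: "0 \<le> ?e * (1 - inverse (real (Suc n)))" "?e * (1 - inverse (real (Suc n))) < ?e" for n
  using e by (auto simp: field_simps)
 have "(\<lambda>n. D (?e * (1 - inverse (real (Suc n)))) w) \<longlonglongrightarrow> D ?e w"
  using continuous_on_tendsto_compose[OF cont l] e p(1) by auto
 then show ?thesis
  using before_exit_time[OF T p(1) p(2)] by (intro LIMSEQ_le_const2) auto
qed

end

section \<open>Continuous local martingales of bounded variation\<close>

text \<open>Taylor estimate for a convex function of linear growth: quadratic in small steps, linear
  in large ones. It takes the place of the square for martingales of which only first moments are
  known.\<close>

lemma sqrt_taylor_bound:
 fixes x h :: real
 shows "sqrt (1 + (x + h)^2) - sqrt (1 + x^2) - x / sqrt (1 + x^2) * h \<le> \<bar>h\<bar> * min (\<bar>h\<bar> / 2) 2"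
proof -
 define s where "s = sqrt (1 + x^2)"
 define t where "t = sqrt (1 + (x + h)^2)"
 have s: "1 \<le> s" "s^2 = 1 + x^2" and t: "1 \<le> t" "t^2 = 1 + (x + h)^2"
  by (auto simp: s_def t_def)
 have xs: "\<bar>x\<bar> \<le> s" unfolding s_def by (rule real_le_rsqrt) simp
 have "0 \<le> (t - s)^2" by simp
 then have "2 * (t * s) \<le> 2 + x^2 + (x + h)^2" using s t by (simp add: power2_diff)
 then have ts: "t * s - 1 - x * (x + h) \<le> h^2 / 2" by (simp add: power2_eq_square algebra_simps)
 have "t - s - x / s * h = (t * s - s^2 - x * h) / s"
  using s by (simp add: field_simps power2_eq_square)
 also have "\<dots> = (t * s - 1 - x * (x + h)) / s" using s by (simp add: power2_eq_square algebra_simps)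
 also have "\<dots> \<le> (h^2 / 2) / s" using ts s by (intro divide_right_mono) auto
 also have "\<dots> \<le> (h^2 / 2) / 1" using s by (intro divide_left_mono) auto
 finally have 1: "t - s - x / s * h \<le> \<bar>h\<bar> * (\<bar>h\<bar> / 2)" by (simp add: power2_eq_square)
 have "(t - s) * (t + s) = h * ((x + h) + x)" using s t by (simp add: power2_eq_square algebra_simps)
 also have "\<dots> \<le> \<bar>h\<bar> * (t + s)"
 proof -
  have "\<bar>x + h\<bar> \<le> t" unfolding t_def by (rule real_le_rsqrt) simp
  then have "\<bar>(x + h) + x\<bar> \<le> t + s" using xs by linarith
  have "h * ((x + h) + x) \<le> \<bar>h\<bar> * \<bar>(x + h) + x\<bar>" by (metis abs_ge_self abs_mult)
  also have "\<dots> \<le> \<bar>h\<bar> * (t + s)" using \<open>\<bar>(x + h) + x\<bar> \<le> t + s\<close> by (rule mult_left_mono) simp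
  finally show ?thesis .
 qed
 finally have "t - s \<le> \<bar>h\<bar>" using s t by (simp add: mult_le_cancel_right)
 moreover have "- (x / s * h) \<le> \<bar>h\<bar>"
 proof -
  have "\<bar>x / s\<bar> \<le> 1" using xs s by (simp add: abs_div divide_le_eq)
  then have "\<bar>x / s\<bar> * \<bar>h\<bar> \<le> 1 * \<bar>h\<bar>" by (rule mult_right_mono) simp
  then show ?thesis by (metis abs_ge_minus_self abs_mult mult_1 order_trans)
 qed
 ultimately have 2: "t - s - x / s * h \<le> \<bar>h\<bar> * 2" by linarith
 show ?thesis
  using 1 2 unfolding s_def[symmetric] t_def[symmetric] by (auto simp: min_def)
qed

lemma continuous_zero_on_rationals:
 fixes f :: "real => real"
 assumes f: "continuous_on {0..} f" and z: "\<And>q. q \<in> \<rat> ==> 0 < q ==> f q = 0" and t: "0 \<le> t"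
 shows "f t = 0"
proof (rule ccontr)
 assume "f t \<noteq> 0"
 have "(f \<longlongrightarrow> f t) (at t within {0..})" using f t by (auto simp: continuous_on_def)
 then have "(f \<longlongrightarrow> f t) (at_right t)" by (rule tendsto_within_subset) (use t in auto)
 then have "\<forall>\<^sub>F s in at_right t. f s \<noteq> 0" using \<open>f t \<noteq> 0\<close> by (rule tendsto_imp_eventually_ne)
 then obtain b where b: "t < b" "\<And>y. t < y ==> y < b ==> f y \<noteq> 0"
  unfolding eventually_at_right_field by auto
 obtain q where "q \<in> \<rat>" "t < q" "q < b" using Rats_dense_in_real[OF b(1)] by auto
 then show False using b(2)[of q] z[of q] t by simp
qed

lemma grid_increments_small:
 fixes f :: "real => real" and T :: real
 assumes f: "continuous_on {0..T} f" and T: "0 \<le> T" and e: "0 < e"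
 shows "\<forall>\<^sub>F n in sequentially. \<forall>i<2^n. \<bar>f (Suc i * T / 2^n) - f (i * T / 2^n)\<bar> < e"
proof -
 have "uniformly_continuous_on {0..T} f" using f by (rule compact_uniformly_continuous) simp
 then obtain d where d: "0 < d" "\<And>x y. x \<in> {0..T} ==> y \<in> {0..T} ==> dist y x < d ==> dist (f y) (f x) < e"
  using e unfolding uniformly_continuous_on_def by metis
 have "(\<lambda>n. T * inverse 2 ^ n) \<longlonglongrightarrow> T * 0"
  by (intro tendsto_intros LIMSEQ_realpow_zero) auto
 then have "\<forall>\<^sub>F n in sequentially. T * inverse 2 ^ n < d" using d by (intro order_tendstoD) auto
 then show ?thesis
 proof eventually_elim
  case (elim n)
  show ?case
  proof (intro allI impI)
   fix i :: nat assume i: "i < 2^n"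
   have "real (Suc i) \<le> 2 ^ n" using i by (metis Suc_leI of_nat_le_iff of_nat_numeral of_nat_power)
   moreover from this have "real i \<le> 2 ^ n" using of_nat_Suc[of i] by linarith
   ultimately have "real (Suc i) * T \<le> 2^n * T" "real i * T \<le> 2^n * T" using T by (auto intro!: mult_right_mono simp del: of_nat_Suc)
   then have "Suc i * T / 2^n \<in> {0..T}" "i * T / 2^n \<in> {0..T}"
    using T by (auto simp: divide_le_eq mult.commute)
   moreover have "dist (Suc i * T / 2^n) (i * T / 2^n) < d"
   proof -
    have "Suc i * T / 2^n - i * T / 2^n = T * inverse 2 ^ n"
     by (simp add: field_simps power_inverse)
    then show ?thesis using elim T by (simp add: dist_real_def)
   qed
   ultimately show "\<bar>f (Suc i * T / 2^n) - f (i * T / 2^n)\<bar> < e"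
    using d(2)[of "i * T / 2^n" "Suc i * T / 2^n"] by (simp add: dist_real_def)
  qed
 qed
qed

lemma sum_le_total_variation:
 assumes "mono \<tau>" "\<tau> 0 = 0" "\<tau> n = t"
 shows "(\<Sum>i<n. ennreal \<bar>f (\<tau> (Suc i)) - f (\<tau> i)\<bar>) \<le> total_variation f t"
 unfolding total_variation_def
 by (rule SUP_upper2[of "(n, \<tau>)"]) (use assms in auto)

context filtered_prob_space
begin

lemma martingale_incr_bounded:
 assumes m: "martingale M F m" and st: "0 \<le> s" "s \<le> t" and \<xi>: "\<xi> \<in> borel_measurable (F s)"
  and bd: "\<And>w. w \<in> space M ==> \<bar>\<xi> w\<bar> \<le> c"
 shows "has_bochner_integral M (\<lambda>w. \<xi> w * (m t w - m s w)) 0"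
proof -
 have "integrable M (m t)" using m st by (simp add: martingale_def)
 then have 1: "integrable M (\<lambda>w. \<xi> w * m t w)"
  using measurable_F[OF st(1) \<xi>] bd by (rule integrable_bounded_mult)
 show ?thesis using martingale_orthogonal[OF m st \<xi> 1] 1
  by (simp add: has_bochner_integral_iff right_diff_distrib)
qed

text \<open>The martingale is stopped at the first grid point at which the variation along the grid exceeds
 \<open>K\<close>. The overshoot of that last step is not bounded, but it is dominated through
 \<open>E[\<bar>P\<bar> \<epsilon>] \<le> E[\<bar>m T\<bar> \<epsilon>]\<close>, where \<open>P\<close> is the stopped value and \<open>\<epsilon>\<close> a bound for the increments used.\<close>

lemma bounded_variation_stopped_bound:
 fixes n :: nat
 assumes m: "martingale M F m" and u: "u 0 = 0" "mono u" and K: "0 \<le> K"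
 defines "V \<equiv> \<lambda>i w. \<Sum>l<i. \<bar>m (u (Suc l)) w - m (u l) w\<bar>"
 defines "\<kappa> \<equiv> \<lambda>i w. if V i w \<le> K then 1 else (0::real)"
 defines "P \<equiv> transform m \<kappa> u"
 shows "\<exists>\<epsilon>. \<epsilon> \<in> borel_measurable M \<and> (\<forall>w. 0 \<le> \<epsilon> w \<and> \<epsilon> w \<le> 2)
  \<and> (\<forall>w e. 0 \<le> e \<longrightarrow> (\<forall>i<n. \<bar>m (u (Suc i)) w - m (u i) w\<bar> \<le> e) \<longrightarrow> \<epsilon> w \<le> e)
  \<and> integrable M (P n)
  \<and> \<E> (\<lambda>w. sqrt (1 + (P n w)^2) - 1) \<le> \<E> (\<lambda>w. (2 * K + \<bar>m (u n) w\<bar> + \<bar>m 0 w\<bar>) * \<epsilon> w)"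
proof -
 define h where "h i w = \<kappa> i w * (m (u (Suc i)) w - m (u i) w)" for i w
 \<comment> \<open>\<open>mx\<close> records the largest increment used so far;
   \<open>\<epsilon>\<close> is the factor \<open>min (\<bar>h\<bar> / 2) 2\<close> of the Taylor
   bound, evaluated at that maximum.\<close>
 define mx where "mx i w = Max (insert 0 ((\<lambda>l. \<bar>h l w\<bar>) ` {..<i}))" for i w
 define \<epsilon> where "\<epsilon> i w = min (mx i w / 2) 2" for i w
 have u0: "0 \<le> u i" for i using u monoD[OF u(2), of 0 i] by simp
 have un: "u i \<le> u (Suc i)" for i using u by (simp add: monoD)
 have mF: "m (u i) \<in> borel_measurable (F (u j))" if "i \<le> j" for i j
  using m measurable_F_mono[of "m (u i)" "u i" "u j"] monoD[OF u(2) that] u0 by (auto simp: martingale_def)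
 have im: "integrable M (m (u i))" for i using m u0 by (simp add: martingale_def)
 have VF: "V i \<in> borel_measurable (F (u i))" for i
  unfolding V_def using mF by (intro borel_measurable_sum borel_measurable_abs borel_measurable_diff) auto
 have \<kappa>F: "\<kappa> i \<in> borel_measurable (F (u i))" for i
  unfolding \<kappa>_def using borel_measurable_le[OF VF[of i] borel_measurable_const[of K]]
  by (intro measurable_If) auto
 have \<kappa>F': "\<kappa> i \<in> borel_measurable (F (u j))" if "i \<le> j" for i j
  using measurable_F_mono[OF \<kappa>F monoD[OF u(2) that]] .
 have hF: "h i \<in> borel_measurable (F (u j))" if "i < j" for i j
  unfolding h_def using \<kappa>F' mF that by (intro borel_measurable_times borel_measurable_diff) auto
 have PS: "P i w = (\<Sum>l<i. h l w)" for i w by (simp add: P_def transform_def h_def)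
 have PSuc: "P (Suc i) w = P i w + h i w" "P 0 w = 0" for i w by (simp_all add: PS)
 have PF: "P i \<in> borel_measurable (F (u i))" for i
  unfolding PS using hF by (intro borel_measurable_sum) auto
 have w0: "0 \<le> mx i w" for i w unfolding mx_def by (intro Max_ge) auto
 have wSuc: "mx (Suc i) w = max \<bar>h i w\<bar> (mx i w)" "mx 0 w = 0" for i w
  unfolding mx_def lessThan_Suc image_insert insert_commute[of 0] by (subst Max_insert) auto
 have wF: "mx i \<in> borel_measurable (F (u j))" if "i \<le> j" for i j
  using that
 proof (induction i)
  case 0
  show ?case by (simp add: wSuc(2)[abs_def])
 next
  case (Suc i)
  then have "(\<lambda>w. max \<bar>h i w\<bar> (mx i w)) \<in> borel_measurable (F (u j))"
   using hF[of i j] by (intro borel_measurable_max borel_measurable_abs) auto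
  then show ?case by (simp add: wSuc(1)[abs_def])
 qed
 have \<epsilon>F: "\<epsilon> i \<in> borel_measurable (F (u i))" for i
  unfolding \<epsilon>_def using wF[of i i] by (intro borel_measurable_min borel_measurable_divide) auto
 have \<epsilon>b: "0 \<le> \<epsilon> i w" "\<epsilon> i w \<le> 2" for i w using w0[of i w] by (auto simp: \<epsilon>_def)
 note M_meas[measurable] = measurable_F[OF u0 \<kappa>F] measurable_F[OF u0 PF] measurable_F[OF u0 \<epsilon>F]
  measurable_F[OF u0 hF[OF lessI]] measurable_F[OF u0 mF[OF order_refl]]
 have \<kappa>01: "\<kappa> i w \<in> {0,1}" for i w by (simp add: \<kappa>_def)
 have Vmono: "V i w \<le> V j w" if "i \<le> j" for i j w
  unfolding V_def using that by (intro sum_mono2) auto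
 have \<kappa>0: "\<kappa> j w = 0" if "\<kappa> i w = 0" "i \<le> j" for i j w
  using Vmono[OF that(2), of w] that(1) by (auto simp: \<kappa>_def split: if_splits)
 have ih: "integrable M (h i)" for i
  unfolding h_def using im
 proof (intro integrable_bounded_mult[where c=1])
  show "\<bar>\<kappa> i w\<bar> \<le> 1" for w by (simp add: \<kappa>_def)
 qed auto
 have iP: "integrable M (P i)" for i unfolding PS using ih by auto
 \<comment> \<open>Once the coefficient is 0 it stays 0, and neither \<open>P\<close> nor
   \<open>\<epsilon>\<close> changes any more.\<close>
 have frozen: "P j w = P i w \<and> \<epsilon> j w = \<epsilon> i w" if "\<kappa> i w = 0" "i \<le> j" for i j w
 proof -
  have "P j w = P i w \<and> mx j w = mx i w"
   using that(2)
  proof (induction j rule: dec_induct)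
   case (step j)
   then have "h j w = 0" using \<kappa>0[OF that(1)] by (simp add: h_def)
   then show ?case using step w0[of j w] by (simp add: PSuc wSuc)
  qed simp
  then show ?thesis by (simp add: \<epsilon>_def)
 qed
 \<comment> \<open>Before the overshooting step the variation used is at most \<open>K\<close>, and
   so is \<open>\<bar>P\<bar>\<close>; the overshooting step itself is then at most
   \<open>\<bar>P n\<bar> + K\<close>.\<close>
 have hsum: "(\<Sum>i<n. \<bar>h i w\<bar>) \<le> 2 * K + \<bar>P n w\<bar>" for w
 proof -
  have "(\<Sum>i<k. \<bar>h i w\<bar>) \<le> (if \<kappa> k w = 1 then K else 2 * K + \<bar>P k w\<bar>)
    \<and> (\<kappa> k w = 1 \<longrightarrow> \<bar>P k w\<bar> \<le> K)" for k
  proof (induction k)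
   case 0
   show ?case using K by (simp add: \<kappa>_def PSuc)
  next
   case (Suc k)
   consider "\<kappa> k w = 0" | "\<kappa> k w = 1" "\<kappa> (Suc k) w = 0" | "\<kappa> k w = 1" "\<kappa> (Suc k) w = 1"
    using \<kappa>01[of k w] \<kappa>01[of "Suc k" w] by auto
   then show ?case
   proof cases
    case 1
    then have "\<kappa> (Suc k) w = 0" using \<kappa>0 by simp
    then show ?thesis using 1 Suc by (simp add: h_def PSuc)
   next
    case 2
    then show ?thesis using Suc by (auto simp: PSuc)
   next
    case 3
    have all1: "\<kappa> l w = 1" if "l \<le> k" for l using \<kappa>0[OF _ that] 3 \<kappa>01[of l w] by auto
    have "(\<Sum>i<Suc k. \<bar>h i w\<bar>) = V (Suc k) w"
     unfolding V_def h_def using all1 by (intro sum.cong) auto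
    also have "\<dots> \<le> K" using 3 by (auto simp: \<kappa>_def split: if_splits)
    finally have s: "(\<Sum>i<Suc k. \<bar>h i w\<bar>) \<le> K" .
    have "\<bar>P (Suc k) w\<bar> \<le> (\<Sum>i<Suc k. \<bar>h i w\<bar>)" unfolding PS by (rule sum_abs)
    then show ?thesis using s 3 by auto
   qed
  qed
  from this[of n] K show ?thesis by (auto split: if_splits)
 qed
 define \<Phi> where "\<Phi> x = sqrt (1 + x^2) - 1" for x :: real
 define \<phi> where "\<phi> x = x / sqrt (1 + x^2)" for x :: real
 have \<Phi>m: "\<Phi> \<in> borel_measurable borel" and \<phi>m: "\<phi> \<in> borel_measurable borel"
  unfolding \<Phi>_def \<phi>_def by (auto intro!: borel_measurable_divide)
 have \<phi>b: "\<bar>\<phi> x\<bar> \<le> 1" for x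
 proof -
  have "\<bar>x\<bar> \<le> sqrt (1 + x^2)" by (rule real_le_rsqrt) simp
  moreover have "0 < sqrt (1 + x^2)" by (simp add: add_pos_nonneg)
  ultimately show ?thesis by (simp add: \<phi>_def divide_le_eq)
 qed
 have step: "\<Phi> (P (Suc i) w) \<le> \<Phi> (P i w) + \<phi> (P i w) * h i w + \<bar>h i w\<bar> * \<epsilon> n w" if "i < n" for i w
 proof -
  have "\<bar>h i w\<bar> \<le> mx n w" unfolding mx_def using that by (intro Max_ge) auto
  then have "\<bar>h i w\<bar> * min (\<bar>h i w\<bar> / 2) 2 \<le> \<bar>h i w\<bar> * \<epsilon> n w"
   unfolding \<epsilon>_def by (intro mult_left_mono) auto
  then show ?thesis using sqrt_taylor_bound[of "P i w" "h i w"] by (simp add: \<Phi>_def \<phi>_def PSuc)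
 qed
 have path: "\<Phi> (P n w) \<le> (\<Sum>i<n. \<phi> (P i w) * h i w) + (2 * K + \<bar>P n w\<bar>) * \<epsilon> n w" for w
 proof -
  have "k \<le> n ==> \<Phi> (P k w) \<le> (\<Sum>i<k. \<phi> (P i w) * h i w) + (\<Sum>i<k. \<bar>h i w\<bar>) * \<epsilon> n w" for k
  proof (induction k)
   case 0
   show ?case by (simp add: \<Phi>_def PSuc)
  next
   case (Suc k)
   then show ?case using step[of k w] by (simp add: distrib_right)
  qed
  from this[of n] mult_right_mono[OF hsum[of w] \<epsilon>b(1)[of n w]] show ?thesis by simp
 qed
 have i1: "has_bochner_integral M (\<lambda>w. \<phi> (P i w) * h i w) 0" for i
 proof -
  have "(\<lambda>w. \<phi> (P i w) * \<kappa> i w) \<in> borel_measurable (F (u i))"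
   using measurable_compose[OF PF \<phi>m] \<kappa>F by (intro borel_measurable_times)
  moreover have "\<bar>\<phi> (P i w) * \<kappa> i w\<bar> \<le> 1" for w using \<phi>b \<kappa>01[of i w] by (auto simp: abs_mult)
  ultimately have "has_bochner_integral M (\<lambda>w. \<phi> (P i w) * \<kappa> i w * (m (u (Suc i)) w - m (u i) w)) 0"
   using martingale_incr_bounded[OF m u0 un] by blast
  then show ?thesis by (simp add: h_def mult.assoc)
 qed
 have i2: "has_bochner_integral M (\<lambda>w. \<Sum>i<n. \<phi> (P i w) * h i w) 0"
  using has_bochner_integral_sum[of "{..<n}" M "\<lambda>i w. \<phi> (P i w) * h i w" "\<lambda>_. 0"] i1 by simp
 have ia: "integrable M (\<lambda>w. \<epsilon> n w * \<bar>P n w\<bar>)" "integrable M (\<lambda>w. \<epsilon> n w * \<bar>m (u k) w\<bar>)" "integrable M (\<epsilon> n)" for k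
  using iP im \<epsilon>b by (auto intro: integrable_bounded_mult[where c=2] intro!: bounded_integrable[where f="\<epsilon> n" and c=2])
 have i\<Phi>: "integrable M (\<lambda>w. \<Phi> (P n w))"
 proof (rule Bochner_Integration.integrable_bound[OF iP[of n]])
  show "(\<lambda>w. \<Phi> (P n w)) \<in> borel_measurable M" using measurable_compose[OF M_meas(2) \<Phi>m] .
  show "AE w in M. norm (\<Phi> (P n w)) \<le> norm (P n w)"
  proof (rule AE_I2)
   fix w
   have "sqrt (1 + (P n w)^2) \<le> 1 + \<bar>P n w\<bar>" by (rule real_le_lsqrt) (auto simp: power2_sum)
   then show "norm (\<Phi> (P n w)) \<le> norm (P n w)" by (simp add: \<Phi>_def)
  qed
 qed
 text \<open>After stopping nothing changes, so \<open>sgn P \<sqdot> \<epsilon>\<close> is known at every later grid point.\<close>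
 have dom: "\<E> (\<lambda>w. \<epsilon> n w * \<bar>P n w\<bar>) \<le> \<E> (\<lambda>w. \<epsilon> n w * (\<bar>m (u n) w\<bar> + \<bar>m 0 w\<bar>))"
 proof -
  define \<xi> where "\<xi> i w = sgn (P i w) * \<epsilon> i w" for i w
  have \<xi>F: "\<xi> i \<in> borel_measurable (F (u i))" for i
   unfolding \<xi>_def using \<epsilon>F PF by (intro borel_measurable_times measurable_compose[OF PF] borel_measurable_sgn) auto
  have \<xi>b: "\<bar>\<xi> i w\<bar> \<le> 2" for i w using \<epsilon>b[of i w] by (auto simp: \<xi>_def abs_mult sgn_real_def)
  have j1: "has_bochner_integral M (\<lambda>w. \<xi> n w * (1 - \<kappa> i w) * (m (u (Suc i)) w - m (u i) w)) 0" if i: "i < n" for i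
  proof -
   have eq: "\<xi> n w * (1 - \<kappa> i w) = \<xi> i w * (1 - \<kappa> i w)" for w
    using frozen[of i w n] \<kappa>01[of i w] i by (auto simp: \<xi>_def)
   have "(\<lambda>w. \<xi> i w * (1 - \<kappa> i w)) \<in> borel_measurable (F (u i))"
    using \<xi>F \<kappa>F by simp
   moreover have "\<bar>\<xi> i w * (1 - \<kappa> i w)\<bar> \<le> 2" for w using \<xi>b \<kappa>01[of i w] by auto
   ultimately show ?thesis unfolding eq using martingale_incr_bounded[OF m u0 un, of "\<lambda>w. \<xi> i w * (1 - \<kappa> i w)" i 2] by blast
  qed
  have "has_bochner_integral M (\<lambda>w. \<Sum>i<n. \<xi> n w * (1 - \<kappa> i w) * (m (u (Suc i)) w - m (u i) w)) 0"
   using has_bochner_integral_sum[of "{..<n}" M "\<lambda>i w. \<xi> n w * (1 - \<kappa> i w) * (m (u (Suc i)) w - m (u i) w)" "\<lambda>_. 0"] j1 by simp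
  moreover have "(\<Sum>i<k. c * (1 - \<kappa> i w) * (m (u (Suc i)) w - m (u i) w)) = c * (m (u k) w - m 0 w - P k w)" for w c k
   by (induction k) (simp_all add: PSuc h_def u(1) algebra_simps)
  ultimately have J: "has_bochner_integral M (\<lambda>w. \<xi> n w * (m (u n) w - m 0 w - P n w)) 0" by simp
  have "\<epsilon> n w * \<bar>P n w\<bar> \<le> \<epsilon> n w * (\<bar>m (u n) w\<bar> + \<bar>m 0 w\<bar>) - \<xi> n w * (m (u n) w - m 0 w - P n w)" for w
  proof -
   have "\<xi> n w * P n w = \<epsilon> n w * \<bar>P n w\<bar>" by (auto simp: \<xi>_def sgn_real_def)
   moreover have "\<xi> n w * (m (u n) w - m 0 w) \<le> \<epsilon> n w * (\<bar>m (u n) w\<bar> + \<bar>m 0 w\<bar>)"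
   proof -
    have "\<xi> n w * (m (u n) w - m 0 w) \<le> \<bar>\<xi> n w\<bar> * \<bar>m (u n) w - m 0 w\<bar>"
     by (metis abs_ge_self abs_mult)
    also have "\<dots> \<le> \<epsilon> n w * (\<bar>m (u n) w\<bar> + \<bar>m 0 w\<bar>)"
     using \<epsilon>b[of n w] by (intro mult_mono) (auto simp: \<xi>_def abs_mult sgn_real_def)
    finally show ?thesis .
   qed
   ultimately show ?thesis by (simp add: right_diff_distrib)
  qed
  then have "\<E> (\<lambda>w. \<epsilon> n w * \<bar>P n w\<bar>)
   \<le> \<E> (\<lambda>w. \<epsilon> n w * (\<bar>m (u n) w\<bar> + \<bar>m 0 w\<bar>) - \<xi> n w * (m (u n) w - m 0 w - P n w))"
   using ia ia(2)[of 0] J u(1) by (intro integral_mono) (auto simp: has_bochner_integral_iff distrib_left)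
  also have "\<dots> = \<E> (\<lambda>w. \<epsilon> n w * (\<bar>m (u n) w\<bar> + \<bar>m 0 w\<bar>))"
   using ia ia(2)[of 0] J u(1) by (subst Bochner_Integration.integral_diff) (auto simp: has_bochner_integral_iff distrib_left)
  finally show ?thesis .
 qed
 have "\<E> (\<lambda>w. \<Phi> (P n w)) \<le> \<E> (\<lambda>w. (\<Sum>i<n. \<phi> (P i w) * h i w) + (2 * K * \<epsilon> n w + \<epsilon> n w * \<bar>P n w\<bar>))"
  using path i\<Phi> i2 ia by (intro integral_mono) (auto simp: has_bochner_integral_iff algebra_simps)
 also have "\<dots> = 2 * K * \<E> (\<epsilon> n) + \<E> (\<lambda>w. \<epsilon> n w * \<bar>P n w\<bar>)"
  using i2 ia by (auto simp: has_bochner_integral_iff)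
 also have "\<dots> \<le> 2 * K * \<E> (\<epsilon> n) + \<E> (\<lambda>w. \<epsilon> n w * (\<bar>m (u n) w\<bar> + \<bar>m 0 w\<bar>))"
  using dom by simp
 also have "\<dots> = \<E> (\<lambda>w. (2 * K + \<bar>m (u n) w\<bar> + \<bar>m 0 w\<bar>) * \<epsilon> n w)"
  using ia(2)[of n] ia(2)[of 0] ia(3) u(1) by (simp add: algebra_simps)
 finally have main: "\<E> (\<lambda>w. \<Phi> (P n w)) \<le> \<E> (\<lambda>w. (2 * K + \<bar>m (u n) w\<bar> + \<bar>m 0 w\<bar>) * \<epsilon> n w)" .
 have small: "\<epsilon> n w \<le> e" if e: "0 \<le> e" "\<forall>i<n. \<bar>m (u (Suc i)) w - m (u i) w\<bar> \<le> e" for w e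
 proof -
  have "\<bar>h i w\<bar> \<le> e" if "i < n" for i
   using e that \<kappa>01[of i w] by (auto simp: h_def)
  then have "mx n w \<le> e" unfolding mx_def using e by (intro Max.boundedI) auto
  then show ?thesis using e by (auto simp: \<epsilon>_def)
 qed
 show ?thesis
  by (rule exI[of _ "\<epsilon> n"]) (use \<epsilon>b small iP[of n] main in \<open>auto simp: \<Phi>_def\<close>)
qed

text \<open>On the event that all grid variations are at most \<open>K\<close> no stopping occurs
  and the stopped sum is \<open>m T - m 0\<close>. The bound of
  \<open>bounded_variation_stopped_bound\<close> tends to 0 by dominated convergence, because path
  continuity sends \<open>\<epsilon>\<close> to 0; and \<open>\<Phi>\<close> vanishes only at
  0.\<close>

lemma bv_martingale_constant:
 fixes T :: real
 assumes m: "martingale M F m" and T: "0 \<le> T"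
  and cont: "AE w in M. continuous_on {0..T} (\<lambda>t. m t w)"
  and bv: "AE w in M. \<exists>C. \<forall>n. (\<Sum>i<2^n. \<bar>m (Suc i * T / 2^n) w - m (i * T / 2^n) w\<bar>) \<le> C"
 shows "AE w in M. m T w = m 0 w"
proof -
 define u where "u n i = real i * T / 2^n" for n i :: nat
 have u: "u n 0 = 0" "mono (u n)" "u n (2^n) = T" for n
  using T by (auto simp: u_def intro!: monoI divide_right_mono mult_right_mono)
 have u0: "0 \<le> u n i" for n i using u monoD[OF u(2), of 0 i n] by simp
 define V where "V n w = (\<Sum>i<2^n. \<bar>m (u n (Suc i)) w - m (u n i) w\<bar>)" for n w
 have mM[measurable]: "m t \<in> borel_measurable M" if "0 \<le> t" for t
  using m that measurable_F[of t] by (auto simp: martingale_def)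
 have [measurable]: "V n \<in> borel_measurable M" for n
  unfolding V_def using mM[OF u0] by (intro borel_measurable_sum borel_measurable_abs borel_measurable_diff)
 have imT: "integrable M (m T)" "integrable M (m 0)" using m T by (auto simp: martingale_def)
 have main: "AE w in M. (\<forall>n. V n w \<le> real K) \<longrightarrow> m T w = m 0 w" for K :: nat
 proof -
  define P where "P n = transform m (\<lambda>i w. if (\<Sum>l<i. \<bar>m (u n (Suc l)) w - m (u n l) w\<bar>) \<le> real K then 1 else 0) (u n) (2^n)" for n
  have "\<forall>n. \<exists>\<epsilon>. \<epsilon> \<in> borel_measurable M \<and> (\<forall>w. 0 \<le> \<epsilon> w \<and> \<epsilon> w \<le> 2)
  \<and> (\<forall>w e. 0 \<le> e \<longrightarrow> (\<forall>i<2^n. \<bar>m (u n (Suc i)) w - m (u n i) w\<bar> \<le> e) \<longrightarrow> \<epsilon> w \<le> e)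
  \<and> integrable M (P n)
  \<and> \<E> (\<lambda>w. sqrt (1 + (P n w)^2) - 1) \<le> \<E> (\<lambda>w. (2 * real K + \<bar>m (u n (2^n)) w\<bar> + \<bar>m 0 w\<bar>) * \<epsilon> w)"
   unfolding P_def using bounded_variation_stopped_bound[OF m u(1) u(2), of "real K"] by auto
  then obtain \<epsilon> where \<epsilon>: "\<And>n. \<epsilon> n \<in> borel_measurable M" "\<And>n w. 0 \<le> \<epsilon> n w" "\<And>n w. \<epsilon> n w \<le> 2"
   "\<And>n w e. 0 \<le> e ==> (\<forall>i<2^n. \<bar>m (u n (Suc i)) w - m (u n i) w\<bar> \<le> e) ==> \<epsilon> n w \<le> e"
   "\<And>n. integrable M (P n)"
   "\<And>n. \<E> (\<lambda>w. sqrt (1 + (P n w)^2) - 1) \<le> \<E> (\<lambda>w. (2 * real K + \<bar>m T w\<bar> + \<bar>m 0 w\<bar>) * \<epsilon> n w)"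
   unfolding choice_iff u(3) by blast
  note [measurable] = \<epsilon>(1)
  have lim\<epsilon>: "AE w in M. (\<lambda>n. \<epsilon> n w) \<longlonglongrightarrow> 0"
   using cont
  proof eventually_elim
   case (elim w)
   show ?case
   proof (rule order_tendstoI)
    fix a :: real assume a: "0 < a"
    then have "0 < a / 2" by simp
    from grid_increments_small[OF elim T this] show "\<forall>\<^sub>F n in sequentially. \<epsilon> n w < a"
    proof eventually_elim
     case (elim n)
     then have "\<epsilon> n w \<le> a / 2" using a by (intro \<epsilon>(4)) (auto simp: u_def less_imp_le)
     then show ?case using a by simp
    qed
   qed (use \<epsilon>(2) in \<open>auto intro: less_le_trans always_eventually\<close>)
  qed
  define W where "W w = 2 * real K + \<bar>m T w\<bar> + \<bar>m 0 w\<bar>" for w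
  have iW: "integrable M W" unfolding W_def using imT by simp
  have [measurable]: "W \<in> borel_measurable M" using iW by simp
  have "(\<lambda>n. \<E> (\<lambda>w. W w * \<epsilon> n w)) \<longlonglongrightarrow> \<E> (\<lambda>w. 0)"
  proof (rule integral_dominated_convergence[where w="\<lambda>w. W w * 2"])
   show "AE w in M. (\<lambda>n. W w * \<epsilon> n w) \<longlonglongrightarrow> 0"
    using lim\<epsilon> by eventually_elim (auto intro: tendsto_mult_right_zero)
   have "0 \<le> W w" for w by (simp add: W_def)
   then show "AE w in M. norm (W w * \<epsilon> n w) \<le> W w * 2" for n
    using \<epsilon>(2,3) by (auto simp: abs_mult intro!: AE_I2 mult_mono)
  qed (use iW in auto)
  then have limW: "(\<lambda>n. \<E> (\<lambda>w. W w * \<epsilon> n w)) \<longlonglongrightarrow> 0" by simp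
  define G where "G = {w\<in>space M. \<forall>n. V n w \<le> real K}"
  have Gm[measurable]: "G \<in> sets M" unfolding G_def by measurable
  define \<Phi> where "\<Phi> x = sqrt (1 + x^2) - 1" for x :: real
  have \<Phi>0: "0 \<le> \<Phi> x" for x by (simp add: \<Phi>_def)
  have \<Phi>m: "\<Phi> \<in> borel_measurable borel" unfolding \<Phi>_def by simp
  have i\<Phi>: "integrable M (\<lambda>w. \<Phi> (f w))" if "integrable M f" for f
  proof (rule Bochner_Integration.integrable_bound[OF that])
   show "(\<lambda>w. \<Phi> (f w)) \<in> borel_measurable M" using that by (intro measurable_compose[OF _ \<Phi>m]) auto
   have "sqrt (1 + x^2) \<le> 1 + \<bar>x\<bar>" for x by (rule real_le_lsqrt) (auto simp: power2_sum)
   then have "norm (\<Phi> x) \<le> norm x" for x using \<Phi>0[of x] by (simp add: \<Phi>_def diff_le_eq add.commute)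
   then show "AE w in M. norm (\<Phi> (f w)) \<le> norm (f w)" by (intro AE_I2)
  qed
  have iG: "integrable M (\<lambda>w. indicat_real G w * \<Phi> (m T w - m 0 w))"
   using i\<Phi>[OF Bochner_Integration.integrable_diff[OF imT]] by (intro integrable_bounded_mult[where c=1]) (auto simp: indicator_def)
  have le: "\<E> (\<lambda>w. indicat_real G w * \<Phi> (m T w - m 0 w)) \<le> \<E> (\<lambda>w. W w * \<epsilon> n w)" for n
  proof -
   have "\<E> (\<lambda>w. indicat_real G w * \<Phi> (m T w - m 0 w)) \<le> \<E> (\<lambda>w. \<Phi> (P n w))"
   proof (rule integral_mono[OF iG i\<Phi>[OF \<epsilon>(5)]])
    show "indicat_real G w * \<Phi> (m T w - m 0 w) \<le> \<Phi> (P n w)" for w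
    proof (cases "w \<in> G")
     case True
     then have V: "V n w \<le> real K" by (simp add: G_def)
     have k1: "(\<Sum>l<i. \<bar>m (u n (Suc l)) w - m (u n l) w\<bar>) \<le> real K" if "i < 2^n" for i
     proof -
      have "(\<Sum>l<i. \<bar>m (u n (Suc l)) w - m (u n l) w\<bar>) \<le> V n w"
       unfolding V_def using that by (intro sum_mono2) auto
      then show ?thesis using V by simp
     qed
     have "P n w = (\<Sum>i<2^n. m (u n (Suc i)) w - m (u n i) w)"
      unfolding P_def transform_def using k1 by (intro sum.cong) auto
     also have "\<dots> = m T w - m 0 w" using sum_lessThan_telescope[of "\<lambda>i. m (u n i) w" "2^n"] by (simp add: u)
     finally show ?thesis using True by simp
    qed (simp add: \<Phi>0)
   qed
   also have "\<dots> \<le> \<E> (\<lambda>w. W w * \<epsilon> n w)" using \<epsilon>(6)[of n] by (simp add: \<Phi>_def W_def)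
   finally show ?thesis .
  qed
  have "\<E> (\<lambda>w. indicat_real G w * \<Phi> (m T w - m 0 w)) \<le> 0"
   using limW le by (intro LIMSEQ_le_const[OF limW]) auto
  moreover have "0 \<le> \<E> (\<lambda>w. indicat_real G w * \<Phi> (m T w - m 0 w))"
   using \<Phi>0 by (intro Bochner_Integration.integral_nonneg) auto
  ultimately have "\<E> (\<lambda>w. indicat_real G w * \<Phi> (m T w - m 0 w)) = 0" by simp
  then have "AE w in M. indicat_real G w * \<Phi> (m T w - m 0 w) = 0"
   using \<Phi>0 by (subst integral_nonneg_eq_0_iff_AE[OF iG, symmetric]) (auto intro!: AE_I2)
  with AE_space show ?thesis
  proof eventually_elim
   case (elim w)
   then show ?case by (auto simp: G_def \<Phi>_def split: split_indicator_asm)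
  qed
 qed
 have "AE w in M. \<forall>K :: nat. (\<forall>n. V n w \<le> real K) \<longrightarrow> m T w = m 0 w"
  unfolding AE_all_countable using main by blast
 then show ?thesis using bv
 proof eventually_elim
  case (elim w)
  then obtain C where C: "\<And>n. V n w \<le> C" by (auto simp: V_def u_def)
  obtain K :: nat where "C \<le> real K" using real_arch_simple by blast
  then have "\<forall>n. V n w \<le> real K" using C order_trans by blast
  then show ?case using elim by blast
 qed
qed

lemma stopping_time_optional:
 assumes "stopping_time F \<tau>"
 shows "{w\<in>space M. \<tau> w < s} \<in> sets (F s)"
proof -
 have eq: "{w\<in>space M. \<tau> w < s} = (\<Union>n. {w\<in>space M. \<tau> w \<le> s - inverse (real (Suc n))})"
 proof safe
  fix w assume "w \<in> space M" "\<tau> w < s"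
  then obtain n where "inverse (real (Suc n)) < s - \<tau> w" using reals_Archimedean[of "s - \<tau> w"] by auto
  then show "w \<in> (\<Union>n. {w\<in>space M. \<tau> w \<le> s - inverse (real (Suc n))})"
   using \<open>w \<in> space M\<close> by (auto intro!: exI[of _ n] simp del: of_nat_Suc)
 next
  fix w n assume "\<tau> w \<le> s - inverse (real (Suc n))"
  moreover have "0 < inverse (real (Suc n))" by simp
  ultimately show "\<tau> w < s" by linarith
 qed
 have "{w\<in>space M. \<tau> w \<le> s - inverse (real (Suc n))} \<in> sets (F s)" for n
 proof -
  have "{w\<in>space M. \<tau> w \<le> s - inverse (real (Suc n))} \<in> sets (F (s - inverse (real (Suc n))))"
   using stopping_timeD[OF assms, of "s - inverse (real (Suc n))"] by (simp add: pred_def space_F)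
  moreover have "s - inverse (real (Suc n)) \<le> s" by simp
  ultimately show ?thesis using sets_F_mono by blast
 qed
 then show ?thesis unfolding eq by auto
qed

text \<open>Localization turns \<open>N - m\<close> into a martingale with the increments of
  \<open>A\<close>, whose grid variations are bounded by the total variation of \<open>A\<close>; so
  it is constant. This gives one time at once; rational times and continuity give all of
  them.\<close>

theorem local_martingale_bv_unique:
 assumes N: "continuous_local_martingale M F N" and m: "L2_martingale m"
  and A: "bounded_variation_process M A"
  and eq: "AE w in M. \<forall>t\<ge>0. N t w - N 0 w = m t w - m 0 w + A t w"
 shows "AE w in M. \<forall>t\<ge>0. A t w = 0"
proof -
 obtain \<tau> where \<tau>: "\<And>n. stopping_time F (\<tau> n)" "\<And>w n. w \<in> space M ==> 0 \<le> \<tau> n w"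
  "AE w in M. filterlim (\<lambda>n. \<tau> n w) at_top sequentially"
  "\<And>n. martingale M F (\<lambda>t w. N (min t (\<tau> n w)) w - N 0 w)"
  and Nc: "adapted N"
  using N by (auto simp: continuous_local_martingale_def)
 have mc: "adapted m" using m by (simp add: L2_martingale_def)
 have one: "AE w in M. A (min T (\<tau> n w)) w = 0" if T: "0 \<le> T" for n T
 proof -
  define X where "X t w = N (min t (\<tau> n w)) w - N 0 w" for t w
  define Y where "Y t w = m (min t (\<tau> n w)) w" for t w
  define Z where "Z t w = X t w - Y t w" for t w
  have "L2_martingale Y"
   unfolding Y_def[abs_def] using \<tau>(2) stopping_time_optional[OF \<tau>(1)] by (intro stopped_L2_martingale[OF m]) auto
  then have Z: "martingale M F Z"
   unfolding Z_def[abs_def] using \<tau>(4)[of n] by (intro martingale_diff) (simp_all add: L2_martingale_def X_def[abs_def])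
  have ZA: "AE w in M. \<forall>t\<ge>0. Z t w - Z 0 w = A (min t (\<tau> n w)) w"
   using eq AE_space
  proof eventually_elim
   case (elim w)
   then have "0 \<le> t ==> 0 \<le> min t (\<tau> n w)" for t using \<tau>(2)[of w n] by simp
   then show ?case using elim \<tau>(2)[of w n] by (fastforce simp: Z_def X_def Y_def min_absorb1)
  qed
  have "AE w in M. Z T w = Z 0 w"
  proof (rule bv_martingale_constant[OF Z T])
   show "AE w in M. continuous_on {0..T} (\<lambda>t. Z t w)"
   proof (rule AE_I2)
    fix w assume w: "w \<in> space M"
    have c: "continuous_on {0..T} (\<lambda>t. f (min t (\<tau> n w)) w)" if "adapted f" for f
    proof -
     have "continuous_on {0..} (\<lambda>t. f t w)" using that w by (simp add: continuous_adapted_def)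
     then show ?thesis using \<tau>(2)[OF w]
      by (intro continuous_on_compose2[of "{0..}" "\<lambda>t. f t w" _ "\<lambda>t. min t (\<tau> n w)"]) (auto intro!: continuous_intros)
    qed
    show "continuous_on {0..T} (\<lambda>t. Z t w)"
     unfolding Z_def X_def Y_def by (intro continuous_intros c Nc mc)
   qed
   show "AE w in M. \<exists>C. \<forall>j. (\<Sum>i<2^j. \<bar>Z (Suc i * T / 2^j) w - Z (i * T / 2^j) w\<bar>) \<le> C"
    using ZA AE_space
   proof eventually_elim
    case (elim w)
    let ?r = "min T (\<tau> n w)"
    have r: "0 \<le> ?r" "0 \<le> \<tau> n w" using T \<tau>(2) elim by auto
    have fin: "total_variation (\<lambda>t. A t w) ?r < \<infinity>"
     using A elim r by (auto simp: bounded_variation_process_def)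
    have "(\<Sum>i<2^j. \<bar>Z (Suc i * T / 2^j) w - Z (i * T / 2^j) w\<bar>) \<le> enn2real (total_variation (\<lambda>t. A t w) ?r)" for j
    proof -
     \<comment> \<open>The dyadic points stopped at the localizing time partition the interval up to
       \<open>min T (\<tau> n w)\<close>, so \<open>total_variation\<close> bounds the sum for every
       \<open>j\<close>.\<close>
     define \<sigma> where "\<sigma> i = min (real i * T / 2^j) (\<tau> n w)" for i
     have "ennreal (\<Sum>i<2^j. \<bar>A (\<sigma> (Suc i)) w - A (\<sigma> i) w\<bar>) \<le> total_variation (\<lambda>t. A t w) ?r"
      unfolding sum_ennreal[symmetric, OF abs_ge_zero]
     proof (rule sum_le_total_variation)
      show "mono \<sigma>" unfolding \<sigma>_def using T
       by (intro monoI min.mono divide_right_mono mult_right_mono) auto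
     qed (use r in \<open>auto simp: \<sigma>_def\<close>)
     then have "enn2real (ennreal (\<Sum>i<2^j. \<bar>A (\<sigma> (Suc i)) w - A (\<sigma> i) w\<bar>)) \<le> enn2real (total_variation (\<lambda>t. A t w) ?r)"
      using fin by (intro enn2real_mono) auto
     moreover have "Z (real i * T / 2^j) w = Z 0 w + A (\<sigma> i) w" for i
      using elim(1)[rule_format, of "real i * T / 2^j"] T by (simp add: \<sigma>_def)
     ultimately show ?thesis by (simp add: sum_nonneg del: of_nat_Suc)
    qed
    then show ?case by blast
   qed
  qed
  then show ?thesis using ZA by eventually_elim (use T in auto)
 qed
 have "AE w in M. \<forall>n. \<forall>q\<in>\<rat> \<inter> {0..}. A (min q (\<tau> n w)) w = 0"
  unfolding AE_all_countable
 proof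
  fix n
  show "AE w in M. \<forall>q\<in>\<rat> \<inter> {0..}. A (min q (\<tau> n w)) w = 0"
   using one by (subst AE_ball_countable) (auto intro: countable_rat)
 qed
 then show ?thesis
  using \<tau>(3) eq AE_space
 proof eventually_elim
  case (elim w)
  have q: "A q w = 0" if q: "q \<in> \<rat>" "0 < q" for q
  proof -
   have "\<forall>\<^sub>F n in sequentially. q \<le> \<tau> n w" using elim(2) by (simp add: filterlim_at_top)
   then obtain n where "q \<le> \<tau> n w" by (auto simp: eventually_sequentially)
   moreover have "A (min q (\<tau> n w)) w = 0" using elim(1) q by auto
   ultimately show ?thesis by (simp add: min_absorb1)
  qed
  \<comment> \<open>A continuous function with the same values as \<open>A\<close> on the given path
    carries the identity from rational times to all times.\<close>
  define f where "f t = N t w - N 0 w - (m t w - m 0 w)" for t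
  have "continuous_on {0..} (\<lambda>t. N t w)" "continuous_on {0..} (\<lambda>t. m t w)"
   using Nc mc elim(4) by (auto simp: continuous_adapted_def)
  then have cf: "continuous_on {0..} f"
   unfolding f_def[abs_def] by (intro continuous_on_diff continuous_on_const)
  have fA: "f t = A t w" if "0 \<le> t" for t using elim(3) that by (simp add: f_def)
  have "f t = 0" if "0 \<le> t" for t
  proof (rule continuous_zero_on_rationals[OF cf _ that])
   show "f r = 0" if "r \<in> \<rat>" "0 < r" for r using q[OF that] fA[of r] that by simp
  qed
  then show ?case using fA by simp
 qed
qed

end

section \<open>Total variation and Stieltjes measures\<close>

lemma total_variation_le:
 assumes le: "\<And>x y. 0 \<le> x ==> x \<le> y ==> \<bar>f y - f x\<bar> \<le> g y - g x"
 shows "total_variation f t \<le> ennreal (g t - g 0)"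
 unfolding total_variation_def
proof (rule SUP_least, clarify)
 fix n :: nat and \<tau> :: "nat => real" assume \<tau>: "mono \<tau>" "\<tau> 0 = 0" "t = \<tau> n"
 have "0 \<le> \<tau> i" for i using monoD[OF \<tau>(1), of 0 i] \<tau>(2) by simp
 then have "(\<Sum>i<n. \<bar>f (\<tau> (Suc i)) - f (\<tau> i)\<bar>) \<le> (\<Sum>i<n. g (\<tau> (Suc i)) - g (\<tau> i))"
  using \<tau> by (intro sum_mono le) (auto simp: monoD)
 also have "\<dots> = g (\<tau> n) - g 0" using sum_lessThan_telescope[of "\<lambda>i. g (\<tau> i)" n] \<tau> by simp
 finally show "(\<Sum>i<n. ennreal \<bar>f (\<tau> (Suc i)) - f (\<tau> i)\<bar>) \<le> ennreal (g (\<tau> n) - g 0)"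
  by (subst sum_ennreal) (auto intro: ennreal_leI)
qed

lemma total_variation_diff_le:
 "total_variation (\<lambda>s. f s - g s) t \<le> total_variation f t + total_variation g t"
proof -
 have "(\<Sum>i<n. ennreal \<bar>f (\<tau> (Suc i)) - g (\<tau> (Suc i)) - (f (\<tau> i) - g (\<tau> i))\<bar>) \<le> total_variation f t + total_variation g t"
  if \<tau>: "mono \<tau>" "\<tau> 0 = 0" "\<tau> n = t" for n :: nat and \<tau> :: "nat => real"
 proof -
  have "(\<Sum>i<n. ennreal \<bar>f (\<tau> (Suc i)) - g (\<tau> (Suc i)) - (f (\<tau> i) - g (\<tau> i))\<bar>)
   \<le> (\<Sum>i<n. ennreal \<bar>f (\<tau> (Suc i)) - f (\<tau> i)\<bar> + ennreal \<bar>g (\<tau> (Suc i)) - g (\<tau> i)\<bar>)"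
   by (intro sum_mono) (auto simp: ennreal_plus[symmetric] simp del: ennreal_plus intro!: ennreal_leI)
  also have "\<dots> \<le> total_variation f t + total_variation g t"
   unfolding sum.distrib by (intro add_mono sum_le_total_variation \<tau>)
  finally show ?thesis .
 qed
 then show ?thesis unfolding total_variation_def[of "\<lambda>s. f s - g s"]
  by (intro SUP_least) auto
qed

lemma total_variation_append:
 assumes "0 \<le> s" "s \<le> t"
 shows "total_variation f s + ennreal \<bar>f t - f s\<bar> \<le> total_variation f t"
proof -
 let ?I = "{(n :: nat, \<tau> :: nat => real). mono \<tau> \<and> \<tau> 0 = 0 \<and> \<tau> n = s}"
 have "(1, \<lambda>i. if i = 0 then 0 else s) \<in> ?I" using assms by (auto intro!: monoI)
 then have ne: "?I \<noteq> {}" by blast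
 have "total_variation f s + ennreal \<bar>f t - f s\<bar>
  = (SUP (n, \<tau>) \<in> ?I. (\<Sum>i<n. ennreal \<bar>f (\<tau> (Suc i)) - f (\<tau> i)\<bar>) + ennreal \<bar>f t - f s\<bar>)"
  unfolding total_variation_def by (subst ennreal_SUP_add_left[OF ne, symmetric]) (simp add: case_prod_beta)
 also have "\<dots> \<le> total_variation f t"
 proof (rule SUP_least, clarify)
  fix n :: nat and \<tau> :: "nat => real" assume \<tau>: "mono \<tau>" "\<tau> 0 = 0" "s = \<tau> n"
  define \<sigma> where "\<sigma> i = (if i \<le> n then \<tau> i else t)" for i :: nat
  have "(\<Sum>i<Suc n. ennreal \<bar>f (\<sigma> (Suc i)) - f (\<sigma> i)\<bar>) \<le> total_variation f t"
  proof (rule sum_le_total_variation)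
   show "mono \<sigma>"
   proof (rule monoI)
    fix x y :: nat assume "x \<le> y"
    moreover have "\<tau> x \<le> t" if "x \<le> n" using monoD[OF \<tau>(1) that] \<tau> assms by simp
    ultimately show "\<sigma> x \<le> \<sigma> y" using monoD[OF \<tau>(1), of x y] by (auto simp: \<sigma>_def)
   qed
  qed (use \<tau> in \<open>auto simp: \<sigma>_def\<close>)
  moreover have "(\<Sum>i<n. ennreal \<bar>f (\<sigma> (Suc i)) - f (\<sigma> i)\<bar>) = (\<Sum>i<n. ennreal \<bar>f (\<tau> (Suc i)) - f (\<tau> i)\<bar>)"
   by (intro sum.cong) (auto simp: \<sigma>_def)
  ultimately show "(\<Sum>i<n. ennreal \<bar>f (\<tau> (Suc i)) - f (\<tau> i)\<bar>) + ennreal \<bar>f t - f (\<tau> n)\<bar> \<le> total_variation f t"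
   by (simp add: \<sigma>_def)
 qed
 finally show ?thesis .
qed

lemma total_variation_lipschitz:
 assumes lip: "\<And>x y. 0 \<le> x ==> x \<le> y ==> \<bar>f y - f x\<bar> \<le> C * (y - x)" and st: "0 \<le> s" "s \<le> t"
 shows "total_variation f t \<le> total_variation f s + ennreal (C * (t - s))"
 unfolding total_variation_def[of f t]
proof (rule SUP_least, clarify)
 fix n :: nat and \<tau> :: "nat => real" assume \<tau>: "mono \<tau>" "\<tau> 0 = 0" "t = \<tau> n"
 have \<tau>0: "0 \<le> \<tau> i" for i using monoD[OF \<tau>(1), of 0 i] \<tau>(2) by simp
 have \<tau>S: "\<tau> i \<le> \<tau> (Suc i)" for i using \<tau> by (simp add: monoD)
 \<comment> \<open>Every partition interval is cut at \<open>s\<close>: the part before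
   \<open>s\<close> counts towards \<open>total_variation f s\<close>, the rest is measured by the
   Lipschitz constant.\<close>
 have step: "\<bar>f (\<tau> (Suc i)) - f (\<tau> i)\<bar> \<le> \<bar>f (min (\<tau> (Suc i)) s) - f (min (\<tau> i) s)\<bar> + C * (max (\<tau> (Suc i)) s - max (\<tau> i) s)" for i
 proof (cases "\<tau> i \<le> s")
  case True
  then show ?thesis using lip[of s "\<tau> (Suc i)"] st by (cases "\<tau> (Suc i) \<le> s") (auto simp: min_def max_def)
 next
  case False
  then show ?thesis using lip[of "\<tau> i" "\<tau> (Suc i)"] \<tau>S[of i] \<tau>0[of i] by (auto simp: min_def max_def)
 qed
 have C0: "0 \<le> C" using lip[of 0 1] by auto
 have "(\<Sum>i<n. ennreal \<bar>f (\<tau> (Suc i)) - f (\<tau> i)\<bar>)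
  \<le> (\<Sum>i<n. ennreal \<bar>f (min (\<tau> (Suc i)) s) - f (min (\<tau> i) s)\<bar> + ennreal (C * (max (\<tau> (Suc i)) s - max (\<tau> i) s)))"
 proof (intro sum_mono)
  fix i
  have "0 \<le> C * (max (\<tau> (Suc i)) s - max (\<tau> i) s)" using C0 \<tau>S[of i] by (intro mult_nonneg_nonneg) auto
  then show "ennreal \<bar>f (\<tau> (Suc i)) - f (\<tau> i)\<bar> \<le> ennreal \<bar>f (min (\<tau> (Suc i)) s) - f (min (\<tau> i) s)\<bar> + ennreal (C * (max (\<tau> (Suc i)) s - max (\<tau> i) s))"
   using ennreal_leI[OF step[of i]] by (simp add: ennreal_plus)
 qed
 also have "\<dots> = (\<Sum>i<n. ennreal \<bar>f (min (\<tau> (Suc i)) s) - f (min (\<tau> i) s)\<bar>) + (\<Sum>i<n. ennreal (C * (max (\<tau> (Suc i)) s - max (\<tau> i) s)))"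
  by (rule sum.distrib)
 also have "(\<Sum>i<n. ennreal (C * (max (\<tau> (Suc i)) s - max (\<tau> i) s))) = ennreal (\<Sum>i<n. C * (max (\<tau> (Suc i)) s - max (\<tau> i) s))"
 proof (intro sum_ennreal mult_nonneg_nonneg C0)
  show "0 \<le> max (\<tau> (Suc i)) s - max (\<tau> i) s" for i using \<tau>S[of i] by simp
 qed
 also have "(\<Sum>i<n. C * (max (\<tau> (Suc i)) s - max (\<tau> i) s)) = C * (\<tau> n - s)"
  unfolding sum_distrib_left[symmetric] using sum_lessThan_telescope[of "\<lambda>i. max (\<tau> i) s" n] \<tau> st by simp
 also have "(\<Sum>i<n. ennreal \<bar>f (min (\<tau> (Suc i)) s) - f (min (\<tau> i) s)\<bar>) \<le> total_variation f s"
 proof (rule sum_le_total_variation)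
  show "mono (\<lambda>i. min (\<tau> i) s)" by (intro monoI min.mono monoD[OF \<tau>(1)]) auto
 qed (use \<tau> st in auto)
 finally show "(\<Sum>i<n. ennreal \<bar>f (\<tau> (Suc i)) - f (\<tau> i)\<bar>) \<le> total_variation f s + ennreal (C * (\<tau> n - s))"
  by (simp add: add_right_mono)
qed

section \<open>Interval measures with continuous densities\<close>

lemma interval_measure_unique:
 fixes F :: "real => real"
 assumes mono: "\<And>x y. x \<le> y ==> F x \<le> F y" and cont: "\<And>a. continuous (at_right a) F"
  and sets: "sets N = sets borel"
  and eq: "\<And>a b. a \<le> b ==> emeasure N {a<..b} = ennreal (F b - F a)"
 shows "interval_measure F = N"
proof (rule measure_eqI_generator_eq[where E="range (\<lambda>(a, b). {a<..b::real})" and \<Omega>=UNIV and A="\<lambda>i. {- real i<..real i}"])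
 show "Int_stable (range (\<lambda>(a, b). {a<..b::real}))"
 proof (rule Int_stableI, clarify)
  fix a b c d :: real
  have "{a<..b} \<inter> {c<..d} = (\<lambda>(a, b). {a<..b}) (max a c, min b d)" by auto
  then show "{a<..b} \<inter> {c<..d} \<in> range (\<lambda>(a, b). {a<..b})" by blast
 qed
 show "emeasure (interval_measure F) X = emeasure N X" if "X \<in> range (\<lambda>(a, b). {a<..b})" for X
 proof -
  obtain p :: "real \<times> real" where "X = (case p of (a, b) => {a<..b})" using \<open>X \<in> _\<close> by blast
  then obtain a b where X: "X = {a<..b}" by (cases p) auto
  show ?thesis
  proof (cases "a \<le> b")
   case True
   then show ?thesis unfolding X using eq[OF True] emeasure_interval_measure_Ioc[OF True mono cont] by simp
  qed (simp add: X)
 qed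
 show "sets (interval_measure F) = sigma_sets UNIV (range (\<lambda>(a, b). {a<..b}))"
  "sets N = sigma_sets UNIV (range (\<lambda>(a, b). {a<..b}))"
  using sets by (simp_all add: borel_sigma_sets_Ioc)
 show "(\<Union>i. {- real i<..real i}) = UNIV" by (rule UN_Ioc_eq_UNIV)
 show "emeasure (interval_measure F) {- real i<..real i} \<noteq> \<infinity>" for i
  by (subst emeasure_interval_measure_Ioc) (auto intro: mono cont)
qed auto

text \<open>Differences of measures are compared by moving the negative parts to the other side,
  which involves only sums of interval measures.\<close>

lemma emeasure_interval_measure_add:
 fixes F G :: "real => real"
 assumes F: "\<And>x y. x \<le> y ==> F x \<le> F y" "\<And>a. continuous (at_right a) F"
  and G: "\<And>x y. x \<le> y ==> G x \<le> G y" "\<And>a. continuous (at_right a) G"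
  and A: "A \<in> sets borel"
 shows "emeasure (interval_measure (\<lambda>x. F x + G x)) A = emeasure (interval_measure F) A + emeasure (interval_measure G) A"
proof -
 define N where "N = measure_of UNIV (sets borel) (\<lambda>A. emeasure (interval_measure F) A + emeasure (interval_measure G) A)"
 have sN: "sets N = sets borel" unfolding N_def using sets.sigma_sets_eq[of borel] by (subst sets_measure_of) auto
 have ca: "countably_additive (sets borel) (\<lambda>A. emeasure (interval_measure F) A + emeasure (interval_measure G) A)"
 proof (rule countably_additiveI)
  fix A :: "nat => real set" assume A: "range A \<subseteq> sets borel" "disjoint_family A"
  have "(\<Sum>i. emeasure (interval_measure F) (A i) + emeasure (interval_measure G) (A i))
   = (\<Sum>i. emeasure (interval_measure F) (A i)) + (\<Sum>i. emeasure (interval_measure G) (A i))"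
   by (intro suminf_add[symmetric]) auto
  then show "(\<Sum>i. emeasure (interval_measure F) (A i) + emeasure (interval_measure G) (A i))
   = emeasure (interval_measure F) (\<Union>i. A i) + emeasure (interval_measure G) (\<Union>i. A i)"
   using A by (simp add: suminf_emeasure)
 qed
 have eN: "emeasure N A = emeasure (interval_measure F) A + emeasure (interval_measure G) A" if "A \<in> sets borel" for A
  using ca that sets.sigma_algebra_axioms[of borel] unfolding N_def
  by (intro emeasure_measure_of_sigma) (auto simp: positive_def)
 have "interval_measure (\<lambda>x. F x + G x) = N"
 proof (rule interval_measure_unique)
  fix a b :: real assume ab: "a \<le> b"
  show "emeasure N {a<..b} = ennreal (F b + G b - (F a + G a))"
   using F(1)[OF ab] G(1)[OF ab] eN[of "{a<..b}"] emeasure_interval_measure_Ioc[OF ab F] emeasure_interval_measure_Ioc[OF ab G]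
   by (simp add: ennreal_plus[symmetric] algebra_simps del: ennreal_plus)
 qed (use F G sN in \<open>auto intro: add_mono continuous_intros\<close>)
 then show ?thesis using eN[OF A] by simp
qed

lemma set_integral_Icc_combine:
 fixes \<gamma> :: "real => real"
 assumes \<gamma>: "continuous_on {0..} \<gamma>" and st: "0 \<le> s" "s \<le> t"
 shows "(LBINT u:{0..t}. \<gamma> u) = (LBINT u:{0..s}. \<gamma> u) + (LBINT u:{s<..t}. \<gamma> u)"
proof -
 have i: "set_integrable lborel {0..t} \<gamma>"
  using \<gamma> by (intro borel_integrable_atLeastAtMost') (auto intro: continuous_on_subset)
 have "{0..t} = {0..s} \<union> {s<..t}" "{0..s} \<inter> {s<..t} = {}" using st by auto
 moreover have "set_integrable lborel {0..s} \<gamma>" "set_integrable lborel {s<..t} \<gamma>"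
  by (rule set_integrable_subset[OF i]; use st in auto)+
 ultimately show ?thesis by (simp add: set_integral_Un)
qed

lemma integrable_indicator_Ioc: "integrable lborel (indicat_real {a<..b::real})"
proof -
 have "emeasure lborel {a<..b} < \<infinity>" by (cases "a \<le> b") auto
 then show ?thesis by (intro integrable_real_indicator) auto
qed

lemma set_integrable_bounded:
 fixes f :: "real => real"
 assumes "f \<in> borel_measurable borel" "\<And>r. r \<in> {s<..t} ==> \<bar>f r\<bar> \<le> c"
 shows "set_integrable lborel {s<..t} f"
 unfolding set_integrable_def
proof (rule Bochner_Integration.integrable_bound)
 show "integrable lborel (\<lambda>r. c * indicat_real {s<..t} r)"
  by (intro integrable_mult_right integrable_indicator_Ioc)
 show "(\<lambda>r. indicat_real {s<..t} r *\<^sub>R f r) \<in> borel_measurable lborel" using assms(1) by simp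
 show "AE r in lborel. norm (indicat_real {s<..t} r *\<^sub>R f r) \<le> norm (c * indicat_real {s<..t} r)"
  using assms(2) by (intro AE_I2) (auto simp: indicator_def intro: order_trans[OF _ abs_ge_self])
qed

lemma set_integral_bounded:
 fixes f :: "real => real"
 assumes f: "f \<in> borel_measurable borel" "\<And>r. r \<in> {s<..t} ==> \<bar>f r\<bar> \<le> c" and st: "s \<le> t"
 shows "\<bar>LBINT r:{s<..t}. f r\<bar> \<le> c * (t - s)"
proof -
 have i: "set_integrable lborel {s<..t} f" by (rule set_integrable_bounded[OF f])
 have "\<bar>LBINT r:{s<..t}. f r\<bar> \<le> (LBINT r:{s<..t}. \<bar>f r\<bar>)"
  using set_integral_norm_bound[OF i] by simp
 also have "\<dots> \<le> (LBINT r:{s<..t}. c)"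
  using f(2) by (intro set_integral_mono set_integrable_abs[OF i] set_integrable_bounded[where c="\<bar>c\<bar>"]) auto
 also have "\<dots> = c * (t - s)" using st by (simp add: set_lebesgue_integral_def)
 finally show ?thesis .
qed

lemma continuous_on_max_0:
 fixes f :: "real => real"
 assumes "continuous_on {0..} f" shows "continuous_on UNIV (\<lambda>s. f (max 0 s))" "(\<lambda>s. f (max 0 s)) \<in> borel_measurable borel"
proof -
 show "continuous_on UNIV (\<lambda>s. f (max 0 s))"
  using assms by (rule continuous_on_compose2) (auto intro!: continuous_intros)
 then show "(\<lambda>s. f (max 0 s)) \<in> borel_measurable borel" by (rule borel_measurable_continuous_onI)
qed

lemma set_integral_Ioc_bound:
 fixes \<gamma> :: "real => real"
 assumes \<gamma>: "continuous_on {0..} \<gamma>" and bd: "\<And>u. 0 \<le> u ==> \<bar>\<gamma> u\<bar> \<le> C" and st: "0 \<le> s" "s \<le> t"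
 shows "\<bar>LBINT u:{s<..t}. \<gamma> u\<bar> \<le> C * (t - s)"
proof -
 have "(LBINT u:{s<..t}. \<gamma> u) = (LBINT u:{s<..t}. \<gamma> (max 0 u))"
  using st by (intro set_lebesgue_integral_cong) auto
 then show ?thesis using set_integral_bounded[OF continuous_on_max_0(2)[OF \<gamma>] bd st(2)] by simp
qed

lemma set_integral_lipschitz:
 fixes \<gamma> :: "real => real"
 assumes "continuous_on {0..} \<gamma>" "\<And>u. 0 \<le> u ==> \<bar>\<gamma> u\<bar> \<le> C" "0 \<le> s" "s \<le> t"
 shows "\<bar>(LBINT u:{0..t}. \<gamma> u) - (LBINT u:{0..s}. \<gamma> u)\<bar> \<le> C * (t - s)"
 using set_integral_Ioc_bound[OF assms] set_integral_Icc_combine[OF assms(1,3,4)] by simp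

lemma lipschitz_continuous_at_right:
 fixes F :: "real => real"
 assumes "\<And>x y. x \<le> y ==> \<bar>F y - F x\<bar> \<le> C * (y - x)"
 shows "continuous (at_right a) F"
proof -
 have "\<bar>F y - F x\<bar> \<le> C * \<bar>y - x\<bar>" for x y using assms[of x y] assms[of y x] by (cases "x \<le> y") (auto simp: abs_minus_commute)
 moreover have "0 \<le> C" using assms[of 0 1] by auto
 ultimately have "C-lipschitz_on UNIV F" by (intro lipschitz_onI) (auto simp: dist_real_def)
 then have "continuous_on UNIV F" by (rule lipschitz_on_continuous_on)
 then show ?thesis by (simp add: continuous_on_eq_continuous_within continuous_at_imp_continuous_at_within)
qed

text \<open>A primitive generates the measure with the given density. Half-open intervals determine
  it, and the point 0, at which the density is cut off, is a null set.\<close>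

lemma interval_measure_integral:
 fixes \<gamma> :: "real => real"
 assumes \<gamma>: "continuous_on {0..} \<gamma>" and bd: "\<And>u. 0 \<le> u ==> 0 \<le> \<gamma> u \<and> \<gamma> u \<le> C"
 defines "G \<equiv> \<lambda>s. LBINT u:{0..max 0 s}. \<gamma> u"
 shows "\<And>x y. x \<le> y ==> G x \<le> G y" "\<And>x y. x \<le> y ==> \<bar>G y - G x\<bar> \<le> C * (y - x)"
  "\<And>S t. S \<in> sets borel ==> S \<subseteq> {0..t} ==> emeasure (interval_measure G) S = ennreal (LBINT u:S. \<gamma> u)"
proof -
 have bd': "\<bar>\<gamma> u\<bar> \<le> C" if "0 \<le> u" for u using bd[OF that] by simp
 have C0: "0 \<le> C" using bd[of 0] by auto
 have i: "set_integrable lborel S \<gamma>" if "S \<in> sets borel" "S \<subseteq> {0..t}" for S t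
 proof (rule set_integrable_subset)
  show "set_integrable lborel {0..t} \<gamma>"
   using \<gamma> by (intro borel_integrable_atLeastAtMost') (auto intro: continuous_on_subset)
 qed (use that in auto)
 have diff: "G y - G x = (LBINT u:{max 0 x<..max 0 y}. \<gamma> u)" if "x \<le> y" for x y
  using set_integral_Icc_combine[OF \<gamma>, of "max 0 x" "max 0 y"] that by (auto simp: G_def)
 show mono: "G x \<le> G y" if "x \<le> y" for x y
 proof -
  have "0 \<le> (LBINT u:{max 0 x<..max 0 y}. \<gamma> u)"
   unfolding set_lebesgue_integral_def using bd by (intro Bochner_Integration.integral_nonneg) (auto simp: indicator_def)
  then show ?thesis using diff[OF that] by simp
 qed
 show lip: "\<bar>G y - G x\<bar> \<le> C * (y - x)" if "x \<le> y" for x y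
 proof -
  have "\<bar>G y - G x\<bar> \<le> C * (max 0 y - max 0 x)"
   unfolding diff[OF that] using that by (intro set_integral_Ioc_bound[OF \<gamma> bd']) auto
  also have "\<dots> \<le> C * (y - x)" using C0 that by (intro mult_left_mono) auto
  finally show ?thesis .
 qed
 define \<gamma>' where "\<gamma>' u = indicator {0..} u * \<gamma> u" for u :: real
 have m\<gamma>: "\<gamma>' \<in> borel_measurable borel"
  unfolding \<gamma>'_def using borel_measurable_continuous_on_indicator[OF _ \<gamma>] by simp
 define N where "N = density lborel (\<lambda>u. ennreal (\<gamma>' u))"
 have eN: "emeasure N S = ennreal (LBINT u:S \<inter> {0..}. \<gamma> u)" if S: "S \<in> sets borel" "S \<subseteq> {..t}" for S t
 proof -
  have S': "S \<inter> {0..} \<in> sets borel" "S \<inter> {0..} \<subseteq> {0..t}" using S by auto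
  have "emeasure N S = (\<integral>\<^sup>+u. ennreal (\<gamma>' u) * indicator S u \<partial>lborel)"
   unfolding N_def using S m\<gamma> by (intro emeasure_density) auto
  also have "\<dots> = (\<integral>\<^sup>+u. ennreal (indicator (S \<inter> {0..}) u *\<^sub>R \<gamma> u) \<partial>lborel)"
   by (intro nn_integral_cong) (auto simp: \<gamma>'_def indicator_def)
  also have "\<dots> = ennreal (LBINT u:S \<inter> {0..}. \<gamma> u)"
   unfolding set_lebesgue_integral_def using i[OF S'] bd
   by (intro nn_integral_eq_integral) (auto simp: set_integrable_def indicator_def)
  finally show ?thesis .
 qed
 have GN: "interval_measure G = N"
 proof (rule interval_measure_unique[OF mono])
  show "continuous (at_right a) G" for a using lip by (rule lipschitz_continuous_at_right)
  show "emeasure N {a<..b} = ennreal (G b - G a)" if ab: "a \<le> b" for a b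
  proof -
   have "{a<..b} \<inter> {0..} \<in> sets borel" by simp
   have "(LBINT u:{a<..b} \<inter> {0..}. \<gamma> u) = (LBINT u:{max 0 a<..max 0 b}. \<gamma> u)"
    unfolding set_lebesgue_integral_def
   proof (rule integral_cong_AE)
    have "AE u in lborel. u \<noteq> (0::real)" by (rule AE_lborel_singleton)
    then show "AE u in lborel. indicat_real ({a<..b} \<inter> {0..}) u *\<^sub>R \<gamma> u = indicat_real {max 0 a<..max 0 b} u *\<^sub>R \<gamma> u"
     by eventually_elim (auto simp: indicator_def)
    show "(\<lambda>u. indicat_real ({a<..b} \<inter> {0..}) u *\<^sub>R \<gamma> u) \<in> borel_measurable lborel"
     using i[of "{a<..b} \<inter> {0..}" b, unfolded set_integrable_def, THEN borel_measurable_integrable] by force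
    show "(\<lambda>u. indicat_real {max 0 a<..max 0 b} u *\<^sub>R \<gamma> u) \<in> borel_measurable lborel"
     using i[of "{max 0 a<..max 0 b}" "max 0 b", unfolded set_integrable_def, THEN borel_measurable_integrable] by force
   qed
   moreover have "{a<..b} \<subseteq> {..b}" by auto
   ultimately show ?thesis using eN[of "{a<..b}" b] diff[OF ab] by simp
  qed
  show "sets N = sets borel" unfolding N_def by simp
 qed
 show "emeasure (interval_measure G) S = ennreal (LBINT u:S. \<gamma> u)" if S: "S \<in> sets borel" "S \<subseteq> {0..t}" for S t
 proof -
  have "S \<inter> {0..} = S" using S by auto
  then show ?thesis unfolding GN using eN[of S t] S by fastforce
 qed
qed

text \<open>The Jordan decomposition built from the total variation is never computed. With the
  primitives \<open>Gp\<close> and \<open>Gn\<close> of the positive and negative parts of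
  \<open>\<beta>\<close>, both \<open>Fp - Fn\<close> and \<open>Gp - Gn\<close> are equal to
  \<open>f\<close>. So \<open>Fp + Gn = Fn + Gp\<close>, and additivity of the generated measures
  gives equal differences on bounded sets.\<close>

lemma stieltjes_integral_indicator:
 fixes f \<beta> :: "real => real"
 assumes \<beta>: "continuous_on {0..} \<beta>" and bd: "\<And>u. 0 \<le> u ==> \<bar>\<beta> u\<bar> \<le> C"
  and f: "\<And>t. 0 \<le> t ==> f t = (LBINT u:{0..t}. \<beta> u)"
  and S: "S \<in> sets borel" and t: "0 \<le> t"
 shows "stieltjes_integral (indicator S) f t = (LBINT u:{0..t}. indicator S u * \<beta> u)"
proof -
 define v where "v s = enn2real (total_variation f (max 0 s))" for s
 define Fp where "Fp s = (v s + f (max 0 s)) / 2" for s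
 define Fn where "Fn s = (v s - f (max 0 s)) / 2" for s
 define \<beta>p where "\<beta>p u = max 0 (\<beta> u)" for u
 define \<beta>n where "\<beta>n u = max 0 (- \<beta> u)" for u
 define Gp where "Gp s = (LBINT u:{0..max 0 s}. \<beta>p u)" for s
 define Gn where "Gn s = (LBINT u:{0..max 0 s}. \<beta>n u)" for s
 have C0: "0 \<le> C" using bd[of 0] by auto
 have flip: "\<bar>f y - f x\<bar> \<le> C * (y - x)" if "0 \<le> x" "x \<le> y" for x y
  using set_integral_lipschitz[OF \<beta> bd that] f that by simp
 have fin: "total_variation f x < \<infinity>" for x
  using total_variation_le[of f "\<lambda>x. C * x" x] flip by (auto simp: right_diff_distrib intro: le_less_trans)
 have vd: "\<bar>f y - f x\<bar> \<le> v y - v x \<and> v y - v x \<le> C * (y - x)" if "0 \<le> x" "x \<le> y" for x y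
 proof -
  have a: "total_variation f x = ennreal (v x)" "total_variation f y = ennreal (v y)"
   using fin that by (auto simp: v_def max_absorb2)
  have v0: "0 \<le> v x" "0 \<le> v y" by (auto simp: v_def)
  have "ennreal (v x + \<bar>f y - f x\<bar>) \<le> ennreal (v y)"
   using total_variation_append[OF that, of f] v0 unfolding a by (simp add: ennreal_plus)
  then have "v x + \<bar>f y - f x\<bar> \<le> v y" using v0 by (subst (asm) ennreal_le_iff)
  moreover have "ennreal (v y) \<le> ennreal (v x + C * (y - x))"
   using total_variation_lipschitz[OF flip that] v0 C0 that unfolding a by (simp add: ennreal_plus)
  then have "v y \<le> v x + C * (y - x)" using v0 C0 that by (subst (asm) ennreal_le_iff) auto
  ultimately show ?thesis by simp
 qed
 have vd': "\<bar>f (max 0 y) - f (max 0 x)\<bar> \<le> v y - v x \<and> v y - v x \<le> C * (y - x)" if "x \<le> y" for x y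
 proof -
  have "v y = v (max 0 y)" "v x = v (max 0 x)" by (simp_all add: v_def)
  moreover have "C * (max 0 y - max 0 x) \<le> C * (y - x)" using C0 that by (intro mult_left_mono) auto
  moreover have "max 0 x \<le> max 0 y" using that by auto
  ultimately show ?thesis using vd[of "max 0 x" "max 0 y"] by auto
 qed
 have Fp: "Fp x \<le> Fp y" "\<bar>Fp y - Fp x\<bar> \<le> C * (y - x)" and Fn: "Fn x \<le> Fn y" "\<bar>Fn y - Fn x\<bar> \<le> C * (y - x)" if "x \<le> y" for x y
  using vd'[OF that] by (auto simp: Fp_def Fn_def abs_le_iff field_simps)
 have cp: "continuous_on {0..} \<beta>p" "continuous_on {0..} \<beta>n"
  unfolding \<beta>p_def \<beta>n_def using \<beta> by (auto intro!: continuous_intros)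
 have bp: "0 \<le> \<beta>p u \<and> \<beta>p u \<le> C" "0 \<le> \<beta>n u \<and> \<beta>n u \<le> C" if "0 \<le> u" for u
  using bd[OF that] C0 by (auto simp: \<beta>p_def \<beta>n_def)
 have G1: "Gp x \<le> Gp y" "Gn x \<le> Gn y" "\<bar>Gp y - Gp x\<bar> \<le> C * (y - x)" "\<bar>Gn y - Gn x\<bar> \<le> C * (y - x)" if "x \<le> y" for x y
  unfolding Gp_def Gn_def using bp that
  by (auto intro!: interval_measure_integral(1,2)[OF cp(1)] interval_measure_integral(1,2)[OF cp(2)] simp del: abs_le_iff)
 have G3: "emeasure (interval_measure Gp) A = ennreal (LBINT u:A. \<beta>p u)"
  "emeasure (interval_measure Gn) A = ennreal (LBINT u:A. \<beta>n u)" if "A \<in> sets borel" "A \<subseteq> {0..t}" for A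
  unfolding Gp_def[abs_def] Gn_def[abs_def] using bp
  by (auto intro!: interval_measure_integral(3)[OF cp(1) _ that] interval_measure_integral(3)[OF cp(2) _ that])
 have "interval_measure (\<lambda>x. Fp x + Gn x) = interval_measure (\<lambda>x. Fn x + Gp x)"
 proof -
  have "Fp x + Gn x = Fn x + Gp x" for x
  proof -
   have i: "set_integrable lborel {0..max 0 x} \<beta>p" "set_integrable lborel {0..max 0 x} \<beta>n"
    using cp by (auto intro!: borel_integrable_atLeastAtMost' intro: continuous_on_subset)
   have "\<beta> u = \<beta>p u - \<beta>n u" for u by (auto simp: \<beta>p_def \<beta>n_def)
   then have "f (max 0 x) = Gp x - Gn x" unfolding Gp_def Gn_def using i f[of "max 0 x"] by simp
   then show ?thesis by (simp add: Fp_def Fn_def field_simps)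
  qed
  then show ?thesis by simp
 qed
 then have em: "emeasure (interval_measure Fp) A + emeasure (interval_measure Gn) A
  = emeasure (interval_measure Fn) A + emeasure (interval_measure Gp) A" if "A \<in> sets borel" for A
 proof -
  have c: "continuous (at_right a) Fp" "continuous (at_right a) Fn" "continuous (at_right a) Gp" "continuous (at_right a) Gn" for a
   using lipschitz_continuous_at_right[OF Fp(2)] lipschitz_continuous_at_right[OF Fn(2)]
    lipschitz_continuous_at_right[OF G1(3)] lipschitz_continuous_at_right[OF G1(4)] by auto
  show ?thesis
   using emeasure_interval_measure_add[OF Fp(1) c(1) G1(2) c(4) that] emeasure_interval_measure_add[OF Fn(1) c(2) G1(1) c(3) that]
    \<open>interval_measure (\<lambda>x. Fp x + Gn x) = interval_measure (\<lambda>x. Fn x + Gp x)\<close> by simp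
 qed
 define A where "A = S \<inter> {0..t}"
 have A: "A \<in> sets borel" "A \<subseteq> {0..t}" using S by (auto simp: A_def)
 have finite_meas: "emeasure (interval_measure Fp) A = ennreal (measure (interval_measure Fp) A)"
  "emeasure (interval_measure Fn) A = ennreal (measure (interval_measure Fn) A)"
 proof -
  have "emeasure (interval_measure H) A < \<infinity>" if H: "\<And>x y. x \<le> y ==> H x \<le> H y" "\<And>x y. x \<le> y ==> \<bar>H y - H x\<bar> \<le> C * (y - x)" for H
  proof -
   have "emeasure (interval_measure H) A \<le> emeasure (interval_measure H) {-1<..t}"
    using A by (intro emeasure_mono) auto
   also have "\<dots> < \<infinity>" using t H lipschitz_continuous_at_right[OF H(2)] by (subst emeasure_interval_measure_Ioc) auto
   finally show ?thesis .
  qed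
  from this[OF Fp] this[OF Fn]
  show "emeasure (interval_measure Fp) A = ennreal (measure (interval_measure Fp) A)"
   "emeasure (interval_measure Fn) A = ennreal (measure (interval_measure Fn) A)"
   by (auto intro!: emeasure_eq_ennreal_measure simp: less_top)
 qed
 have i: "set_integrable lborel A \<beta>p" "set_integrable lborel A \<beta>n"
  by (rule set_integrable_subset[OF borel_integrable_atLeastAtMost'[of 0 t]]; use cp A in \<open>auto intro: continuous_on_subset\<close>)+
 have nn: "0 \<le> (LBINT u:A. \<beta>p u)" "0 \<le> (LBINT u:A. \<beta>n u)"
  unfolding set_lebesgue_integral_def by (auto intro!: Bochner_Integration.integral_nonneg simp: \<beta>p_def \<beta>n_def)
 have "ennreal (measure (interval_measure Fp) A + (LBINT u:A. \<beta>n u)) = ennreal (measure (interval_measure Fn) A + (LBINT u:A. \<beta>p u))"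
  using em[OF A(1)] nn unfolding finite_meas G3[OF A] by (simp add: ennreal_plus)
 then have "measure (interval_measure Fp) A - measure (interval_measure Fn) A = (LBINT u:A. \<beta>p u) - (LBINT u:A. \<beta>n u)"
  using nn by (subst (asm) ennreal_inj) auto
 also have "\<dots> = (LBINT u:A. \<beta>p u - \<beta>n u)" using i by simp
 also have "\<dots> = (LBINT u:{0..t}. indicator S u * \<beta> u)"
  unfolding set_lebesgue_integral_def by (intro Bochner_Integration.integral_cong) (auto simp: A_def indicator_def \<beta>p_def \<beta>n_def)
 finally have 1: "measure (interval_measure Fp) A - measure (interval_measure Fn) A = (LBINT u:{0..t}. indicator S u * \<beta> u)" .
 have 2: "(LINT u:{0..t}|N. indicator S u) = measure N A" if "sets N = sets borel" for N :: "real measure"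
 proof -
  have "(LINT u:{0..t}|N. indicator S u) = (LINT u|N. indicat_real A u)"
   unfolding set_lebesgue_integral_def by (intro Bochner_Integration.integral_cong) (auto simp: A_def indicator_def)
  also have "\<dots> = measure N A" using that sets_eq_imp_space_eq[OF that] by simp
  finally show ?thesis .
 qed
 show ?thesis
  unfolding stieltjes_integral_def using 1 2 by (simp add: pos_variation_measure_def neg_variation_measure_def Fp_def[abs_def] Fn_def[abs_def] v_def)
qed

section \<open>The bracket of Brownian motion\<close>

context brownian_space
begin

lemma B_L2_martingale: "L2_martingale (\<lambda>t w. B t w - B 0 w)"
proof (rule L2_martingaleI)
 show "adapted (\<lambda>t w. B t w - B 0 w)"
  using B_adapted continuous_adapted_measurable_le[OF B_adapted, of 0]
  by (auto simp: continuous_adapted_def intro!: continuous_intros)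
 fix s t A assume st: "0 \<le> s" "s \<le> t" and A: "A \<in> sets (F s)"
 have AF: "indicat_real A \<in> borel_measurable (F s)" "indicat_real A \<in> borel_measurable M"
  using A sets_F_subset[OF st(1)] by auto
 then show "\<E> (\<lambda>w. indicat_real A w * (B t w - B 0 w - (B s w - B 0 w))) = 0"
  using B_incr_mult_power[OF st AF(1) bounded_integrable[OF AF(2) indicator_abs_le_1], of 1] B_incr_moments(1)[OF st] by simp
qed (use B_incr_integrable[of 0 _ 2] in auto)

lemma B_L2_martingale_square: "L2_martingale (\<lambda>t w. (B t w - B 0 w)^2 - t)"
proof (rule L2_martingaleI)
 show "adapted (\<lambda>t w. (B t w - B 0 w)^2 - t)"
  using B_adapted continuous_adapted_measurable_le[OF B_adapted, of 0]
  by (auto simp: continuous_adapted_def intro!: continuous_intros)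
 have i: "integrable M (\<lambda>w. (B t w - B 0 w)^k)" if "0 \<le> t" for t k
  using B_incr_integrable[of 0 t k] that by simp
 show "integrable M (\<lambda>w. ((B t w - B 0 w)^2 - t)^2)" if "0 \<le> t" for t
 proof -
  have "(x^2 - t)^2 = x^4 - 2 * t * x^2 + t^2" for x :: real
   by (simp add: power2_eq_square power4_eq_xxxx algebra_simps)
  then show ?thesis using i[OF that] by simp
 qed
 fix s t A assume st: "0 \<le> s" "s \<le> t" and A: "A \<in> sets (F s)"
 let ?D = "\<lambda>w. B t w - B s w"
 have AF: "indicat_real A \<in> borel_measurable (F s)" "indicat_real A \<in> borel_measurable M"
  using A sets_F_subset[OF st(1)] by auto
 have iA: "integrable M (indicat_real A)" using AF(2) indicator_abs_le_1[of A] by (intro bounded_integrable)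
 have 1: "integrable M (\<lambda>w. indicat_real A w * ?D w ^ 2)"
  "\<E> (\<lambda>w. indicat_real A w * ?D w ^ 2) = \<E> (indicat_real A) * (t - s)"
  using B_incr_mult_power[OF st AF(1) iA, of 2] B_incr_moments[OF st] by auto
 have xF: "(\<lambda>w. indicat_real A w * (B s w - B 0 w)) \<in> borel_measurable (F s)"
  using AF(1) st continuous_adapted_measurable_le[OF B_adapted, of s s] continuous_adapted_measurable_le[OF B_adapted, of 0 s] by simp
 have xi: "integrable M (\<lambda>w. indicat_real A w * (B s w - B 0 w))"
  using i[OF st(1), of 1] indicator_abs_le_1[of A] by (intro integrable_bounded_mult[OF _ AF(2)]) auto
 have 2: "integrable M (\<lambda>w. indicat_real A w * (B s w - B 0 w) * ?D w)"
  "\<E> (\<lambda>w. indicat_real A w * (B s w - B 0 w) * ?D w) = 0"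
  using B_incr_mult_power[OF st xF xi, of 1] B_incr_moments[OF st] by auto
 have e: "indicat_real A w * ((B t w - B 0 w)^2 - t - ((B s w - B 0 w)^2 - s))
   = 2 * (indicat_real A w * (B s w - B 0 w) * ?D w) + (indicat_real A w * ?D w ^ 2 - (t - s) * indicat_real A w)" for w
  by (simp add: algebra_simps power2_eq_square)
 show "\<E> (\<lambda>w. indicat_real A w * ((B t w - B 0 w)^2 - t - ((B s w - B 0 w)^2 - s))) = 0"
  unfolding e using 1 2 iA by simp
qed

text \<open>The bracket in the definition of the integral is an arbitrary witness. One of
  \<open>(B - B 0)^2 - Q\<close> and \<open>(B - B 0)^2 - t\<close> is a local martingale, the other
  a square integrable martingale, and they differ by a process of bounded variation, which must
  vanish.\<close>

lemma bracket_eq: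
 assumes Q: "is_bracket M F B Q"
 shows "AE w in M. \<forall>t\<ge>0. Q t w = t"
proof -
 have "AE w in M. \<forall>t\<ge>0. (\<lambda>t w. t - Q t w) t w = 0"
 proof (rule local_martingale_bv_unique[OF _ B_L2_martingale_square])
  show "continuous_local_martingale M F (\<lambda>t w. (B t w - B 0 w)^2 - Q t w)"
   using Q by (simp add: is_bracket_def)
  have Q0: "Q 0 w = 0" "mono_on {0..} (\<lambda>t. Q t w)" if "w \<in> space M" for w
   using Q that by (auto simp: is_bracket_def)
  show "bounded_variation_process M (\<lambda>t w. t - Q t w)"
   unfolding bounded_variation_process_def
  proof (intro ballI allI impI)
   fix w t assume w: "w \<in> space M"
   have "total_variation (\<lambda>s. s - Q s w) t \<le> ennreal (t + Q t w - (0 + Q 0 w))"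
   proof (rule total_variation_le)
    fix x y :: real assume "0 \<le> x" "x \<le> y"
    then have "Q x w \<le> Q y w" using mono_onD[OF Q0(2)[OF w], of x y] by simp
    then show "\<bar>y - Q y w - (x - Q x w)\<bar> \<le> y + Q y w - (x + Q x w)" using \<open>x \<le> y\<close> by auto
   qed
   then show "total_variation (\<lambda>s. s - Q s w) t < \<infinity>" by (simp add: le_less_trans)
  qed
  show "AE w in M. \<forall>t\<ge>0. (B t w - B 0 w)^2 - Q t w - ((B 0 w - B 0 w)^2 - Q 0 w)
    = (B t w - B 0 w)^2 - t - ((B 0 w - B 0 w)^2 - 0) + (t - Q t w)"
   using Q0 by (intro AE_I2) auto
 qed
 then show ?thesis by eventually_elim auto
qed

lemma bracket_measure_eq:
 assumes Q: "is_bracket M F B Q"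
 shows "AE w in M. bracket_measure Q w = density lborel (indicator {0..})"
 using bracket_eq[OF Q]
proof eventually_elim
 case (elim w)
 have "bracket_measure Q w = interval_measure (\<lambda>s. max 0 s)"
  unfolding bracket_measure_def using elim by (intro arg_cong[where f=interval_measure]) auto
 also have "\<dots> = density lborel (indicator {0..})"
 proof (rule interval_measure_unique)
  fix a b :: real assume ab: "a \<le> b"
  have "emeasure (density lborel (indicator {0..})) {a<..b} = (\<integral>\<^sup>+x. indicator {0..} x * indicator {a<..b} x \<partial>lborel)"
   by (rule emeasure_density) auto
  also have "\<dots> = (\<integral>\<^sup>+x. indicator ({a<..b} \<inter> {0..}) x \<partial>lborel)"
   by (intro nn_integral_cong) (simp split: split_indicator)
  also have "\<dots> = emeasure lborel ({a<..b} \<inter> {0..})" by (rule nn_integral_indicator) simp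
  also have "\<dots> = emeasure lborel {max 0 a<..max 0 b}"
  proof (rule emeasure_eq_AE)
   have "AE u in lborel. u \<noteq> (0::real)" by (rule AE_lborel_singleton)
   then show "AE u in lborel. (u \<in> {a<..b} \<inter> {0..}) = (u \<in> {max 0 a<..max 0 b})"
    by eventually_elim auto
  qed auto
  also have "\<dots> = ennreal (max 0 b - max 0 a)" using ab by (subst emeasure_lborel_Ioc) auto
  finally show "emeasure (density lborel (indicator {0..})) {a<..b} = ennreal (max 0 b - max 0 a)" .
 qed (auto intro!: continuous_intros)
 finally show ?case .
qed

end

section \<open>Stochastic integrals of bounded processes\<close>

text \<open>At most one interval of the partition contains \<open>s\<close>. Its index depends on
  the partition alone, so one case distinction serves several coefficient families at once.\<close>

lemma simple_value_cases:
 assumes "mono \<tau>"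
 obtains i where "i < n" "\<tau> i < s" "s \<le> \<tau> (Suc i)" "\<And>(\<zeta> :: nat => 'w => real) w. simple_value (n, \<tau>, \<zeta>) s w = \<zeta> i w"
 | "\<And>(\<zeta> :: nat => 'w => real) w. simple_value (n, \<tau>, \<zeta>) s w = 0"
proof (cases "\<exists>i<n. s \<in> {\<tau> i<..\<tau> (Suc i)}")
 case True
 then obtain i where i: "i < n" "s \<in> {\<tau> i<..\<tau> (Suc i)}" by blast
 have other: "s \<notin> {\<tau> j<..\<tau> (Suc j)}" if "j \<noteq> i" for j
  using i(2) that monoD[OF assms, of "Suc i" j] monoD[OF assms, of "Suc j" i] by (cases "i < j") auto
 have "simple_value (n, \<tau>, \<zeta>) s w = \<zeta> i w" for \<zeta> :: "nat => 'w => real" and w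
 proof -
  have "simple_value (n, \<tau>, \<zeta>) s w = (\<Sum>j<n. if j = i then \<zeta> i w else 0)"
   unfolding simple_value_def prod.case
  proof (intro sum.cong refl)
   show "\<zeta> j w * indicator {\<tau> j<..\<tau> (Suc j)} s = (if j = i then \<zeta> i w else 0)" for j
    using i other[of j] by (cases "j = i") (auto simp: indicator_def)
  qed
  then show ?thesis using i by simp
 qed
 then show ?thesis using i that(1)[of i] by auto
next
 case False
 then have "simple_value (n, \<tau>, \<zeta>) s w = 0" for \<zeta> :: "nat => 'w => real" and w
  unfolding simple_value_def by (auto intro!: sum.neutral simp: indicator_def)
 then show ?thesis using that(2) by blast
qed

text \<open>For nonnegative \<open>c\<close>, the projection onto the interval from
  \<open>- c\<close> to \<open>c\<close>; it forces the bound of an integrand onto its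
  approximants.\<close>

definition clamp_real :: "real => real => real" where
 "clamp_real c x = max (- c) (min c x)"

lemma clamp_real_bounds: "0 \<le> c ==> \<bar>clamp_real c x\<bar> \<le> c" "0 \<le> c ==> clamp_real c 0 = 0"
 by (auto simp: clamp_real_def)

lemma clamp_real_dist:
 assumes "\<bar>y\<bar> \<le> c"
 shows "\<bar>clamp_real c x - y\<bar> \<le> \<bar>x - y\<bar>" "\<bar>x - clamp_real c x\<bar> \<le> \<bar>x - y\<bar>"
 using assms by (auto simp: clamp_real_def max_def min_def)

lemma clamp_real_measurable[measurable]: "clamp_real c \<in> borel_measurable borel"
 unfolding clamp_real_def[abs_def] by measurable

context filtered_prob_space
begin

text \<open>The increment over \<open>[s, t]\<close> of the integral of a simple process is a \<open>transform\<close> along the times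
 clipped to \<open>[s, t]\<close>; coefficients known only after \<open>t\<close> are multiplied by zero increments.\<close>

lemma simple_integral_incr:
 assumes "0 \<le> s" "s \<le> t" "mono \<tau>"
 shows "simple_integral (n, \<tau>, \<xi>) N t w - simple_integral (n, \<tau>, \<xi>) N s w
  = transform N (\<lambda>i w. if \<tau> i \<le> t then \<xi> i w else 0) (\<lambda>i. max s (min t (\<tau> i))) n w"
 unfolding simple_integral_def transform_def prod.case sum_subtractf[symmetric]
proof (intro sum.cong refl)
 fix i
 have "N (min t (\<tau> j)) w - N (min s (\<tau> j)) w = N (max s (min t (\<tau> j))) w - N s w" for j
  using assms by (cases "\<tau> j \<le> s") (auto simp: min_def max_def)
 from this[of i] this[of "Suc i"] have "N (min t (\<tau> (Suc i))) w - N (min t (\<tau> i)) w - (N (min s (\<tau> (Suc i))) w - N (min s (\<tau> i)) w)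
  = N (max s (min t (\<tau> (Suc i)))) w - N (max s (min t (\<tau> i))) w" by simp
 moreover have "N (max s (min t (\<tau> (Suc i)))) w = N (max s (min t (\<tau> i))) w" if "\<not> \<tau> i \<le> t"
  using that monoD[OF assms(3), of i "Suc i"] by (simp add: min_def)
 ultimately show "\<xi> i w * (N (min t (\<tau> (Suc i))) w - N (min t (\<tau> i)) w) - \<xi> i w * (N (min s (\<tau> (Suc i))) w - N (min s (\<tau> i)) w)
  = (if \<tau> i \<le> t then \<xi> i w else 0) * (N (max s (min t (\<tau> (Suc i)))) w - N (max s (min t (\<tau> i))) w)"
  by (auto simp: right_diff_distrib[symmetric])
qed

lemma clipped_times:
 assumes "0 \<le> s" "s \<le> t" "mono \<tau>" and \<xi>: "i < n ==> \<xi> i \<in> borel_measurable (F (\<tau> i))"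
 shows "0 \<le> max s (min t (\<tau> 0))" "mono (\<lambda>i. max s (min t (\<tau> i)))"
  "i < n ==> (\<lambda>w. if \<tau> i \<le> t then \<xi> i w else 0) \<in> borel_measurable (F (max s (min t (\<tau> i))))"
proof -
 show "0 \<le> max s (min t (\<tau> 0))" using assms by simp
 show "mono (\<lambda>i. max s (min t (\<tau> i)))" using assms(3) by (auto intro!: monoI max.mono min.mono dest: monoD)
 show "(\<lambda>w. if \<tau> i \<le> t then \<xi> i w else 0) \<in> borel_measurable (F (max s (min t (\<tau> i))))" if "i < n"
  using measurable_F_mono[OF \<xi>[OF that], of "max s (min t (\<tau> i))"] by (cases "\<tau> i \<le> t") auto
qed

lemma simple_integral_0:
 assumes "0 \<le> \<tau> 0" "mono \<tau>"
 shows "simple_integral (n, \<tau>, \<xi>) N 0 w = 0"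
proof -
 have "0 \<le> \<tau> i" for i using assms monoD[OF assms(2), of 0 i] by simp
 then show ?thesis by (simp add: simple_integral_def min_absorb1)
qed

lemma simple_integral_continuous_adapted:
 assumes N: "adapted N" and K: "simple_process M F (n, \<tau>, \<xi>)"
 shows "adapted (simple_integral (n, \<tau>, \<xi>) N)"
 unfolding continuous_adapted_def
proof (intro conjI allI impI ballI)
 have \<tau>: "0 \<le> \<tau> 0" "mono \<tau>" and \<xi>: "\<And>i. i < n ==> \<xi> i \<in> borel_measurable (F (\<tau> i))"
  using K by (auto simp: simple_process_def)
 have \<tau>0: "0 \<le> \<tau> i" for i using \<tau> monoD[OF \<tau>(2), of 0 i] by simp
 show "simple_integral (n, \<tau>, \<xi>) N t \<in> borel_measurable (F t)" if t: "0 \<le> t" for t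
 proof -
  have "transform N (\<lambda>i w. if \<tau> i \<le> t then \<xi> i w else 0) (\<lambda>i. max 0 (min t (\<tau> i))) n \<in> borel_measurable (F (max 0 (min t (\<tau> n))))"
   using clipped_times[OF order_refl t \<tau>(2), of _ n \<xi>] \<xi> by (intro transform_measurable[OF N]) auto
  then have "transform N (\<lambda>i w. if \<tau> i \<le> t then \<xi> i w else 0) (\<lambda>i. max 0 (min t (\<tau> i))) n \<in> borel_measurable (F t)"
   by (rule measurable_F_mono) (use t in auto)
  moreover have "simple_integral (n, \<tau>, \<xi>) N t = transform N (\<lambda>i w. if \<tau> i \<le> t then \<xi> i w else 0) (\<lambda>i. max 0 (min t (\<tau> i))) n"
   using simple_integral_incr[OF order_refl t \<tau>(2), of n \<xi> N] simple_integral_0[OF \<tau>, of n \<xi> N] by auto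
  ultimately show ?thesis by simp
 qed
 show "continuous_on {0..} (\<lambda>t. simple_integral (n, \<tau>, \<xi>) N t w)" if w: "w \<in> space M" for w
 proof -
  have "continuous_on {0..} (\<lambda>t. N t w)" using N w by (simp add: continuous_adapted_def)
  then have "continuous_on {0..} (\<lambda>t. N (min t (\<tau> i)) w)" for i
   using \<tau>0[of i] by (intro continuous_on_compose2[of "{0..}" "\<lambda>t. N t w" _ "\<lambda>t. min t (\<tau> i)"]) (auto intro!: continuous_intros)
  then show ?thesis unfolding simple_integral_def prod.case by (intro continuous_intros)
 qed
qed

lemma simple_integral_L2_martingale:
 assumes m: "L2_martingale m" and K: "simple_process M F (n, \<tau>, \<xi>)"
 shows "L2_martingale (simple_integral (n, \<tau>, \<xi>) m)"
proof -
 have mc: "adapted m" using m by (simp add: L2_martingale_def)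
 have \<tau>: "0 \<le> \<tau> 0" "mono \<tau>" and \<xi>: "\<And>i. i < n ==> \<xi> i \<in> borel_measurable (F (\<tau> i))" "\<And>i. i < n ==> bounded (\<xi> i ` space M)"
  using K by (auto simp: simple_process_def)
 obtain c where "0 \<le> c" "\<And>i w. i < n ==> w \<in> space M ==> \<bar>\<xi> i w\<bar> \<le> c" using common_bound[of n \<xi> "space M"] \<xi>(2) by metis
 then have c: "\<bar>if \<tau> i \<le> t then \<xi> i w else 0\<bar> \<le> c" if "i < n" "w \<in> space M" for i w t using that by simp
 note ad = simple_integral_continuous_adapted[OF mc K]
 have tr: "integrable M (\<lambda>w. (simple_integral (n, \<tau>, \<xi>) m t w - simple_integral (n, \<tau>, \<xi>) m s w)^2)"
  "\<And>\<eta>. \<eta> \<in> borel_measurable (F s) ==> integrable M (\<lambda>w. (\<eta> w)^2)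
   ==> has_bochner_integral M (\<lambda>w. \<eta> w * (simple_integral (n, \<tau>, \<xi>) m t w - simple_integral (n, \<tau>, \<xi>) m s w)) 0"
  if st: "0 \<le> s" "s \<le> t" for s t
 proof -
  note ct = clipped_times[OF st \<tau>(2), of _ n \<xi>]
  note T = transform_L2[OF m ct(1,2), where n=n and \<zeta>="\<lambda>i w. if \<tau> i \<le> t then \<xi> i w else 0" and c=c]
  show "integrable M (\<lambda>w. (simple_integral (n, \<tau>, \<xi>) m t w - simple_integral (n, \<tau>, \<xi>) m s w)^2)"
   unfolding simple_integral_incr[OF st \<tau>(2)] using ct(3) c \<xi> by (intro T(1)) auto
  fix \<eta> :: "'w => real" assume \<eta>: "\<eta> \<in> borel_measurable (F s)" "integrable M (\<lambda>w. (\<eta> w)^2)"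
  have "\<eta> \<in> borel_measurable (F (max s (min t (\<tau> 0))))" by (rule measurable_F_mono[OF \<eta>(1)]) auto
  then show "has_bochner_integral M (\<lambda>w. \<eta> w * (simple_integral (n, \<tau>, \<xi>) m t w - simple_integral (n, \<tau>, \<xi>) m s w)) 0"
   unfolding simple_integral_incr[OF st \<tau>(2)] using ct(3) c \<xi> \<eta> by (intro T(2)) auto
 qed
 have sq: "integrable M (\<lambda>w. (simple_integral (n, \<tau>, \<xi>) m t w)^2)" if "0 \<le> t" for t
  using tr(1)[OF order_refl that] simple_integral_0[OF \<tau>, of n \<xi> m] by simp
 show ?thesis
 proof (rule L2_martingaleI[OF ad sq])
  fix s t A assume st: "0 \<le> s" "s \<le> t" and A: "A \<in> sets (F s)"
  have AF: "indicat_real A \<in> borel_measurable (F s)" "indicat_real A \<in> borel_measurable M"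
   using A sets_F_subset[OF st(1)] by auto
  have "(indicat_real A w)^2 = indicat_real A w" for w by (simp add: indicator_def)
  then have "integrable M (\<lambda>w. (indicat_real A w)^2)" using bounded_integrable[OF AF(2) indicator_abs_le_1] by simp
  from tr(2)[OF st AF(1) this]
  show "\<E> (\<lambda>w. indicat_real A w * (simple_integral (n, \<tau>, \<xi>) m t w - simple_integral (n, \<tau>, \<xi>) m s w)) = 0"
   by (rule has_bochner_integral_integral_eq)
 qed
qed

end

section \<open>Joint measurability in time and outcome\<close>

lemma continuous_joint_measurable:
 fixes X :: "real => 'a => real"
 assumes X: "\<And>r. X r \<in> borel_measurable N" and c: "\<And>w. w \<in> space N ==> continuous_on UNIV (\<lambda>r. X r w)"
 shows "(\<lambda>p. X (fst p) (snd p)) \<in> borel_measurable (borel \<Otimes>\<^sub>M N)"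
proof (rule borel_measurable_LIMSEQ_real)
 \<comment> \<open>Time is rounded down to the grid of mesh \<open>1 / Suc n\<close>, so that
   \<open>U n\<close> is a countable gluing of measurable functions.\<close>
 define U where "U n p = X (of_int \<lfloor>real (Suc n) * fst p\<rfloor> / real (Suc n)) (snd p)" for n and p :: "real \<times> 'a"
 show "U n \<in> borel_measurable (borel \<Otimes>\<^sub>M N)" for n
  unfolding U_def
 proof (rule measurable_compose_countable[where f="\<lambda>i p. X (of_int i / real (Suc n)) (snd p)"])
  show "(\<lambda>p. X (of_int i / real (Suc n)) (snd p)) \<in> borel_measurable (borel \<Otimes>\<^sub>M N)" for i
   using X by (intro measurable_compose[OF measurable_snd])
  show "(\<lambda>p. \<lfloor>real (Suc n) * fst p\<rfloor>) \<in> measurable (borel \<Otimes>\<^sub>M N) (count_space UNIV)"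
   by measurable
 qed
 show "(\<lambda>n. U n p) \<longlonglongrightarrow> X (fst p) (snd p)" if "p \<in> space (borel \<Otimes>\<^sub>M N)" for p
 proof -
  have "continuous_on UNIV (\<lambda>r. X r (snd p))" using that c by (auto simp: space_pair_measure)
  moreover have "(\<lambda>n. of_int \<lfloor>real (Suc n) * fst p\<rfloor> / real (Suc n)) \<longlonglongrightarrow> fst p"
  proof (rule tendsto_sandwich)
   have "(\<lambda>n. fst p - inverse (real (Suc n))) \<longlonglongrightarrow> fst p - 0"
    by (intro tendsto_intros LIMSEQ_inverse_real_of_nat)
   then show "(\<lambda>n. fst p - inverse (real (Suc n))) \<longlonglongrightarrow> fst p" by simp
   have le: "of_int \<lfloor>real (Suc n) * fst p\<rfloor> \<le> real (Suc n) * fst p" "real (Suc n) * fst p - 1 \<le> of_int \<lfloor>real (Suc n) * fst p\<rfloor>" for n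
    by linarith+
   have "of_int \<lfloor>real (Suc n) * fst p\<rfloor> / real (Suc n) \<le> fst p" for n
    using le(1)[of n] by (subst pos_divide_le_eq) (simp_all add: mult.commute)
   then show "\<forall>\<^sub>F n in sequentially. of_int \<lfloor>real (Suc n) * fst p\<rfloor> / real (Suc n) \<le> fst p" by simp
   have "fst p - inverse (real (Suc n)) \<le> of_int \<lfloor>real (Suc n) * fst p\<rfloor> / real (Suc n)" for n
   proof (subst pos_le_divide_eq)
    have "(fst p - inverse (real (Suc n))) * real (Suc n) = real (Suc n) * fst p - 1" by (subst left_diff_distrib) (simp add: mult.commute del: of_nat_Suc)
    then show "(fst p - inverse (real (Suc n))) * real (Suc n) \<le> of_int \<lfloor>real (Suc n) * fst p\<rfloor>" using le(2)[of n] by simp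
   qed simp
   then show "\<forall>\<^sub>F n in sequentially. fst p - inverse (real (Suc n)) \<le> of_int \<lfloor>real (Suc n) * fst p\<rfloor> / real (Suc n)" by simp
  qed simp
  ultimately show ?thesis unfolding U_def
   by (intro continuous_on_tendsto_compose[where f="\<lambda>r. X r (snd p)" and s=UNIV]) auto
 qed
qed

lemma set_integral_joint_measurable:
 fixes f :: "real => 'a => real"
 assumes f: "(\<lambda>p. f (fst p) (snd p)) \<in> borel_measurable (borel \<Otimes>\<^sub>M N)" and S: "S \<in> sets borel"
 shows "(\<lambda>w. LBINT r:S. f r w) \<in> borel_measurable N"
proof -
 have "(\<lambda>p. indicat_real S (fst p) * f (fst p) (snd p)) \<in> borel_measurable (borel \<Otimes>\<^sub>M N)"
  using f S by measurable
 then have "(\<lambda>p. indicat_real S (snd p) * f (snd p) (fst p)) \<in> borel_measurable (N \<Otimes>\<^sub>M lborel)"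
  by (subst measurable_pair_swap_iff) (simp add: case_prod_beta cong: measurable_cong_sets)
 then show ?thesis
  unfolding set_lebesgue_integral_def by (intro lborel.borel_measurable_lebesgue_integral) (simp add: case_prod_beta)
qed

context filtered_prob_space
begin

text \<open>Freezing time below 0, or outside \<open>[0, t]\<close>, gives paths that are continuous
  on the whole line; the second freezing involves only variables known at time
  \<open>t\<close>.\<close>

lemma continuous_adapted_joint_measurable:
 assumes X: "adapted X"
 shows "(\<lambda>p. X (max 0 (fst p)) (snd p)) \<in> borel_measurable (borel \<Otimes>\<^sub>M M)"
  "0 \<le> t ==> (\<lambda>p. X (max 0 (min t (fst p))) (snd p)) \<in> borel_measurable (borel \<Otimes>\<^sub>M F t)"
proof -
 have c: "continuous_on UNIV (\<lambda>r. X (max 0 (g r)) w)" if "continuous_on UNIV g" "w \<in> space M" for g :: "real => real" and w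
  using X that by (intro continuous_on_compose2[of "{0..}" "\<lambda>r. X r w" UNIV "\<lambda>r. max 0 (g r)"])
   (auto simp: continuous_adapted_def intro!: continuous_intros)
 show "(\<lambda>p. X (max 0 (fst p)) (snd p)) \<in> borel_measurable (borel \<Otimes>\<^sub>M M)"
  using continuous_adapted_measurable_M[OF X] c[of "\<lambda>r. r"]
  by (intro continuous_joint_measurable[where X="\<lambda>r w. X (max 0 r) w"]) (auto intro: continuous_intros)
 show "(\<lambda>p. X (max 0 (min t (fst p))) (snd p)) \<in> borel_measurable (borel \<Otimes>\<^sub>M F t)" if t: "0 \<le> t"
  using continuous_adapted_measurable_le[OF X, of _ t] t c[of "\<lambda>r. min t r", OF continuous_on_min[OF continuous_on_const continuous_on_id]]
  by (intro continuous_joint_measurable[where X="\<lambda>r w. X (max 0 (min t r)) w"]) (auto simp: space_F intro: continuous_intros)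
qed

lemma set_integral_path_measurable:
 assumes X: "adapted X" and st: "0 \<le> s" "0 \<le> t"
 shows "(\<lambda>w. LBINT r:{s..t}. X r w) \<in> borel_measurable (F t)"
proof -
 have "(\<lambda>w. LBINT r:{s..t}. X (max 0 (min t r)) w) \<in> borel_measurable (F t)"
  using continuous_adapted_joint_measurable(2)[OF X st(2)] by (rule set_integral_joint_measurable) simp
 moreover have "(LBINT r:{s..t}. X (max 0 (min t r)) w) = (LBINT r:{s..t}. X r w)" for w
  using st by (intro set_lebesgue_integral_cong) auto
 ultimately show ?thesis by simp
qed

end

lemma continuous_path_integrable:
 fixes f :: "real => real"
 assumes "continuous_on {0..} f" "0 \<le> s" shows "set_integrable lborel {s..t} f"
 using assms by (intro borel_integrable_atLeastAtMost') (auto intro: continuous_on_subset)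

context brownian_space
begin

definition bounded_integral :: "real => (real => 'a => real) => (real => 'a => real) => bool" where
 "bounded_integral c H I \<longleftrightarrow> has_local_mart_integral M F B H I \<and> adapted H
   \<and> (\<forall>s\<ge>0. \<forall>w\<in>space M. \<bar>H s w\<bar> \<le> c) \<and> 0 \<le> c"

lemma simple_value_joint_measurable:
 assumes "simple_process M F K"
 shows "(\<lambda>p. simple_value K (fst p) (snd p)) \<in> borel_measurable (borel \<Otimes>\<^sub>M M)"
  "(\<lambda>s. simple_value K s w) \<in> borel_measurable borel"
proof -
 obtain n \<tau> \<xi> where K: "K = (n, \<tau>, \<xi>)" by (cases K) auto
 have \<tau>0: "0 \<le> \<tau> i" for i using assms monoD[of \<tau> 0 i] by (auto simp: simple_process_def K intro: order_trans)
 have "(\<lambda>p. \<xi> i (snd p)) \<in> borel_measurable (borel \<Otimes>\<^sub>M M)" if "i < n" for i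
  using that assms measurable_F[OF \<tau>0] by (intro measurable_compose[OF measurable_snd]) (auto simp: simple_process_def K)
 moreover have "(\<lambda>p. indicat_real {\<tau> i<..\<tau> (Suc i)} (fst p)) \<in> borel_measurable (borel \<Otimes>\<^sub>M M)" for i
  by (intro measurable_compose[OF measurable_fst]) auto
 ultimately show "(\<lambda>p. simple_value K (fst p) (snd p)) \<in> borel_measurable (borel \<Otimes>\<^sub>M M)"
  unfolding K simple_value_def prod.case by (intro borel_measurable_sum borel_measurable_times) auto
 show "(\<lambda>s. simple_value K s w) \<in> borel_measurable borel"
  unfolding K simple_value_def prod.case by measurable
qed

text \<open>The sum is the bracket at time \<open>t\<close> that enters
  \<open>transform_tail_bound\<close>. Written as the integral of a step function over the clipped
  times, it is bounded by the quantity that the definition of the stochastic integral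
  controls.\<close>

lemma simple_sum_le_integral:
 fixes D :: "nat => 'a => real"
 assumes \<tau>: "0 \<le> \<tau> 0" "mono \<tau>" and t: "0 \<le> t"
 shows "ennreal (\<Sum>i<n. (if \<tau> i \<le> t then D i w else 0)^2 * (max 0 (min t (\<tau> (Suc i))) - max 0 (min t (\<tau> i))))
   \<le> (\<integral>\<^sup>+s\<in>{0..t}. ennreal ((simple_value (n, \<tau>, D) s w)^2) \<partial>lborel)"
proof -
 define u where "u i = max 0 (min t (\<tau> i))" for i
 define z where "z i = (if \<tau> i \<le> t then D i w else 0)" for i
 have um: "mono u" unfolding u_def using \<tau>(2) by (auto intro!: monoI max.mono min.mono dest: monoD)
 have uS: "u i \<le> u (Suc i)" for i using um by (simp add: monoD)
 have "ennreal (\<Sum>i<n. (z i)^2 * (u (Suc i) - u i)) = (\<Sum>i<n. \<integral>\<^sup>+s. ennreal ((z i)^2 * indicator {u i<..u (Suc i)} s) \<partial>lborel)"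
  using uS by (subst sum_ennreal[symmetric]) (auto intro!: sum.cong simp: ennreal_mult' ennreal_indicator nn_integral_cmult_indicator)
 also have "\<dots> = (\<integral>\<^sup>+s. ennreal (simple_value (n, u, \<lambda>i _. (z i)^2) s w) \<partial>lborel)"
  unfolding simple_value_def prod.case by (subst nn_integral_sum[symmetric]) (auto simp: sum_ennreal)
 also have "\<dots> \<le> (\<integral>\<^sup>+s\<in>{0..t}. ennreal ((simple_value (n, \<tau>, D) s w)^2) \<partial>lborel)"
 proof (rule nn_integral_mono)
  fix s :: real
  show "ennreal (simple_value (n, u, \<lambda>i _. (z i)^2) s w) \<le> ennreal ((simple_value (n, \<tau>, D) s w)^2) * indicator {0..t} s"
  proof (cases rule: simple_value_cases[OF um, of n s, where 'w='a])
   case (1 i)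
   then have s: "0 < s" "s \<le> t" using t by (auto simp: u_def)
   have "simple_value (n, \<tau>, D) s w = simple_value (n, u, D) s w"
    unfolding simple_value_def prod.case using s by (intro sum.cong refl) (auto simp: u_def indicator_def)
   also have "\<dots> = D i w" by (rule 1)
   finally show ?thesis using s 1(4)[of "\<lambda>i _. (z i)^2"] by (simp add: z_def)
  qed simp
 qed
 finally show ?thesis by (simp add: u_def z_def)
qed

end

lemma power4_sum_le:
 fixes x y :: real shows "(x + y)^4 \<le> 8 * x^4 + 8 * y^4"
proof -
 have sq: "(a + b)^2 \<le> 2 * a^2 + 2 * b^2" for a b :: real
  using sum_squares_ge_zero[of "a - b" 0] by (simp add: power2_eq_square algebra_simps)
 have "((x + y)^2)^2 \<le> (2 * x^2 + 2 * y^2)^2" using sq[of x y] by (intro power_mono) auto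
 also have "\<dots> \<le> 2 * (2 * x^2)^2 + 2 * (2 * y^2)^2" by (rule sq)
 finally show ?thesis by (simp add: power_mult_distrib flip: power_mult)
qed

context brownian_space
begin

text \<open>The simple processes of the definition come without a common bound. Clamping their
  coefficients to the bound \<open>c\<close> of \<open>H\<close> does not move them away from
  \<open>H\<close>, and the part cut off is pointwise at most the distance of the simple process
  from \<open>H\<close>, so its stochastic integral tends to 0 in probability by the tail
  bound.\<close>

lemma bounded_integral_approx:
 assumes "bounded_integral c H I"
 obtains K where "\<And>k. simple_process M F (K k)" "\<And>k i w. \<bar>snd (snd (K k)) i w\<bar> \<le> c"
  "\<And>t. 0 \<le> t ==> null_in_prob (\<lambda>k w. simple_integral (K k) B t w - I t w)"
  "\<And>t. 0 \<le> t ==> null_in_prob (\<lambda>k w. LBINT s:{0..t}. (simple_value (K k) s w - H s w)^2)"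
proof -
 have HI: "has_local_mart_integral M F B H I" and Hc: "adapted H"
  and Hb: "\<And>s w. 0 \<le> s ==> w \<in> space M ==> \<bar>H s w\<bar> \<le> c" and c0: "0 \<le> c"
  using assms by (auto simp: bounded_integral_def)
 obtain Q K where Q: "is_bracket M F B Q" and K: "\<And>k. simple_process M F (K k)"
  and Y: "\<And>t. 0 \<le> t ==> tendsto_zero_in_prob M (\<lambda>k w. \<integral>\<^sup>+s\<in>{0..t}. ennreal ((simple_value (K k) s w - H s w)^2) \<partial>bracket_measure Q w)"
  and S: "\<And>t. 0 \<le> t ==> tendsto_zero_in_prob M (\<lambda>k w. SUP s\<in>{0..t}. ennreal \<bar>simple_integral (K k) B s w - I s w\<bar>)"
  and Ic: "adapted I"
  using HI by (auto simp: has_local_mart_integral_def)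
 define n where "n k = fst (K k)" for k
 define \<tau> where "\<tau> k = fst (snd (K k))" for k
 define \<xi> where "\<xi> k = snd (snd (K k))" for k
 have Keq: "K k = (n k, \<tau> k, \<xi> k)" for k by (simp add: n_def \<tau>_def \<xi>_def)
 define L where "L k = (n k, \<tau> k, \<lambda>i w. clamp_real c (\<xi> k i w))" for k
 define D where "D k i w = \<xi> k i w - clamp_real c (\<xi> k i w)" for k i w
 define E where "E k = (n k, \<tau> k, D k)" for k
 have \<tau>: "0 \<le> \<tau> k 0" "mono (\<tau> k)" and \<xi>: "\<And>i. i < n k ==> \<xi> k i \<in> borel_measurable (F (\<tau> k i))" "\<And>i. i < n k ==> bounded (\<xi> k i ` space M)" for k
  using K[of k] by (auto simp: Keq simple_process_def)
 have Lm: "(\<lambda>w. clamp_real c (\<xi> k i w)) \<in> borel_measurable (F (\<tau> k i))" if "i < n k" for k i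
  using measurable_compose[OF \<xi>(1)[OF that] clamp_real_measurable] .
 have Dm: "D k i \<in> borel_measurable (F (\<tau> k i))" if "i < n k" for k i
  unfolding D_def using \<xi>(1)[OF that] Lm[OF that] by simp
 have Db: "bounded (D k i ` space M)" if i: "i < n k" for k i
 proof -
  obtain b where "\<And>w. w \<in> space M ==> \<bar>\<xi> k i w\<bar> \<le> b" using \<xi>(2)[OF i] by (auto simp: bounded_iff)
  then show ?thesis using clamp_real_bounds(1)[OF c0]
   by (force simp: bounded_iff D_def intro!: exI[of _ "b + c"] order_trans[OF abs_triangle_ineq4] add_mono)
 qed
 have Lp: "simple_process M F (L k)" and Ep: "simple_process M F (E k)" for k
  using \<tau> Lm Dm Db clamp_real_bounds(1)[OF c0] by (auto simp: L_def E_def simple_process_def bounded_iff intro!: exI[of _ c])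
 have sv: "simple_value (L k) s w = clamp_real c (simple_value (K k) s w)
  \<and> simple_value (E k) s w = simple_value (K k) s w - clamp_real c (simple_value (K k) s w)" for k s w
  unfolding L_def E_def Keq
  by (rule simple_value_cases[OF \<tau>(2)[of k], where n="n k" and s=s and 'w='a]) (simp_all add: D_def clamp_real_bounds c0)
 define Yt where "Yt t k w = (\<integral>\<^sup>+s\<in>{0..t}. ennreal ((simple_value (K k) s w - H s w)^2) \<partial>bracket_measure Q w)" for t k w
 have Y0: "tendsto_zero_in_prob M (Yt t)" and YM: "Yt t k \<in> borel_measurable M" if "0 \<le> t" for t k
  using Y[OF that] by (auto simp: tendsto_zero_in_prob_def Yt_def[abs_def])
 have mH: "(\<lambda>s. H (max 0 s) w) \<in> borel_measurable borel" if "w \<in> space M" for w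
  using measurable_compose[OF measurable_Pair2'[OF that] continuous_adapted_joint_measurable(1)[OF Hc]] by simp
 \<comment> \<open>Integration against the witness \<open>Q\<close> for the bracket becomes Lebesgue
   integration.\<close>
 have YL: "AE w in M. \<forall>t k. Yt t k w = (\<integral>\<^sup>+s\<in>{0..t}. ennreal ((simple_value (K k) s w - H s w)^2) \<partial>lborel)"
  using bracket_measure_eq[OF Q] AE_space
 proof eventually_elim
  case (elim w)
  show ?case
  proof (intro allI)
   fix t k
   define f where "f s = ennreal ((simple_value (K k) s w - H (max 0 s) w)^2) * indicator {0..t} s" for s
   have fm: "f \<in> borel_measurable lborel"
    unfolding f_def using mH[OF elim(2)] simple_value_joint_measurable(2)[OF K, of k w] by simp
   have e: "ennreal ((simple_value (K k) s w - H s w)^2) * indicator {0..t} s = f s" for s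
    by (auto simp: f_def indicator_def)
   have "Yt t k w = (\<integral>\<^sup>+s. indicator {0..} s * f s \<partial>lborel)"
    unfolding Yt_def elim(1) e using fm by (intro nn_integral_density) auto
   also have "\<dots> = (\<integral>\<^sup>+s. f s \<partial>lborel)"
    by (intro nn_integral_cong) (auto simp: f_def indicator_def)
   finally show "Yt t k w = (\<integral>\<^sup>+s\<in>{0..t}. ennreal ((simple_value (K k) s w - H s w)^2) \<partial>lborel)"
    unfolding e .
  qed
 qed
 have LI: "null_in_prob (\<lambda>k w. LBINT s:{0..t}. (simple_value (L k) s w - H s w)^2)" if t: "0 \<le> t" for t
 proof (rule null_in_prob_ennreal[OF Y0[OF t]])
  fix k
  define g where "g s w = indicat_real {0..t} s * (simple_value (L k) s w - H (max 0 s) w)^2" for s w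
  have g: "(LBINT s:{0..t}. (simple_value (L k) s w - H s w)^2) = (LBINT s. g s w)" for w
   unfolding set_lebesgue_integral_def by (intro Bochner_Integration.integral_cong) (auto simp: g_def indicator_def)
  have joint: "(\<lambda>p. (simple_value (L k) (fst p) (snd p) - H (max 0 (fst p)) (snd p))^2) \<in> borel_measurable (borel \<Otimes>\<^sub>M M)"
   using simple_value_joint_measurable(1)[OF Lp] continuous_adapted_joint_measurable(1)[OF Hc] by measurable
  show "(\<lambda>w. LBINT s:{0..t}. (simple_value (L k) s w - H s w)^2) \<in> borel_measurable M"
   using set_integral_joint_measurable[OF joint, of "{0..t}"] unfolding g g_def by (simp add: set_lebesgue_integral_def)
  show "AE w in M. Yt t k w \<le> 1 \<longrightarrow> ennreal \<bar>LBINT s:{0..t}. (simple_value (L k) s w - H s w)^2\<bar> \<le> Yt t k w"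
   using YL AE_space
  proof eventually_elim
   case w: (elim w)
   have g0: "0 \<le> g s w" for s by (simp add: g_def)
   then have "0 \<le> (LBINT s. g s w)" by (intro Bochner_Integration.integral_nonneg)
   moreover have "ennreal (LBINT s. g s w) \<le> (\<integral>\<^sup>+s. ennreal (g s w) \<partial>lborel)"
   proof (cases "integrable lborel (\<lambda>s. g s w)")
    case True
    then show ?thesis using nn_integral_eq_integral[OF True] g0 by simp
   qed (simp add: not_integrable_integral_eq)
   moreover have "\<dots> \<le> Yt t k w"
    unfolding w(1)[rule_format]
   proof (rule nn_integral_mono)
    fix s
    have "s \<in> {0..t} ==> \<bar>simple_value (L k) s w - H s w\<bar> \<le> \<bar>simple_value (K k) s w - H s w\<bar>"
     using sv[of k s w] Hb[of s w] w(2) clamp_real_dist by auto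
    then show "ennreal (g s w) \<le> ennreal ((simple_value (K k) s w - H s w)^2) * indicator {0..t} s"
     by (auto simp: g_def indicator_def abs_le_square_iff intro!: ennreal_leI)
   qed
   ultimately show ?case unfolding g by (auto intro: order_trans)
  qed
 qed
 have IE: "null_in_prob (\<lambda>k. simple_integral (E k) B t)" if t: "0 \<le> t" for t
  unfolding null_in_prob_def
 proof (intro conjI allI impI)
  show "simple_integral (E k) B t \<in> borel_measurable M" for k
   using continuous_adapted_measurable_M[OF simple_integral_continuous_adapted[OF B_adapted Ep[of k, unfolded E_def]] t] by (simp add: E_def)
  fix e :: real assume e: "0 < e"
  define \<zeta> where "\<zeta> k i w = (if \<tau> k i \<le> t then D k i w else 0)" for k i w
  define u where "u k i = max 0 (min t (\<tau> k i))" for k i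
  let ?q = "\<lambda>k w. \<Sum>i<n k. (\<zeta> k i w)^2 * (u k (Suc i) - u k i)"
  have q: "AE w in M. ennreal (?q k w) \<le> Yt t k w" for k
   using YL AE_space
  proof eventually_elim
   case (elim w)
   have "ennreal (?q k w) \<le> (\<integral>\<^sup>+s\<in>{0..t}. ennreal ((simple_value (E k) s w)^2) \<partial>lborel)"
    unfolding \<zeta>_def u_def E_def by (rule simple_sum_le_integral[OF \<tau> t])
   also have "\<dots> \<le> Yt t k w"
    unfolding elim(1)[rule_format]
   proof (rule nn_integral_mono)
    fix s
    have "s \<in> {0..t} ==> \<bar>simple_value (E k) s w\<bar> \<le> \<bar>simple_value (K k) s w - H s w\<bar>"
     using sv[of k s w] Hb[of s w] elim(2) clamp_real_dist by auto
    then show "ennreal ((simple_value (E k) s w)^2) * indicator {0..t} s \<le> ennreal ((simple_value (K k) s w - H s w)^2) * indicator {0..t} s"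
     by (auto simp: indicator_def abs_le_square_iff intro!: ennreal_leI)
   qed
   finally show ?case .
  qed
  have tail: "prob {w\<in>space M. e < \<bar>simple_integral (E k) B t w\<bar>} \<le> d / e^2 + prob {w\<in>space M. ennreal d < Yt t k w}"
   if d: "0 < d" for d k
  proof -
   have si: "simple_integral (E k) B t = transform B (\<zeta> k) (u k) (n k)"
    using simple_integral_incr[OF order_refl t \<tau>(2), of "n k" k "D k" B] simple_integral_0[OF \<tau>, of "n k" k "D k" B]
    by (auto simp: E_def \<zeta>_def[abs_def] u_def[abs_def])
   have "prob {w\<in>space M. e < \<bar>transform B (\<zeta> k) (u k) (n k) w\<bar>} \<le> d / e^2 + prob {w\<in>space M. d < ?q k w}"
   proof (rule transform_tail_bound)
    show "bounded (\<zeta> k i ` space M)" if "i < n k" for i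
     using Db[OF that] by (cases "\<tau> k i \<le> t") (auto simp: \<zeta>_def bounded_iff)
    show "\<zeta> k i \<in> borel_measurable (F (u k i))" if "i < n k" for i
     unfolding \<zeta>_def[abs_def] u_def using clipped_times(3)[OF order_refl t \<tau>(2), of i "n k" "D k" k] Dm that by simp
    show "mono (u k)" unfolding u_def[abs_def] using clipped_times(2)[OF order_refl t \<tau>(2), of i "n k" "D k" k] Dm by simp
   qed (use d e in \<open>auto simp: u_def\<close>)
   also have "prob {w\<in>space M. d < ?q k w} \<le> prob {w\<in>space M. ennreal d < Yt t k w}"
   proof (rule finite_measure_mono_AE)
    show "AE w in M. w \<in> {w\<in>space M. d < ?q k w} \<longrightarrow> w \<in> {w\<in>space M. ennreal d < Yt t k w}"
     using q[of k]
    proof eventually_elim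
     case (elim w)
     have "d < ?q k w ==> ennreal d < ennreal (?q k w)" using d by (simp add: ennreal_less_iff)
     then show ?case using elim by (auto intro: less_le_trans)
    qed
    show "{w\<in>space M. ennreal d < Yt t k w} \<in> events" using YM[OF t, of k] by measurable
   qed
   finally show ?thesis by (simp add: si)
  qed
  show "(\<lambda>k. prob {w\<in>space M. e < \<bar>simple_integral (E k) B t w\<bar>}) \<longlonglongrightarrow> 0"
  proof (rule order_tendstoI)
   fix a :: real assume a: "0 < a"
   \<comment> \<open>With this choice the Chebyshev term \<open>d / e^2\<close> of the tail bound is
     \<open>a / 2\<close>.\<close>
   define d where "d = a / 2 * e^2"
   have d: "0 < d" using a e by (simp add: d_def)
   have "(\<lambda>k. prob {w\<in>space M. ennreal d < Yt t k w}) \<longlonglongrightarrow> 0"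
    using Y0[OF t, unfolded tendsto_zero_in_prob_def, THEN conjunct2, rule_format, OF d] .
   then have "\<forall>\<^sub>F k in sequentially. prob {w\<in>space M. ennreal d < Yt t k w} < a / 2"
    using a by (intro order_tendstoD) auto
   then show "\<forall>\<^sub>F k in sequentially. prob {w\<in>space M. e < \<bar>simple_integral (E k) B t w\<bar>} < a"
   proof eventually_elim
    case (elim k)
    have "d / e^2 = a / 2" using e by (simp add: d_def)
    then show ?case using tail[OF d, of k] elim by linarith
   qed
  qed (auto intro: always_eventually less_le_trans[OF _ measure_nonneg])
 qed
 show ?thesis
 proof (rule that[of L, OF Lp _ _ LI])
  show "\<bar>snd (snd (L k)) i w\<bar> \<le> c" for k i w by (simp add: L_def clamp_real_bounds c0)
  fix t :: real assume t: "0 \<le> t"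
  have m: "simple_integral (K k) B t \<in> borel_measurable M" "simple_integral (L k) B t \<in> borel_measurable M" "I t \<in> borel_measurable M" for k
   using simple_integral_continuous_adapted[OF B_adapted K[of k, unfolded Keq]] simple_integral_continuous_adapted[OF B_adapted Lp[of k, unfolded L_def]]
    Ic t by (auto simp: Keq L_def intro: continuous_adapted_measurable_M)
  have IK: "null_in_prob (\<lambda>k w. simple_integral (K k) B t w - I t w)"
  proof (rule null_in_prob_ennreal[OF S[OF t]])
   show "AE w in M. (SUP s\<in>{0..t}. ennreal \<bar>simple_integral (K k) B s w - I s w\<bar>) \<le> 1 \<longrightarrow>
    ennreal \<bar>simple_integral (K k) B t w - I t w\<bar> \<le> (SUP s\<in>{0..t}. ennreal \<bar>simple_integral (K k) B s w - I s w\<bar>)" for k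
    using t by (intro AE_I2 impI SUP_upper) auto
  qed (use m in simp)
  show "null_in_prob (\<lambda>k w. simple_integral (L k) B t w - I t w)"
  proof (rule null_in_prob_le_add[OF IK IE[OF t]])
   fix k w
   have "simple_integral (L k) B t w = simple_integral (K k) B t w - simple_integral (E k) B t w"
    by (simp add: Keq L_def E_def simple_integral_def D_def sum_subtractf[symmetric] algebra_simps)
   then show "\<bar>simple_integral (L k) B t w - I t w\<bar> \<le> \<bar>simple_integral (K k) B t w - I t w\<bar> + \<bar>simple_integral (E k) B t w\<bar>" by simp
  qed (use m in simp)
 qed
qed

end

section \<open>Increments of bounded integrals: moments and products\<close>

lemma set_integral_sum:
 fixes f :: "'i => 'a => real"
 assumes "\<And>i. i \<in> I ==> set_integrable M A (f i)"
 shows "set_integrable M A (\<lambda>x. \<Sum>i\<in>I. f i x)"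
  "(LINT x:A|M. \<Sum>i\<in>I. f i x) = (\<Sum>i\<in>I. LINT x:A|M. f i x)"
 using assms unfolding set_integrable_def set_lebesgue_integral_def scaleR_sum_right
 by (auto intro: Bochner_Integration.integrable_sum Bochner_Integration.integral_sum)

context brownian_space
begin

lemma transform_moments_within:
 assumes s: "0 \<le> s" and u: "mono u" "s \<le> u 0" "u n \<le> t"
  and \<zeta>: "\<And>i. i < n ==> \<zeta> i \<in> borel_measurable (F (u i))" "\<And>i w. \<bar>\<zeta> i w\<bar> \<le> c"
 shows "transform B \<zeta> u n \<in> borel_measurable M"
  "integrable M (\<lambda>w. (transform B \<zeta> u n w)^2)" "\<E> (\<lambda>w. (transform B \<zeta> u n w)^2) \<le> c^2 * (t - s)"
  "integrable M (\<lambda>w. (transform B \<zeta> u n w)^4)" "\<E> (\<lambda>w. (transform B \<zeta> u n w)^4) \<le> 3 * c^4 * (t - s)^2"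
proof -
 have u0: "0 \<le> u i" for i using monoD[OF u(1), of 0 i] u(2) s by simp
 show "transform B \<zeta> u n \<in> borel_measurable M"
  using measurable_F[OF u0 transform_measurable[OF B_adapted u0 u(1) \<zeta>(1)]] .
 have d: "0 \<le> u n - u 0" "u n - u 0 \<le> t - s" using monoD[OF u(1), of 0 n] u by auto
 have "c^2 * (u n - u 0) \<le> c^2 * (t - s)" "3 * c^4 * (u n - u 0)^2 \<le> 3 * c^4 * (t - s)^2"
  using d by (auto intro!: mult_left_mono power_mono)
 then show "integrable M (\<lambda>w. (transform B \<zeta> u n w)^2)" "\<E> (\<lambda>w. (transform B \<zeta> u n w)^2) \<le> c^2 * (t - s)"
  "integrable M (\<lambda>w. (transform B \<zeta> u n w)^4)" "\<E> (\<lambda>w. (transform B \<zeta> u n w)^4) \<le> 3 * c^4 * (t - s)^2"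
  using transform_moments[of u n \<zeta> c, OF u0 u(1) \<zeta>] by auto
qed

text \<open>The definition controls the time integral of \<open>(simple_value - H)^2\<close> in
  probability. On a bounded interval this controls the first power, and because the difference is at
  most \<open>2 * c\<close>, expectations converge too. Almost sure convergence of the increments
  costs a subsequence.\<close>

lemma bounded_integral_incr_approx:
 assumes BI: "bounded_integral c H I" and st: "0 \<le> s" "s \<le> t"
 obtains n u \<zeta> where "\<And>k. mono (u k)" "\<And>k. s \<le> u k 0" "\<And>k. u k (n k) \<le> t"
  "\<And>k i. i < n k ==> \<zeta> k i \<in> borel_measurable (F (u k i))" "\<And>k i w. \<bar>\<zeta> k i w\<bar> \<le> c"
  "AE w in M. (\<lambda>k. transform B (\<zeta> k) (u k) (n k) w) \<longlonglongrightarrow> I t w - I s w"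
  "(\<lambda>k. \<E> (\<lambda>w. LBINT r:{s<..t}. \<bar>simple_value (n k, u k, \<zeta> k) r w - H r w\<bar>)) \<longlonglongrightarrow> 0"
proof -
 have Hc: "adapted H" and Hb: "\<And>s w. 0 \<le> s ==> w \<in> space M ==> \<bar>H s w\<bar> \<le> c" and c0: "0 \<le> c"
  and Ic: "adapted I"
  using BI by (auto simp: bounded_integral_def has_local_mart_integral_def)
 have t0: "0 \<le> t" using st by simp
 obtain K where K: "\<And>k. simple_process M F (K k)" and Kb: "\<And>k i w. \<bar>snd (snd (K k)) i w\<bar> \<le> c"
  and KI: "\<And>t. 0 \<le> t ==> null_in_prob (\<lambda>k w. simple_integral (K k) B t w - I t w)"
  and KH: "\<And>t. 0 \<le> t ==> null_in_prob (\<lambda>k w. LBINT s:{0..t}. (simple_value (K k) s w - H s w)^2)"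
  by (rule bounded_integral_approx[OF BI], rule that)
 define n where "n k = fst (K k)" for k
 define \<tau> where "\<tau> k = fst (snd (K k))" for k
 define \<xi> where "\<xi> k = snd (snd (K k))" for k
 have Keq: "K k = (n k, \<tau> k, \<xi> k)" for k by (simp add: n_def \<tau>_def \<xi>_def)
 have \<tau>: "0 \<le> \<tau> k 0" "mono (\<tau> k)" "\<And>i. i < n k ==> \<xi> k i \<in> borel_measurable (F (\<tau> k i))" and \<xi>b: "\<bar>\<xi> k i w\<bar> \<le> c" for k i w
  using K[of k] Kb[of k i w] by (auto simp: simple_process_def Keq)
 define u where "u k i = max s (min t (\<tau> k i))" for k i
 define \<zeta> where "\<zeta> k i w = (if \<tau> k i \<le> t then \<xi> k i w else 0)" for k i w
 have u: "mono (u k)" "s \<le> u k 0" "u k i \<le> t" for k i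
  using clipped_times(2)[OF st \<tau>(2), of i "n k" "\<xi> k" k] \<tau>(3)[of i k] st unfolding u_def[abs_def] by auto
 have \<zeta>: "\<zeta> k i \<in> borel_measurable (F (u k i))" if "i < n k" for k i
  unfolding \<zeta>_def[abs_def] u_def using clipped_times(3)[OF st \<tau>(2), of i "n k" "\<xi> k" k] \<tau>(3) that by simp
 have \<zeta>b: "\<bar>\<zeta> k i w\<bar> \<le> c" for k i w using \<xi>b c0 by (simp add: \<zeta>_def)
 have "null_in_prob (\<lambda>k w. transform B (\<zeta> k) (u k) (n k) w - (I t w - I s w))"
 proof (rule null_in_prob_le_add[OF KI[OF t0] KI[OF st(1)]])
  show "(\<lambda>w. transform B (\<zeta> k) (u k) (n k) w - (I t w - I s w)) \<in> borel_measurable M" for k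
   using continuous_adapted_measurable_M[OF Ic] st transform_moments_within(1)[OF st(1) u(1,2,3) \<zeta> \<zeta>b] by simp
  have "simple_integral (K k) B t w - simple_integral (K k) B s w = transform B (\<zeta> k) (u k) (n k) w" for k w
   unfolding Keq simple_integral_incr[OF st \<tau>(2)] by (simp add: \<zeta>_def[abs_def] u_def[abs_def])
  from this[symmetric] show "\<bar>transform B (\<zeta> k) (u k) (n k) w - (I t w - I s w)\<bar>
   \<le> \<bar>simple_integral (K k) B t w - I t w\<bar> + \<bar>simple_integral (K k) B s w - I s w\<bar>" for k w by simp
 qed
 then obtain \<rho> :: "nat => nat" where \<rho>: "strict_mono \<rho>"
  "AE w in M. (\<lambda>k. transform B (\<zeta> (\<rho> k)) (u (\<rho> k)) (n (\<rho> k)) w - (I t w - I s w)) \<longlonglongrightarrow> 0"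
  by (rule null_in_prob_AE_subseq)
 define v where "v k r w = simple_value (K k) r w - H (max 0 r) w" for k r w
 define L where "L k w = (LBINT r:{s<..t}. \<bar>v k r w\<bar>)" for k w
 define S where "S k w = (LBINT r:{0..t}. (v k r w)^2)" for k w
 have S: "null_in_prob S"
 proof -
  have "(LBINT s:{0..t}. (simple_value (K k) s w - H s w)^2) = S k w" for k w
   unfolding S_def v_def by (intro set_lebesgue_integral_cong) (auto simp: max_absorb2)
  then show ?thesis using KH[OF t0] by simp
 qed
 have joint: "(\<lambda>p. v k (fst p) (snd p)) \<in> borel_measurable (borel \<Otimes>\<^sub>M M)" for k
  unfolding v_def using simple_value_joint_measurable(1)[OF K] continuous_adapted_joint_measurable(1)[OF Hc] by measurable
 have sec: "(\<lambda>r. v k r w) \<in> borel_measurable borel" if "w \<in> space M" for k w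
  using measurable_compose[OF measurable_Pair2'[OF that] joint[of k]] by simp
 have vb: "\<bar>v k r w\<bar> \<le> 2 * c" if "w \<in> space M" for k r w
 proof -
  have "\<bar>simple_value (K k) r w\<bar> \<le> c" unfolding Keq
   by (rule simple_value_cases[OF \<tau>(2)[of k], where n="n k" and s=r and 'w='a]) (use \<xi>b c0 in simp_all)
  then show ?thesis using Hb[of "max 0 r" w] that by (auto simp: v_def)
 qed
 have LM: "L k \<in> borel_measurable M" for k
  unfolding L_def using joint[of k] by (intro set_integral_joint_measurable) auto
 have Lb: "\<bar>L k w\<bar> \<le> 2 * c * (t - s)" if w: "w \<in> space M" for k w
  unfolding L_def using vb[OF w] sec[OF w] st by (intro set_integral_bounded) auto
 \<comment> \<open>The weighted inequality under the time integral; \<open>e\<close> is later chosen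
   so that the first term is at most \<open>a / 2\<close>.\<close>
 have path: "L k w \<le> e * (t - s) + S k w / (4 * e)" if w: "w \<in> space M" and e: "0 < e" for k w e
 proof -
  have i: "integrable lborel (\<lambda>r. indicat_real {s<..t} r * \<bar>v k r w\<bar>)"
   using set_integrable_bounded[of "\<lambda>r. \<bar>v k r w\<bar>" s t "2 * c"] vb[OF w] sec[OF w] by (simp add: set_integrable_def)
  have "(v k r w)^2 \<le> (2 * c)^2" for r using power_mono[OF vb[OF w], of k r 2] by simp
  then have "set_integrable lborel {-1<..t} (\<lambda>r. (v k r w)^2)"
   using sec[OF w] by (intro set_integrable_bounded) auto
  then have "set_integrable lborel {0..t} (\<lambda>r. (v k r w)^2)" by (rule set_integrable_subset) auto
  then have j: "integrable lborel (\<lambda>r. indicat_real {0..t} r * (v k r w)^2)" by (simp add: set_integrable_def)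
  have "L k w \<le> (LBINT r. e * indicat_real {s<..t} r + (indicat_real {0..t} r * (v k r w)^2) / (4 * e))"
   unfolding L_def set_lebesgue_integral_def real_scaleR_def
  proof (rule integral_mono[OF i])
   fix r
   show "indicat_real {s<..t} r * \<bar>v k r w\<bar> \<le> e * indicat_real {s<..t} r + (indicat_real {0..t} r * (v k r w)^2) / (4 * e)"
    using abs_mult_le_weighted[OF e, of 1 "v k r w"] st e by (auto simp: indicator_def)
  qed (intro Bochner_Integration.integrable_add integrable_mult_right integrable_indicator_Ioc integrable_divide j)
  also have "\<dots> = e * (t - s) + S k w / (4 * e)"
   using st j unfolding S_def set_lebesgue_integral_def real_scaleR_def
   by (subst Bochner_Integration.integral_add) (auto intro!: integrable_mult_right integrable_indicator_Ioc integrable_divide)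
  finally show ?thesis .
 qed
 have L: "null_in_prob L"
  unfolding null_in_prob_def
 proof (intro conjI allI impI LM)
  fix a :: real assume a: "0 < a"
  \<comment> \<open>The summand 1 keeps the denominator positive when \<open>s = t\<close>.\<close>
  define e where "e = a / (2 * (t - s + 1))"
  have e: "0 < e" "e * (t - s) \<le> a / 2" using a st by (auto simp: e_def divide_simps mult_left_mono)
  have [measurable]: "S k \<in> borel_measurable M" for k using S by (simp add: null_in_prob_def)
  show "(\<lambda>k. prob {w\<in>space M. a < \<bar>L k w\<bar>}) \<longlonglongrightarrow> 0"
  proof (rule tendsto_sandwich[OF _ _ tendsto_const])
   show "(\<lambda>k. prob {w\<in>space M. 2 * e * a < \<bar>S k w\<bar>}) \<longlonglongrightarrow> 0"
    using S[unfolded null_in_prob_def, THEN conjunct2, rule_format, of "2 * e * a"] a e by simp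
   have "prob {w\<in>space M. a < \<bar>L k w\<bar>} \<le> prob {w\<in>space M. 2 * e * a < \<bar>S k w\<bar>}" for k
   proof (rule finite_measure_mono, safe)
    fix w assume w: "w \<in> space M" "a < \<bar>L k w\<bar>"
    have "0 \<le> L k w" unfolding L_def set_lebesgue_integral_def by (intro Bochner_Integration.integral_nonneg) auto
    then have "a / 2 < S k w / (4 * e)" using path[OF w(1) e(1), of k] e(2) w(2) by linarith
    then have "2 * e * a < S k w" using e(1) by (simp add: pos_less_divide_eq mult_ac)
    then show "2 * e * a < \<bar>S k w\<bar>" by simp
   qed measurable
   then show "\<forall>\<^sub>F k in sequentially. prob {w\<in>space M. a < \<bar>L k w\<bar>} \<le> prob {w\<in>space M. 2 * e * a < \<bar>S k w\<bar>}" by simp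
  qed simp
 qed
 have "(\<lambda>k. \<E> (\<lambda>w. \<bar>L k w\<bar>)) \<longlonglongrightarrow> 0"
 proof (rule expectation_tendsto_zero[OF L])
  have b: "\<bar>(L k w)^2\<bar> \<le> (2 * c * (t - s))^2" if "w \<in> space M" for k w
   using power_mono[OF Lb[OF that], of k 2] by simp
  show i2: "integrable M (\<lambda>w. (L k w)^2)" for k
   using LM by (intro bounded_integrable[OF _ b]) auto
  show "\<E> (\<lambda>w. (L k w)^2) \<le> (2 * c * (t - s))^2" for k
   using integral_mono[OF i2, of "\<lambda>_. (2 * c * (t - s))^2" k] b by (simp add: prob_space)
 qed
 moreover have "\<bar>L k w\<bar> = (LBINT r:{s<..t}. \<bar>simple_value (n k, u k, \<zeta> k) r w - H r w\<bar>)" for k w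
 proof -
  have "simple_value (n k, u k, \<zeta> k) r w = simple_value (K k) r w" if "r \<in> {s<..t}" for r
   unfolding simple_value_def prod.case Keq using that by (intro sum.cong refl) (auto simp: u_def \<zeta>_def indicator_def)
  then have "(LBINT r:{s<..t}. \<bar>simple_value (n k, u k, \<zeta> k) r w - H r w\<bar>) = L k w"
   unfolding L_def v_def using st by (intro set_lebesgue_integral_cong) (auto simp: max_absorb2)
  moreover have "0 \<le> L k w" unfolding L_def set_lebesgue_integral_def by (intro Bochner_Integration.integral_nonneg) auto
  ultimately show ?thesis by simp
 qed
 ultimately have L0: "(\<lambda>k. \<E> (\<lambda>w. LBINT r:{s<..t}. \<bar>simple_value (n k, u k, \<zeta> k) r w - H r w\<bar>)) \<longlonglongrightarrow> 0" by simp
 have "AE w in M. (\<lambda>k. transform B (\<zeta> (\<rho> k)) (u (\<rho> k)) (n (\<rho> k)) w) \<longlonglongrightarrow> I t w - I s w"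
  using \<rho>(2) by (simp add: LIM_zero_iff)
 then show ?thesis
  using LIMSEQ_subseq_LIMSEQ[OF L0 \<rho>(1)] u \<zeta> \<zeta>b
  by (intro that[of "\<lambda>k. u (\<rho> k)" "\<lambda>k. n (\<rho> k)" "\<lambda>k. \<zeta> (\<rho> k)"]) (auto simp: o_def)
qed

lemma bounded_integral_adapted: "bounded_integral c H I ==> adapted I"
 by (simp add: bounded_integral_def has_local_mart_integral_def)

lemma bounded_integral_incr_measurable:
 assumes "bounded_integral c H I" "0 \<le> s" "s \<le> t"
 shows "(\<lambda>w. I t w - I s w) \<in> borel_measurable M"
 using continuous_adapted_measurable_M[OF bounded_integral_adapted[OF assms(1)]] assms by simp

text \<open>Fatou passes the bound for transforms to the limit. Fourth moments are what controls the
  square of a second order term in Taylor's formula.\<close>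

lemma bounded_integral_moment4:
 assumes BI: "bounded_integral c H I" and st: "0 \<le> s" "s \<le> t"
 shows "integrable M (\<lambda>w. (I t w - I s w)^4)" "\<E> (\<lambda>w. (I t w - I s w)^4) \<le> 3 * c^4 * (t - s)^2"
proof -
 obtain n u \<zeta> where u: "\<And>k. mono (u k)" "\<And>k. s \<le> u k 0" "\<And>k. u k (n k) \<le> t"
  and \<zeta>: "\<And>k i. i < n k ==> \<zeta> k i \<in> borel_measurable (F (u k i))" "\<And>k i w. \<bar>\<zeta> k i w\<bar> \<le> c"
  and lim: "AE w in M. (\<lambda>k. transform B (\<zeta> k) (u k) (n k) w) \<longlonglongrightarrow> I t w - I s w"
  by (rule bounded_integral_incr_approx[OF BI st], rule that)
 note T = transform_moments_within[OF st(1) u \<zeta>]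
 have lim4: "AE w in M. (\<lambda>k. (transform B (\<zeta> k) (u k) (n k) w)^4) \<longlonglongrightarrow> (I t w - I s w)^4"
  using lim by eventually_elim (intro tendsto_power)
 have [measurable]: "(\<lambda>w. I t w - I s w) \<in> borel_measurable M" by (rule bounded_integral_incr_measurable[OF BI st])
 show "integrable M (\<lambda>w. (I t w - I s w)^4)" "\<E> (\<lambda>w. (I t w - I s w)^4) \<le> 3 * c^4 * (t - s)^2"
  by (rule fatou_real[OF _ _ _ T(4,5) lim4]; (intro borel_measurable_power T)?; simp)+
qed

text \<open>Polarized Ito isometry for simple processes. Both sides are expanded over pairs of
  partition intervals; the same overlap lengths \<open>ov\<close> come from
  \<open>B_incr_overlap\<close> on the left and from products of indicators on the right.\<close>

lemma transform_product:
 assumes s: "0 \<le> s" and \<eta>: "\<eta> \<in> borel_measurable (F s)" "\<And>w. w \<in> space M ==> \<bar>\<eta> w\<bar> \<le> d"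
  and u: "mono u" "s \<le> u 0" "u n \<le> t" and \<zeta>: "\<And>i. i < n ==> \<zeta> i \<in> borel_measurable (F (u i))" "\<And>i w. \<bar>\<zeta> i w\<bar> \<le> c"
  and u': "mono u'" "s \<le> u' 0" "u' n' \<le> t" and \<zeta>': "\<And>i. i < n' ==> \<zeta>' i \<in> borel_measurable (F (u' i))" "\<And>i w. \<bar>\<zeta>' i w\<bar> \<le> c'"
 shows "has_bochner_integral M (\<lambda>w. \<eta> w * (transform B \<zeta> u n w * transform B \<zeta>' u' n' w))
  (\<E> (\<lambda>w. \<eta> w * (LBINT r:{s<..t}. simple_value (n, u, \<zeta>) r w * simple_value (n', u', \<zeta>') r w)))"
proof -
 define ov where "ov i j = max 0 (min (u (Suc i)) (u' (Suc j)) - max (u i) (u' j))" for i j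
 have u0: "0 \<le> u i" "s \<le> u i" for i using monoD[OF u(1), of 0 i] u(2) s by auto
 have u0': "0 \<le> u' i" "s \<le> u' i" for i using monoD[OF u'(1), of 0 i] u'(2) s by auto
 have uS: "u i \<le> u (Suc i)" "u' i \<le> u' (Suc i)" for i using u(1) u'(1) by (auto simp: monoD)
 have \<eta>M: "\<eta> \<in> borel_measurable M" using measurable_F[OF s \<eta>(1)] .
 have \<eta>\<zeta>: "(\<lambda>w. \<eta> w * \<zeta> i w) \<in> borel_measurable (F (u i))" "\<And>w. w \<in> space M ==> \<bar>\<eta> w * \<zeta> i w\<bar> \<le> d * c" if "i < n" for i
  using measurable_F_mono[OF \<eta>(1) u0(2)] \<zeta>(1)[OF that] mult_mono[OF \<eta>(2) \<zeta>(2)[of i]] order_trans[OF abs_ge_zero \<eta>(2)]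
  by (auto simp: abs_mult)
 have one: "has_bochner_integral M (\<lambda>w. \<eta> w * \<zeta> i w * \<zeta>' j w * (B (u (Suc i)) w - B (u i) w) * (B (u' (Suc j)) w - B (u' j) w))
   (\<E> (\<lambda>w. \<eta> w * \<zeta> i w * \<zeta>' j w) * ov i j)" if "i < n" "j < n'" for i j
  unfolding ov_def
  by (rule B_incr_overlap[OF u0(1) uS(1) u0'(1) uS(2) \<eta>\<zeta>[OF that(1)] \<zeta>'(1)[OF that(2)] \<zeta>'(2)])
 have L: "has_bochner_integral M (\<lambda>w. \<Sum>i<n. \<Sum>j<n'. \<eta> w * \<zeta> i w * \<zeta>' j w * (B (u (Suc i)) w - B (u i) w) * (B (u' (Suc j)) w - B (u' j) w))
   (\<Sum>i<n. \<Sum>j<n'. \<E> (\<lambda>w. \<eta> w * \<zeta> i w * \<zeta>' j w) * ov i j)"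
  by (intro has_bochner_integral_sum one) auto
 have P: "(\<Sum>i<n. \<Sum>j<n'. \<eta> w * \<zeta> i w * \<zeta>' j w * (B (u (Suc i)) w - B (u i) w) * (B (u' (Suc j)) w - B (u' j) w))
   = \<eta> w * (transform B \<zeta> u n w * transform B \<zeta>' u' n' w)" for w
  unfolding transform_def sum_product by (simp add: sum_distrib_left mult_ac)
 have I1: "(LBINT r:{s<..t}. indicat_real {u i<..u (Suc i)} r * indicat_real {u' j<..u' (Suc j)} r) = ov i j"
  "set_integrable lborel {s<..t} (\<lambda>r. indicat_real {u i<..u (Suc i)} r * indicat_real {u' j<..u' (Suc j)} r)"
  if "i < n" "j < n'" for i j
 proof -
  have "u (Suc i) \<le> t" using monoD[OF u(1), of "Suc i" n] u(3) that by simp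
  then have e: "indicat_real {s<..t} r *\<^sub>R (indicat_real {u i<..u (Suc i)} r * indicat_real {u' j<..u' (Suc j)} r)
   = indicat_real {max (u i) (u' j)<..min (u (Suc i)) (u' (Suc j))} r" for r
   using u0(2)[of i] by (auto simp: indicator_def)
  show "(LBINT r:{s<..t}. indicat_real {u i<..u (Suc i)} r * indicat_real {u' j<..u' (Suc j)} r) = ov i j"
   unfolding set_lebesgue_integral_def e by (cases "max (u i) (u' j) \<le> min (u (Suc i)) (u' (Suc j))") (auto simp: ov_def)
  show "set_integrable lborel {s<..t} (\<lambda>r. indicat_real {u i<..u (Suc i)} r * indicat_real {u' j<..u' (Suc j)} r)"
   unfolding set_integrable_def e by (rule integrable_indicator_Ioc)
 qed
 have Q: "\<eta> w * (LBINT r:{s<..t}. simple_value (n, u, \<zeta>) r w * simple_value (n', u', \<zeta>') r w)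
  = (\<Sum>i<n. \<Sum>j<n'. \<eta> w * \<zeta> i w * \<zeta>' j w * ov i j)" for w
 proof -
  have "(LBINT r:{s<..t}. simple_value (n, u, \<zeta>) r w * simple_value (n', u', \<zeta>') r w)
   = (LBINT r:{s<..t}. \<Sum>i<n. \<Sum>j<n'. \<zeta> i w * \<zeta>' j w * (indicat_real {u i<..u (Suc i)} r * indicat_real {u' j<..u' (Suc j)} r))"
   unfolding simple_value_def prod.case sum_product by (simp add: mult_ac)
  also have "\<dots> = (\<Sum>i<n. LBINT r:{s<..t}. \<Sum>j<n'. \<zeta> i w * \<zeta>' j w * (indicat_real {u i<..u (Suc i)} r * indicat_real {u' j<..u' (Suc j)} r))"
   using I1(2) by (intro set_integral_sum(2)) (auto intro!: set_integral_sum(1) set_integrable_mult_right)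
  also have "\<dots> = (\<Sum>i<n. \<Sum>j<n'. LBINT r:{s<..t}. \<zeta> i w * \<zeta>' j w * (indicat_real {u i<..u (Suc i)} r * indicat_real {u' j<..u' (Suc j)} r))"
   using I1(2) by (intro sum.cong refl set_integral_sum(2)) (auto intro!: set_integrable_mult_right)
  also have "\<dots> = (\<Sum>i<n. \<Sum>j<n'. \<zeta> i w * \<zeta>' j w * ov i j)"
   using I1(1) by (intro sum.cong refl) (simp add: set_integral_mult_right)
  finally show ?thesis by (simp add: sum_distrib_left mult_ac)
 qed
 have "\<E> (\<lambda>w. \<Sum>i<n. \<Sum>j<n'. \<eta> w * \<zeta> i w * \<zeta>' j w * ov i j) = (\<Sum>i<n. \<Sum>j<n'. \<E> (\<lambda>w. \<eta> w * \<zeta> i w * \<zeta>' j w) * ov i j)"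
 proof -
  have i: "integrable M (\<lambda>w. \<eta> w * \<zeta> i w * \<zeta>' j w)" if "i < n" "j < n'" for i j
  proof (rule bounded_integrable)
   show "(\<lambda>w. \<eta> w * \<zeta> i w * \<zeta>' j w) \<in> borel_measurable M"
    using \<eta>M measurable_F[OF u0(1) \<zeta>(1)[OF that(1)]] measurable_F[OF u0'(1) \<zeta>'(1)[OF that(2)]] by simp
   show "\<bar>\<eta> w * \<zeta> i w * \<zeta>' j w\<bar> \<le> d * c * c'" if w: "w \<in> space M" for w
    unfolding abs_mult[of "\<eta> w * \<zeta> i w"] using \<eta>\<zeta>(2)[OF \<open>i < n\<close> w] \<zeta>'(2)[of j w] order_trans[OF abs_ge_zero \<eta>\<zeta>(2)[OF \<open>i < n\<close> w]]
    by (intro mult_mono) auto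
  qed
  have "\<E> (\<lambda>w. \<Sum>i<n. \<Sum>j<n'. \<eta> w * \<zeta> i w * \<zeta>' j w * ov i j) = (\<Sum>i<n. \<E> (\<lambda>w. \<Sum>j<n'. \<eta> w * \<zeta> i w * \<zeta>' j w * ov i j))"
   using i by (intro Bochner_Integration.integral_sum Bochner_Integration.integrable_sum integrable_mult_left) auto
  also have "\<dots> = (\<Sum>i<n. \<Sum>j<n'. \<E> (\<lambda>w. \<eta> w * \<zeta> i w * \<zeta>' j w * ov i j))"
   using i by (intro sum.cong refl Bochner_Integration.integral_sum integrable_mult_left) auto
  finally show ?thesis by simp
 qed
 then show ?thesis using L unfolding P Q by simp
qed

lemma bounded_integral_incr:
 assumes BI: "bounded_integral c H I" and st: "0 \<le> s" "s \<le> t"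
  and \<eta>: "\<eta> \<in> borel_measurable (F s)" "\<And>w. w \<in> space M ==> \<bar>\<eta> w\<bar> \<le> d"
 shows "has_bochner_integral M (\<lambda>w. \<eta> w * (I t w - I s w)) 0"
proof -
 obtain n u \<zeta> where u: "\<And>k. mono (u k)" "\<And>k. s \<le> u k 0" "\<And>k. u k (n k) \<le> t"
  and \<zeta>: "\<And>k i. i < n k ==> \<zeta> k i \<in> borel_measurable (F (u k i))" "\<And>k i w. \<bar>\<zeta> k i w\<bar> \<le> c"
  and lim: "AE w in M. (\<lambda>k. transform B (\<zeta> k) (u k) (n k) w) \<longlonglongrightarrow> I t w - I s w"
  by (rule bounded_integral_incr_approx[OF BI st], rule that)
 define T where "T k = transform B (\<zeta> k) (u k) (n k)" for k
 note T = transform_moments_within[OF st(1) u \<zeta>, folded T_def]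
 have [measurable]: "(\<lambda>w. I t w - I s w) \<in> borel_measurable M" "\<eta> \<in> borel_measurable M" "T k \<in> borel_measurable M" for k
  using bounded_integral_incr_measurable[OF BI st] measurable_F[OF st(1) \<eta>(1)] T(1) by auto
 have \<eta>2: "\<bar>(\<eta> w)^2\<bar> \<le> d^2" if "w \<in> space M" for w
  using power_mono[OF \<eta>(2)[OF that], of 2] by simp
 have Y: "integrable M (\<lambda>w. (\<eta> w * T k w)^2)" "\<E> (\<lambda>w. (\<eta> w * T k w)^2) \<le> d^2 * (c^2 * (t - s))" for k
 proof -
  show i: "integrable M (\<lambda>w. (\<eta> w * T k w)^2)"
   unfolding power_mult_distrib by (rule integrable_bounded_mult[OF T(2) _ \<eta>2]) auto
  have "\<E> (\<lambda>w. (\<eta> w * T k w)^2) \<le> \<E> (\<lambda>w. d^2 * (T k w)^2)"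
   using i T(2) \<eta>2 by (intro integral_mono) (auto simp: power_mult_distrib intro!: mult_right_mono)
  also have "\<dots> \<le> d^2 * (c^2 * (t - s))" unfolding integral_mult_right_zero using T(3) by (intro mult_left_mono) auto
  finally show "\<E> (\<lambda>w. (\<eta> w * T k w)^2) \<le> d^2 * (c^2 * (t - s))" .
 qed
 have "AE w in M. (\<lambda>k. \<eta> w * T k w - \<eta> w * (I t w - I s w)) \<longlonglongrightarrow> 0"
  using lim unfolding T_def by eventually_elim (intro LIM_zero tendsto_mult tendsto_const)
 then have "null_in_prob (\<lambda>k w. \<eta> w * T k w - \<eta> w * (I t w - I s w))" by (intro null_in_prob_AE) auto
 note L = L2_bounded_limit[OF this _ _ Y]
 have "\<E> (\<lambda>w. \<eta> w * T k w) = 0" for k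
 proof -
  have u0: "0 \<le> u k 0" using u(2)[of k] st by simp
  \<comment> \<open>Only increments of \<open>B\<close> enter, so the square integrable martingale
    \<open>B - B 0\<close> may take its place.\<close>
  have e: "T k = transform (\<lambda>t w. B t w - B 0 w) (\<zeta> k) (u k) (n k)"
   by (simp add: T_def transform_def[abs_def])
  have "integrable M (\<lambda>w. (\<eta> w)^2)" using \<eta>2 by (intro bounded_integrable) auto
  then have "has_bochner_integral M (\<lambda>w. \<eta> w * T k w) 0"
   unfolding e using \<zeta> measurable_F_mono[OF \<eta>(1) u(2)] by (intro transform_L2(2)[OF B_L2_martingale u0 u(1)]) auto
  then show ?thesis by (rule has_bochner_integral_integral_eq)
 qed
 moreover have "(\<lambda>k. \<E> (\<lambda>w. \<eta> w * T k w)) \<longlonglongrightarrow> \<E> (\<lambda>w. \<eta> w * (I t w - I s w))" by (rule L) simp_all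
 ultimately have "\<E> (\<lambda>w. \<eta> w * (I t w - I s w)) = 0" by (simp add: LIMSEQ_const_iff)
 moreover have "integrable M (\<lambda>w. \<eta> w * (I t w - I s w))"
  by (rule square_integrable_imp_integrable[OF _ L(1)]) simp_all
 ultimately show ?thesis by (simp add: has_bochner_integral_iff)
qed

lemma bounded_integral_0:
 assumes BI: "bounded_integral c H I" shows "AE w in M. I 0 w = 0"
proof -
 obtain K where K: "\<And>k. simple_process M F (K k)"
  and KI: "\<And>t. 0 \<le> t ==> null_in_prob (\<lambda>k w. simple_integral (K k) B t w - I t w)"
  by (rule bounded_integral_approx[OF BI], rule that)
 have "simple_integral (K k) B 0 w = 0" for k w
  using K[of k] simple_integral_0[of "fst (snd (K k))" "fst (K k)" "snd (snd (K k))" B w] by (auto simp: simple_process_def split: prod.splits)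
 then have "null_in_prob (\<lambda>k w. - I 0 w)" using KI[of 0] by simp
 then obtain r :: "nat => nat" where "AE w in M. (\<lambda>n. - I 0 w) \<longlonglongrightarrow> 0" by (rule null_in_prob_AE_subseq)
 then show ?thesis by (simp add: LIMSEQ_const_iff)
qed

text \<open>The value \<open>I 0\<close> is 0 almost surely by the approximation, and then the
  fourth moment of the increment from 0 gives square integrability.\<close>

lemma bounded_integral_L2_martingale:
 assumes BI: "bounded_integral c H I" shows "L2_martingale I"
proof (rule L2_martingaleI)
 show ad: "adapted I" by (rule bounded_integral_adapted[OF BI])
 show "integrable M (\<lambda>w. (I t w)^2)" if t: "0 \<le> t" for t
 proof -
  have [measurable]: "I t \<in> borel_measurable M" "I 0 \<in> borel_measurable M"
   using continuous_adapted_measurable_M[OF ad] t by auto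
  have "integrable M (\<lambda>w. ((I t w - I 0 w)^2)^2)"
   using bounded_integral_moment4(1)[OF BI order_refl t] by (simp flip: power_mult)
  then have "integrable M (\<lambda>w. (I t w - I 0 w)^2)"
   by (rule square_integrable_imp_integrable[rotated]) auto
  moreover have "AE w in M. (I t w - I 0 w)^2 = (I t w)^2"
   using bounded_integral_0[OF BI] by eventually_elim simp
  ultimately show ?thesis by (subst (asm) integrable_cong_AE) auto
 qed
 fix s t A assume st: "0 \<le> s" "s \<le> t" and A: "A \<in> sets (F s)"
 show "\<E> (\<lambda>w. indicat_real A w * (I t w - I s w)) = 0"
  using A by (intro has_bochner_integral_integral_eq bounded_integral_incr[OF BI st _ indicator_abs_le_1]) auto
qed

text \<open>Both sides pass to the limit from the simple case. Products of increments of the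
  approximants are bounded in mean square by fourth moments. The time integrals converge in mean
  since all integrands are bounded, through
  \<open>v * v' - h * h' = v' * (v - h) + h * (v' - h')\<close>.\<close>

lemma bounded_integral_product:
 assumes BI: "bounded_integral c H I" and BI': "bounded_integral c' H' I'" and st: "0 \<le> s" "s \<le> t"
  and \<eta>: "\<eta> \<in> borel_measurable (F s)" "\<And>w. w \<in> space M ==> \<bar>\<eta> w\<bar> \<le> d"
 shows "has_bochner_integral M (\<lambda>w. \<eta> w * ((I t w - I s w) * (I' t w - I' s w)))
  (\<E> (\<lambda>w. \<eta> w * (LBINT r:{s<..t}. H r w * H' r w)))"
proof -
 have Hc: "adapted H" "adapted H'"
  and Hb: "\<And>s w. 0 \<le> s ==> w \<in> space M ==> \<bar>H s w\<bar> \<le> c" "\<And>s w. 0 \<le> s ==> w \<in> space M ==> \<bar>H' s w\<bar> \<le> c'"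
  and c0: "0 \<le> c" "0 \<le> c'"
  using BI BI' by (auto simp: bounded_integral_def)
 have d0: "0 \<le> d" using not_empty order_trans[OF abs_ge_zero \<eta>(2)] by auto
 obtain n u \<zeta> where u: "\<And>k. mono (u k)" "\<And>k. s \<le> u k 0" "\<And>k. u k (n k) \<le> t"
  and \<zeta>: "\<And>k i. i < n k ==> \<zeta> k i \<in> borel_measurable (F (u k i))" "\<And>k i w. \<bar>\<zeta> k i w\<bar> \<le> c"
  and lim: "AE w in M. (\<lambda>k. transform B (\<zeta> k) (u k) (n k) w) \<longlonglongrightarrow> I t w - I s w"
  and L: "(\<lambda>k. \<E> (\<lambda>w. LBINT r:{s<..t}. \<bar>simple_value (n k, u k, \<zeta> k) r w - H r w\<bar>)) \<longlonglongrightarrow> 0"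
  by (rule bounded_integral_incr_approx[OF BI st], rule that)
 obtain n' u' \<zeta>' where u': "\<And>k. mono (u' k)" "\<And>k. s \<le> u' k 0" "\<And>k. u' k (n' k) \<le> t"
  and \<zeta>': "\<And>k i. i < n' k ==> \<zeta>' k i \<in> borel_measurable (F (u' k i))" "\<And>k i w. \<bar>\<zeta>' k i w\<bar> \<le> c'"
  and lim': "AE w in M. (\<lambda>k. transform B (\<zeta>' k) (u' k) (n' k) w) \<longlonglongrightarrow> I' t w - I' s w"
  and L': "(\<lambda>k. \<E> (\<lambda>w. LBINT r:{s<..t}. \<bar>simple_value (n' k, u' k, \<zeta>' k) r w - H' r w\<bar>)) \<longlonglongrightarrow> 0"
  by (rule bounded_integral_incr_approx[OF BI' st], rule that)
 define T where "T k = transform B (\<zeta> k) (u k) (n k)" for k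
 define T' where "T' k = transform B (\<zeta>' k) (u' k) (n' k)" for k
 note T = transform_moments_within[OF st(1) u \<zeta>, folded T_def]
 note T' = transform_moments_within[OF st(1) u' \<zeta>', folded T'_def]
 define D where "D w = I t w - I s w" for w
 define D' where "D' w = I' t w - I' s w" for w
 have \<eta>M[measurable]: "\<eta> \<in> borel_measurable M" using measurable_F[OF st(1) \<eta>(1)] .
 have [measurable]: "D \<in> borel_measurable M" "D' \<in> borel_measurable M" "T k \<in> borel_measurable M" "T' k \<in> borel_measurable M" for k
  unfolding D_def D'_def using bounded_integral_incr_measurable[OF BI st] bounded_integral_incr_measurable[OF BI' st] T(1) T'(1) by auto
 define Y where "Y k w = \<eta> w * (T k w * T' k w)" for k w
 define Z where "Z w = \<eta> w * (D w * D' w)" for w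
 have [measurable]: "Y k \<in> borel_measurable M" "Z \<in> borel_measurable M" for k unfolding Y_def Z_def by measurable
 have Ysq: "(Y k w)^2 \<le> d^2 * ((T k w)^4 + (T' k w)^4)" if "w \<in> space M" for k w
 proof -
  have "(\<eta> w)^2 \<le> d^2" using power_mono[OF \<eta>(2)[OF that], of 2] by simp
  moreover have "(x * y)^2 \<le> x^4 + y^4" for x y :: real
  proof -
   have "\<bar>x^2 * y^2\<bar> \<le> 1 * (x^2)^2 + (y^2)^2 / (4 * 1)" by (rule abs_mult_le_weighted) simp
   also have "\<dots> \<le> x^4 + y^4" by (simp flip: power_mult)
   finally show ?thesis by (simp add: power_mult_distrib)
  qed
  ultimately show ?thesis unfolding Y_def power_mult_distrib[of "\<eta> w"] by (intro mult_mono) auto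
 qed
 have Y2: "integrable M (\<lambda>w. (Y k w)^2)" "\<E> (\<lambda>w. (Y k w)^2) \<le> d^2 * (3 * c^4 * (t - s)^2 + 3 * c'^4 * (t - s)^2)" for k
 proof -
  have i: "integrable M (\<lambda>w. d^2 * ((T k w)^4 + (T' k w)^4))" using T(4)[of k] T'(4)[of k] by auto
  show i2: "integrable M (\<lambda>w. (Y k w)^2)"
  proof (rule Bochner_Integration.integrable_bound[OF i])
   show "AE w in M. norm ((Y k w)^2) \<le> norm (d^2 * ((T k w)^4 + (T' k w)^4))"
    using Ysq by (intro AE_I2) (simp add: order_trans[OF _ abs_ge_self])
  qed measurable
  have "\<E> (\<lambda>w. (Y k w)^2) \<le> \<E> (\<lambda>w. d^2 * ((T k w)^4 + (T' k w)^4))"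
   by (rule integral_mono[OF i2 i Ysq])
  also have "\<dots> = d^2 * (\<E> (\<lambda>w. (T k w)^4) + \<E> (\<lambda>w. (T' k w)^4))" using T(4)[of k] T'(4)[of k] by simp
  also have "\<dots> \<le> d^2 * (3 * c^4 * (t - s)^2 + 3 * c'^4 * (t - s)^2)" using T(5)[of k] T'(5)[of k] by (intro mult_left_mono add_mono) auto
  finally show "\<E> (\<lambda>w. (Y k w)^2) \<le> d^2 * (3 * c^4 * (t - s)^2 + 3 * c'^4 * (t - s)^2)" .
 qed
 have "AE w in M. (\<lambda>k. Y k w - Z w) \<longlonglongrightarrow> 0"
  using lim lim' by eventually_elim (auto simp: Y_def Z_def T_def T'_def D_def D'_def intro!: LIM_zero tendsto_mult)
 then have "null_in_prob (\<lambda>k w. Y k w - Z w)" by (intro null_in_prob_AE) auto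
 note YZ = L2_bounded_limit[OF this _ _ Y2]
 have "(\<lambda>k. \<E> (Y k)) \<longlonglongrightarrow> \<E> (\<lambda>w. \<eta> w * (LBINT r:{s<..t}. H r w * H' r w))"
 proof -
  define v where "v k r w = simple_value (n k, u k, \<zeta> k) r w" for k r w
  define v' where "v' k r w = simple_value (n' k, u' k, \<zeta>' k) r w" for k r w
  define h where "h r w = H (max 0 r) w" for r w
  define h' where "h' r w = H' (max 0 r) w" for r w
  have sp: "simple_process M F (n k, u k, \<zeta> k)" "simple_process M F (n' k, u' k, \<zeta>' k)" for k
   using u u' \<zeta> \<zeta>' order_trans[OF st(1)]
   by (auto simp: simple_process_def intro: boundedI[of _ c] boundedI[of _ c'])
  have vb: "\<bar>v k r w\<bar> \<le> c" "\<bar>v' k r w\<bar> \<le> c'" for k r w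
   unfolding v_def v'_def
   by (rule simple_value_cases[OF u(1)[of k], where n="n k" and s=r and 'w='a]; use \<zeta> c0 in simp)
    (rule simple_value_cases[OF u'(1)[of k], where n="n' k" and s=r and 'w='a]; use \<zeta>' c0 in simp)
  have hb: "\<bar>h r w\<bar> \<le> c" "\<bar>h' r w\<bar> \<le> c'" if "w \<in> space M" for r w
   using Hb[of "max 0 r" w] that by (auto simp: h_def h'_def)
  have joint[measurable]: "(\<lambda>p. v k (fst p) (snd p)) \<in> borel_measurable (borel \<Otimes>\<^sub>M M)" "(\<lambda>p. v' k (fst p) (snd p)) \<in> borel_measurable (borel \<Otimes>\<^sub>M M)"
   "(\<lambda>p. h (fst p) (snd p)) \<in> borel_measurable (borel \<Otimes>\<^sub>M M)" "(\<lambda>p. h' (fst p) (snd p)) \<in> borel_measurable (borel \<Otimes>\<^sub>M M)" for k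
   unfolding v_def v'_def h_def h'_def
   using sp[THEN simple_value_joint_measurable(1)] Hc[THEN continuous_adapted_joint_measurable(1)] by auto
  have sec: "(\<lambda>r. v k r w) \<in> borel_measurable borel" "(\<lambda>r. v' k r w) \<in> borel_measurable borel"
   "(\<lambda>r. h r w) \<in> borel_measurable borel" "(\<lambda>r. h' r w) \<in> borel_measurable borel" if "w \<in> space M" for k w
   using joint(1,2)[of k, THEN measurable_compose[OF measurable_Pair2'[OF that]]]
    joint(3,4)[THEN measurable_compose[OF measurable_Pair2'[OF that]]] by simp_all
  define W where "W k w = (LBINT r:{s<..t}. v k r w * v' k r w)" for k w
  define V where "V w = (LBINT r:{s<..t}. h r w * h' r w)" for w
  define A where "A k w = (LBINT r:{s<..t}. \<bar>v k r w - h r w\<bar>)" for k w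
  define A' where "A' k w = (LBINT r:{s<..t}. \<bar>v' k r w - h' r w\<bar>)" for k w
  have hH: "(LBINT r:{s<..t}. H r w * H' r w) = V w"
   "(LBINT r:{s<..t}. \<bar>simple_value (n k, u k, \<zeta> k) r w - H r w\<bar>) = A k w"
   "(LBINT r:{s<..t}. \<bar>simple_value (n' k, u' k, \<zeta>' k) r w - H' r w\<bar>) = A' k w" for w k
   unfolding V_def A_def A'_def h_def h'_def v_def v'_def using st by (auto intro!: set_lebesgue_integral_cong simp: max_absorb2)
  have WM[measurable]: "W k \<in> borel_measurable M" "V \<in> borel_measurable M" "A k \<in> borel_measurable M" "A' k \<in> borel_measurable M" for k
   unfolding W_def V_def A_def A'_def by (rule set_integral_joint_measurable; measurable)+
  have prodb: "\<bar>x * y\<bar> \<le> c * c'" if "\<bar>x\<bar> \<le> c" "\<bar>y\<bar> \<le> c'" for x y :: real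
   unfolding abs_mult using that c0 by (intro mult_mono) auto
  have diffb: "\<bar>\<bar>x - y\<bar>\<bar> \<le> 2 * b" if "\<bar>x\<bar> \<le> b" "\<bar>y\<bar> \<le> b" for x y b :: real using that by linarith
  have si: "set_integrable lborel {s<..t} (\<lambda>r. v k r w * v' k r w)" "set_integrable lborel {s<..t} (\<lambda>r. h r w * h' r w)"
   "set_integrable lborel {s<..t} (\<lambda>r. \<bar>v k r w - h r w\<bar>)" "set_integrable lborel {s<..t} (\<lambda>r. \<bar>v' k r w - h' r w\<bar>)"
   if w: "w \<in> space M" for k w
   using sec[OF w] by (auto intro!: set_integrable_bounded[where c="c * c'"] prodb vb hb[OF w]
     set_integrable_bounded[where f="\<lambda>r. \<bar>v k r w - h r w\<bar>" and c="2 * c"] set_integrable_bounded[where f="\<lambda>r. \<bar>v' k r w - h' r w\<bar>" and c="2 * c'"] diffb)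
  have iWV: "integrable M (\<lambda>w. \<eta> w * W k w)" "integrable M (\<lambda>w. \<eta> w * V w)" "integrable M (A k)" "integrable M (A' k)" for k
  proof -
   have W: "\<bar>W k w\<bar> \<le> c * c' * (t - s)" "\<bar>V w\<bar> \<le> c * c' * (t - s)" "\<bar>A k w\<bar> \<le> 2 * c * (t - s)" "\<bar>A' k w\<bar> \<le> 2 * c' * (t - s)" if w: "w \<in> space M" for w
    unfolding W_def V_def A_def A'_def using sec[OF w] st
    by (auto intro!: set_integral_bounded prodb vb hb[OF w] diffb)
   show "integrable M (A k)" "integrable M (A' k)"
    using bounded_integrable[OF WM(3) W(3)] bounded_integrable[OF WM(4) W(4)] by auto
   show "integrable M (\<lambda>w. \<eta> w * W k w)" "integrable M (\<lambda>w. \<eta> w * V w)"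
    using integrable_bounded_mult[OF bounded_integrable[OF WM(1) W(1)] \<eta>M \<eta>(2)]
     integrable_bounded_mult[OF bounded_integrable[OF WM(2) W(2)] \<eta>M \<eta>(2)] by auto
  qed
  have EY: "\<E> (Y k) = \<E> (\<lambda>w. \<eta> w * W k w)" for k
   using has_bochner_integral_integral_eq[OF transform_product[OF st(1) \<eta> u(1,2,3) \<zeta> u'(1,2,3) \<zeta>', of k k]]
   by (simp add: Y_def[abs_def] T_def T'_def W_def v_def v'_def)
  have path: "\<bar>W k w - V w\<bar> \<le> c' * A k w + c * A' k w" if w: "w \<in> space M" for k w
  proof -
   have id: "set_integrable lborel {s<..t} (\<lambda>r. v k r w * v' k r w - h r w * h' r w)"
    using si[OF w] by (intro set_integral_diff(1))
   have "W k w - V w = (LBINT r:{s<..t}. v k r w * v' k r w - h r w * h' r w)"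
    unfolding W_def V_def using si[OF w] by simp
   then have "\<bar>W k w - V w\<bar> \<le> (LBINT r:{s<..t}. \<bar>v k r w * v' k r w - h r w * h' r w\<bar>)"
    using set_integral_norm_bound[OF id] by simp
   also have "\<dots> \<le> (LBINT r:{s<..t}. c' * \<bar>v k r w - h r w\<bar> + c * \<bar>v' k r w - h' r w\<bar>)"
   proof (rule set_integral_mono[OF set_integrable_abs[OF id]])
    fix r
    have "v k r w * v' k r w - h r w * h' r w = v' k r w * (v k r w - h r w) + h r w * (v' k r w - h' r w)" by (simp add: algebra_simps)
    then have "\<bar>v k r w * v' k r w - h r w * h' r w\<bar> \<le> \<bar>v' k r w\<bar> * \<bar>v k r w - h r w\<bar> + \<bar>h r w\<bar> * \<bar>v' k r w - h' r w\<bar>"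
     by (metis abs_mult abs_triangle_ineq)
    also have "\<dots> \<le> c' * \<bar>v k r w - h r w\<bar> + c * \<bar>v' k r w - h' r w\<bar>"
     using vb hb[OF w] by (intro add_mono mult_right_mono) auto
    finally show "\<bar>v k r w * v' k r w - h r w * h' r w\<bar> \<le> c' * \<bar>v k r w - h r w\<bar> + c * \<bar>v' k r w - h' r w\<bar>" .
   qed (intro set_integral_add(1) set_integrable_mult_right si w)
   also have "\<dots> = c' * A k w + c * A' k w"
    unfolding A_def A'_def using si[OF w] by (subst set_integral_add(2)) (auto intro!: set_integrable_mult_right)
   finally show ?thesis .
  qed
  have bound: "norm (\<E> (\<lambda>w. \<eta> w * W k w) - \<E> (\<lambda>w. \<eta> w * V w)) \<le> d * (c' * \<E> (A k) + c * \<E> (A' k))" for k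
  proof -
   have "norm (\<E> (\<lambda>w. \<eta> w * W k w) - \<E> (\<lambda>w. \<eta> w * V w)) \<le> \<E> (\<lambda>w. \<bar>\<eta> w * W k w - \<eta> w * V w\<bar>)"
    using integral_abs_bound[of M "\<lambda>w. \<eta> w * W k w - \<eta> w * V w"] iWV by simp
   also have "\<dots> \<le> \<E> (\<lambda>w. d * (c' * A k w + c * A' k w))"
   proof (rule integral_mono)
    fix w assume w: "w \<in> space M"
    show "\<bar>\<eta> w * W k w - \<eta> w * V w\<bar> \<le> d * (c' * A k w + c * A' k w)"
     unfolding right_diff_distrib[symmetric] abs_mult using path[OF w] \<eta>(2)[OF w] d0 by (intro mult_mono) auto
   qed (use iWV in auto)
   also have "\<dots> = d * (c' * \<E> (A k) + c * \<E> (A' k))" using iWV by simp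
   finally show ?thesis .
  qed
  have "(\<lambda>k. d * (c' * \<E> (A k) + c * \<E> (A' k))) \<longlonglongrightarrow> d * (c' * 0 + c * 0)"
   using L L' unfolding hH by (intro tendsto_intros)
  then have "(\<lambda>k. d * (c' * \<E> (A k) + c * \<E> (A' k))) \<longlonglongrightarrow> 0" by simp
  from Lim_null_comparison[OF always_eventually[OF allI[OF bound]] this]
  show ?thesis unfolding EY hH by (simp only: LIM_zero_iff)
 qed
 moreover have "(\<lambda>k. \<E> (Y k)) \<longlonglongrightarrow> \<E> Z" by (rule YZ) simp_all
 ultimately have "\<E> Z = \<E> (\<lambda>w. \<eta> w * (LBINT r:{s<..t}. H r w * H' r w))"
  by (intro LIMSEQ_unique)
 moreover have "integrable M Z" by (rule square_integrable_imp_integrable[OF _ YZ(1)]) simp_all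
 ultimately show ?thesis by (simp add: has_bochner_integral_iff Z_def[abs_def] D_def D'_def)
qed

end

section \<open>Vanishing local time\<close>

lemma set_integral_singleton: "(LBINT r:{x::real}. f r) = (0 :: real)"
proof -
 have "AE r in lborel. r \<noteq> x" by (rule AE_lborel_singleton)
 then have "AE r in lborel. indicator {x} r *\<^sub>R f r = (0::real)" by eventually_elim auto
 then show ?thesis unfolding set_lebesgue_integral_def by (rule integral_eq_zero_AE)
qed

lemma set_integral_Icc_bounded:
 fixes f :: "real => real"
 assumes [measurable]: "f \<in> borel_measurable borel" and bd: "\<And>r. s \<le> r ==> r \<le> t ==> \<bar>f r\<bar> \<le> c" and st: "s \<le> t"
 shows "set_integrable lborel {s..t} f" "\<bar>LBINT r:{s..t}. f r\<bar> \<le> c * (t - s)"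
proof -
 have c: "set_integrable lborel {s..t} (\<lambda>_. c)" by (intro borel_integrable_atLeastAtMost') auto
 show i: "set_integrable lborel {s..t} f"
  unfolding set_integrable_def
 proof (rule Bochner_Integration.integrable_bound)
  show "integrable lborel (\<lambda>x. indicat_real {s..t} x *\<^sub>R c)" using c by (simp add: set_integrable_def)
  show "AE x in lborel. norm (indicat_real {s..t} x *\<^sub>R f x) \<le> norm (indicat_real {s..t} x *\<^sub>R c)"
   using bd by (force simp: indicator_def intro!: AE_I2)
 qed measurable
 have "\<bar>LBINT r:{s..t}. f r\<bar> \<le> (LBINT r:{s..t}. \<bar>f r\<bar>)"
  using set_integral_norm_bound[OF i] by simp
 also have "\<dots> \<le> (LBINT r:{s..t}. c)"
  using bd by (intro set_integral_mono set_integrable_abs i c) auto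
 also have "\<dots> = c * (t - s)" using st by (simp add: set_lebesgue_integral_def)
 finally show "\<bar>LBINT r:{s..t}. f r\<bar> \<le> c * (t - s)" .
qed

context filtered_prob_space
begin

lemma continuous_adapted_diff:
 assumes "adapted X" "adapted Y"
 shows "adapted (\<lambda>t w. X t w - Y t w)"
 using assms unfolding continuous_adapted_def by (simp add: borel_measurable_diff continuous_on_diff)

lemma continuous_adapted_compose:
 assumes X: "adapted X" and g: "continuous_on UNIV g"
 shows "adapted (\<lambda>t w. g (X t w) :: real)"
 unfolding continuous_adapted_def
proof (intro conjI allI impI ballI)
 show "(\<lambda>w. g (X t w)) \<in> borel_measurable (F t)" if "0 \<le> t" for t
  using X that by (intro measurable_compose[OF _ borel_measurable_continuous_onI[OF g]]) (simp add: continuous_adapted_def)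
 show "continuous_on {0..} (\<lambda>t. g (X t w))" if "w \<in> space M" for w
  using X that by (intro continuous_on_compose2[OF g]) (auto simp: continuous_adapted_def)
qed

lemma L2_martingale_diff:
 assumes m: "L2_martingale m" "L2_martingale m'"
 shows "L2_martingale (\<lambda>t w. m t w - m' t w)"
proof -
 have "integrable M (\<lambda>w. (m t w - m' t w)^2)" if "0 \<le> t" for t
  using m that L2_martingale_measurable(2)[OF m(1) that] L2_martingale_measurable(2)[OF m(2) that]
  by (intro integrable_diff_L2) (auto simp: L2_martingale_def)
 then show ?thesis using m by (simp add: L2_martingale_def continuous_adapted_diff martingale_diff)
qed

lemma L2_martingale_cong_AE:
 assumes m: "L2_martingale m" and N: "adapted N" and eq: "AE w in M. \<forall>t\<ge>0. N t w = m t w"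
 shows "L2_martingale N"
proof (rule L2_martingaleI[OF N])
 have eqt: "AE w in M. N t w = m t w" if "0 \<le> t" for t using eq by eventually_elim (use that in auto)
 have [measurable]: "N t \<in> borel_measurable M" "m t \<in> borel_measurable M" if "0 \<le> t" for t
  using continuous_adapted_measurable_M[OF N that] L2_martingale_measurable(2)[OF m that] by auto
 show "integrable M (\<lambda>w. (N t w)^2)" if t: "0 \<le> t" for t
 proof -
  have "AE w in M. (N t w)^2 = (m t w)^2" using eqt[OF t] by eventually_elim simp
  then show ?thesis using m t by (subst integrable_cong_AE) (auto simp: L2_martingale_def)
 qed
 fix s t A assume st: "0 \<le> s" "s \<le> t" and A: "A \<in> sets (F s)"
 have AF: "indicat_real A \<in> borel_measurable (F s)" and [measurable]: "indicat_real A \<in> borel_measurable M"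
  using A sets_F_subset[OF st(1)] by auto
 have "(indicat_real A w)^2 = indicat_real A w" for w by (simp add: indicator_def)
 then have "integrable M (\<lambda>w. (indicat_real A w)^2)" using bounded_integrable[of "indicat_real A" 1] by simp
 note L2_martingale_incr[OF m st AF this, THEN has_bochner_integral_integral_eq]
 moreover have "AE w in M. indicat_real A w * (N t w - N s w) = indicat_real A w * (m t w - m s w)"
  using eqt[OF st(1)] eqt[OF order_trans[OF st]] by eventually_elim simp
 ultimately show "\<E> (\<lambda>w. indicat_real A w * (N t w - N s w)) = 0"
  using st by (subst integral_cong_AE) auto
qed

text \<open>The integrals of the approximating simple processes are stopped as soon as they differ from the
 limit by one: then they inherit the bound on the limit.\<close>

lemma local_mart_integral_expectation_zero:
 assumes N: "L2_martingale N" and HI: "has_local_mart_integral M F N H J"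
  and J0: "AE w in M. J 0 w = 0" and dom: "AE w in M. \<forall>s\<in>{0..t}. \<bar>J s w\<bar> \<le> \<bar>N s w\<bar> + C" and t: "0 \<le> t"
 shows "has_bochner_integral M (J t) 0"
proof -
 have Nc: "adapted N" using N by (simp add: L2_martingale_def)
 obtain K where K: "\<And>k. simple_process M F (K k)"
  and S: "tendsto_zero_in_prob M (\<lambda>k w. SUP s\<in>{0..t}. ennreal \<bar>simple_integral (K k) N s w - J s w\<bar>)"
  and Jc: "adapted J"
  using HI t unfolding has_local_mart_integral_def by blast
 define X where "X k = simple_integral (K k) N" for k
 have X: "L2_martingale (X k)" "X k 0 w = 0" for k w
 proof -
  obtain n \<tau> \<xi> where Keq: "K k = (n, \<tau>, \<xi>)" by (cases "K k") auto
  show "L2_martingale (X k)" using simple_integral_L2_martingale[OF N, of n \<tau> \<xi>] K[of k] by (simp add: X_def Keq)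
  show "X k 0 w = 0" using K[of k] unfolding X_def Keq by (intro simple_integral_0) (auto simp: simple_process_def)
 qed
 have Xc: "adapted (X k)" for k using X(1)[of k] by (simp add: L2_martingale_def)
 define D where "D k s w = \<bar>X k s w - J s w\<bar>" for k s w
 have D: "adapted (D k)" for k
  unfolding D_def[abs_def]
  by (rule continuous_adapted_compose[OF continuous_adapted_diff[OF Xc Jc]]) (intro continuous_intros)
 define \<tau> where "\<tau> k = exit_time (D k) 1 t" for k
 have \<tau>: "\<And>w. w \<in> space M ==> 0 \<le> \<tau> k w" "\<And>w. w \<in> space M ==> \<tau> k w \<le> t"
  "\<And>s. 0 < s ==> s \<le> t ==> {w\<in>space M. \<tau> k w < s} \<in> sets (F s)" for k
  unfolding \<tau>_def using exit_time_bounds[OF t] exit_time_optional[OF D t] by auto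
 define Y where "Y k w = X k (\<tau> k w) w" for k w
 have [measurable]: "Y k \<in> borel_measurable M" for k
  unfolding Y_def using stopped_measurable(1)[OF Xc t \<tau>] by (intro measurable_F[OF t])
 have [measurable]: "(\<lambda>w. N (\<tau> k w) w) \<in> borel_measurable M" for k
  using stopped_measurable(1)[OF Nc t \<tau>] by (intro measurable_F[OF t])
 have [measurable]: "J t \<in> borel_measurable M" "N t \<in> borel_measurable M"
  using continuous_adapted_measurable_M[OF Jc t] continuous_adapted_measurable_M[OF Nc t] by auto
 have osX: "integrable M (\<lambda>w. (Y k w)^2)" "\<E> (Y k) = \<E> (X k 0)" for k
  unfolding Y_def[abs_def] by (rule optional_stopping[OF X(1) t \<tau>]; assumption)+
 have osN: "integrable M (\<lambda>w. (N (\<tau> k w) w)^2)"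
  "\<E> (\<lambda>w. (N (\<tau> k w) w)^2) \<le> \<E> (\<lambda>w. (N t w)^2)" for k
  by (rule optional_stopping[OF N t \<tau>]; assumption)+
 have Yb: "AE w in M. (Y k w)^2 \<le> 2 * (N (\<tau> k w) w)^2 + 2 * (\<bar>C\<bar> + 1)^2" for k
  using dom J0 AE_space
 proof eventually_elim
  case (elim w)
  \<comment> \<open>\<open>D\<close> starts at 0, so at the exit time it has not passed 1, and
    \<open>Y k\<close> inherits the bound on \<open>J\<close> up to 1.\<close>
  have "D k (\<tau> k w) w \<le> 1"
   unfolding \<tau>_def using elim X(2) by (intro at_exit_time[OF D t]) (auto simp: D_def)
  moreover have "\<bar>J (\<tau> k w) w\<bar> \<le> \<bar>N (\<tau> k w) w\<bar> + C" using elim \<tau>(1,2)[of w k] by auto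
  ultimately have "\<bar>Y k w\<bar> \<le> \<bar>N (\<tau> k w) w\<bar> + (\<bar>C\<bar> + 1)" unfolding D_def Y_def by linarith
  then have "(Y k w)^2 \<le> (\<bar>N (\<tau> k w) w\<bar> + (\<bar>C\<bar> + 1))^2" using power_mono[of "\<bar>Y k w\<bar>" _ 2] by fastforce
  also have "\<dots> \<le> 2 * \<bar>N (\<tau> k w) w\<bar>^2 + 2 * (\<bar>C\<bar> + 1)^2"
   using sum_squares_ge_zero[of "\<bar>N (\<tau> k w) w\<bar> - (\<bar>C\<bar> + 1)" 0] unfolding power2_eq_square by (simp add: algebra_simps)
  finally show ?case by simp
 qed
 have Y2: "\<E> (\<lambda>w. (Y k w)^2) \<le> 2 * \<E> (\<lambda>w. (N t w)^2) + 2 * (\<bar>C\<bar> + 1)^2" for k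
 proof -
  have "\<E> (\<lambda>w. (Y k w)^2) \<le> \<E> (\<lambda>w. 2 * (N (\<tau> k w) w)^2 + 2 * (\<bar>C\<bar> + 1)^2)"
   using osX(1) osN(1) Yb by (intro integral_mono_AE) auto
  also have "\<dots> = 2 * \<E> (\<lambda>w. (N (\<tau> k w) w)^2) + 2 * (\<bar>C\<bar> + 1)^2" using osN(1) by (simp add: prob_space)
  also have "\<dots> \<le> 2 * \<E> (\<lambda>w. (N t w)^2) + 2 * (\<bar>C\<bar> + 1)^2" using osN(2) by simp
  finally show ?thesis .
 qed
 have "null_in_prob (\<lambda>k w. Y k w - J t w)"
 proof (rule null_in_prob_ennreal[OF S])
  show "AE w in M. (SUP s\<in>{0..t}. ennreal \<bar>simple_integral (K k) N s w - J s w\<bar>) \<le> 1 \<longrightarrow>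
   ennreal \<bar>Y k w - J t w\<bar> \<le> (SUP s\<in>{0..t}. ennreal \<bar>simple_integral (K k) N s w - J s w\<bar>)" for k
  proof (intro AE_I2 impI)
   fix w assume le: "(SUP s\<in>{0..t}. ennreal \<bar>simple_integral (K k) N s w - J s w\<bar>) \<le> 1"
   \<comment> \<open>Where the supremum is at most 1 the stopping is not triggered before
     \<open>t\<close>, so \<open>Y k\<close> is the unstopped value.\<close>
   have "D k s w \<le> 1" if "s \<in> {0..t}" for s
    using order_trans[OF SUP_upper[OF that] le] by (simp add: D_def X_def ennreal_le_1)
   then have "\<tau> k w = t" unfolding \<tau>_def by (intro exit_time_eq[OF t]) auto
   then show "ennreal \<bar>Y k w - J t w\<bar> \<le> (SUP s\<in>{0..t}. ennreal \<bar>simple_integral (K k) N s w - J s w\<bar>)"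
    using t by (intro SUP_upper2[of t]) (simp_all add: Y_def X_def)
  qed
 qed measurable
 note L = L2_bounded_limit[OF this _ _ osX(1) Y2]
 have J2: "integrable M (\<lambda>w. (J t w)^2)" by (rule L) simp_all
 have "(\<lambda>k. \<E> (Y k)) \<longlonglongrightarrow> \<E> (J t)" by (rule L) simp_all
 moreover have "\<E> (Y k) = 0" for k using osX(2) by (simp add: X(2)[abs_def])
 ultimately have "\<E> (J t) = 0" by (simp add: LIMSEQ_const_iff)
 moreover have "integrable M (J t)" by (rule square_integrable_imp_integrable[OF _ J2]) auto
 ultimately show ?thesis by (simp add: has_bochner_integral_iff)
qed

end

context brownian_space
begin

definition ito_process ::
  "real => (real => 'a => real) => (real => 'a => real) => (real => 'a => real) => (real => 'a => real) => bool" where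
 "ito_process c X H \<beta> I \<longleftrightarrow> adapted X \<and> bounded_integral c H I \<and> adapted \<beta>
   \<and> (\<forall>s\<ge>0. \<forall>w\<in>space M. \<bar>\<beta> s w\<bar> \<le> c)
   \<and> (AE w in M. \<forall>t\<ge>0. X t w = X 0 w + I t w + (LBINT r:{0..t}. \<beta> r w))"

text \<open>With zero local time, Tanaka's formula expresses the stochastic integral of the
  indicator pathwise by \<open>R\<close>, once the decomposition \<open>N\<close>, \<open>A\<close>
  supplied by the definition is identified with \<open>m\<close>, \<open>V\<close> by uniqueness.
  The expectation of this integral is 0 because \<open>R\<close> is dominated by
  \<open>\<bar>N\<bar>\<close> plus a constant; this stands in for an isometry with a discontinuous
  integrand.\<close>

theorem vanishing_local_time_expectation:
 assumes X: "ito_process c X H \<beta> I" and X': "ito_process c X' H' \<beta>' I'" and t: "0 \<le> t"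
  and LT: "is_local_time_at_zero M F (\<lambda>t w. X t w - X' t w) (\<lambda>t w. 0)"
 defines "Z \<equiv> \<lambda>t w. X t w - X' t w"
 shows "has_bochner_integral M (\<lambda>w. max (Z t w) 0 - max (Z 0 w) 0
  - (LBINT r:{0..t}. (if Z r w > 0 then 1 else 0) * (\<beta> r w - \<beta>' r w))) 0"
proof -
 let ?H = "\<lambda>s w. if Z s w > 0 then 1 else 0 :: real"
 define \<gamma> where "\<gamma> r w = \<beta> r w - \<beta>' r w" for r w
 define V where "V t w = (LBINT r:{0..t}. \<gamma> r w)" for t w
 have c0: "0 \<le> c" and BI: "bounded_integral c H I" "bounded_integral c H' I'"
  using X X' by (auto simp: ito_process_def bounded_integral_def)
 have \<beta>c: "adapted \<beta>" "adapted \<beta>'" using X X' by (auto simp: ito_process_def)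
 have \<gamma>c: "continuous_on {0..} (\<lambda>r. \<gamma> r w)" if "w \<in> space M" for w
  using \<beta>c that by (auto simp: \<gamma>_def continuous_adapted_def intro!: continuous_intros)
 have \<gamma>b: "\<bar>\<gamma> r w\<bar> \<le> 2 * c" if "w \<in> space M" "0 \<le> r" for r w
 proof -
  have "\<bar>\<beta> r w\<bar> \<le> c" "\<bar>\<beta>' r w\<bar> \<le> c" using X X' that by (auto simp: ito_process_def)
  then show ?thesis unfolding \<gamma>_def by linarith
 qed
 define m where "m t w = I t w - I' t w" for t w
 have m: "L2_martingale m" unfolding m_def[abs_def]
  by (intro L2_martingale_diff bounded_integral_L2_martingale[OF BI(1)] bounded_integral_L2_martingale[OF BI(2)])
 have m0: "AE w in M. m 0 w = 0" using bounded_integral_0[OF BI(1)] bounded_integral_0[OF BI(2)] by eventually_elim (simp add: m_def)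
 have Zc: "adapted Z" using X X' unfolding Z_def by (intro continuous_adapted_diff) (auto simp: ito_process_def)
 have Zeq: "AE w in M. \<forall>t\<ge>0. Z t w = Z 0 w + m t w + V t w"
 proof -
  have "AE w in M. \<forall>t\<ge>0. X t w = X 0 w + I t w + (LBINT r:{0..t}. \<beta> r w)" using X by (simp add: ito_process_def)
  moreover have "AE w in M. \<forall>t\<ge>0. X' t w = X' 0 w + I' t w + (LBINT r:{0..t}. \<beta>' r w)" using X' by (simp add: ito_process_def)
  ultimately show ?thesis using AE_space
  proof eventually_elim
   case (elim w)
   show ?case
   proof (intro allI impI)
    fix t :: real assume t: "0 \<le> t"
    have "set_integrable lborel {0..t} (\<lambda>r. \<beta> r w)" "set_integrable lborel {0..t} (\<lambda>r. \<beta>' r w)"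
     using \<beta>c elim(3) by (auto intro!: continuous_path_integrable simp: continuous_adapted_def)
    then have "V t w = (LBINT r:{0..t}. \<beta> r w) - (LBINT r:{0..t}. \<beta>' r w)" unfolding V_def \<gamma>_def by (rule set_integral_diff(2))
    then show "Z t w = Z 0 w + m t w + V t w" using elim(1,2)[rule_format, OF t] by (simp add: Z_def m_def)
   qed
  qed
 qed
 obtain J where J: "has_semimart_integral M F Z ?H J"
  and Jeq: "AE w in M. \<forall>t\<ge>0. 1/2 * 0 = max (Z t w) 0 - max (Z 0 w) 0 - J t w"
  using LT unfolding is_local_time_at_zero_def indistinguishable_def Z_def by blast
 obtain N A K where dec: "semimart_decomposition M F Z N A" and K: "has_local_mart_integral M F N ?H K"
  and JK: "AE w in M. \<forall>t\<ge>0. J t w = K t w + stieltjes_integral (\<lambda>s. ?H s w) (\<lambda>s. A s w) t"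
  using J unfolding has_semimart_integral_def indistinguishable_def by blast
 have N: "continuous_local_martingale M F N" "\<And>w. w \<in> space M ==> N 0 w = 0" "adapted N"
  and A: "adapted A" "bounded_variation_process M A" "\<And>w. w \<in> space M ==> A 0 w = 0"
  and NA: "AE w in M. \<forall>t\<ge>0. Z t w = Z 0 w + N t w + A t w"
  using dec by (auto simp: semimart_decomposition_def indistinguishable_def continuous_local_martingale_def)
 have Vlip: "\<bar>V y w - V x w\<bar> \<le> 2 * c * (y - x)" if "w \<in> space M" "0 \<le> x" "x \<le> y" for x y w
  unfolding V_def by (rule set_integral_lipschitz[OF \<gamma>c[OF that(1)] \<gamma>b[OF that(1)] that(2,3)])
 have V0: "V 0 w = 0" for w by (simp add: V_def set_integral_singleton)
 have "AE w in M. \<forall>t\<ge>0. V t w - A t w = 0"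
 proof (rule local_martingale_bv_unique[OF N(1) m])
  show "bounded_variation_process M (\<lambda>t w. V t w - A t w)"
   unfolding bounded_variation_process_def
  proof (intro ballI allI impI)
   fix w and t :: real assume w: "w \<in> space M" and t: "0 \<le> t"
   have "total_variation (\<lambda>s. V s w - A s w) t \<le> total_variation (\<lambda>s. V s w) t + total_variation (\<lambda>s. A s w) t"
    by (rule total_variation_diff_le)
   also have "total_variation (\<lambda>s. V s w) t \<le> ennreal (2 * c * t - 2 * c * 0)"
    using Vlip[OF w] by (intro total_variation_le) (simp add: right_diff_distrib)
   finally have "total_variation (\<lambda>s. V s w - A s w) t \<le> ennreal (2 * c * t - 2 * c * 0) + total_variation (\<lambda>s. A s w) t"
    by (simp add: add_right_mono)
   also have "\<dots> < \<infinity>" using A(2) w t by (simp add: bounded_variation_process_def ennreal_add_less_top)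
   finally show "total_variation (\<lambda>s. V s w - A s w) t < \<infinity>" .
  qed
  show "AE w in M. \<forall>t\<ge>0. N t w - N 0 w = m t w - m 0 w + (V t w - A t w)"
   using Zeq NA m0 AE_space
  proof eventually_elim
   case (elim w)
   have "N t w - N 0 w = m t w - m 0 w + (V t w - A t w)" if "0 \<le> t" for t
    using elim(1,2)[rule_format, OF that] N(2)[OF elim(4)] elim(3) by simp
   then show ?case by blast
  qed
 qed
 then have AV: "AE w in M. \<forall>t\<ge>0. A t w = V t w" by eventually_elim auto
 have Nm: "AE w in M. \<forall>t\<ge>0. N t w = m t w"
  using AV Zeq NA
 proof eventually_elim
  case (elim w)
  have "N t w = m t w" if "0 \<le> t" for t using elim[rule_format, OF that] by simp
  then show ?case by blast
 qed
 have NL: "L2_martingale N" by (rule L2_martingale_cong_AE[OF m N(3) Nm])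
 define R where "R t w = max (Z t w) 0 - max (Z 0 w) 0 - (LBINT r:{0..t}. ?H r w * \<gamma> r w)" for t w
 have Sb: "{s. 0 < Z (max 0 s) w} \<in> sets borel" if w: "w \<in> space M" for w
 proof -
  have "(\<lambda>s. Z (max 0 s) w) \<in> borel_measurable borel"
   using Zc w by (intro continuous_on_max_0(2)) (auto simp: continuous_adapted_def)
  then have "{s\<in>space borel. 0 < Z (max 0 s) w} \<in> sets borel" by measurable
  then show ?thesis by simp
 qed
 have KR: "AE w in M. \<forall>t\<ge>0. K t w = R t w"
  using Jeq JK AV AE_space
 proof eventually_elim
  case (elim w)
  show ?case
  proof (intro allI impI)
   fix t :: real assume t: "0 \<le> t"
   let ?S = "{s. 0 < Z (max 0 s) w}"
   have "stieltjes_integral (\<lambda>s. ?H s w) (\<lambda>s. A s w) t = stieltjes_integral (indicator ?S) (\<lambda>s. A s w) t"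
    unfolding stieltjes_integral_def
    by (intro arg_cong2[where f="(-)"] set_lebesgue_integral_cong) (auto simp: pos_variation_measure_def neg_variation_measure_def indicator_def max_absorb2)
   also have "\<dots> = (LBINT u:{0..t}. indicator ?S u * \<gamma> u w)"
    using elim(3) \<gamma>b[OF elim(4)] by (intro stieltjes_integral_indicator[OF \<gamma>c[OF elim(4)] _ _ Sb[OF elim(4)] t]) (auto simp: V_def)
   also have "\<dots> = (LBINT r:{0..t}. ?H r w * \<gamma> r w)"
    by (intro set_lebesgue_integral_cong) (auto simp: indicator_def max_absorb2)
   finally have "stieltjes_integral (\<lambda>s. ?H s w) (\<lambda>s. A s w) t = (LBINT r:{0..t}. ?H r w * \<gamma> r w)" .
   moreover have "J t w = K t w + stieltjes_integral (\<lambda>s. ?H s w) (\<lambda>s. A s w) t" "J t w = max (Z t w) 0 - max (Z 0 w) 0"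
    using elim(1,2)[rule_format, OF t] by auto
   ultimately show "K t w = R t w" by (simp add: R_def)
  qed
 qed
 \<comment> \<open>The positive part is 1-Lipschitz. The drift of \<open>Z\<close> and the integral
   of \<open>\<gamma>\<close> over the times with \<open>Z > 0\<close> contribute
   \<open>2 * c * s\<close> each, as \<open>\<gamma>\<close> is bounded by
   \<open>2 * c\<close>.\<close>
 have Rb: "AE w in M. \<forall>s\<in>{0..t}. \<bar>R s w\<bar> \<le> \<bar>N s w\<bar> + 4 * c * t"
  using Zeq Nm AE_space
 proof eventually_elim
  case (elim w)
  show ?case
  proof
   fix s assume s: "s \<in> {0..t}"
   have V: "\<bar>V s w\<bar> \<le> 2 * c * s" using Vlip[OF elim(3), of 0 s] s V0 by simp
   have "\<bar>max (Z s w) 0 - max (Z 0 w) 0\<bar> \<le> \<bar>Z s w - Z 0 w\<bar>" by linarith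
   also have "\<dots> \<le> \<bar>N s w\<bar> + 2 * c * s"
   proof -
    have "Z s w = Z 0 w + m s w + V s w" "N s w = m s w" using elim(1,2)[rule_format, of s] s by auto
    then show ?thesis using V by linarith
   qed
   finally have 1: "\<bar>max (Z s w) 0 - max (Z 0 w) 0\<bar> \<le> \<bar>N s w\<bar> + 2 * c * s" .
   have "\<bar>LBINT r:{0..s}. ?H r w * \<gamma> r w\<bar> \<le> 2 * c * s"
   proof -
    let ?g = "\<lambda>r. indicator {s. 0 < Z (max 0 s) w} r * \<gamma> (max 0 r) w"
    have e: "(LBINT r:{0..s}. ?H r w * \<gamma> r w) = (LBINT r:{0..s}. ?g r)"
     by (intro set_lebesgue_integral_cong) (auto simp: indicator_def max_absorb2)
    have gm: "?g \<in> borel_measurable borel"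
     by (intro borel_measurable_times borel_measurable_indicator Sb[OF elim(3)] continuous_on_max_0(2)[OF \<gamma>c[OF elim(3)]])
    have gb: "\<bar>?g r\<bar> \<le> 2 * c" for r using \<gamma>b[OF elim(3), of "max 0 r"] c0 by (simp add: indicator_def)
    have "\<bar>LBINT r:{0..s}. ?g r\<bar> \<le> 2 * c * (s - 0)" using s by (intro set_integral_Icc_bounded(2)[OF gm gb]) simp
    then show ?thesis unfolding e by simp
   qed
   then have "\<bar>R s w\<bar> \<le> \<bar>N s w\<bar> + 4 * c * s" using 1 unfolding R_def by linarith
   moreover have "4 * c * s \<le> 4 * c * t" using s c0 by (intro mult_left_mono) auto
   ultimately show "\<bar>R s w\<bar> \<le> \<bar>N s w\<bar> + 4 * c * t" by linarith
  qed
 qed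
 have "has_bochner_integral M (K t) 0"
 proof (rule local_mart_integral_expectation_zero[OF NL K _ _ t])
  show "AE w in M. \<forall>s\<in>{0..t}. \<bar>K s w\<bar> \<le> \<bar>N s w\<bar> + 4 * c * t" using Rb KR by eventually_elim auto
  show "AE w in M. K 0 w = 0"
   using KR by eventually_elim (simp add: R_def set_integral_singleton)
 qed
 moreover have "AE w in M. K t w = R t w" using KR by eventually_elim (use t in auto)
 moreover have "R t \<in> borel_measurable M"
 proof -
  note [measurable] = \<beta>c[THEN continuous_adapted_joint_measurable(1)] Zc[THEN continuous_adapted_joint_measurable(1)]
  have "(\<lambda>w. LBINT r:{0..t}. (if Z (max 0 r) w > 0 then 1 else 0) * (\<beta> (max 0 r) w - \<beta>' (max 0 r) w)) \<in> borel_measurable M"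
   by (rule set_integral_joint_measurable; measurable)
  moreover have "(LBINT r:{0..t}. (if Z (max 0 r) w > 0 then 1 else 0) * (\<beta> (max 0 r) w - \<beta>' (max 0 r) w)) = (LBINT r:{0..t}. ?H r w * \<gamma> r w)" for w
   by (intro set_lebesgue_integral_cong) (auto simp: max_absorb2 \<gamma>_def)
  ultimately show ?thesis unfolding R_def[abs_def] using continuous_adapted_measurable_M[OF Zc] t by simp
 qed
 moreover have "K t \<in> borel_measurable M"
  using K t continuous_adapted_measurable_M[of K t] by (auto simp: has_local_mart_integral_def)
 ultimately have "has_bochner_integral M (R t) 0"
  by (subst (asm) has_bochner_integral_cong_AE) auto
 then show ?thesis by (simp add: R_def[abs_def] \<gamma>_def)
qed

end

section \<open>Ito's formula\<close>

text \<open>For bounded functions this is uniform continuity, in a form to be integrated against second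
 moments of increments.\<close>

definition square_modulus :: "('a :: metric_space => real) => bool" where
 "square_modulus g \<longleftrightarrow> (\<forall>e>0. \<exists>C\<ge>0. \<forall>p q. \<bar>g p - g q\<bar> \<le> e + C * (dist p q)^2)"

lemma square_modulus_continuous:
 assumes g: "square_modulus g" shows "continuous_on S g"
proof (rule continuous_on_subset[OF _ subset_UNIV])
 show "continuous_on UNIV g"
  unfolding continuous_on_iff
 proof (intro ballI allI impI)
  fix p and e :: real assume e: "0 < e"
  obtain C where C: "0 \<le> C" "\<And>p q. \<bar>g p - g q\<bar> \<le> e / 2 + C * (dist p q)^2"
   using g e unfolding square_modulus_def by (meson half_gt_zero)
  let ?d = "sqrt (e / (2 * (C + 1)))"
  have "dist (g q) (g p) < e" if "dist q p < ?d" for q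
  proof -
   have "(dist q p)^2 < e / (2 * (C + 1))"
    using power_strict_mono[OF that, of 2] e C(1) by simp
   then have "(C + 1) * (dist q p)^2 < e / 2" using C(1) by (simp add: field_simps)
   moreover have "(C + 1) * (dist q p)^2 = C * (dist q p)^2 + (dist q p)^2" "0 \<le> (dist q p)^2" by (simp_all add: distrib_right)
   ultimately have "C * (dist q p)^2 < e / 2" by linarith
   then show ?thesis using C(2)[of q p] by (simp add: dist_real_def)
  qed
  moreover have "0 < ?d" using e C(1) by simp
  ultimately show "\<exists>d>0. \<forall>q\<in>UNIV. dist q p < d \<longrightarrow> dist (g q) (g p) < e" by blast
 qed
qed

text \<open>Derivatives are required along straight lines, the form in which Taylor's formula uses
  them. One bound \<open>K\<close> serves for all five partial derivatives; \<open>f\<close> itself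
  may be unbounded.\<close>

definition uniform_C2 :: "real => (real \<times> real => real) => (real \<times> real => real) => (real \<times> real => real) =>
  (real \<times> real => real) => (real \<times> real => real) => (real \<times> real => real) => bool" where
 "uniform_C2 K f fx fy fxx fxy fyy \<longleftrightarrow>
  (\<forall>x y h k s. ((\<lambda>s. f (x + s * h, y + s * k)) has_real_derivative
    fx (x + s * h, y + s * k) * h + fy (x + s * h, y + s * k) * k) (at s)) \<and>
  (\<forall>x y h k s. ((\<lambda>s. fx (x + s * h, y + s * k) * h + fy (x + s * h, y + s * k) * k) has_real_derivative
    fxx (x + s * h, y + s * k) * h^2 + 2 * fxy (x + s * h, y + s * k) * (h * k) + fyy (x + s * h, y + s * k) * k^2) (at s)) \<and>
  (\<forall>g\<in>{fx, fy, fxx, fxy, fyy}. square_modulus g \<and> (\<forall>p. \<bar>g p\<bar> \<le> K)) \<and> 0 \<le> K"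

lemma uniform_C2_modulus:
 assumes f: "uniform_C2 K f fx fy fxx fxy fyy" and e: "0 < e"
 obtains C where "0 \<le> C" "\<And>g p q. g \<in> {fx, fy, fxx, fxy, fyy} ==> \<bar>g p - g q\<bar> \<le> e + C * (dist p q)^2"
proof -
 have "\<forall>g\<in>{fx, fy, fxx, fxy, fyy}. \<exists>C\<ge>0. \<forall>p q. \<bar>g p - g q\<bar> \<le> e + C * (dist p q)^2"
  using f e by (auto simp: uniform_C2_def square_modulus_def)
 then obtain c where c: "\<And>g. g \<in> {fx, fy, fxx, fxy, fyy} ==> 0 \<le> c g \<and> (\<forall>p q. \<bar>g p - g q\<bar> \<le> e + c g * (dist p q)^2)"
  by metis
 show ?thesis
 proof
  let ?C = "\<Sum>g\<in>{fx, fy, fxx, fxy, fyy}. c g"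
  show "0 \<le> ?C" using c by (intro sum_nonneg) auto
  fix g and p q :: "real \<times> real" assume g: "g \<in> {fx, fy, fxx, fxy, fyy}"
  have "c g \<le> ?C" using c g by (intro member_le_sum) auto
  then have "c g * (dist p q)^2 \<le> ?C * (dist p q)^2" by (intro mult_right_mono) auto
  moreover have "\<bar>g p - g q\<bar> \<le> e + c g * (dist p q)^2" using c[OF g] by blast
  ultimately show "\<bar>g p - g q\<bar> \<le> e + ?C * (dist p q)^2" by linarith
 qed
qed

lemma two_mult_le_squares: "2 * \<bar>h * k\<bar> \<le> h^2 + k^2" for h k :: real
 using zero_le_power2[of "\<bar>h\<bar> - \<bar>k\<bar>"] by (simp add: power2_diff abs_mult)

lemma abs_half_sum_le:
 fixes x y z :: real
 assumes "\<bar>x\<bar> \<le> X" "\<bar>y\<bar> \<le> Y" "\<bar>z\<bar> \<le> Z"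
 shows "\<bar>(x + 2 * y + z) / 2\<bar> \<le> (X + 2 * Y + Z) / 2"
 using assms by (auto simp: abs_le_iff)

text \<open>Second order expansion along the segment. Replacing the second derivatives at the
  intermediate point by those at the base point costs \<open>e + C * r\<close>, where
  \<open>r\<close> is the squared length of the step.\<close>

lemma uniform_C2_taylor:
 assumes f: "uniform_C2 K f fx fy fxx fxy fyy"
  and C: "0 \<le> C" "\<And>g p q. g \<in> {fx, fy, fxx, fxy, fyy} ==> \<bar>g p - g q\<bar> \<le> e + C * (dist p q)^2" and e: "0 \<le> e"
 shows "\<bar>f (x + h, y + k) - f (x, y) - fx (x, y) * h - fy (x, y) * k
   - (fxx (x, y) * h^2 + 2 * fxy (x, y) * (h * k) + fyy (x, y) * k^2) / 2\<bar> \<le> (e + C * (h^2 + k^2)) * (h^2 + k^2)"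
proof -
 let ?p = "\<lambda>s. (x + s * h, y + s * k)" and ?r = "h^2 + k^2"
 define d :: "nat => real => real" where "d m = (if m = 0 then (\<lambda>s. f (?p s)) else if m = 1 then (\<lambda>s. fx (?p s) * h + fy (?p s) * k)
   else (\<lambda>s. fxx (?p s) * h^2 + 2 * fxy (?p s) * (h * k) + fyy (?p s) * k^2))" for m
 have "\<exists>t::real. 0 < t \<and> t < 1 \<and> d 0 1 = sum (\<lambda>m. (d m 0 / fact m) * 1 ^ m) {..<2} + (d 2 t / fact 2) * 1 ^ 2"
 proof (rule Maclaurin)
  show "\<forall>m t. m < 2 \<and> 0 \<le> t \<and> t \<le> 1 \<longrightarrow> DERIV (d m) t :> d (Suc m) t"
   using f by (auto simp: d_def uniform_C2_def less_2_cases_iff)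
 qed simp_all
 then obtain t where t: "0 < t" "t < 1" and eq: "d 0 1 = d 0 0 + d 1 0 + d 2 t / 2"
  by (auto simp: numeral_2_eq_2)
 have b: "\<bar>g (?p t) - g (x, y)\<bar> \<le> e + C * ?r" if "g \<in> {fx, fy, fxx, fxy, fyy}" for g
 proof -
  have "(dist (?p t) (x, y))^2 = t^2 * ?r" by (simp add: dist_Pair_Pair dist_real_def power_mult_distrib algebra_simps)
  also have "\<dots> \<le> 1 * ?r" using t by (intro mult_right_mono power_le_one) auto
  finally have "C * (dist (?p t) (x, y))^2 \<le> C * ?r" using C(1) by (intro mult_left_mono) auto
  then show ?thesis using C(2)[OF that, of "?p t" "(x, y)"] by linarith
 qed
 let ?A = "fxx (?p t) - fxx (x, y)" and ?B = "fxy (?p t) - fxy (x, y)" and ?D = "fyy (?p t) - fyy (x, y)"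
 have m: "\<bar>?A * h^2\<bar> \<le> (e + C * ?r) * h^2" "\<bar>?D * k^2\<bar> \<le> (e + C * ?r) * k^2"
  "\<bar>?B * (h * k)\<bar> \<le> (e + C * ?r) * (?r / 2)"
 proof -
  show "\<bar>?A * h^2\<bar> \<le> (e + C * ?r) * h^2" "\<bar>?D * k^2\<bar> \<le> (e + C * ?r) * k^2"
   unfolding abs_mult by (simp_all add: b mult_right_mono)
  show "\<bar>?B * (h * k)\<bar> \<le> (e + C * ?r) * (?r / 2)"
   unfolding abs_mult[of ?B] using b[of fxy] two_mult_le_squares[of h k] by (intro mult_mono) auto
 qed
 have "f (x + h, y + k) - f (x, y) - fx (x, y) * h - fy (x, y) * k
   - (fxx (x, y) * h^2 + 2 * fxy (x, y) * (h * k) + fyy (x, y) * k^2) / 2 = (?A * h^2 + 2 * (?B * (h * k)) + ?D * k^2) / 2"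
  using eq by (simp add: d_def algebra_simps diff_divide_distrib add_divide_distrib)
 moreover have "((e + C * ?r) * h^2 + 2 * ((e + C * ?r) * (?r / 2)) + (e + C * ?r) * k^2) / 2 = (e + C * ?r) * ?r"
  by (simp add: field_simps)
 ultimately show ?thesis using abs_half_sum_le[OF m(1) m(3) m(2)] by metis
qed

text \<open>The drift of \<open>f (X, Y)\<close> in Ito's formula for
  \<open>dX = a dB + b dt\<close> and \<open>dY = a' dB + b' dt\<close>, driven by the same
  \<open>B\<close>.\<close>

definition ito_drift :: "(real \<times> real => real) => (real \<times> real => real) => (real \<times> real => real) => (real \<times> real => real) =>
  (real \<times> real => real) => real \<times> real => real => real => real => real => real" where
 "ito_drift fx fy fxx fxy fyy p b b' a a' =
  fx p * b + fy p * b' + (fxx p * (a * a) + 2 * fxy p * (a * a') + fyy p * (a' * a')) / 2"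

lemma ito_drift_le:
 assumes c: "\<bar>b\<bar> \<le> c" "\<bar>b'\<bar> \<le> c" "\<bar>a\<bar> \<le> c" "\<bar>a'\<bar> \<le> c"
  and g: "\<And>g. g \<in> {fx, fy, fxx, fxy, fyy} ==> \<bar>g p\<bar> \<le> d"
 shows "\<bar>ito_drift fx fy fxx fxy fyy p b b' a a'\<bar> \<le> d * (2 * c + 2 * c^2)"
proof -
 have c0: "0 \<le> c" "0 \<le> d" using c(1) g[of fx] by force+
 have m: "\<bar>fx p * b\<bar> \<le> d * c" "\<bar>fy p * b'\<bar> \<le> d * c"
  "\<bar>fxx p * (a * a)\<bar> \<le> d * (c * c)" "\<bar>fxy p * (a * a')\<bar> \<le> d * (c * c)" "\<bar>fyy p * (a' * a')\<bar> \<le> d * (c * c)"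
  unfolding abs_mult by (intro mult_mono g c c0 mult_nonneg_nonneg abs_ge_zero; simp)+
 have "\<bar>fx p * b + fy p * b' + (fxx p * (a * a) + 2 * (fxy p * (a * a')) + fyy p * (a' * a')) / 2\<bar>
  \<le> d * c + d * c + (d * (c * c) + 2 * (d * (c * c)) + d * (c * c)) / 2"
  by (intro order_trans[OF abs_triangle_ineq] add_mono abs_half_sum_le m)
 then show ?thesis by (simp add: ito_drift_def algebra_simps power2_eq_square)
qed

text \<open>A statement about single paths, with \<open>C\<close> chosen before the paths.
  \<open>i\<close> and \<open>i'\<close> stand for the martingale parts of the increments.
  Subtracted are the integrated drift and the terms that will have expectation 0 given the past:
  first order terms and compensated products.\<close>

definition ito_estimate where
 "ito_estimate c e C f fx fy fxx fxy fyy \<longleftrightarrow> (\<forall>X Y b b' a a' i i' u v.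
  (\<forall>g\<in>{X, Y, b, b', a, a'}. continuous_on {0..} g) \<longrightarrow> (\<forall>g\<in>{b, b', a, a'}. \<forall>r\<ge>0. \<bar>g r\<bar> \<le> c) \<longrightarrow> 0 \<le> u \<longrightarrow> u \<le> v \<longrightarrow>
  X v - X u = i + (LBINT r:{u<..v}. b r) \<longrightarrow> Y v - Y u = i' + (LBINT r:{u<..v}. b' r) \<longrightarrow>
  \<bar>f (X v, Y v) - f (X u, Y u) - (LBINT r:{u<..v}. ito_drift fx fy fxx fxy fyy (X r, Y r) (b r) (b' r) (a r) (a' r))
   - (fx (X u, Y u) * i + fy (X u, Y u) * i' + (fxx (X u, Y u) * (i * i - (LBINT r:{u<..v}. a r * a r))
     + 2 * fxy (X u, Y u) * (i * i' - (LBINT r:{u<..v}. a r * a' r)) + fyy (X u, Y u) * (i' * i' - (LBINT r:{u<..v}. a' r * a' r))) / 2)\<bar>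
   \<le> e * ((X v - X u)^2 + (Y v - Y u)^2 + (v - u)) + C * (((X v - X u)^2 + (Y v - Y u)^2)^2 + (v - u)^2
    + (LBINT r:{u<..v}. (X r - X u)^2 + (Y r - Y u)^2)))"

lemma ito_remainder:
 assumes f: "uniform_C2 K f fx fy fxx fxy fyy" and e: "0 < e" and c: "0 \<le> c"
 obtains C where "0 \<le> C" "ito_estimate c e C f fx fy fxx fxy fyy"
proof -
 define m where "m = 2 * c + 2 * c^2"
 have m: "0 \<le> m" using c by (simp add: m_def)
 \<comment> \<open>\<open>m\<close> is the factor by which an oscillation of the derivatives enters
   the drift. This \<open>e'\<close> keeps the Taylor error within \<open>e / 2\<close> and the
   error from freezing the drift within \<open>e\<close>.\<close>
 define e' where "e' = e / (2 * m + 2)"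
 have e': "0 < e'" "e' \<le> e / 2" "m * e' \<le> e" using e m by (auto simp: e'_def field_simps)
 obtain C where C: "0 \<le> C" "\<And>g p q. g \<in> {fx, fy, fxx, fxy, fyy} ==> \<bar>g p - g q\<bar> \<le> e' + C * (dist p q)^2"
  using uniform_C2_modulus[OF f e'(1)] by blast
 have K: "0 \<le> K" "\<And>g p. g \<in> {fx, fy, fxx, fxy, fyy} ==> \<bar>g p\<bar> \<le> K" using f by (auto simp: uniform_C2_def)
 \<comment> \<open>From replacing products of increments by products of martingale parts: the
   weighted inequality with weight \<open>e / 2\<close>, applied to \<open>h\<close> and to
   \<open>k\<close>, plus the square of the drift.\<close>
 define C2 where "C2 = 4 * (K * c)^2 / e + 2 * (K * c^2)"
 have C2: "0 \<le> C2" using e K c by (simp add: C2_def)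
 have "ito_estimate c e (C + C2 + m * C) f fx fy fxx fxy fyy"
  unfolding ito_estimate_def
 proof (intro allI impI)
  fix X Y b b' a a' :: "real => real" and i i' u v
  assume cont: "\<forall>g\<in>{X, Y, b, b', a, a'}. continuous_on {0..} g"
   and bd: "\<forall>g\<in>{b, b', a, a'}. \<forall>r\<ge>0. \<bar>g r\<bar> \<le> c" and uv: "0 \<le> u" "u \<le> v"
   and X: "X v - X u = i + (LBINT r:{u<..v}. b r)" and Y: "Y v - Y u = i' + (LBINT r:{u<..v}. b' r)"
  define h where "h = X v - X u" define k where "k = Y v - Y u"
  define J where "J = (LBINT r:{u<..v}. b r)" define J' where "J' = (LBINT r:{u<..v}. b' r)"
  have ii: "i = h - J" "i' = k - J'" using X Y by (auto simp: h_def k_def J_def J'_def)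
  let ?P = "\<lambda>r. (X r, Y r)"
  let ?L = "\<lambda>p r. ito_drift fx fy fxx fxy fyy p (b r) (b' r) (a r) (a' r)"
  let ?\<rho> = "\<lambda>r. (X r - X u)^2 + (Y r - Y u)^2"
  have int: "set_integrable lborel {u<..v} g" if "continuous_on {0..} g" for g :: "real => real"
   using continuous_path_integrable[OF that uv(1), of v] by (rule set_integrable_subset) auto
  have [continuous_intros]: "continuous_on {0..} X" "continuous_on {0..} Y" "continuous_on {0..} b" "continuous_on {0..} b'"
   "continuous_on {0..} a" "continuous_on {0..} a'" using cont by auto
  have gP: "continuous_on {0..} (\<lambda>r. g (?P r))" if "g \<in> {fx, fy, fxx, fxy, fyy}" for g
   using that f by (intro continuous_on_compose2[OF square_modulus_continuous[of g UNIV]] continuous_intros) (auto simp: uniform_C2_def)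
  have [continuous_intros]: "continuous_on {0..} (\<lambda>r. fx (?P r))" "continuous_on {0..} (\<lambda>r. fy (?P r))" "continuous_on {0..} (\<lambda>r. fxx (?P r))"
   "continuous_on {0..} (\<lambda>r. fxy (?P r))" "continuous_on {0..} (\<lambda>r. fyy (?P r))" by (rule gP; simp)+
  have T: "\<bar>f (?P v) - f (?P u) - fx (?P u) * h - fy (?P u) * k
   - (fxx (?P u) * h^2 + 2 * fxy (?P u) * (h * k) + fyy (?P u) * k^2) / 2\<bar> \<le> (e' + C * (h^2 + k^2)) * (h^2 + k^2)"
   using uniform_C2_taylor[OF f C, of "X u" h "Y u" k] e' by (simp add: h_def k_def)
  let ?\<Delta> = "v - u"
  have J: "\<bar>J\<bar> \<le> c * ?\<Delta>" "\<bar>J'\<bar> \<le> c * ?\<Delta>"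
   unfolding J_def J'_def using cont bd uv by (auto intro!: set_integral_Ioc_bound)
  define Q where "Q = fxx (?P u) * (h^2 - i * i) + 2 * (fxy (?P u) * (h * k - i * i')) + fyy (?P u) * (k^2 - i' * i')"
  have Q: "\<bar>Q / 2\<bar> \<le> e / 2 * (h^2 + k^2) + C2 * ?\<Delta>^2"
  proof -
   define d where "d = c * ?\<Delta>"
   have d: "0 \<le> d" "\<bar>J\<bar> \<le> d" "\<bar>J'\<bar> \<le> d" using c uv J by (auto simp: d_def)
   have s: "\<bar>x * z\<bar> \<le> d * y" if "\<bar>x\<bar> \<le> d" "\<bar>z\<bar> \<le> y" for x y z using that by (simp add: abs_mult mult_mono)
   have "\<bar>h^2 - i * i\<bar> \<le> d * (2 * \<bar>h\<bar> + d)" "\<bar>k^2 - i' * i'\<bar> \<le> d * (2 * \<bar>k\<bar> + d)"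
    using s[OF d(2), of "2 * h - J" "2 * \<bar>h\<bar> + d"] s[OF d(3), of "2 * k - J'" "2 * \<bar>k\<bar> + d"] d
    by (auto simp: ii algebra_simps power2_eq_square)
   moreover have "\<bar>h * k - i * i'\<bar> \<le> d * (\<bar>h\<bar> + \<bar>k\<bar> + d)"
    proof -
    have "\<bar>k - J'\<bar> \<le> \<bar>k\<bar> + d" using d(3) by linarith
    then have "\<bar>J' * h + J * (k - J')\<bar> \<le> d * \<bar>h\<bar> + d * (\<bar>k\<bar> + d)"
     by (intro order_trans[OF abs_triangle_ineq] add_mono s d order_refl)
    then show ?thesis by (simp add: ii algebra_simps)
   qed
   ultimately have "\<bar>fxx (?P u) * (h^2 - i * i)\<bar> \<le> K * (d * (2 * \<bar>h\<bar> + d))"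
    "\<bar>fxy (?P u) * (h * k - i * i')\<bar> \<le> K * (d * (\<bar>h\<bar> + \<bar>k\<bar> + d))" "\<bar>fyy (?P u) * (k^2 - i' * i')\<bar> \<le> K * (d * (2 * \<bar>k\<bar> + d))"
    unfolding abs_mult using K by (auto intro!: mult_mono)
   then have "\<bar>Q / 2\<bar> \<le> (K * (d * (2 * \<bar>h\<bar> + d)) + 2 * (K * (d * (\<bar>h\<bar> + \<bar>k\<bar> + d))) + K * (d * (2 * \<bar>k\<bar> + d))) / 2"
    unfolding Q_def by (rule abs_half_sum_le)
   also have "\<dots> = \<bar>h * (2 * K * d)\<bar> + \<bar>k * (2 * K * d)\<bar> + 2 * (K * d^2)"
    using d(1) K(1) by (simp add: abs_mult algebra_simps power2_eq_square)
   also have "\<dots> \<le> (e / 2 * h^2 + (2 * K * d)^2 / (4 * (e / 2))) + (e / 2 * k^2 + (2 * K * d)^2 / (4 * (e / 2))) + 2 * (K * d^2)"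
    using e by (intro add_mono abs_mult_le_weighted order_refl) auto
   also have "\<dots> = e / 2 * (h^2 + k^2) + C2 * ?\<Delta>^2"
    using e by (simp add: C2_def d_def field_simps power2_eq_square)
   finally show ?thesis .
  qed
  \<comment> \<open>The drift is linear in the derivatives, so the error from freezing them at time
    \<open>u\<close> is estimated by \<open>ito_drift_le\<close> with their oscillation as the
    bound.\<close>
  have Ld: "?L p r - ?L q r = ito_drift (\<lambda>_. fx p - fx q) (\<lambda>_. fy p - fy q) (\<lambda>_. fxx p - fxx q) (\<lambda>_. fxy p - fxy q) (\<lambda>_. fyy p - fyy q) p
    (b r) (b' r) (a r) (a' r)" for p q r
   by (simp add: ito_drift_def algebra_simps add_divide_distrib diff_divide_distrib)
  have Lc: "continuous_on {0..} (\<lambda>r. ?L (?P r) r)" "continuous_on {0..} (\<lambda>r. ?L (?P u) r)"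
   unfolding ito_drift_def by (intro continuous_intros; simp)+
  have Lu: "(LBINT r:{u<..v}. ?L (?P u) r) = fx (?P u) * J + fy (?P u) * J' + (fxx (?P u) * (LBINT r:{u<..v}. a r * a r)
    + 2 * fxy (?P u) * (LBINT r:{u<..v}. a r * a' r) + fyy (?P u) * (LBINT r:{u<..v}. a' r * a' r)) / 2"
  proof -
   have "set_integrable lborel {u<..v} b" "set_integrable lborel {u<..v} b'" "set_integrable lborel {u<..v} (\<lambda>r. a r * a r)"
    "set_integrable lborel {u<..v} (\<lambda>r. a r * a' r)" "set_integrable lborel {u<..v} (\<lambda>r. a' r * a' r)"
    by (intro int continuous_intros)+
   then show ?thesis unfolding ito_drift_def J_def J'_def by (simp add: set_integral_add)
  qed
  have \<rho>: "set_integrable lborel {u<..v} ?\<rho>" by (intro int continuous_intros)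
  have "\<bar>(LBINT r:{u<..v}. ?L (?P r) r) - (LBINT r:{u<..v}. ?L (?P u) r)\<bar> = \<bar>LBINT r:{u<..v}. ?L (?P r) r - ?L (?P u) r\<bar>"
   using Lc by (simp add: set_integral_diff int)
  also have "\<dots> \<le> (LBINT r:{u<..v}. \<bar>?L (?P r) r - ?L (?P u) r\<bar>)"
   using Lc by (intro set_integral_norm_bound[where f="\<lambda>r. ?L (?P r) r - ?L (?P u) r", unfolded real_norm_def] set_integral_diff int)
  also have "\<dots> \<le> (LBINT r:{u<..v}. (e' + C * ?\<rho> r) * m)"
  proof (rule set_integral_mono)
   show "set_integrable lborel {u<..v} (\<lambda>r. \<bar>?L (?P r) r - ?L (?P u) r\<bar>)" using Lc by (intro int continuous_intros)
   show "set_integrable lborel {u<..v} (\<lambda>r. (e' + C * ?\<rho> r) * m)" by (intro int continuous_intros)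
   fix r assume r: "r \<in> {u<..v}"
   have "(dist (?P r) (?P u))^2 = ?\<rho> r" by (simp add: dist_Pair_Pair dist_real_def)
   then have "\<bar>g (?P r) - g (?P u)\<bar> \<le> e' + C * ?\<rho> r" if "g \<in> {fx, fy, fxx, fxy, fyy}" for g
    using C(2)[OF that, of "?P r" "?P u"] by simp
   then show "\<bar>?L (?P r) r - ?L (?P u) r\<bar> \<le> (e' + C * ?\<rho> r) * m"
    unfolding m_def Ld using r uv bd by (intro ito_drift_le) auto
  qed
  also have "\<dots> = m * e' * ?\<Delta> + m * C * (LBINT r:{u<..v}. ?\<rho> r)"
  proof -
   have "set_integrable lborel {u<..v} (\<lambda>r. e' * m)" by (intro int continuous_intros)
   then have "(LBINT r:{u<..v}. e' * m + C * m * ?\<rho> r) = (LBINT r:{u<..v}. e' * m) + C * m * (LBINT r:{u<..v}. ?\<rho> r)"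
    using \<rho> by (subst set_integral_add) (auto simp: set_integral_mult_right)
   moreover have "(LBINT r:{u<..v}. e' * m) = e' * m * ?\<Delta>" using uv by (simp add: set_lebesgue_integral_def)
   ultimately show ?thesis by (simp add: algebra_simps)
  qed
  finally have D: "\<bar>(LBINT r:{u<..v}. ?L (?P r) r) - (LBINT r:{u<..v}. ?L (?P u) r)\<bar>
   \<le> m * e' * ?\<Delta> + m * C * (LBINT r:{u<..v}. ?\<rho> r)" .
  have I0: "0 \<le> (LBINT r:{u<..v}. ?\<rho> r)" unfolding set_lebesgue_integral_def by (intro Bochner_Integration.integral_nonneg) auto
  have "\<bar>f (?P v) - f (?P u) - (LBINT r:{u<..v}. ?L (?P r) r)
    - (fx (?P u) * i + fy (?P u) * i' + (fxx (?P u) * (i * i - (LBINT r:{u<..v}. a r * a r))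
      + 2 * fxy (?P u) * (i * i' - (LBINT r:{u<..v}. a r * a' r)) + fyy (?P u) * (i' * i' - (LBINT r:{u<..v}. a' r * a' r))) / 2)\<bar>
   = \<bar>(f (?P v) - f (?P u) - fx (?P u) * h - fy (?P u) * k - (fxx (?P u) * h^2 + 2 * fxy (?P u) * (h * k) + fyy (?P u) * k^2) / 2)
     + Q / 2 - ((LBINT r:{u<..v}. ?L (?P r) r) - (LBINT r:{u<..v}. ?L (?P u) r))\<bar>" (is "?l = _")
   unfolding Lu Q_def ii by (rule arg_cong[where f=abs]) (simp add: field_simps power2_eq_square)
  also have "\<dots> \<le> (e' + C * (h^2 + k^2)) * (h^2 + k^2) + (e / 2 * (h^2 + k^2) + C2 * ?\<Delta>^2)
    + (m * e' * ?\<Delta> + m * C * (LBINT r:{u<..v}. ?\<rho> r))"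
   using T Q D by linarith
  also have "\<dots> = e' * (h^2 + k^2) + e / 2 * (h^2 + k^2) + m * e' * ?\<Delta>
   + (C * (h^2 + k^2)^2 + C2 * ?\<Delta>^2 + m * C * (LBINT r:{u<..v}. ?\<rho> r))"
   by (simp add: algebra_simps power2_eq_square)
  also have "\<dots> \<le> e / 2 * (h^2 + k^2) + e / 2 * (h^2 + k^2) + e * ?\<Delta>
   + ((C + C2 + m * C) * (h^2 + k^2)^2 + (C + C2 + m * C) * ?\<Delta>^2 + (C + C2 + m * C) * (LBINT r:{u<..v}. ?\<rho> r))"
   using e' uv C(1) C2 m I0 by (intro add_mono mult_right_mono) auto
  also have "\<dots> = e * (h^2 + k^2 + ?\<Delta>) + (C + C2 + m * C) * ((h^2 + k^2)^2 + ?\<Delta>^2 + (LBINT r:{u<..v}. ?\<rho> r))"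
   by (simp add: algebra_simps)
  finally show "?l \<le> e * ((X v - X u)^2 + (Y v - Y u)^2 + (v - u)) + (C + C2 + m * C) * (((X v - X u)^2 + (Y v - Y u)^2)^2 + (v - u)^2
    + (LBINT r:{u<..v}. ?\<rho> r))" by (simp add: h_def k_def)
 qed
 moreover have "0 \<le> C + C2 + m * C" using C(1) C2 m by simp
 ultimately show ?thesis by (rule that[rotated])
qed

lemma uniform_C2_lipschitz:
 assumes f: "uniform_C2 K f fx fy fxx fxy fyy"
 shows "\<bar>f (x', y') - f (x, y)\<bar> \<le> K * (\<bar>x' - x\<bar> + \<bar>y' - y\<bar>)"
proof -
 let ?p = "\<lambda>s. (x + s * (x' - x), y + s * (y' - y))"
 have "\<exists>s::real. 0 < s \<and> s < 1 \<and> f (?p 1) - f (?p 0) = (1 - 0) * (fx (?p s) * (x' - x) + fy (?p s) * (y' - y))"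
  using f by (intro MVT2) (auto simp: uniform_C2_def)
 then obtain s where "f (?p 1) - f (?p 0) = fx (?p s) * (x' - x) + fy (?p s) * (y' - y)" by auto
 moreover have "\<bar>fx (?p s) * (x' - x)\<bar> \<le> K * \<bar>x' - x\<bar>" "\<bar>fy (?p s) * (y' - y)\<bar> \<le> K * \<bar>y' - y\<bar>"
  unfolding abs_mult using f by (auto simp: uniform_C2_def intro!: mult_right_mono)
 ultimately show ?thesis using abs_triangle_ineq[of "fx (?p s) * (x' - x)" "fy (?p s) * (y' - y)"]
  by (simp add: distrib_left)
qed

lemma uniform_C2_continuous:
 assumes f: "uniform_C2 K f fx fy fxx fxy fyy" shows "continuous_on UNIV f"
proof (rule square_modulus_continuous)
 show "square_modulus f"
  unfolding square_modulus_def
 proof (intro allI impI)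
  fix e :: real assume e: "0 < e"
  have "\<bar>f p - f q\<bar> \<le> e + (2 * K)^2 / (4 * e) * (dist p q)^2" for p q
  proof -
   have "\<bar>f p - f q\<bar> \<le> K * (dist (fst p) (fst q) + dist (snd p) (snd q))"
    using uniform_C2_lipschitz[OF f, of "fst p" "snd p" "fst q" "snd q"] by (simp add: dist_real_def)
   also have "\<dots> \<le> K * (dist p q + dist p q)"
    using f by (intro mult_left_mono add_mono dist_fst_le dist_snd_le) (simp add: uniform_C2_def)
   also have "\<dots> \<le> \<bar>1 * (2 * K * dist p q)\<bar>" by simp
   also have "\<dots> \<le> e * 1^2 + (2 * K * dist p q)^2 / (4 * e)" by (rule abs_mult_le_weighted[OF e])
   finally show ?thesis by (simp add: power_mult_distrib)
  qed
  then show "\<exists>C\<ge>0. \<forall>p q. \<bar>f p - f q\<bar> \<le> e + C * (dist p q)^2" using e by (intro exI[of _ "(2 * K)^2 / (4 * e)"]) auto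
 qed
qed

text \<open>Such a function has derivative 0 everywhere. It makes sums over partitions unnecessary:
  a martingale property follows from an estimate over one short step.\<close>

lemma constant_by_modulus:
 fixes G :: "real => real"
 assumes G: "\<And>e. 0 < e ==> \<exists>C\<ge>0. \<forall>u v. s \<le> u \<and> u \<le> v \<and> v \<le> u + 1 \<longrightarrow> \<bar>G v - G u\<bar> \<le> e * (v - u) + C * (v - u)^2"
  and st: "s \<le> t"
 shows "G t = G s"
proof -
 have "\<exists>c. \<forall>x\<in>{s..t}. G x = c"
 proof (rule has_field_derivative_zero_constant)
  fix x assume x: "x \<in> {s..t}"
  show "(G has_field_derivative 0) (at x within {s..t})"
   unfolding has_field_derivative_iff Lim_within
  proof (intro allI impI)
   fix e :: real assume e: "0 < e"
   obtain C where C: "0 \<le> C" "\<And>u v. s \<le> u ==> u \<le> v ==> v \<le> u + 1 ==> \<bar>G v - G u\<bar> \<le> e / 2 * (v - u) + C * (v - u)^2"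
    using G[of "e / 2"] e by auto
   let ?d = "min 1 (e / (2 * (C + 1)))"
   have "dist ((G y - G x) / (y - x)) 0 < e" if y: "y \<in> {s..t}" "0 < dist y x" "dist y x < ?d" for y
   proof -
    let ?h = "\<bar>y - x\<bar>"
    have h: "0 < ?h" "?h < 1" "?h < e / (2 * (C + 1))" using y by (auto simp: dist_real_def)
    have "\<bar>G y - G x\<bar> \<le> e / 2 * ?h + C * ?h^2"
     using C(2)[of x y] C(2)[of y x] x y(1) h(2) by (cases "x \<le> y") (auto simp: abs_minus_commute)
    also have "\<dots> = (e / 2 + C * ?h) * ?h" by (simp add: algebra_simps power2_eq_square)
    finally have "\<bar>G y - G x\<bar> / ?h \<le> e / 2 + C * ?h" using h(1) by (simp add: pos_divide_le_eq)
    moreover have "C * ?h < e / 2"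
    proof -
     have "(C + 1) * ?h < e / 2" using h(3) C(1) by (simp add: field_simps)
     moreover have "(C + 1) * ?h = C * ?h + ?h" by (simp add: distrib_right)
     ultimately show ?thesis using h(1) by linarith
    qed
    ultimately show ?thesis by (simp add: dist_real_def)
   qed
   moreover have "0 < ?d" using e C(1) by simp
   ultimately show "\<exists>d>0. \<forall>y\<in>{s..t}. 0 < dist y x \<and> dist y x < d \<longrightarrow> dist ((G y - G x) / (y - x)) 0 < e" by blast
  qed
 qed simp
 then show ?thesis using st by auto
qed

lemma (in prob_space) expectation_set_integral_le:
 fixes g :: "real => 'a => real"
 assumes [measurable]: "(\<lambda>p. g (fst p) (snd p)) \<in> borel_measurable (borel \<Otimes>\<^sub>M M)"
  and nn: "\<And>r w. r \<in> {u<..v} ==> w \<in> space M ==> 0 \<le> g r w"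
  and g: "\<And>r. r \<in> {u<..v} ==> integrable M (g r)" "\<And>r. r \<in> {u<..v} ==> \<E> (g r) \<le> K" and uv: "u \<le> v" and K: "0 \<le> K"
 shows "integrable M (\<lambda>w. LBINT r:{u<..v}. g r w)" "\<E> (\<lambda>w. LBINT r:{u<..v}. g r w) \<le> K * (v - u)"
proof -
 interpret pair_sigma_finite lborel M ..
 let ?G = "\<lambda>w. LBINT r:{u<..v}. g r w"
 let ?g = "\<lambda>r w. ennreal (indicator {u<..v} r *\<^sub>R g r w)"
 have [measurable]: "?G \<in> borel_measurable M" by (rule set_integral_joint_measurable) auto
 have [measurable]: "(\<lambda>(r, w). ?g r w) \<in> borel_measurable (lborel \<Otimes>\<^sub>M M)"
  by (subst measurable_cong_sets[OF sets_pair_measure_cong[OF sets_lborel refl] refl]) (simp add: case_prod_beta)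
 have G0: "0 \<le> ?G w" if "w \<in> space M" for w
  unfolding set_lebesgue_integral_def using nn that by (intro Bochner_Integration.integral_nonneg) (auto simp: indicator_def)
 have "(\<integral>\<^sup>+w. ennreal (?G w) \<partial>M) \<le> (\<integral>\<^sup>+w. \<integral>\<^sup>+r. ?g r w \<partial>lborel \<partial>M)"
 proof (rule nn_integral_mono)
  fix w assume w: "w \<in> space M"
  have [measurable]: "(\<lambda>r. g r w) \<in> borel_measurable borel"
   using w measurable_compose[OF measurable_Pair2', of w M "\<lambda>p. g (fst p) (snd p)" borel] assms(1) by simp
  show "ennreal (?G w) \<le> (\<integral>\<^sup>+r. ?g r w \<partial>lborel)"
   unfolding set_lebesgue_integral_def
   using nn w by (subst integral_eq_nn_integral) (auto simp: indicator_def ennreal_enn2real_if)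
 qed
 also have "\<dots> = (\<integral>\<^sup>+r. \<integral>\<^sup>+w. ?g r w \<partial>M \<partial>lborel)" by (rule Fubini') measurable
 also have "\<dots> \<le> (\<integral>\<^sup>+r. ennreal K * indicator {u<..v} r \<partial>lborel)"
 proof (rule nn_integral_mono)
  fix r
  show "(\<integral>\<^sup>+w. ?g r w \<partial>M) \<le> ennreal K * indicator {u<..v} r"
  proof (cases "r \<in> {u<..v}")
   case True
   then have "(\<integral>\<^sup>+w. ?g r w \<partial>M) = ennreal (\<E> (g r))"
    using nn g(1) by (simp add: nn_integral_eq_integral AE_I2)
   then show ?thesis using True g(2) by (simp add: ennreal_leI)
  qed simp
 qed
 also have "\<dots> = ennreal (K * (v - u))" using uv K by (simp add: nn_integral_cmult_indicator ennreal_mult)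
 finally have le: "(\<integral>\<^sup>+w. ennreal (?G w) \<partial>M) \<le> ennreal (K * (v - u))" .
 show i: "integrable M ?G"
  using le G0 by (intro integrableI_nonneg) (auto simp: AE_I2 intro: le_less_trans)
 have "ennreal (\<E> ?G) = (\<integral>\<^sup>+w. ennreal (?G w) \<partial>M)" using i G0 by (intro nn_integral_eq_integral[symmetric]) auto
 then have "ennreal (\<E> ?G) \<le> ennreal (K * (v - u))" using le by simp
 then show "\<E> ?G \<le> K * (v - u)" using uv K by (subst (asm) ennreal_le_iff) auto
qed

context filtered_prob_space
begin

lemma continuous_adapted_add:
 assumes "adapted X" "adapted Y"
 shows "adapted (\<lambda>t w. X t w + Y t w)"
 using assms unfolding continuous_adapted_def by (simp add: borel_measurable_add continuous_on_add)

lemma continuous_adapted_mult: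
 assumes "adapted X" "adapted Y"
 shows "adapted (\<lambda>t w. X t w * Y t w)"
 using assms unfolding continuous_adapted_def by (simp add: borel_measurable_times continuous_on_mult)

lemma continuous_adapted_compose2:
 assumes X: "adapted X" "adapted Y" and g: "continuous_on UNIV (g :: real \<times> real => real)"
 shows "adapted (\<lambda>t w. g (X t w, Y t w))"
 unfolding continuous_adapted_def
proof (intro conjI allI impI ballI)
 have gm: "g \<in> borel_measurable (borel \<Otimes>\<^sub>M borel)" using borel_measurable_continuous_onI[OF g] by (simp add: borel_prod)
 show "(\<lambda>w. g (X t w, Y t w)) \<in> borel_measurable (F t)" if "0 \<le> t" for t
  by (rule measurable_compose[OF measurable_Pair gm]) (rule continuous_adapted_measurable[OF _ that], rule X)+
 show "continuous_on {0..} (\<lambda>t. g (X t w, Y t w))" if "w \<in> space M" for w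
  using X that by (intro continuous_on_compose2[OF g]) (auto simp: continuous_adapted_def intro!: continuous_intros)
qed

lemma continuous_adapted_integral:
 assumes \<beta>: "adapted \<beta>" and bd: "\<And>r w. 0 \<le> r ==> w \<in> space M ==> \<bar>\<beta> r w\<bar> \<le> c"
 shows "adapted (\<lambda>t w. LBINT r:{0..t}. \<beta> r w)"
 unfolding continuous_adapted_def
proof (intro conjI allI impI ballI)
 show "(\<lambda>w. LBINT r:{0..t}. \<beta> r w) \<in> borel_measurable (F t)" if "0 \<le> t" for t
  by (rule set_integral_path_measurable[OF \<beta> _ that]) simp
 fix w assume w: "w \<in> space M"
 let ?V = "\<lambda>t. LBINT r:{0..t}. \<beta> r w"
 have c: "continuous_on {0..} (\<lambda>r. \<beta> r w)" using \<beta> w by (simp add: continuous_adapted_def)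
 have c0: "0 \<le> c" using bd[OF _ w, of 0] by force
 have 1: "\<bar>?V y - ?V x\<bar> \<le> c * \<bar>y - x\<bar>" if "0 \<le> x" "x \<le> y" for x y
  using set_integral_lipschitz[OF c bd[OF _ w] that] that by simp
 have "c-lipschitz_on {0..} ?V"
 proof (rule lipschitz_onI[OF _ c0])
  fix x y :: real assume "x \<in> {0..}" "y \<in> {0..}"
  then show "dist (?V x) (?V y) \<le> c * dist x y"
   using 1[of x y] 1[of y x] by (cases "x \<le> y") (auto simp: dist_real_def abs_minus_commute)
 qed
 then show "continuous_on {0..} ?V" by (rule lipschitz_on_continuous_on)
qed

lemma set_integral_incr_measurable:
 assumes \<beta>: "adapted \<beta>" and st: "0 \<le> s" "s \<le> t"
 shows "(\<lambda>w. LBINT r:{s<..t}. \<beta> r w) \<in> borel_measurable M"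
proof -
 have m: "(\<lambda>w. LBINT r:{0..x}. \<beta> r w) \<in> borel_measurable M" if "0 \<le> x" for x
  by (rule measurable_F[OF that set_integral_path_measurable[OF \<beta> _ that]]) simp
 have "(\<lambda>w. (LBINT r:{0..t}. \<beta> r w) - (LBINT r:{0..s}. \<beta> r w)) \<in> borel_measurable M"
  using st by (intro borel_measurable_diff m) auto
 moreover have "(LBINT r:{s<..t}. \<beta> r w) = (LBINT r:{0..t}. \<beta> r w) - (LBINT r:{0..s}. \<beta> r w)" if "w \<in> space M" for w
  using set_integral_Icc_combine[OF _ st, of "\<lambda>r. \<beta> r w"] \<beta> that by (simp add: continuous_adapted_def)
 ultimately show ?thesis by (simp cong: measurable_cong)
qed

end

section \<open>Ito's formula as a martingale property\<close>

context brownian_space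
begin

lemma bounded_integral_product_bound:
 assumes BI: "bounded_integral c H I" and BI': "bounded_integral c' H' I'" and st: "0 \<le> s" "s \<le> t" and w: "w \<in> space M"
 shows "\<bar>LBINT r:{s<..t}. H r w * H' r w\<bar> \<le> c * c' * (t - s)"
proof (rule set_integral_Ioc_bound[OF _ _ st])
 have "continuous_on {0..} (\<lambda>r. H r w)" "continuous_on {0..} (\<lambda>r. H' r w)"
  using BI BI' w by (simp_all add: continuous_adapted_def bounded_integral_def)
 then show "continuous_on {0..} (\<lambda>r. H r w * H' r w)" by (rule continuous_on_mult)
 show "\<bar>H r w * H' r w\<bar> \<le> c * c'" if "0 \<le> r" for r
  unfolding abs_mult using BI BI' w that by (intro mult_mono) (auto simp: bounded_integral_def)
qed

lemma bounded_integral_product_zero: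
 assumes BI: "bounded_integral c H I" and BI': "bounded_integral c' H' I'" and st: "0 \<le> s" "s \<le> t"
  and \<eta>: "\<eta> \<in> borel_measurable (F s)" "\<And>w. w \<in> space M ==> \<bar>\<eta> w\<bar> \<le> d"
 shows "has_bochner_integral M (\<lambda>w. \<eta> w * ((I t w - I s w) * (I' t w - I' s w) - (LBINT r:{s<..t}. H r w * H' r w))) 0"
proof -
 let ?L = "\<lambda>w. LBINT r:{s<..t}. H r w * H' r w"
 have H: "adapted (\<lambda>r w. H r w * H' r w)" using BI BI' by (intro continuous_adapted_mult) (auto simp: bounded_integral_def)
 have "integrable M ?L" by (rule bounded_integrable[OF set_integral_incr_measurable[OF H st] bounded_integral_product_bound[OF BI BI' st]])
 then have "integrable M (\<lambda>w. \<eta> w * ?L w)" using \<eta> measurable_F[OF st(1) \<eta>(1)] by (intro integrable_bounded_mult) auto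
 then have "has_bochner_integral M (\<lambda>w. \<eta> w * ?L w) (\<E> (\<lambda>w. \<eta> w * ?L w))" by (rule has_bochner_integral_integrable)
 from has_bochner_integral_diff[OF bounded_integral_product[OF BI BI' st \<eta>] this] show ?thesis by (simp add: right_diff_distrib)
qed

lemma ito_process_incr:
 assumes X: "ito_process c X H \<beta> I"
 shows "AE w in M. \<forall>s\<ge>0. \<forall>t\<ge>s. X t w - X s w = (I t w - I s w) + (LBINT r:{s<..t}. \<beta> r w)"
proof -
 have "AE w in M. \<forall>t\<ge>0. X t w = X 0 w + I t w + (LBINT r:{0..t}. \<beta> r w)" using X by (simp add: ito_process_def)
 then show ?thesis using AE_space
 proof eventually_elim
  case (elim w)
  show ?case
  proof (intro allI impI)
   fix s t :: real assume st: "0 \<le> s" "s \<le> t"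
   have "continuous_on {0..} (\<lambda>r. \<beta> r w)" using X elim(2) by (simp add: ito_process_def continuous_adapted_def)
   from set_integral_Icc_combine[OF this st] elim(1)[rule_format, of s] elim(1)[rule_format, of t] st
   show "X t w - X s w = (I t w - I s w) + (LBINT r:{s<..t}. \<beta> r w)" by simp
  qed
 qed
qed

text \<open>The increment is a martingale part of order \<open>sqrt (t - s)\<close> plus a drift of
  order \<open>t - s\<close>. For steps of length at most 1 the powers of \<open>t - s\<close> are
  those of Brownian motion.\<close>

lemma ito_process_moments:
 assumes X: "ito_process c X H \<beta> I" and st: "0 \<le> s" "s \<le> t"
 shows "integrable M (\<lambda>w. (X t w - X s w)^2)" "integrable M (\<lambda>w. (X t w - X s w)^4)"
  "t \<le> s + 1 ==> \<E> (\<lambda>w. (X t w - X s w)^2) \<le> 16 * c^2 * (t - s)"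
  "t \<le> s + 1 ==> \<E> (\<lambda>w. (X t w - X s w)^4) \<le> 32 * c^4 * (t - s)^2"
proof -
 have BI: "bounded_integral c H I" and c: "0 \<le> c" and Xc: "adapted X" "adapted \<beta>" "adapted I"
  using X by (auto simp: ito_process_def bounded_integral_def has_local_mart_integral_def)
 note Im = bounded_integral_moment4[OF BI st]
 let ?\<Delta> = "t - s"
 have [measurable]: "X t \<in> borel_measurable M" "X s \<in> borel_measurable M" "I t \<in> borel_measurable M" "I s \<in> borel_measurable M"
  using continuous_adapted_measurable_M[OF Xc(1)] continuous_adapted_measurable_M[OF Xc(3)] st by auto
 have "has_bochner_integral M (\<lambda>w. 1 * ((I t w - I s w) * (I t w - I s w))) (\<E> (\<lambda>w. 1 * (LBINT r:{s<..t}. H r w * H r w)))"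
  by (rule bounded_integral_product[OF BI BI st, where d=1]) auto
 then have I2: "integrable M (\<lambda>w. (I t w - I s w)^2)" "\<E> (\<lambda>w. (I t w - I s w)^2) = \<E> (\<lambda>w. LBINT r:{s<..t}. H r w * H r w)"
  by (simp_all add: has_bochner_integral_iff power2_eq_square)
 have H: "adapted (\<lambda>r w. H r w * H r w)" using BI by (intro continuous_adapted_mult) (auto simp: bounded_integral_def)
 note Hb = bounded_integral_product_bound[OF BI BI st]
 have "\<E> (\<lambda>w. LBINT r:{s<..t}. H r w * H r w) \<le> \<E> (\<lambda>_. c * c * ?\<Delta>)"
  using Hb bounded_integrable[OF set_integral_incr_measurable[OF H st] Hb] by (intro integral_mono) (auto simp: abs_le_iff)
 then have I2b: "\<E> (\<lambda>w. (I t w - I s w)^2) \<le> c^2 * ?\<Delta>"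
  unfolding I2(2) by (simp add: prob_space power2_eq_square)
 have J: "AE w in M. \<exists>J. X t w - X s w = (I t w - I s w) + J \<and> \<bar>J\<bar> \<le> c * ?\<Delta>"
  using ito_process_incr[OF X] AE_space
 proof eventually_elim
  case (elim w)
  have "\<bar>LBINT r:{s<..t}. \<beta> r w\<bar> \<le> c * ?\<Delta>"
   using X elim(2) by (intro set_integral_Ioc_bound st) (auto simp: ito_process_def continuous_adapted_def)
  then show ?case using elim(1) st by blast
 qed
 have le: "AE w in M. (X t w - X s w)^k \<le> 8 * (I t w - I s w)^k + 8 * (c * ?\<Delta>)^k" if k: "k \<in> {2, 4}" for k
  using J
 proof eventually_elim
  case (elim w)
  then obtain J where J: "X t w - X s w = (I t w - I s w) + J" "\<bar>J\<bar> \<le> c * ?\<Delta>" by blast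
  have "(x + y)^2 \<le> 8 * x^2 + 8 * y^2" for x y :: real
   using zero_le_power2[of "x - y"] zero_le_power2[of x] zero_le_power2[of y] unfolding power2_sum power2_diff by linarith
  then have "((I t w - I s w) + J)^k \<le> 8 * (I t w - I s w)^k + 8 * \<bar>J\<bar>^k"
   using power4_sum_le[of "I t w - I s w" J] k by auto
  also have "\<bar>J\<bar>^k \<le> (c * ?\<Delta>)^k" using J(2) by (intro power_mono) auto
  finally show ?case using J(1) by simp
 qed
 have i: "integrable M (\<lambda>w. (X t w - X s w)^k)" if k: "k \<in> {2, 4}" for k
 proof (rule Bochner_Integration.integrable_bound)
  show "integrable M (\<lambda>w. 8 * (I t w - I s w)^k + 8 * (c * ?\<Delta>)^k)" using k I2(1) Im(1) by auto
  have nn: "0 \<le> (y::real)^k" for y using k by auto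
  show "AE w in M. norm ((X t w - X s w)^k) \<le> norm (8 * (I t w - I s w)^k + 8 * (c * ?\<Delta>)^k)"
   using le[OF k] by eventually_elim (use nn in \<open>simp add: abs_of_nonneg\<close>)
 qed measurable
 show i2: "integrable M (\<lambda>w. (X t w - X s w)^2)" and i4: "integrable M (\<lambda>w. (X t w - X s w)^4)" by (rule i; simp)+
 assume t: "t \<le> s + 1"
 have \<Delta>: "?\<Delta>^2 \<le> ?\<Delta>" "?\<Delta>^4 \<le> ?\<Delta>^2" using st t power_decreasing[of 1 2 ?\<Delta>] power_decreasing[of 2 4 ?\<Delta>] by auto
 have "\<E> (\<lambda>w. (X t w - X s w)^k) \<le> 8 * \<E> (\<lambda>w. (I t w - I s w)^k) + 8 * (c^k * ?\<Delta>^k)" if k: "k \<in> {2, 4}" for k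
 proof -
  have iI: "integrable M (\<lambda>w. (I t w - I s w)^k)" using k I2(1) Im(1) by auto
  have "\<E> (\<lambda>w. (X t w - X s w)^k) \<le> \<E> (\<lambda>w. 8 * (I t w - I s w)^k + 8 * (c * ?\<Delta>)^k)"
   using le[OF k] iI i[OF k] by (intro integral_mono_AE) auto
  also have "\<dots> = 8 * \<E> (\<lambda>w. (I t w - I s w)^k) + 8 * (c^k * ?\<Delta>^k)" using iI by (simp add: prob_space power_mult_distrib)
  finally show ?thesis .
 qed
 from this[of 2] this[of 4]
 show "\<E> (\<lambda>w. (X t w - X s w)^2) \<le> 16 * c^2 * ?\<Delta>" "\<E> (\<lambda>w. (X t w - X s w)^4) \<le> 32 * c^4 * ?\<Delta>^2"
  using I2b Im(2) mult_left_mono[OF \<Delta>(1) zero_le_power2[of c]] mult_left_mono[OF \<Delta>(2), of "c^4"] by simp_all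
qed

text \<open>Tested on an event \<open>A\<close> of \<open>F s\<close>, the expectation
  \<open>G u\<close> is constant in \<open>u\<close>. Over one step the first and second order terms
  have expectation 0, by the martingale property and the product formula, and the pathwise remainder
  has expectation at most \<open>e * (v - u)\<close> plus a multiple of \<open>(v - u)^2\<close>,
  with \<open>e\<close> arbitrarily small.\<close>

theorem ito_L2_martingale:
 assumes X: "ito_process c X H \<beta> I" and Y: "ito_process c Y H' \<beta>' I'" and f: "uniform_C2 K f fx fy fxx fxy fyy"
 defines "L \<equiv> \<lambda>r w. ito_drift fx fy fxx fxy fyy (X r w, Y r w) (\<beta> r w) (\<beta>' r w) (H r w) (H' r w)"
 shows "adapted L" "\<And>r w. 0 \<le> r ==> w \<in> space M ==> \<bar>L r w\<bar> \<le> K * (2 * c + 2 * c^2)"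
  "L2_martingale (\<lambda>t w. f (X t w, Y t w) - f (X 0 w, Y 0 w) - (LBINT r:{0..t}. L r w))"
proof -
 let ?P = "\<lambda>t w. (X t w, Y t w)"
 have BI: "bounded_integral c H I" "bounded_integral c H' I'" and c: "0 \<le> c"
  and ca: "adapted X" "adapted Y" "adapted \<beta>" "adapted \<beta>'"
   "adapted H" "adapted H'"
  and bd: "\<And>r w. 0 \<le> r ==> w \<in> space M ==> \<bar>\<beta> r w\<bar> \<le> c \<and> \<bar>\<beta>' r w\<bar> \<le> c \<and> \<bar>H r w\<bar> \<le> c \<and> \<bar>H' r w\<bar> \<le> c"
  using X Y by (auto simp: ito_process_def bounded_integral_def)
 have K: "0 \<le> K" "\<And>g p. g \<in> {fx, fy, fxx, fxy, fyy} ==> \<bar>g p\<bar> \<le> K"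
  "\<And>g. g \<in> {fx, fy, fxx, fxy, fyy} ==> continuous_on UNIV g"
  using f by (auto simp: uniform_C2_def square_modulus_continuous)
 have gP: "adapted (\<lambda>t w. g (?P t w))" if "g \<in> {fx, fy, fxx, fxy, fyy}" for g
  by (rule continuous_adapted_compose2[OF ca(1,2) K(3)[OF that]])
 have half: "adapted (\<lambda>t w. Z t w / 2)" if "adapted Z" for Z
  by (rule continuous_adapted_compose[OF that]) (intro continuous_intros, simp)
 have two: "adapted (\<lambda>t w. 2 * Z t w)" if "adapted Z" for Z
  by (rule continuous_adapted_compose[OF that]) (intro continuous_intros)
 show Lc: "adapted L" unfolding L_def ito_drift_def
  by (intro continuous_adapted_add continuous_adapted_mult half two gP ca) simp_all
 show Lb: "\<bar>L r w\<bar> \<le> K * (2 * c + 2 * c^2)" if "0 \<le> r" "w \<in> space M" for r w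
  unfolding L_def using bd[OF that] K(2) by (intro ito_drift_le) auto
 let ?M = "\<lambda>t w. f (?P t w) - f (?P 0 w) - (LBINT r:{0..t}. L r w)"
 have fc: "adapted (\<lambda>t w. f (?P t w))" by (rule continuous_adapted_compose2[OF ca(1,2) uniform_C2_continuous[OF f]])
 have f0: "adapted (\<lambda>t w. f (?P 0 w))"
  using continuous_adapted_measurable_le[OF fc, of 0] by (simp add: continuous_adapted_def)
 note iLc = continuous_adapted_integral[OF Lc Lb]
 have Mc: "adapted ?M" by (intro continuous_adapted_diff fc f0 iLc)
 have meas: "Z t \<in> borel_measurable M" if "adapted Z" "0 \<le> t" for Z t by (rule continuous_adapted_measurable_M[OF that])
 have M2: "integrable M (\<lambda>w. (?M t w)^2)" if t: "0 \<le> t" for t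
 proof (rule integrable_diff_L2)
  have [measurable]: "(\<lambda>w. f (?P t w)) \<in> borel_measurable M" "(\<lambda>w. f (?P 0 w)) \<in> borel_measurable M"
   using meas[OF fc t] meas[OF fc order_refl] .
  show "(\<lambda>w. f (?P t w) - f (?P 0 w)) \<in> borel_measurable M" by measurable
  show iLm: "(\<lambda>w. LBINT r:{0..t}. L r w) \<in> borel_measurable M" by (rule meas[OF iLc t])
  show "integrable M (\<lambda>w. (f (?P t w) - f (?P 0 w))^2)"
  proof (rule Bochner_Integration.integrable_bound)
   show "integrable M (\<lambda>w. K^2 * (2 * (X t w - X 0 w)^2 + 2 * (Y t w - Y 0 w)^2))"
    using ito_process_moments(1)[OF X order_refl t] ito_process_moments(1)[OF Y order_refl t] by simp
   show "AE w in M. norm ((f (?P t w) - f (?P 0 w))^2) \<le> norm (K^2 * (2 * (X t w - X 0 w)^2 + 2 * (Y t w - Y 0 w)^2))"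
   proof (rule AE_I2)
    fix w
    have "\<bar>f (?P t w) - f (?P 0 w)\<bar>^2 \<le> (K * (\<bar>X t w - X 0 w\<bar> + \<bar>Y t w - Y 0 w\<bar>))^2"
     by (intro power_mono uniform_C2_lipschitz[OF f]) auto
    also have "\<dots> \<le> K^2 * (2 * (X t w - X 0 w)^2 + 2 * (Y t w - Y 0 w)^2)"
     using two_mult_le_squares[of "X t w - X 0 w" "Y t w - Y 0 w"]
     unfolding power_mult_distrib by (intro mult_left_mono) (auto simp: power2_sum abs_mult)
    finally show "norm ((f (?P t w) - f (?P 0 w))^2) \<le> norm (K^2 * (2 * (X t w - X 0 w)^2 + 2 * (Y t w - Y 0 w)^2))" by simp
   qed
  qed measurable
  have "\<bar>LBINT r:{0..t}. L r w\<bar> \<le> K * (2 * c + 2 * c^2) * t" if w: "w \<in> space M" for w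
  proof -
   have "(LBINT r:{0..t}. L r w) = (LBINT r:{0..t}. L (max 0 r) w)"
    by (intro set_lebesgue_integral_cong) (auto simp: max_absorb2)
   then show ?thesis
    using Lc Lb w t set_integral_Icc_bounded(2)[OF continuous_on_max_0(2)[of "\<lambda>r. L r w"], of 0 t "K * (2 * c + 2 * c^2)"]
    by (simp add: continuous_adapted_def)
  qed
  then have "\<bar>(LBINT r:{0..t}. L r w)^2\<bar> \<le> (K * (2 * c + 2 * c^2) * t)^2" if "w \<in> space M" for w
   using that power_mono[of "\<bar>LBINT r:{0..t}. L r w\<bar>" _ 2] by simp
  then show "integrable M (\<lambda>w. (LBINT r:{0..t}. L r w)^2)" using iLm by (intro bounded_integrable) auto
 qed
 have M1: "integrable M (?M t)" if "0 \<le> t" for t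
  by (rule square_integrable_imp_integrable[OF meas[OF Mc that] M2[OF that]])
 show "L2_martingale ?M"
 proof (rule L2_martingaleI[OF Mc M2])
  fix s t A assume st: "0 \<le> s" "s \<le> t" and A: "A \<in> sets (F s)"
  have "A \<in> sets M" using A sets_F_subset[OF st(1)] by auto
  then have AM: "integrable M (\<lambda>w. indicat_real A w * ?M u w)" if "0 \<le> u" for u
   using integrable_bounded_mult[OF M1[OF that], of "indicat_real A" 1] by (simp add: indicator_le_1)
  define N where "N u w = indicat_real A w * ?M u w" for u w
  have N: "integrable M (N u)" if "0 \<le> u" for u unfolding N_def[abs_def] by (rule AM[OF that])
  define G where "G u = \<E> (N u)" for u
  have "G t = G s"
  proof (rule constant_by_modulus[OF _ st(2)])
   fix e :: real assume e: "0 < e"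
   \<comment> \<open>The factor of \<open>e'\<close> in the remainder has expectation at most
     \<open>(32 * c^2 + 1) * (v - u)\<close>.\<close>
   define e' where "e' = e / (32 * c^2 + 1)"
   have "0 < 32 * c^2 + 1" using zero_le_power2[of c] by linarith
   then have e': "0 < e'" "e' * (32 * c^2 + 1) = e" using e by (auto simp: e'_def)
   obtain C where C: "0 \<le> C" and rem: "ito_estimate c e' C f fx fy fxx fxy fyy" by (rule ito_remainder[OF f e'(1) c])
   let ?C = "C * (128 * c^4 + 1 + 32 * c^2)"
   have "\<bar>G v - G u\<bar> \<le> e * (v - u) + ?C * (v - u)^2" if uv: "s \<le> u" "u \<le> v" "v \<le> u + 1" for u v
   proof -
    have u: "0 \<le> u" "0 \<le> v" using uv st by auto
    let ?dI = "\<lambda>w. I v w - I u w" and ?dI' = "\<lambda>w. I' v w - I' u w"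
    let ?q = "\<lambda>g g' w. LBINT r:{u<..v}. g r w * g' r w"
    define \<eta> where "\<eta> g w = indicat_real A w * g (?P u w)" for g :: "real \<times> real => real" and w
    have \<eta>: "\<eta> g \<in> borel_measurable (F u)" "\<And>w. \<bar>\<eta> g w\<bar> \<le> K" if g: "g \<in> {fx, fy, fxx, fxy, fyy}" for g
    proof -
     have "A \<in> sets (F u)" using A sets_F_mono uv(1) by auto
     then show "\<eta> g \<in> borel_measurable (F u)" unfolding \<eta>_def[abs_def]
      using continuous_adapted_measurable[OF gP[OF g] u(1)] by (intro borel_measurable_times borel_measurable_indicator) auto
     show "\<bar>\<eta> g w\<bar> \<le> K" for w using K(1) K(2)[OF g] by (simp add: \<eta>_def indicator_def)
    qed
    \<comment> \<open>Collects the terms with expectation 0; their coefficients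
      \<open>\<eta>\<close> are bounded and known at time \<open>u\<close>.\<close>
    define T where "T w = \<eta> fx w * ?dI w + \<eta> fy w * ?dI' w + (\<eta> fxx w * (?dI w * ?dI w - ?q H H w)
     + 2 * (\<eta> fxy w * (?dI w * ?dI' w - ?q H H' w)) + \<eta> fyy w * (?dI' w * ?dI' w - ?q H' H' w)) / 2" for w
    have "has_bochner_integral M (\<lambda>w. \<eta> fx w * ?dI w) 0" "has_bochner_integral M (\<lambda>w. \<eta> fy w * ?dI' w) 0"
     "has_bochner_integral M (\<lambda>w. \<eta> fxx w * (?dI w * ?dI w - ?q H H w)) 0"
     "has_bochner_integral M (\<lambda>w. \<eta> fxy w * (?dI w * ?dI' w - ?q H H' w)) 0"
     "has_bochner_integral M (\<lambda>w. \<eta> fyy w * (?dI' w * ?dI' w - ?q H' H' w)) 0"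
     by (rule bounded_integral_incr[OF _ u(1) uv(2) \<eta>, OF BI(1)] bounded_integral_incr[OF _ u(1) uv(2) \<eta>, OF BI(2)]
      bounded_integral_product_zero[OF _ _ u(1) uv(2) \<eta>, OF BI(1) BI(1)] bounded_integral_product_zero[OF _ _ u(1) uv(2) \<eta>, OF BI]
      bounded_integral_product_zero[OF _ _ u(1) uv(2) \<eta>, OF BI(2) BI(2)]; simp)+
    then have T: "integrable M T" "\<E> T = 0"
     unfolding has_bochner_integral_iff T_def[abs_def] by auto
    let ?\<rho> = "\<lambda>r w. (X (max 0 r) w - X u w)^2 + (Y (max 0 r) w - Y u w)^2"
    have [measurable]: "X u \<in> borel_measurable M" "Y u \<in> borel_measurable M" using meas[OF ca(1) u(1)] meas[OF ca(2) u(1)] .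
    have \<rho>m: "(\<lambda>p. ?\<rho> (fst p) (snd p)) \<in> borel_measurable (borel \<Otimes>\<^sub>M M)"
     using continuous_adapted_joint_measurable(1)[OF ca(1)] continuous_adapted_joint_measurable(1)[OF ca(2)] by measurable
    have \<rho>i: "integrable M (?\<rho> r)" "\<E> (?\<rho> r) \<le> 32 * c^2 * (v - u)" if r: "r \<in> {u<..v}" for r
    proof -
     have r': "max 0 r = r" "u \<le> r" "r \<le> u + 1" using r u uv by auto
     show "integrable M (?\<rho> r)" unfolding r'(1)
      by (intro Bochner_Integration.integrable_add ito_process_moments(1)[OF X u(1) r'(2)] ito_process_moments(1)[OF Y u(1) r'(2)])
     have "\<E> (?\<rho> r) = \<E> (\<lambda>w. (X r w - X u w)^2) + \<E> (\<lambda>w. (Y r w - Y u w)^2)" unfolding r'(1)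
      using ito_process_moments(1)[OF X u(1) r'(2)] ito_process_moments(1)[OF Y u(1) r'(2)] by simp
     also have "\<dots> \<le> 32 * c^2 * (r - u)"
      using ito_process_moments(3)[OF X u(1) r'(2,3)] ito_process_moments(3)[OF Y u(1) r'(2,3)] by linarith
     also have "\<dots> \<le> 32 * c^2 * (v - u)" using r by (intro mult_left_mono) auto
     finally show "\<E> (?\<rho> r) \<le> 32 * c^2 * (v - u)" .
    qed
    note \<rho> = expectation_set_integral_le[OF \<rho>m _ \<rho>i uv(2), simplified]
    define R where "R w = e' * ((X v w - X u w)^2 + (Y v w - Y u w)^2 + (v - u))
     + C * (2 * (X v w - X u w)^4 + 2 * (Y v w - Y u w)^4 + (v - u)^2 + (LBINT r:{u<..v}. ?\<rho> r w))" for w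
    note mX = ito_process_moments[OF X u(1) uv(2)] and mY = ito_process_moments[OF Y u(1) uv(2)]
    have R: "integrable M R" unfolding R_def using mX(1,2) mY(1,2) \<rho>(1) uv by simp
    have "\<E> R = e' * (\<E> (\<lambda>w. (X v w - X u w)^2) + \<E> (\<lambda>w. (Y v w - Y u w)^2) + (v - u))
     + C * (2 * \<E> (\<lambda>w. (X v w - X u w)^4) + 2 * \<E> (\<lambda>w. (Y v w - Y u w)^4) + (v - u)^2
      + \<E> (\<lambda>w. LBINT r:{u<..v}. ?\<rho> r w))"
     unfolding R_def using mX(1,2) mY(1,2) \<rho>(1) uv by (simp add: prob_space)
    also have "\<dots> \<le> e' * (16 * c^2 * (v - u) + 16 * c^2 * (v - u) + (v - u))
     + C * (2 * (32 * c^4 * (v - u)^2) + 2 * (32 * c^4 * (v - u)^2) + (v - u)^2 + 32 * c^2 * (v - u) * (v - u))"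
     using e'(1) C mX(3,4) mY(3,4) uv \<rho>(2) by (intro add_mono mult_left_mono order_refl) auto
    also have "\<dots> = e' * (32 * c^2 + 1) * (v - u) + ?C * (v - u)^2" by (simp add: algebra_simps power2_eq_square)
    finally have Rle: "\<E> R \<le> e * (v - u) + ?C * (v - u)^2" by (simp only: e'(2))
    have le: "AE w in M. \<bar>N v w - N u w - T w\<bar> \<le> R w"
     using ito_process_incr[OF X] ito_process_incr[OF Y] AE_space
    proof eventually_elim
     case (elim w)
     define B where "B = fx (?P u w) * ?dI w + fy (?P u w) * ?dI' w + (fxx (?P u w) * (?dI w * ?dI w - ?q H H w)
       + 2 * fxy (?P u w) * (?dI w * ?dI' w - ?q H H' w) + fyy (?P u w) * (?dI' w * ?dI' w - ?q H' H' w)) / 2"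
     have Mvu: "?M v w - ?M u w = f (?P v w) - f (?P u w) - (LBINT r:{u<..v}. L r w)"
      using Lc elim(3) set_integral_Icc_combine[of "\<lambda>r. L r w" u v] u uv by (simp add: continuous_adapted_def)
     have TB: "T w = indicat_real A w * B" by (simp add: T_def \<eta>_def B_def algebra_simps add_divide_distrib diff_divide_distrib)
     have "\<bar>f (?P v w) - f (?P u w) - (LBINT r:{u<..v}. L r w) - B\<bar>
      \<le> e' * ((X v w - X u w)^2 + (Y v w - Y u w)^2 + (v - u)) + C * (((X v w - X u w)^2 + (Y v w - Y u w)^2)^2 + (v - u)^2
      + (LBINT r:{u<..v}. (X r w - X u w)^2 + (Y r w - Y u w)^2))"
      unfolding L_def B_def
     proof (rule rem[unfolded ito_estimate_def, rule_format, of "\<lambda>r. X r w" "\<lambda>r. Y r w" "\<lambda>r. \<beta> r w" "\<lambda>r. \<beta>' r w" "\<lambda>r. H r w" "\<lambda>r. H' r w"])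
      show "continuous_on {0..} g" if "g \<in> {\<lambda>r. X r w, \<lambda>r. Y r w, \<lambda>r. \<beta> r w, \<lambda>r. \<beta>' r w, \<lambda>r. H r w, \<lambda>r. H' r w}" for g
       using that ca elim(3) by (auto simp: continuous_adapted_def)
      show "\<bar>g r\<bar> \<le> c" if "g \<in> {\<lambda>r. \<beta> r w, \<lambda>r. \<beta>' r w, \<lambda>r. H r w, \<lambda>r. H' r w}" "0 \<le> r" for g r
       using that bd[OF _ elim(3)] by auto
     qed (use elim(1,2) u uv in auto)
     also have "(LBINT r:{u<..v}. (X r w - X u w)^2 + (Y r w - Y u w)^2) = (LBINT r:{u<..v}. ?\<rho> r w)"
      using u by (intro set_lebesgue_integral_cong) auto
     also have "((X v w - X u w)^2 + (Y v w - Y u w)^2)^2 \<le> 2 * (X v w - X u w)^4 + 2 * (Y v w - Y u w)^4"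
      using two_mult_le_squares[of "(X v w - X u w)^2" "(Y v w - Y u w)^2"] by (simp add: power2_sum abs_mult)
     finally have 1: "\<bar>?M v w - ?M u w - B\<bar> \<le> R w" using C unfolding Mvu R_def by (simp add: mult_left_mono)
     have 2: "\<bar>indicat_real A w * (?M v w - ?M u w - B)\<bar> \<le> \<bar>?M v w - ?M u w - B\<bar>"
      by (simp add: indicator_def)
     have 3: "N v w - N u w - T w = indicat_real A w * (?M v w - ?M u w - B)"
     proof -
      have "x * p - x * q - x * r = x * (p - q - r)" for x p q r :: real by (simp add: right_diff_distrib)
      then show ?thesis by (simp only: TB N_def)
     qed
     show ?case unfolding 3 by (rule order_trans[OF 2 1])
    qed
    have "G v - G u = \<E> (\<lambda>w. N v w - N u w - T w)"
     unfolding G_def using N[OF u(1)] N[OF u(2)] T by simp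
    also have "\<bar>\<dots>\<bar> \<le> \<E> R"
     using N[OF u(1)] N[OF u(2)] T(1) by (intro order_trans[OF integral_abs_bound integral_mono_AE[OF _ R le]]) auto
    finally show ?thesis using Rle by linarith
   qed
   moreover have "0 \<le> ?C" using C by simp
   ultimately show "\<exists>C\<ge>0. \<forall>u v. s \<le> u \<and> u \<le> v \<and> v \<le> u + 1 \<longrightarrow> \<bar>G v - G u\<bar> \<le> e * (v - u) + C * (v - u)^2" by blast
  qed
  moreover have "indicat_real A w * (?M t w - ?M s w) = N t w - N s w" for w by (simp only: N_def right_diff_distrib)
  ultimately show "\<E> (\<lambda>w. indicat_real A w * (?M t w - ?M s w)) = 0"
   using N[OF st(1)] N[OF order_trans[OF st]] by (simp only: G_def) simp
 qed
qed

end

section \<open>Test functions\<close>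

lemma square_modulus_lipschitz:
 assumes "\<And>p q. \<bar>g p - g q\<bar> \<le> L * dist p q" shows "square_modulus g"
 unfolding square_modulus_def
proof (intro allI impI)
 fix e :: real assume e: "0 < e"
 have "\<bar>g p - g q\<bar> \<le> e + L^2 / (4 * e) * (dist p q)^2" for p q
 proof -
  have "\<bar>g p - g q\<bar> \<le> \<bar>1 * (L * dist p q)\<bar>" using assms[of p q] by simp
  also have "\<dots> \<le> e * 1^2 + (L * dist p q)^2 / (4 * e)" by (rule abs_mult_le_weighted[OF e])
  finally show ?thesis by (simp add: power_mult_distrib)
 qed
 then show "\<exists>C\<ge>0. \<forall>p q. \<bar>g p - g q\<bar> \<le> e + C * (dist p q)^2" using e by (intro exI[of _ "L^2 / (4 * e)"]) auto
qed

lemma square_modulus_compose: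
 fixes g :: "real => real"
 assumes g: "square_modulus g" and u: "\<And>p q. \<bar>u p - u q\<bar> \<le> L * dist p q"
 shows "square_modulus (\<lambda>p. g (u p))"
 unfolding square_modulus_def
proof (intro allI impI)
 fix e :: real assume e: "0 < e"
 then obtain C where C: "0 \<le> C" "\<And>x y. \<bar>g x - g y\<bar> \<le> e + C * (dist x y)^2" using g by (auto simp: square_modulus_def)
 have "\<bar>g (u p) - g (u q)\<bar> \<le> e + C * L^2 * (dist p q)^2" for p q
 proof -
  have "C * (dist (u p) (u q))^2 \<le> C * (L * dist p q)^2"
   using u[of p q] C(1) by (intro mult_left_mono power_mono) (auto simp: dist_real_def)
  then show ?thesis using C(2)[of "u p" "u q"] by (simp add: power_mult_distrib)
 qed
 then show "\<exists>C\<ge>0. \<forall>p q. \<bar>g (u p) - g (u q)\<bar> \<le> e + C * (dist p q)^2" using C(1) by (intro exI[of _ "C * L^2"]) auto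
qed

text \<open>Boundedness makes the class closed under products, so that the conditions of
  \<open>uniform_C2\<close> can be checked by closure rules.\<close>

definition bounded_modulus :: "('a :: metric_space => real) => bool" where
 "bounded_modulus g \<longleftrightarrow> square_modulus g \<and> (\<exists>K. \<forall>p. \<bar>g p\<bar> \<le> K)"

lemma bounded_modulus_add:
 assumes "bounded_modulus g" "bounded_modulus h" shows "bounded_modulus (\<lambda>p. g p + h p)"
proof -
 have "square_modulus (\<lambda>p. g p + h p)"
  unfolding square_modulus_def
 proof (intro allI impI)
  fix e :: real assume "0 < e"
  then have "0 < e / 2" by simp
  then obtain C C' where C: "0 \<le> C" "\<And>p q. \<bar>g p - g q\<bar> \<le> e / 2 + C * (dist p q)^2"
   and C': "0 \<le> C'" "\<And>p q. \<bar>h p - h q\<bar> \<le> e / 2 + C' * (dist p q)^2"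
   using assms unfolding bounded_modulus_def square_modulus_def by meson
  have "\<bar>(g p + h p) - (g q + h q)\<bar> \<le> e + (C + C') * (dist p q)^2" for p q
   using C(2)[of p q] C'(2)[of p q] by (simp add: distrib_right)
  then show "\<exists>C\<ge>0. \<forall>p q. \<bar>(g p + h p) - (g q + h q)\<bar> \<le> e + C * (dist p q)^2" using C(1) C'(1) by (intro exI[of _ "C + C'"]) auto
 qed
 moreover obtain K K' where "\<And>p. \<bar>g p\<bar> \<le> K" "\<And>p. \<bar>h p\<bar> \<le> K'" using assms by (auto simp: bounded_modulus_def)
 then have "\<bar>g p + h p\<bar> \<le> K + K'" for p by (intro order_trans[OF abs_triangle_ineq] add_mono)
 ultimately show ?thesis by (auto simp: bounded_modulus_def)
qed

lemma bounded_modulus_mult: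
 assumes "bounded_modulus g" "bounded_modulus h" shows "bounded_modulus (\<lambda>p. g p * h p)"
proof -
 obtain K1 K2 where K12: "\<And>p. \<bar>g p\<bar> \<le> K1" "\<And>p. \<bar>h p\<bar> \<le> K2" using assms by (auto simp: bounded_modulus_def)
 define K where "K = max K1 K2"
 have b: "\<bar>g p\<bar> \<le> K" "\<bar>h p\<bar> \<le> K" for p using K12[of p] by (auto simp: K_def)
 have K: "0 \<le> K" using b(1)[of undefined] by linarith
 have "square_modulus (\<lambda>p. g p * h p)"
  unfolding square_modulus_def
 proof (intro allI impI)
  fix e :: real assume e: "0 < e"
  define d where "d = e / (2 * K + 1)"
  have d: "0 < d" "2 * K * d \<le> e" using e K by (auto simp: d_def field_simps)
  obtain C C' where C: "0 \<le> C" "\<And>p q. \<bar>g p - g q\<bar> \<le> d + C * (dist p q)^2"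
   and C': "0 \<le> C'" "\<And>p q. \<bar>h p - h q\<bar> \<le> d + C' * (dist p q)^2"
   using assms d(1) unfolding bounded_modulus_def square_modulus_def by meson
  have "\<bar>g p * h p - g q * h q\<bar> \<le> e + K * (C + C') * (dist p q)^2" for p q
  proof -
   have "\<bar>(g p - g q) * h p + g q * (h p - h q)\<bar> \<le> (d + C * (dist p q)^2) * K + K * (d + C' * (dist p q)^2)"
    using C C' b K d by (intro order_trans[OF abs_triangle_ineq] add_mono) (auto simp: abs_mult intro!: mult_mono)
   also have "\<dots> = 2 * K * d + K * (C + C') * (dist p q)^2" by (simp add: algebra_simps)
   finally show ?thesis using d(2) by (simp add: algebra_simps)
  qed
  then show "\<exists>C\<ge>0. \<forall>p q. \<bar>g p * h p - g q * h q\<bar> \<le> e + C * (dist p q)^2"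
   using C(1) C'(1) K by (intro exI[of _ "K * (C + C')"]) auto
 qed
 moreover have "\<bar>g p * h p\<bar> \<le> K * K" for p unfolding abs_mult using b K by (intro mult_mono) auto
 ultimately show ?thesis by (auto simp: bounded_modulus_def)
qed

lemma bounded_modulus_const: "bounded_modulus (\<lambda>_. c)"
 using square_modulus_lipschitz[of "\<lambda>_. c" 0] by (auto simp: bounded_modulus_def)

lemma bounded_modulus_minus: "bounded_modulus h ==> bounded_modulus (\<lambda>p. - h p)"
 using bounded_modulus_mult[OF bounded_modulus_const[of "- 1"], of h] by simp

lemma lipschitz_of_deriv:
 fixes f f' :: "real => real"
 assumes f: "\<And>x. (f has_real_derivative f' x) (at x)" and bd: "\<And>x. \<bar>f' x\<bar> \<le> L"
 shows "\<bar>f x - f y\<bar> \<le> L * dist x y"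
 using field_differentiable_bound[of UNIV f f' L x y] f bd by (simp add: dist_real_def has_field_derivative_at_within)

lemma bounded_modulusI:
 fixes f f' :: "real => real"
 assumes "\<And>x. (f has_real_derivative f' x) (at x)" "\<And>x. \<bar>f' x\<bar> \<le> L" "\<And>x. \<bar>f x\<bar> \<le> K"
 shows "bounded_modulus f"
 using assms(3) square_modulus_lipschitz[OF lipschitz_of_deriv[OF assms(1,2)]] by (auto simp: bounded_modulus_def)

lemma bounded_modulus_compose:
 fixes g :: "real => real"
 assumes "bounded_modulus g" "\<And>p q. \<bar>u p - u q\<bar> \<le> L * dist p q" shows "bounded_modulus (\<lambda>p. g (u p))"
 using assms square_modulus_compose[of g u L] by (auto simp: bounded_modulus_def)

text \<open>Chain rule for \<open>g (x + \<phi> (y - x))\<close>, where the inner function has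
  partial derivatives \<open>1 - \<phi>'\<close> and \<open>\<phi>'\<close>. The former is written
  \<open>1 + - \<phi>'\<close> so that the closure rules for sums, products and negation
  match.\<close>

lemma uniform_C2_compose:
 fixes g p q \<phi> \<phi>' \<phi>'' :: "real => real"
 assumes g: "\<And>x. (g has_real_derivative p x) (at x)" "\<And>x. (p has_real_derivative q x) (at x)"
  and pq: "bounded_modulus p" "bounded_modulus q"
  and \<phi>: "\<And>x. (\<phi> has_real_derivative \<phi>' x) (at x)" "\<And>x. (\<phi>' has_real_derivative \<phi>'' x) (at x)"
  and \<phi>b: "bounded_modulus \<phi>'" "bounded_modulus \<phi>''"
 defines "z \<equiv> \<lambda>u :: real \<times> real. snd u - fst u" and "w \<equiv> \<lambda>u :: real \<times> real. fst u + \<phi> (snd u - fst u)"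
 shows "\<exists>K. uniform_C2 K (\<lambda>u. g (w u)) (\<lambda>u. p (w u) * (1 + - \<phi>' (z u))) (\<lambda>u. p (w u) * \<phi>' (z u))
  (\<lambda>u. q (w u) * ((1 + - \<phi>' (z u)) * (1 + - \<phi>' (z u))) + p (w u) * \<phi>'' (z u))
  (\<lambda>u. q (w u) * (\<phi>' (z u) * (1 + - \<phi>' (z u))) + - (p (w u) * \<phi>'' (z u)))
  (\<lambda>u. q (w u) * (\<phi>' (z u) * \<phi>' (z u)) + p (w u) * \<phi>'' (z u))" (is "\<exists>K. uniform_C2 K _ ?fx ?fy ?fxx ?fxy ?fyy")
proof -
 obtain N where N: "\<And>x. \<bar>\<phi>' x\<bar> \<le> N" using \<phi>b(1) by (auto simp: bounded_modulus_def)
 have zl: "\<bar>z u - z v\<bar> \<le> 2 * dist u v" for u v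
  using dist_fst_le[of u v] dist_snd_le[of u v] by (simp add: z_def dist_real_def)
 have wl: "\<bar>w u - w v\<bar> \<le> (1 + 2 * N) * dist u v" for u v
 proof -
  have "0 \<le> N" using N[of 0] by linarith
  then have "N * dist (z u) (z v) \<le> N * (2 * dist u v)" using zl by (intro mult_left_mono) (auto simp: dist_real_def)
  then have "\<bar>\<phi> (z u) - \<phi> (z v)\<bar> \<le> N * (2 * dist u v)" by (rule order_trans[OF lipschitz_of_deriv[OF \<phi>(1) N]])
  then show ?thesis using dist_fst_le[of u v] by (simp add: w_def z_def dist_real_def distrib_right)
 qed
 note neg = bounded_modulus_minus and one = bounded_modulus_const[of 1]
 note bm = bounded_modulus_compose[OF pq(1) wl] bounded_modulus_compose[OF pq(2) wl]
  bounded_modulus_compose[OF \<phi>b(1) zl] bounded_modulus_compose[OF \<phi>b(2) zl]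
 have f5: "bounded_modulus ?fx" "bounded_modulus ?fy" "bounded_modulus ?fxx" "bounded_modulus ?fxy" "bounded_modulus ?fyy"
  by (intro bounded_modulus_add bounded_modulus_mult neg one bm)+
 obtain K1 K2 K3 K4 K5 where Ks: "\<And>u. \<bar>?fx u\<bar> \<le> K1" "\<And>u. \<bar>?fy u\<bar> \<le> K2" "\<And>u. \<bar>?fxx u\<bar> \<le> K3" "\<And>u. \<bar>?fxy u\<bar> \<le> K4" "\<And>u. \<bar>?fyy u\<bar> \<le> K5"
  using f5 unfolding bounded_modulus_def by blast
 define K where "K = Max {K1, K2, K3, K4, K5}"
 have le: "K1 \<le> K" "K2 \<le> K" "K3 \<le> K" "K4 \<le> K" "K5 \<le> K" by (auto simp: K_def)
 have K: "\<bar>?fx u\<bar> \<le> K" "\<bar>?fy u\<bar> \<le> K" "\<bar>?fxx u\<bar> \<le> K" "\<bar>?fxy u\<bar> \<le> K" "\<bar>?fyy u\<bar> \<le> K" for u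
  by (rule order_trans[OF Ks(1) le(1)] order_trans[OF Ks(2) le(2)] order_trans[OF Ks(3) le(3)] order_trans[OF Ks(4) le(4)] order_trans[OF Ks(5) le(5)])+
 have d: "((\<lambda>s. g (w (x + s * h, y + s * k))) has_real_derivative
    ?fx (x + s * h, y + s * k) * h + ?fy (x + s * h, y + s * k) * k) (at s)" (is ?d1)
  "((\<lambda>s. ?fx (x + s * h, y + s * k) * h + ?fy (x + s * h, y + s * k) * k) has_real_derivative
    ?fxx (x + s * h, y + s * k) * h^2 + 2 * ?fxy (x + s * h, y + s * k) * (h * k) + ?fyy (x + s * h, y + s * k) * k^2) (at s)" (is ?d2)
  for x y h k s
 proof -
  define P where "P s = (x + s * h, y + s * k)" for s
  have dz: "((\<lambda>s. z (P s)) has_real_derivative (k - h)) (at s)" unfolding z_def P_def by (auto intro!: derivative_eq_intros)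
  have "((\<lambda>s. (x + s * h) + \<phi> (z (P s))) has_real_derivative h + \<phi>' (z (P s)) * (k - h)) (at s)"
   by (rule DERIV_add[OF _ DERIV_chain2[OF \<phi>(1) dz]]) (auto intro!: derivative_eq_intros)
  then have dw: "((\<lambda>s. w (P s)) has_real_derivative h + \<phi>' (z (P s)) * (k - h)) (at s)" by (simp add: w_def z_def P_def)
  note dp = DERIV_chain2[OF g(2) dw] and d\<phi> = DERIV_chain2[OF \<phi>(2) dz]
  have "((\<lambda>s. g (w (P s))) has_real_derivative ?fx (P s) * h + ?fy (P s) * k) (at s)"
   by (rule DERIV_cong[OF DERIV_chain2[OF g(1) dw]]) (simp add: algebra_simps)
  then show ?d1 by (simp only: P_def)
  have "((\<lambda>s. ?fx (P s) * h + ?fy (P s) * k) has_real_derivative ?fxx (P s) * h^2 + 2 * ?fxy (P s) * (h * k) + ?fyy (P s) * k^2) (at s)"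
   by (rule DERIV_cong[OF DERIV_add[OF DERIV_mult[OF DERIV_mult[OF dp DERIV_add[OF DERIV_const DERIV_minus[OF d\<phi>]]] DERIV_const] DERIV_mult[OF DERIV_mult[OF dp d\<phi>] DERIV_const]]])
    (simp add: algebra_simps power2_eq_square)
  then show ?d2 by (simp only: P_def)
 qed
 have "0 \<le> K" using order_trans[OF abs_ge_zero K(1)] .
 then have "uniform_C2 K (\<lambda>u. g (w u)) ?fx ?fy ?fxx ?fxy ?fyy"
  unfolding uniform_C2_def using d K f5 by (auto simp only: bounded_modulus_def ball_simps)
 then show ?thesis by (rule exI[of _ K])
qed

text \<open>Composition with the projection onto \<open>[-r, r]\<close> leaves \<open>q\<close>
  unchanged, which reduces everything to uniform continuity on a compact interval.\<close>

lemma bounded_modulus_compact_support: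
 fixes q :: "real => real"
 assumes q: "continuous_on UNIV q" and 0: "\<And>x. r \<le> \<bar>x\<bar> ==> q x = 0" and r: "0 \<le> r"
 shows "bounded_modulus q"
proof -
 define cl where "cl x = max (- r) (min r x)" for x :: real
 have cl: "cl x \<in> {- r..r}" "q (cl x) = q x" "\<bar>cl x - cl z\<bar> \<le> \<bar>x - z\<bar>" for x z
 proof -
  show "cl x \<in> {- r..r}" "\<bar>cl x - cl z\<bar> \<le> \<bar>x - z\<bar>" using r by (auto simp: cl_def)
  show "q (cl x) = q x"
  proof (cases "\<bar>x\<bar> \<le> r")
   case False
   then have "\<bar>cl x\<bar> = r" using r by (auto simp: cl_def)
   then show ?thesis using 0[of x] 0[of "cl x"] False by simp
  qed (auto simp: cl_def)
 qed
 have qc: "continuous_on {- r..r} q" using q by (rule continuous_on_subset) simp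
 obtain K where K: "\<And>x. x \<in> {- r..r} ==> \<bar>q x\<bar> \<le> K"
  using compact_imp_bounded[OF compact_continuous_image[OF qc compact_Icc]] unfolding bounded_iff real_norm_def by blast
 then have Kx: "\<bar>q x\<bar> \<le> K" for x using cl(1,2)[of x] by metis
 have "square_modulus q"
  unfolding square_modulus_def
 proof (intro allI impI)
  fix e :: real assume e: "0 < e"
  obtain d where d: "0 < d" "\<And>x y. x \<in> {- r..r} ==> y \<in> {- r..r} ==> dist y x < d ==> dist (q y) (q x) < e"
   using compact_uniformly_continuous[OF qc] e unfolding uniformly_continuous_on_def by (metis compact_Icc)
  \<comment> \<open>Points closer than \<open>d\<close> are handled by uniform continuity. For all
    others \<open>1 \<le> (dist x y)^2 / d^2\<close>, and \<open>2 * K\<close> bounds any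
    difference.\<close>
  have "\<bar>q x - q y\<bar> \<le> e + 2 * K / d^2 * (dist x y)^2" for x y
  proof (cases "dist x y < d")
   case True
   then have "dist (q (cl x)) (q (cl y)) < e" using cl(1)[of x] cl(1)[of y] cl(3)[of x y] by (intro d(2)) (auto simp: dist_real_def)
   then have "\<bar>q x - q y\<bar> \<le> e" unfolding cl(2) dist_real_def by (rule less_imp_le)
   moreover have "0 \<le> 2 * K / d^2 * (dist x y)^2" using Kx[of 0] by (intro mult_nonneg_nonneg) auto
   ultimately show ?thesis by linarith
  next
   case False
   then have "1 \<le> (dist x y)^2 / d^2" using d(1) by (simp add: power_mono)
   moreover have "0 \<le> K" using Kx[of 0] by linarith
   ultimately have "2 * K * 1 \<le> 2 * K * ((dist x y)^2 / d^2)" by (intro mult_left_mono) auto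
   moreover have "\<bar>q x - q y\<bar> \<le> 2 * K" using Kx[of x] Kx[of y] by linarith
   ultimately show ?thesis using e by simp
  qed
  moreover have "0 \<le> 2 * K / d^2" using Kx[of 0] by auto
  ultimately show "\<exists>C\<ge>0. \<forall>x y. \<bar>q x - q y\<bar> \<le> e + C * (dist x y)^2" by blast
 qed
 then show ?thesis using Kx by (auto simp: bounded_modulus_def)
qed

section \<open>The differential equation for the test function\<close>

lemma continuous_antiderivative:
 fixes f :: "real => real"
 assumes f: "continuous_on UNIV f"
 obtains F where "\<And>x. (F has_real_derivative f x) (at x)" "F c = 0"
proof -
 have "isCont f x" for x using f by (simp add: continuous_on_eq_continuous_at)
 then have "\<exists>F. \<forall>x :: real. - \<infinity> < ereal x \<longrightarrow> ereal x < \<infinity> \<longrightarrow> (F has_vector_derivative f x) (at x)"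
  by (intro einterval_antiderivative) simp_all
 then obtain F where "\<forall>x :: real. - \<infinity> < ereal x \<longrightarrow> ereal x < \<infinity> \<longrightarrow> (F has_vector_derivative f x) (at x)" ..
 then have F: "(F has_real_derivative f x) (at x)" for x
  unfolding has_real_derivative_iff_has_vector_derivative by simp
 have "((\<lambda>x. F x - F c) has_real_derivative f x) (at x)" for x using DERIV_diff[OF F DERIV_const] by simp
 then show ?thesis by (rule that) simp
qed

text \<open>To the right of the last point of \<open>[c, y]\<close> with \<open>g \<le> 0\<close>
  the function is positive, hence does not increase; by the mean value theorem it cannot have become
  positive.\<close>

lemma barrier:
 fixes g g' :: "real => real"
 assumes g: "\<And>x. (g has_real_derivative g' x) (at x)" and c: "g c \<le> 0"
  and g': "\<And>x. c \<le> x ==> 0 < g x ==> g' x \<le> 0" and y: "c \<le> y"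
 shows "g y \<le> 0"
proof (rule ccontr)
 assume gy: "\<not> g y \<le> 0"
 have gc: "continuous_on S g" for S by (rule DERIV_continuous_on[OF has_field_derivative_at_within[OF g]])
 let ?S = "{c..y} \<inter> g -` {..0}"
 have "compact ?S" using continuous_closed_preimage[OF gc, of "{c..y}" "{..0}"]
  by (auto intro!: compact_Int_closed simp: compact_eq_bounded_closed intro: bounded_subset[OF bounded_closed_interval[of c y]])
 moreover have "c \<in> ?S" using c y by auto
 ultimately have "\<exists>s\<in>?S. \<forall>x\<in>?S. x \<le> s" using compact_attains_sup[of ?S] by blast
 then obtain s where s: "s \<in> ?S" "\<And>x. x \<in> ?S ==> x \<le> s" by blast
 have sy: "s < y" using s(1) gy by (cases "s = y") auto
 obtain x where x: "s < x" "x < y" "g y - g s = (y - s) * g' x" using MVT2[OF sy, of g g'] g by blast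
 have "0 < g x" using s(2)[of x] x s(1) by force
 then have "(y - s) * g' x \<le> 0" using g'[of x] x s(1) sy by (intro mult_nonneg_nonpos) auto
 then show False using x(3) s(1) gy by auto
qed

text \<open>\<open>g\<close>, \<open>p\<close>, \<open>q\<close> are \<open>F\<close>,
  \<open>F'\<close>, \<open>F''\<close>. With \<open>e\<close> separate from \<open>m\<close>,
  \<open>C\<close> and \<open>k\<close>, uniformity in the neighbourhood of 0 is expressed by the
  order of quantifiers.\<close>

definition test_function where
 "test_function a b R m C k e g p q \<longleftrightarrow> (\<forall>x::real. (g has_real_derivative p x) (at x)) \<and> (\<forall>x. (p has_real_derivative q x) (at x))
  \<and> bounded_modulus p \<and> bounded_modulus q \<and> (\<forall>x. m \<le> p x \<and> p x \<le> C) \<and> (\<forall>x. \<bar>(a x)^2 * q x / 2 + b x * p x\<bar> \<le> C)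
  \<and> (\<forall>x. e \<le> \<bar>x\<bar> \<and> \<bar>x\<bar> \<le> R \<longrightarrow> (a x)^2 * q x / 2 + b x * p x = k)"

text \<open>The linear equation \<open>q = 2 * w * (1 - b * p)\<close> is solved by variation of
  constants, \<open>w\<close> being a continuous cutoff of \<open>1 / a^2\<close>. Where
  \<open>p < 1 / B\<close> the solution does not decrease. Near 0, where
  \<open>b x \<ge> b 0 / 2\<close>, it does not increase once \<open>p \<ge> 2 / b 0\<close>,
  whatever the size of \<open>w\<close>. At distance at least \<open>d\<close> from 0,
  \<open>w\<close> has a bound independent of \<open>e\<close>, and growth is at most exponential.
  Hence \<open>C\<close> can be chosen before \<open>e\<close>.\<close>

lemma test_function_pos:
 fixes a b :: "real => real"
 assumes a: "continuous_on UNIV a" "\<And>x. x \<noteq> 0 ==> a x \<noteq> 0"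
  and b: "continuous_on UNIV b" "\<And>x. \<bar>b x\<bar> \<le> B" and B: "1 \<le> B" and b0: "0 < b 0" and R: "0 < R"
 obtains m C where "0 < m" "\<And>e. 0 < e ==> \<exists>g p q. test_function a b R m C 1 e g p q"
proof -
 have inv_bound: "\<exists>K>0. \<forall>x. d \<le> \<bar>x\<bar> \<and> \<bar>x\<bar> \<le> r \<longrightarrow> 1 / (a x)^2 \<le> K" if "0 < d" for d r
 proof -
  let ?S = "{x. d \<le> \<bar>x\<bar> \<and> \<bar>x\<bar> \<le> r}"
  have "compact ?S"
  proof -
   have "closed ?S" by (intro closed_Collect_conj closed_Collect_le continuous_intros)
   moreover have "bounded ?S" by (rule boundedI[of _ r]) auto
   ultimately show ?thesis by (simp add: compact_eq_bounded_closed)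
  qed
  moreover have "continuous_on ?S (\<lambda>x. 1 / (a x)^2)"
  proof (intro continuous_on_divide continuous_on_const continuous_on_power continuous_on_subset[OF a(1)] subset_UNIV ballI)
   show "(a x)^2 \<noteq> 0" if "x \<in> ?S" for x
   proof -
    have "x \<noteq> 0" using that \<open>0 < d\<close> by auto
    then show ?thesis using a(2) by simp
   qed
  qed
  ultimately have "bounded ((\<lambda>x. 1 / (a x)^2) ` ?S)" by (intro compact_imp_bounded compact_continuous_image)
  then obtain K where K: "\<And>x. x \<in> ?S ==> \<bar>1 / (a x)^2\<bar> \<le> K" unfolding bounded_iff real_norm_def by blast
  have "\<forall>x. d \<le> \<bar>x\<bar> \<and> \<bar>x\<bar> \<le> r \<longrightarrow> 1 / (a x)^2 \<le> max 1 K"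
  proof (intro allI impI)
   fix x assume "d \<le> \<bar>x\<bar> \<and> \<bar>x\<bar> \<le> r"
   then have "\<bar>1 / (a x)^2\<bar> \<le> K" by (intro K) simp
   then show "1 / (a x)^2 \<le> max 1 K" by linarith
  qed
  then show ?thesis by (intro exI[of _ "max 1 K"]) auto
 qed
 obtain d where d: "0 < d" "\<And>x. \<bar>x\<bar> \<le> d ==> b 0 / 2 \<le> b x"
 proof -
  have "\<exists>d>0. \<forall>x. dist x 0 < d \<longrightarrow> dist (b x) (b 0) < b 0 / 2"
   using b(1)[unfolded continuous_on_iff, rule_format, of 0 "b 0 / 2"] b0 by simp
  then obtain d where d: "0 < d" "\<And>x. dist x 0 < d ==> dist (b x) (b 0) < b 0 / 2" by blast
  show ?thesis
  proof (rule that[of "d / 2"])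
   fix x :: real assume "\<bar>x\<bar> \<le> d / 2"
   then have "dist (b x) (b 0) < b 0 / 2" using d(1) by (intro d(2)) (auto simp: dist_real_def)
   then show "b 0 / 2 \<le> b x" unfolding dist_real_def by linarith
  qed (use d in auto)
 qed
 \<comment> \<open>Fixed before \<open>e\<close>, because it is used only at distance at least
   \<open>d\<close> from 0.\<close>
 obtain K where K: "0 < K" "\<And>x. d \<le> \<bar>x\<bar> ==> \<bar>x\<bar> \<le> R + 1 ==> 1 / (a x)^2 \<le> K" using inv_bound[OF d(1), of "R + 1"] by blast
 \<comment> \<open>Growth rate: for \<open>p \<ge> 1\<close> and \<open>w \<le> K\<close> one has
   \<open>2 * w * (1 - b * p) \<le> 2 * K * (1 + B) * p\<close>. The exponent in \<open>C1\<close>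
   is this rate times the length \<open>2 * R + 2\<close> of the interval that carries
   \<open>w\<close>.\<close>
 define l where "l = 2 * K * (1 + B)"
 define C0 where "C0 = max 1 (2 / b 0)"
 define C1 where "C1 = C0 * exp (l * (2 * R + 2))"
 \<comment> \<open>As \<open>w * a^2 \<le> 1\<close>, the left-hand side of the equation is at most
   \<open>1 + B * C1\<close> from its second order part and drift compensation, plus another
   \<open>B * C1\<close> from \<open>b * p\<close>.\<close>
 define C where "C = 1 + 2 * B * C1"
 have l: "0 \<le> l" using K B by (simp add: l_def)
 have C1: "1 \<le> C0" "1 \<le> C1" "C1 \<le> C"
 proof -
  show C0: "1 \<le> C0" by (simp add: C0_def)
  have "1 \<le> exp (l * (2 * R + 2))" using l R by simp
  then show C1: "1 \<le> C1" using mult_mono[OF C0] C0 by (fastforce simp: C1_def)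
  have "1 * C1 \<le> (2 * B) * C1" using B C1 by (intro mult_right_mono) auto
  then show "C1 \<le> C" by (simp add: C_def)
 qed
 show ?thesis
 proof (rule that[of "1 / B" C])
  show "0 < 1 / B" using B by simp
  fix e :: real assume e: "0 < e"
  obtain K' where K': "0 < K'" "\<And>x. e \<le> \<bar>x\<bar> ==> \<bar>x\<bar> \<le> R ==> 1 / (a x)^2 \<le> K'" using inv_bound[OF e, of R] by blast
  define \<psi> where "\<psi> x = max 0 (min 1 (R + 1 - \<bar>x\<bar>))" for x :: real
  \<comment> \<open>\<open>1 / K'\<close> is a lower bound of \<open>a^2\<close> on
    \<open>e \<le> \<bar>x\<bar> \<le> R\<close>; as a floor it changes nothing there and keeps
    \<open>w\<close> continuous where \<open>a\<close> vanishes. The factor \<open>\<psi>\<close>,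
    equal to 1 on \<open>[-R, R]\<close>, gives \<open>q\<close> compact support.\<close>
  define w where "w x = \<psi> x / max ((a x)^2) (1 / K')" for x
  have M: "0 < max ((a x)^2) (1 / K')" for x using K'(1) by (simp add: less_max_iff_disj)
  have wc: "continuous_on UNIV w" unfolding w_def \<psi>_def using M by (intro continuous_intros a) (auto simp: less_le)
  have w0: "w x = 0" if "R + 1 \<le> \<bar>x\<bar>" for x using that by (simp add: w_def \<psi>_def)
  have w: "0 \<le> w x" "w x \<le> K'" "w x * (a x)^2 \<le> 1" "x \<noteq> 0 ==> w x \<le> 1 / (a x)^2" for x
  proof -
   have \<psi>: "0 \<le> \<psi> x" "\<psi> x \<le> 1" by (auto simp: \<psi>_def)
   show "0 \<le> w x" using \<psi> M[of x] by (simp add: w_def)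
   have "w x \<le> 1 / max ((a x)^2) (1 / K')" unfolding w_def using \<psi> M[of x] by (intro divide_right_mono) auto
   moreover have "1 / max ((a x)^2) (1 / K') \<le> 1 / (1 / K')" using K'(1) M[of x] by (intro divide_left_mono) auto
   moreover have "1 / max ((a x)^2) (1 / K') \<le> 1 / (a x)^2" if "x \<noteq> 0" using a(2)[OF that] M[of x] by (intro divide_left_mono) auto
   ultimately show "w x \<le> K'" "x \<noteq> 0 ==> w x \<le> 1 / (a x)^2" by auto
   have "\<psi> x * (a x)^2 \<le> 1 * max ((a x)^2) (1 / K')" using \<psi> by (intro mult_mono) auto
   then show "w x * (a x)^2 \<le> 1" using M[of x] by (simp add: w_def divide_le_eq)
  qed
  have w1: "w x * (a x)^2 = 1" if "e \<le> \<bar>x\<bar>" "\<bar>x\<bar> \<le> R" for x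
  proof -
   have "a x \<noteq> 0" using a(2)[of x] that e by auto
   then have "1 / K' \<le> (a x)^2" using K'(2)[OF that] K'(1) by (simp add: field_simps)
   then show ?thesis using that \<open>a x \<noteq> 0\<close> by (simp add: w_def \<psi>_def max_absorb1)
  qed
  define c where "c = - (R + 1)"
  have "continuous_on UNIV (\<lambda>x. 2 * w x * b x)" by (intro continuous_intros wc b(1))
  from continuous_antiderivative[OF this, of c] obtain S where S: "\<And>x. (S has_real_derivative 2 * w x * b x) (at x)" "S c = 0" by blast
  have Sc: "continuous_on UNIV S" using S(1) by (intro DERIV_continuous_on)
  have "continuous_on UNIV (\<lambda>x. 2 * w x * exp (S x))" by (intro continuous_intros wc Sc)
  from continuous_antiderivative[OF this, of c] obtain T where T: "\<And>x. (T has_real_derivative 2 * w x * exp (S x)) (at x)" "T c = 0" by blast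
  \<comment> \<open>Variation of constants with integrating factor \<open>exp S\<close>, started
    from \<open>p = 1\<close> at the left end \<open>c\<close> of the interval that carries
    \<open>w\<close>.\<close>
  define p where "p x = exp (- S x) * (1 + T x)" for x
  define q where "q x = 2 * w x * (1 - b x * p x)" for x
  have p': "(p has_real_derivative q x) (at x)" for x
   unfolding p_def[abs_def]
   by (rule DERIV_cong[OF DERIV_mult[OF DERIV_chain2[OF DERIV_exp DERIV_minus[OF S(1)]] DERIV_add[OF DERIV_const T(1)]]])
    (simp add: q_def p_def algebra_simps exp_minus)
  have const: "f x = f y" if "\<And>x. (f has_real_derivative f' x) (at x)" "\<And>z. x < z ==> z < y ==> f' z = 0" "x \<le> y" for f f' :: "real => real" and x y
  proof (cases "x = y")
   case False
   then have "x < y" using that(3) by simp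
   then have "\<exists>z. x < z \<and> z < y \<and> f y - f x = (y - x) * f' z" by (rule MVT2) (rule that(1))
   then show ?thesis using that(2) by auto
  qed simp
  have left: "w z = 0" if "z < c" for z using that R by (intro w0) (auto simp: c_def)
  have T0: "0 \<le> T x" for x
  proof (cases "c \<le> x")
   case True
   then have "T c \<le> T x"
   proof (rule DERIV_nonneg_imp_nondecreasing)
    show "\<exists>y. (T has_real_derivative y) (at z) \<and> 0 \<le> y" for z using T(1)[of z] w(1)[of z] by (intro exI[of _ "2 * w z * exp (S z)"]) simp
   qed
   then show ?thesis using T(2) by simp
  next
   case False
   then show ?thesis using const[OF T(1), of x c] T(2) left by simp
  qed
  have p0: "0 < p x" for x using T0[of x] by (simp add: p_def)
  have pc: "p c = 1" by (simp add: p_def S T)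
  have pl: "p x = 1" if "x \<le> c" for x using const[OF p', of x c] that left pc by (simp add: q_def)
  have bp: "\<bar>b x * p x\<bar> \<le> B * p x" for x unfolding abs_mult using b(2)[of x] p0[of x] by simp
  have lower: "1 / B \<le> p x" for x
  proof (cases "x \<le> c")
   case False
   have "1 / B - p x \<le> 0"
   proof (rule barrier[of "\<lambda>x. 1 / B - p x" "\<lambda>x. - q x" c])
    show "((\<lambda>x. 1 / B - p x) has_real_derivative - q x) (at x)" for x using DERIV_diff[OF DERIV_const p'] by simp
    show "- q x \<le> 0" if "0 < 1 / B - p x" for x
    proof -
     have "B * p x < 1" using that B by (simp add: field_simps)
     then show ?thesis using bp[of x] w(1)[of x] by (simp add: q_def)
    qed
   qed (use pc B False in auto)
   then show ?thesis by simp
  qed (use pl B in simp)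
  \<comment> \<open>After division by the exponential the barrier argument applies at level
    \<open>C0\<close>. For \<open>\<bar>x\<bar> \<le> d\<close> it uses the sign of
    \<open>1 - b * p\<close>, farther out the growth rate \<open>l\<close>, and beyond
    \<open>R + 1\<close> that \<open>w\<close> is 0.\<close>
  have upper1: "p x \<le> C0 * exp (l * (x - c))" if "c \<le> x" for x
  proof -
   have "p x * exp (- l * (x - c)) - C0 \<le> 0"
   proof (rule barrier[of "\<lambda>x. p x * exp (- l * (x - c)) - C0" "\<lambda>x. (q x - l * p x) * exp (- l * (x - c))" c])
    show "((\<lambda>x. p x * exp (- l * (x - c)) - C0) has_real_derivative (q x - l * p x) * exp (- l * (x - c))) (at x)" for x
    proof -
     have "((\<lambda>x. - l * (x - c)) has_real_derivative - l) (at x)" by (auto intro!: derivative_eq_intros)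
     then show ?thesis
      by (rule DERIV_cong[OF DERIV_diff[OF DERIV_mult[OF p' DERIV_chain2[OF DERIV_exp]] DERIV_const]]) (simp add: algebra_simps)
    qed
    show "(q x - l * p x) * exp (- l * (x - c)) \<le> 0" if x: "c \<le> x" "0 < p x * exp (- l * (x - c)) - C0" for x
    proof -
     have "exp (- l * (x - c)) \<le> 1" using l x(1) by simp
     then have "p x * exp (- l * (x - c)) \<le> p x * 1" using p0[of x] by (intro mult_left_mono) auto
     then have px: "C0 \<le> p x" "1 \<le> p x" using x(2) C1(1) by auto
     have lp: "0 \<le> l * p x" using l p0[of x] by simp
     have "q x \<le> l * p x"
     proof (cases "\<bar>x\<bar> \<le> d")
      case True
      have "1 \<le> b 0 / 2 * C0" using b0 by (simp add: C0_def max_def field_simps)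
      also have "\<dots> \<le> b x * p x" using d(2)[OF True] px(1) C1(1) b0 by (intro mult_mono) auto
      finally have "q x \<le> 0" using w(1)[of x] by (simp add: q_def mult_nonneg_nonpos)
      then show ?thesis using lp by linarith
     next
      case False
      show ?thesis
      proof (cases "\<bar>x\<bar> \<le> R + 1")
       case True
       have "x \<noteq> 0" using False d(1) by auto
       then have "w x \<le> K" using w(4)[of x] K(2)[of x] False True by simp
       moreover have "1 - b x * p x \<le> (1 + B) * p x" using bp[of x] px(2) by (simp add: distrib_right)
       moreover have "0 \<le> (1 + B) * p x" using B p0[of x] by simp
       ultimately have "w x * (1 - b x * p x) \<le> K * ((1 + B) * p x)"
        using w(1)[of x] K(1) by (meson mult_left_mono mult_right_mono order_trans)
       then show ?thesis by (simp add: q_def l_def)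
      qed (use lp in \<open>simp add: q_def w0\<close>)
     qed
     then show ?thesis by (simp add: mult_le_0_iff)
    qed
    show "p c * exp (- l * (c - c)) - C0 \<le> 0" using pc C1(1) by simp
   qed (use that in auto)
   then have "p x * exp (- l * (x - c)) * exp (l * (x - c)) \<le> C0 * exp (l * (x - c))" by (intro mult_right_mono) auto
   then show ?thesis by (simp add: mult.assoc flip: exp_add)
  qed
  have upper: "p x \<le> C1" for x
  proof -
   consider "x \<le> c" | "c \<le> x" "x \<le> R + 1" | "R + 1 \<le> x" using R unfolding c_def by linarith
   then show ?thesis
   proof cases
    case 1 then show ?thesis using pl C1(2) by simp
   next
    case 2
    have "C0 * exp (l * (x - c)) \<le> C1" unfolding C1_def using 2 l C1(1) by (intro mult_left_mono) (auto simp: c_def intro!: mult_left_mono)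
    then show ?thesis using upper1[OF 2(1)] by linarith
   next
    case 3
    have "C0 * exp (l * (R + 1 - c)) \<le> C1" unfolding C1_def by (simp add: c_def)
    moreover have "p x = p (R + 1)" using const[OF p', of "R + 1" x] 3 R by (simp add: q_def w0)
    ultimately show ?thesis using upper1[of "R + 1"] R by (simp add: c_def)
   qed
  qed
  have bpC: "\<bar>b x * p x\<bar> \<le> B * C1" for x using bp[of x] upper[of x] B by (meson mult_left_mono order_trans zero_le_one)
  have Leq: "(a x)^2 * q x / 2 + b x * p x = w x * (a x)^2 * (1 - b x * p x) + b x * p x" for x by (simp add: q_def)
  have Lb: "\<bar>(a x)^2 * q x / 2 + b x * p x\<bar> \<le> C" for x
  proof -
   have "\<bar>w x * (a x)^2 * (1 - b x * p x)\<bar> \<le> 1 * (1 + B * C1)"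
    unfolding abs_mult[of "w x * (a x)^2"] using w(1,3)[of x] bpC[of x] by (intro mult_mono) auto
   then have "\<bar>w x * (a x)^2 * (1 - b x * p x) + b x * p x\<bar> \<le> 1 * (1 + B * C1) + B * C1"
    by (intro order_trans[OF abs_triangle_ineq] add_mono bpC)
   then show ?thesis unfolding Leq C_def by simp
  qed
  have qb: "\<bar>q x\<bar> \<le> 2 * K' * (1 + B * C1)" for x
   unfolding q_def abs_mult using w(1,2)[of x] bpC[of x] by (intro mult_mono) auto
  have pcont: "continuous_on UNIV p" using p' by (intro DERIV_continuous_on)
  have "bounded_modulus q"
   using wc b(1) pcont R by (intro bounded_modulus_compact_support[where r="R + 1"]) (auto simp: q_def[abs_def] w0 intro!: continuous_intros)
  moreover have "bounded_modulus p" using p0 upper by (intro bounded_modulusI[OF p' qb, of C1]) (simp add: less_imp_le)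
  moreover obtain g where "\<And>x. (g has_real_derivative p x) (at x)" using continuous_antiderivative[OF pcont] by blast
  moreover have "(a x)^2 * q x / 2 + b x * p x = 1" if "e \<le> \<bar>x\<bar>" "\<bar>x\<bar> \<le> R" for x unfolding Leq w1[OF that] by simp
  moreover have "p x \<le> C" for x using upper[of x] C1(3) by linarith
  ultimately show "\<exists>g p q. test_function a b R (1 / B) C 1 e g p q"
   unfolding test_function_def using p' lower Lb by blast
 qed
qed

text \<open>Reflection of the line changes the sign of \<open>b 0\<close> and of \<open>k\<close>;
  replacing \<open>g x\<close> by \<open>- g (- x)\<close> keeps the derivative positive and
  preserves all bounds.\<close>

lemma test_function:
 fixes a b :: "real => real"
 assumes a: "continuous_on UNIV a" "\<And>x. x \<noteq> 0 ==> a x \<noteq> 0"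
  and b: "continuous_on UNIV b" "\<And>x. \<bar>b x\<bar> \<le> B" and B: "1 \<le> B" and b0: "b 0 \<noteq> 0" and R: "0 < R"
 obtains m C k where "0 < m" "\<And>e. 0 < e ==> \<exists>g p q. test_function a b R m C k e g p q"
proof (cases "0 < b 0")
 case True
 obtain m C where "0 < m" "\<And>e. 0 < e ==> \<exists>g p q. test_function a b R m C 1 e g p q"
  by (rule test_function_pos[OF a b B True R]) (assumption, rule that, assumption)
 then show ?thesis by (rule that)
next
 case False
 let ?a = "\<lambda>x. a (- x)" and ?b = "\<lambda>x. - b (- x)"
 have r: "continuous_on UNIV ?a" "continuous_on UNIV ?b"
  by (intro continuous_intros continuous_on_compose2[OF a(1)] continuous_on_compose2[OF b(1)]; simp)+
 have ra: "?a x \<noteq> 0" if "x \<noteq> 0" for x using a(2)[of "- x"] that by simp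
 have rb: "\<bar>?b x\<bar> \<le> B" "0 < ?b 0" for x using b(2)[of "- x"] b0 False by auto
 obtain m C where m: "0 < m" and ex: "\<And>e. 0 < e ==> \<exists>g p q. test_function ?a ?b R m C 1 e g p q"
  by (rule test_function_pos[OF r(1) ra r(2) rb(1) B rb(2) R]) (assumption, rule that, assumption)
 show ?thesis
 proof (rule that[OF m])
  fix e :: real assume "0 < e"
  from ex[OF this] obtain g p q where g: "\<And>x. (g has_real_derivative p x) (at x)" and p: "\<And>x. (p has_real_derivative q x) (at x)"
   and bm: "bounded_modulus p" "bounded_modulus q" and mC: "\<And>x. m \<le> p x \<and> p x \<le> C"
   and L: "\<And>x. \<bar>(?a x)^2 * q x / 2 + ?b x * p x\<bar> \<le> C" and L1: "\<And>x. e \<le> \<bar>x\<bar> ==> \<bar>x\<bar> \<le> R ==> (?a x)^2 * q x / 2 + ?b x * p x = 1" unfolding test_function_def by blast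
  have refl: "((\<lambda>x. f (- x)) has_real_derivative - f' (- x)) (at x)" if "\<And>x. (f has_real_derivative f' x) (at x)" for f f' :: "real => real" and x
   using DERIV_chain2[OF that DERIV_minus[OF DERIV_ident]] by simp
  have 1: "((\<lambda>x. - g (- x)) has_real_derivative p (- x)) (at x)" for x using DERIV_minus[OF refl[OF g]] by simp
  have 2: "((\<lambda>x. p (- x)) has_real_derivative - q (- x)) (at x)" for x by (rule refl[OF p])
  have 3: "bounded_modulus (\<lambda>x. p (- x))" "bounded_modulus (\<lambda>x. - q (- x))"
   by (intro bounded_modulus_minus bounded_modulus_compose[OF bm(1), of _ 1] bounded_modulus_compose[OF bm(2), of _ 1]; simp add: dist_real_def)+
  have 4: "(a x)^2 * - q (- x) / 2 + b x * p (- x) = - ((?a (- x))^2 * q (- x) / 2 + ?b (- x) * p (- x))" for x by simp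
  have 5: "\<bar>(a x)^2 * - q (- x) / 2 + b x * p (- x)\<bar> \<le> C" for x using L[of "- x"] unfolding 4 abs_minus_cancel .
  have 6: "(a x)^2 * - q (- x) / 2 + b x * p (- x) = - 1" if "e \<le> \<bar>x\<bar> \<and> \<bar>x\<bar> \<le> R" for x using L1[of "- x"] that unfolding 4 by simp
  show "\<exists>g p q. test_function a b R m C (- 1) e g p q"
   unfolding test_function_def
  proof (rule exI[of _ "\<lambda>x. - g (- x)"], rule exI[of _ "\<lambda>x. p (- x)"], rule exI[of _ "\<lambda>x. - q (- x)"], intro conjI allI impI)
   show "m \<le> p (- x)" "p (- x) \<le> C" for x using mC by simp_all
  qed (rule 1 2 3 5 6, assumption?)+
 qed
qed

section \<open>Smooth approximation of the positive part\<close>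

definition smooth_pos :: "real => real => real" where "smooth_pos d z = (z + sqrt (z^2 + d^2)) / 2"
definition smooth_pos' :: "real => real => real" where "smooth_pos' d z = (1 + z / sqrt (z^2 + d^2)) / 2"
definition smooth_pos'' :: "real => real => real" where "smooth_pos'' d z = d^2 / (2 * sqrt (z^2 + d^2) ^ 3)"

text \<open>The graph of \<open>smooth_pos d\<close> is a branch of a hyperbola asymptotic to the
  graph of the positive part; the error is largest at 0, where it is \<open>d / 2\<close>. The third
  derivative is computed only to give the second one its modulus.\<close>

lemma smooth_pos_deriv:
 assumes d: "0 < d"
 shows "(smooth_pos d has_real_derivative smooth_pos' d z) (at z)" "(smooth_pos' d has_real_derivative smooth_pos'' d z) (at z)"
  "bounded_modulus (smooth_pos' d)" "bounded_modulus (smooth_pos'' d)" "0 \<le> smooth_pos' d z" "smooth_pos' d z \<le> 1" "0 \<le> smooth_pos'' d z"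
  "max z 0 \<le> smooth_pos d z" "smooth_pos d z \<le> max z 0 + d / 2"
proof -
 define s where "s z = sqrt (z^2 + d^2)" for z
 have pos: "0 < z^2 + d^2" for z using d by (simp add: add_nonneg_pos)
 have s: "0 < s z" "d \<le> s z" "\<bar>z\<bar> \<le> s z" "s z \<le> \<bar>z\<bar> + d" "(s z)^2 = z^2 + d^2" for z
 proof -
  show "0 < s z" "(s z)^2 = z^2 + d^2" using pos[of z] by (simp_all add: s_def)
  show "d \<le> s z" "\<bar>z\<bar> \<le> s z" unfolding s_def using d by (auto intro!: real_le_rsqrt)
  show "s z \<le> \<bar>z\<bar> + d" unfolding s_def using d by (intro real_le_lsqrt) (auto simp: power2_sum)
 qed
 have s': "(s has_real_derivative z / s z) (at z)" for z
  unfolding s_def[abs_def] using pos[of z] by (auto intro!: derivative_eq_intros simp: field_simps)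
 have E: "smooth_pos d = (\<lambda>z. (z + s z) / 2)" "smooth_pos' d = (\<lambda>z. (1 + z / s z) / 2)" "smooth_pos'' d = (\<lambda>z. d^2 / (2 * s z ^ 3))"
  by (auto simp: smooth_pos_def smooth_pos'_def smooth_pos''_def s_def)
 show 1: "(smooth_pos d has_real_derivative smooth_pos' d z) (at z)" for z
  unfolding E by (rule DERIV_cong[OF DERIV_cdivide[OF DERIV_add[OF DERIV_ident s']]]) simp
 show 2: "(smooth_pos' d has_real_derivative smooth_pos'' d z) (at z)" for z
 proof -
  have "((\<lambda>z. z / s z) has_real_derivative (1 * s z - z * (z / s z)) / (s z * s z)) (at z)"
   using s(1)[of z] by (intro DERIV_divide DERIV_ident s') auto
  then have "((\<lambda>z. (1 + z / s z) / 2) has_real_derivative (0 + (1 * s z - z * (z / s z)) / (s z * s z)) / 2) (at z)"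
   by (intro DERIV_cdivide DERIV_add DERIV_const)
  moreover have "(0 + (1 * s z - z * (z / s z)) / (s z * s z)) / 2 = d^2 / (2 * s z ^ 3)"
  proof -
   have "d^2 = s z * s z - z * z" using s(5)[of z] by (simp add: power2_eq_square)
   then show ?thesis using s(1)[of z] by (simp add: field_simps power3_eq_cube)
  qed
  ultimately show ?thesis unfolding E by simp
 qed
 have zs: "\<bar>z / s z\<bar> \<le> 1" for z using s(1,3)[of z] by (simp add: abs_divide)
 have "- 1 \<le> z / s z" "z / s z \<le> 1" for z using zs[of z] by linarith+
 note zs' = this
 show 3: "0 \<le> smooth_pos' d z" "smooth_pos' d z \<le> 1" for z unfolding E using zs'[of z] by simp_all
 show 4: "0 \<le> smooth_pos'' d z" for z unfolding E using s(1)[of z] by simp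
 have b2: "\<bar>smooth_pos'' d z\<bar> \<le> d^2 / (2 * d^3)" for z
 proof -
  have "d ^ 3 \<le> s z ^ 3" using s(2)[of z] d by (intro power_mono) auto
  then have "d^2 / (2 * s z ^ 3) \<le> d^2 / (2 * d^3)" using d s(1)[of z] by (intro divide_left_mono) auto
  then show ?thesis using 4[of z] by (simp add: E)
 qed
 show "bounded_modulus (smooth_pos' d)" using 3 by (intro bounded_modulusI[OF 2 b2, of 1]) (simp add: abs_le_iff)
 have 5: "(smooth_pos'' d has_real_derivative - (3 * d^2 * z) / (2 * s z ^ 5)) (at z)" for z
 proof -
  have "((\<lambda>z. 2 * s z ^ 3) has_real_derivative 2 * (of_nat 3 * (z / s z * s z ^ (3 - Suc 0)))) (at z)"
   by (intro DERIV_cmult DERIV_power s')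
  then have "((\<lambda>z. d^2 / (2 * s z ^ 3)) has_real_derivative (0 * (2 * s z ^ 3) - d^2 * (2 * (of_nat 3 * (z / s z * s z ^ (3 - Suc 0))))) / (2 * s z ^ 3 * (2 * s z ^ 3))) (at z)"
   using s(1)[of z] by (intro DERIV_divide DERIV_const) auto
  then show ?thesis unfolding E
   by (rule DERIV_cong) (use s(1)[of z] in \<open>simp add: field_simps eval_nat_numeral\<close>)
 qed
 have "\<bar>- (3 * d^2 * z) / (2 * s z ^ 5)\<bar> \<le> 3 * d^2 / (2 * d ^ 4)" for z
 proof -
  have "\<bar>- (3 * d^2 * z) / (2 * s z ^ 5)\<bar> = 3 * d^2 / (2 * s z ^ 4) * \<bar>z / s z\<bar>"
   using s(1)[of z] by (simp add: abs_mult abs_divide eval_nat_numeral)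
  also have "\<dots> \<le> 3 * d^2 / (2 * s z ^ 4) * 1" using s(1)[of z] by (intro mult_left_mono zs) simp
  also have "\<dots> \<le> 3 * d^2 / (2 * d ^ 4)"
  proof -
   have "d ^ 4 \<le> s z ^ 4" using s(2)[of z] d by (intro power_mono) auto
   then show ?thesis using d s(1)[of z] by (simp add: divide_left_mono)
  qed
  finally show ?thesis .
 qed
 then show "bounded_modulus (smooth_pos'' d)" by (rule bounded_modulusI[OF 5 _ b2])
 show "max z 0 \<le> smooth_pos d z" "smooth_pos d z \<le> max z 0 + d / 2" unfolding E using s(3,4)[of z] by auto
qed

text \<open>At 0 the derivative \<open>smooth_pos' d\<close> is \<open>1/2\<close> for every
  positive \<open>d\<close>, whence the restriction to \<open>z \<noteq> 0\<close>.\<close>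

lemma smooth_pos_tendsto:
 assumes d: "\<And>n. 0 < d n" "d \<longlonglongrightarrow> 0"
 shows "(\<lambda>n. smooth_pos (d n) z) \<longlonglongrightarrow> max z 0" "z \<noteq> 0 ==> (\<lambda>n. smooth_pos' (d n) z) \<longlonglongrightarrow> (if 0 < z then 1 else 0)"
proof -
 have l: "(\<lambda>n. sqrt (z^2 + (d n)^2)) \<longlonglongrightarrow> \<bar>z\<bar>"
  using tendsto_real_sqrt[OF tendsto_add[OF tendsto_const tendsto_power[OF d(2), of 2]], of "z^2"] by simp
 show "(\<lambda>n. smooth_pos (d n) z) \<longlonglongrightarrow> max z 0"
 proof -
  have "max z 0 = (z + \<bar>z\<bar>) / 2" by simp
  then show ?thesis unfolding smooth_pos_def by (simp only:) (intro tendsto_intros l, simp)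
 qed
 assume z: "z \<noteq> 0"
 have "(\<lambda>n. (1 + z / sqrt (z^2 + (d n)^2)) / 2) \<longlonglongrightarrow> (1 + z / \<bar>z\<bar>) / 2"
  using z by (intro tendsto_intros l) auto
 then show "(\<lambda>n. smooth_pos' (d n) z) \<longlonglongrightarrow> (if 0 < z then 1 else 0)"
  unfolding smooth_pos'_def using z by (simp add: abs_if split: if_splits)
qed

section \<open>Consequences of the (LT) condition\<close>

lemma set_integral_stopped:
 fixes f :: "real => real"
 assumes f: "set_integrable lborel {0..t} f" and s: "0 \<le> s" "s \<le> t"
 shows "(LBINT r:{0..s}. f r) = (LBINT r:{0..t}. if r < s then f r else 0)"
proof -
 have "(LBINT r:{0..s}. f r) = (LBINT r:{0..<s}. f r)"
 proof (rule set_integral_cong_set)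
  have "set_borel_measurable lborel {0..s} f"
   using set_integrable_subset[OF f, of "{0..s}"] s by (simp add: set_borel_measurable_def set_integrable_def borel_measurable_integrable)
  then show "set_borel_measurable lborel {0..s} f" "set_borel_measurable lborel {0..<s} f"
   by (auto intro: set_borel_measurable_subset)
  have "AE r in lborel. r \<noteq> s" by (rule AE_lborel_singleton)
  then show "AE r in lborel. (r \<in> {0..<s}) = (r \<in> {0..s})" by eventually_elim auto
 qed
 also have "\<dots> = (LBINT r:{0..t}. if r < s then f r else 0)"
  unfolding set_lebesgue_integral_def using s by (intro Bochner_Integration.integral_cong) (auto simp: indicator_def)
 finally show ?thesis .
qed

section \<open>Time integrals of bounded measurable processes\<close>

context filtered_prob_space
begin

text \<open>Indicators of a continuous process and stopped integrands have discontinuous paths.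
  Joint measurability and a uniform bound are what the convergence of expected time integrals rests
  on.\<close>

definition bounded_process :: "real => (real => 'w => real) => bool" where
 "bounded_process K g \<longleftrightarrow> (\<lambda>p. g (max 0 (fst p)) (snd p)) \<in> borel_measurable (borel \<Otimes>\<^sub>M M) \<and> (\<forall>r\<ge>0. \<forall>w\<in>space M. \<bar>g r w\<bar> \<le> K)"

lemma bounded_process_integral:
 assumes g: "bounded_process K g" and t: "0 \<le> t"
 shows "w \<in> space M ==> set_integrable lborel {0..t} (\<lambda>r. g r w)" "w \<in> space M ==> \<bar>LBINT r:{0..t}. g r w\<bar> \<le> K * t"
  "integrable M (\<lambda>w. LBINT r:{0..t}. g r w)"
proof -
 have eq: "(LBINT r:{0..t}. g (max 0 r) w) = (LBINT r:{0..t}. g r w)" for w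
  by (intro set_lebesgue_integral_cong) (auto simp: max_absorb2)
 have m: "(\<lambda>r. g (max 0 r) w) \<in> borel_measurable borel" if "w \<in> space M" for w
 proof -
  have "(\<lambda>p. g (max 0 (fst p)) (snd p)) \<in> borel_measurable (borel \<Otimes>\<^sub>M M)" using g by (simp add: bounded_process_def)
  from measurable_compose[OF measurable_Pair2'[OF that] this] show ?thesis by simp
 qed
 have b: "\<bar>g (max 0 r) w\<bar> \<le> K" if "w \<in> space M" for r w using g that by (simp add: bounded_process_def)
 show 1: "\<bar>LBINT r:{0..t}. g r w\<bar> \<le> K * t" if "w \<in> space M" for w
  using set_integral_Icc_bounded(2)[OF m[OF that] b[OF that] t] by (simp add: eq)
 show "set_integrable lborel {0..t} (\<lambda>r. g r w)" if "w \<in> space M" for w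
  using set_integral_Icc_bounded(1)[OF m[OF that] b[OF that] t]
  by (rule set_integrable_cong[OF refl refl, THEN iffD1, rotated]) (simp add: max_absorb2)
 have "(\<lambda>w. LBINT r:{0..t}. g (max 0 r) w) \<in> borel_measurable M"
  using g by (intro set_integral_joint_measurable) (auto simp: bounded_process_def)
 then show "integrable M (\<lambda>w. LBINT r:{0..t}. g r w)" unfolding eq by (rule bounded_integrable) (rule 1)
qed

lemma bounded_process_tendsto:
 assumes g: "\<And>n. bounded_process K (g n)" and h: "bounded_process K h" and t: "0 \<le> t"
  and lim: "\<And>r w. 0 \<le> r ==> w \<in> space M ==> (\<lambda>n. g n r w) \<longlonglongrightarrow> h r w"
 shows "(\<lambda>n. \<E> (\<lambda>w. LBINT r:{0..t}. g n r w)) \<longlonglongrightarrow> \<E> (\<lambda>w. LBINT r:{0..t}. h r w)"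
proof (rule integral_dominated_convergence[where w="\<lambda>_. K * t"])
 note gi = bounded_process_integral[OF g t] and hi = bounded_process_integral[OF h t]
 show "(\<lambda>w. LBINT r:{0..t}. h r w) \<in> borel_measurable M" "(\<lambda>w. LBINT r:{0..t}. g n r w) \<in> borel_measurable M" for n
  using gi(3) hi(3) by (simp_all add: borel_measurable_integrable)
 show "AE w in M. norm (LBINT r:{0..t}. g n r w) \<le> K * t" for n using gi(2) by (intro AE_I2) simp
 show "AE w in M. (\<lambda>n. LBINT r:{0..t}. g n r w) \<longlonglongrightarrow> (LBINT r:{0..t}. h r w)"
 proof (rule AE_I2)
  fix w assume w: "w \<in> space M"
  show "(\<lambda>n. LBINT r:{0..t}. g n r w) \<longlonglongrightarrow> (LBINT r:{0..t}. h r w)"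
   unfolding set_lebesgue_integral_def
  proof (rule integral_dominated_convergence[where w="\<lambda>r. indicator {0..t} r * K"])
   show "(\<lambda>r. indicat_real {0..t} r *\<^sub>R h r w) \<in> borel_measurable lborel" "(\<lambda>r. indicat_real {0..t} r *\<^sub>R g n r w) \<in> borel_measurable lborel" for n
    using gi(1)[OF w] hi(1)[OF w] by (simp_all add: set_integrable_def borel_measurable_integrable)
   show "AE r in lborel. (\<lambda>n. indicat_real {0..t} r *\<^sub>R g n r w) \<longlonglongrightarrow> indicat_real {0..t} r *\<^sub>R h r w"
    using lim[OF _ w] by (intro AE_I2) (simp add: indicator_def)
   show "AE r in lborel. norm (indicat_real {0..t} r *\<^sub>R g n r w) \<le> indicator {0..t} r * K" for n
    using g[of n] w by (intro AE_I2) (simp add: indicator_def bounded_process_def)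
   show "integrable lborel (\<lambda>r. indicat_real {0..t} r * K)"
    using borel_integrable_atLeastAtMost'[of 0 t "\<lambda>_. K"] by (simp add: set_integrable_def)
  qed
 qed
qed simp

lemma bounded_process_compose:
 assumes "adapted X" "adapted Y"
  and h: "(\<lambda>p. h (fst p) (snd p)) \<in> borel_measurable (borel \<Otimes>\<^sub>M borel)" "\<And>x y. \<bar>h x y\<bar> \<le> K"
 shows "bounded_process K (\<lambda>r w. h (X r w) (Y r w))"
proof -
 have "(\<lambda>p. (X (max 0 (fst p)) (snd p), Y (max 0 (fst p)) (snd p))) \<in> borel \<Otimes>\<^sub>M M \<rightarrow>\<^sub>M borel \<Otimes>\<^sub>M borel"
  using assms by (intro measurable_Pair continuous_adapted_joint_measurable(1))
 from measurable_compose[OF this h(1)] show ?thesis using h(2) by (simp add: bounded_process_def)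
qed

lemma bounded_process_stopped:
 assumes g: "bounded_process K g" and \<tau>[measurable]: "\<tau> \<in> borel_measurable M" and K: "0 \<le> K"
 shows "bounded_process K (\<lambda>r w. if r < \<tau> w then g r w else 0)"
proof -
 have [measurable]: "(\<lambda>p. g (max 0 (fst p)) (snd p)) \<in> borel_measurable (borel \<Otimes>\<^sub>M M)" using g by (simp add: bounded_process_def)
 have "(\<lambda>p. if max 0 (fst p) < \<tau> (snd p) then g (max 0 (fst p)) (snd p) else 0) \<in> borel_measurable (borel \<Otimes>\<^sub>M M)" by measurable
 then show ?thesis using g K by (simp add: bounded_process_def)
qed

end

section \<open>Tanaka's formula in expectation\<close>

context brownian_space
begin

text \<open>Even the integral of 0 must exhibit a bracket of \<open>B\<close> and the local
  martingale property of \<open>B\<close>; both are taken from the integral given in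
  \<open>BI\<close>.\<close>

lemma zero_ito_process:
 assumes BI: "bounded_integral c H I"
 shows "ito_process c (\<lambda>_ _. 0) (\<lambda>_ _. 0) (\<lambda>_ _. 0) (\<lambda>_ _. 0)"
proof -
 obtain Q where Q: "is_bracket M F B Q" and B: "continuous_local_martingale M F B"
  using BI unfolding bounded_integral_def has_local_mart_integral_def by blast
 have ca: "adapted (\<lambda>_ _. 0)" by (simp add: continuous_adapted_def)
 have z: "tendsto_zero_in_prob M (\<lambda>n w. 0)" by (simp add: tendsto_zero_in_prob_def)
 let ?K = "(0 :: nat, \<lambda>_. 0 :: real, \<lambda>_ _. 0 :: real) :: 'a simple_proc"
 have K: "simple_process M F ?K" "\<And>s w. simple_value ?K s w = 0" "\<And>s w. simple_integral ?K B s w = 0"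
  by (auto simp: simple_process_def simple_value_def simple_integral_def mono_def)
 have "has_local_mart_integral M F B (\<lambda>_ _. 0) (\<lambda>_ _. 0)"
  unfolding has_local_mart_integral_def
 proof (intro conjI exI[of _ Q] exI[of _ "\<lambda>_. ?K"] allI impI)
  show "progressive F (\<lambda>_ _. 0)" by (simp add: progressive_def case_prod_beta)
  fix t :: real assume "0 \<le> t"
  then show "tendsto_zero_in_prob M (\<lambda>n w. SUP s\<in>{0..t}. ennreal \<bar>simple_integral ?K B s w - 0\<bar>)" using z by (simp add: K)
 qed (use Q B ca z K in simp_all)
 then show ?thesis using BI ca
  by (simp add: ito_process_def bounded_integral_def set_lebesgue_integral_def)
qed

text \<open>\<open>LT_condition\<close> starts both solutions from one constant. Putting the initial
  value into the bounded variation part makes 0 that constant, so the formula holds for any two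
  initial values, in particular for \<open>X\<close> and the zero process.\<close>

lemma LT_expectation:
 assumes LT: "LT_condition TYPE('a) a"
  and X: "ito_process c X (\<lambda>s w. a (X s w)) \<beta> I" and Y: "ito_process c Y (\<lambda>s w. a (Y s w)) \<beta>' I'" and t: "0 \<le> t"
 shows "has_bochner_integral M (\<lambda>w. max (X t w - Y t w) 0 - max (X 0 w - Y 0 w) 0
  - (LBINT r:{0..t}. (if X r w - Y r w > 0 then 1 else 0) * (\<beta> r w - \<beta>' r w))) 0"
proof (rule vanishing_local_time_expectation[OF X Y t])
 have sol: "\<exists>V. adapted V \<and> bounded_variation_process M V \<and> solves M F B a (\<lambda>_. 0) V X"
  if X: "ito_process c X (\<lambda>s w. a (X s w)) \<beta> I" for X \<beta> I
 proof -
  let ?V = "\<lambda>t w. X 0 w + (LBINT r:{0..t}. \<beta> r w)"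
  have Xc: "adapted X" and \<beta>: "adapted \<beta>" "\<And>r w. 0 \<le> r ==> w \<in> space M ==> \<bar>\<beta> r w\<bar> \<le> c"
   using X by (auto simp: ito_process_def)
  have "adapted (\<lambda>t. X 0)"
   using continuous_adapted_measurable_le[OF Xc, of 0] by (simp add: continuous_adapted_def)
  then have "adapted ?V" by (intro continuous_adapted_add continuous_adapted_integral[OF \<beta>])
  moreover have "total_variation (\<lambda>s. ?V s w) t < \<infinity>" if w: "w \<in> space M" for w t
  proof -
   have "\<bar>?V y w - ?V x w\<bar> \<le> c * y - c * x" if "0 \<le> x" "x \<le> y" for x y
   proof -
    have "continuous_on {0..} (\<lambda>r. \<beta> r w)" using \<beta>(1) w by (simp add: continuous_adapted_def)
    from set_integral_lipschitz[OF this \<beta>(2)[OF _ w] that] show ?thesis by (simp add: right_diff_distrib)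
   qed
   then have "total_variation (\<lambda>s. ?V s w) t \<le> ennreal (c * t - c * 0)" by (rule total_variation_le)
   then show ?thesis by (rule le_less_trans) simp
  qed
  moreover have "indistinguishable M X (\<lambda>t w. 0 + I t w + ?V t w)"
   using X by (simp add: ito_process_def indistinguishable_def ac_simps)
  ultimately show ?thesis
   using X unfolding solves_def bounded_variation_process_def ito_process_def bounded_integral_def by blast
 qed
 have M: "filtered_prob_space M F" by unfold_locales
 obtain V V' where "adapted V" "bounded_variation_process M V" "solves M F B a (\<lambda>_. 0) V X"
  "adapted V'" "bounded_variation_process M V'" "solves M F B a (\<lambda>_. 0) V' Y" using sol[OF X] sol[OF Y] by blast
 then show "is_local_time_at_zero M F (\<lambda>t w. X t w - Y t w) (\<lambda>t w. 0)"
  using LT M BM unfolding LT_condition_def by blast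
qed

text \<open>Comparison with the zero process in both orders gives Tanaka's formulas for the positive
  and the negative part of \<open>X\<close>. Set against the equation for their difference
  \<open>X\<close>, they leave the drift accumulated while \<open>X = 0\<close>, which is
  \<open>b 0\<close> times the time spent there.\<close>

lemma occupation_of_zero:
 assumes LT: "LT_condition TYPE('a) a" and a0: "a 0 = 0" and b0: "b 0 \<noteq> 0" and b: "continuous_on UNIV b" "\<And>x. \<bar>b x\<bar> \<le> c"
  and X: "ito_process c X (\<lambda>s w. a (X s w)) (\<lambda>s w. b (X s w)) I" and t: "0 \<le> t"
 shows "\<E> (\<lambda>w. LBINT r:{0..t}. if X r w = 0 then 1 else 0 :: real) = 0"
proof -
 have BI: "bounded_integral c (\<lambda>s w. a (X s w)) I" and Xc: "adapted X" and c: "0 \<le> c"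
  using X by (auto simp: ito_process_def bounded_integral_def)
 have [measurable]: "b \<in> borel_measurable borel" using b(1) by (rule borel_measurable_continuous_onI)
 have bp: "bounded_process c (\<lambda>r w. h (X r w))" if "h \<in> borel_measurable borel" "\<And>x. \<bar>h x\<bar> \<le> c" for h
  using bounded_process_compose[OF Xc Xc, of "\<lambda>x _. h x" c] that by simp
 have Z: "ito_process c (\<lambda>_ _. 0) (\<lambda>s w. a 0) (\<lambda>_ _. 0) (\<lambda>_ _. 0)" using zero_ito_process[OF BI] by (simp add: a0)
 let ?p = "\<lambda>w. max (X t w) 0 - max (X 0 w) 0 - (LBINT r:{0..t}. if 0 < X r w then b (X r w) else 0)"
 let ?n = "\<lambda>w. max (- X t w) 0 - max (- X 0 w) 0 - (LBINT r:{0..t}. - (if X r w < 0 then b (X r w) else 0))"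
 have 1: "has_bochner_integral M ?p 0" "has_bochner_integral M ?n 0"
  using LT_expectation[OF LT X Z t] LT_expectation[OF LT Z X t] by (simp_all add: if_distrib[of "\<lambda>x. x * _"] cong: if_cong)
 have 2: "has_bochner_integral M (\<lambda>w. I t w - I 0 w) 0" using bounded_integral_incr[OF BI order_refl t, of "\<lambda>_. 1" 1] by simp
 let ?J = "\<lambda>w. LBINT r:{0..t}. if X r w = 0 then 1 else 0 :: real"
 have "AE w in M. ?p w - ?n w - (I t w - I 0 w) = b 0 * ?J w"
 proof -
  have "AE w in M. \<forall>t\<ge>0. X t w = X 0 w + I t w + (LBINT r:{0..t}. b (X r w))" using X by (simp add: ito_process_def)
  then show ?thesis using bounded_integral_0[OF BI] AE_space
  proof eventually_elim
   case (elim w)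
   note i = bounded_process_integral(1)[OF bp t elim(3)]
   have i': "set_integrable lborel {0..t} (\<lambda>r. b (X r w))" "set_integrable lborel {0..t} (\<lambda>r. if 0 < X r w then b (X r w) else 0)"
    "set_integrable lborel {0..t} (\<lambda>r. - (if X r w < 0 then b (X r w) else 0))"
    by (rule i[of b] i[of "\<lambda>x. if 0 < x then b x else 0"] i[of "\<lambda>x. - (if x < 0 then b x else 0)"]; use b(2) c in simp)+
   have "b 0 * ?J w = (LBINT r:{0..t}. b 0 * (if X r w = 0 then 1 else 0))" by simp
   also have "\<dots> = (LBINT r:{0..t}. b (X r w) - (if 0 < X r w then b (X r w) else 0) + (- (if X r w < 0 then b (X r w) else 0)))"
    by (intro set_lebesgue_integral_cong) auto
   also have "\<dots> = (LBINT r:{0..t}. b (X r w)) - (LBINT r:{0..t}. if 0 < X r w then b (X r w) else 0)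
    + (LBINT r:{0..t}. - (if X r w < 0 then b (X r w) else 0))"
    by (simp only: set_integral_add(2)[OF set_integral_diff(1)[OF i'(1) i'(2)] i'(3)] set_integral_diff(2)[OF i'(1) i'(2)])
   finally show ?case using elim(1)[rule_format, OF t] elim(2) by (simp add: max_def)
  qed
 qed
 moreover have "has_bochner_integral M (\<lambda>w. ?p w - ?n w - (I t w - I 0 w)) 0"
  using has_bochner_integral_diff[OF has_bochner_integral_diff[OF 1] 2] by simp
 moreover have "integrable M ?J"
  using bounded_process_integral(3)[OF bounded_process_compose[OF Xc Xc, of "\<lambda>x _. if x = 0 then 1 else 0" 1] t] by simp
 ultimately have "\<E> (\<lambda>w. b 0 * ?J w) = 0"
  by (subst integral_cong_AE[symmetric]) (auto simp: has_bochner_integral_iff borel_measurable_integrable)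
 then show ?thesis using b0 by simp
qed

end

section \<open>Ito's formula for the smoothed maximum\<close>

lemma smooth_pos_measurable[measurable]:
 assumes d: "0 < d"
 shows "smooth_pos d \<in> borel_measurable borel" "smooth_pos' d \<in> borel_measurable borel" "smooth_pos'' d \<in> borel_measurable borel"
 unfolding smooth_pos_def[abs_def] smooth_pos'_def[abs_def] smooth_pos''_def[abs_def] by measurable

definition smooth_max :: "real => real => real => real" where "smooth_max d x y = x + smooth_pos d (y - x)"

text \<open>For \<open>p\<close>, \<open>q\<close> the derivatives of \<open>g\<close>: the Ito
  drift of \<open>g (smooth_max d X Y)\<close> without the term containing
  \<open>smooth_pos''\<close>. The coefficients of the smoothed maximum are convex combinations of
  those of \<open>X\<close> and \<open>Y\<close>, with weight \<open>smooth_pos'\<close> on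
  \<open>Y\<close>.\<close>

definition smooth_drift :: "real => (real => real) => (real => real) => (real => real) => (real => real) => real => real => real" where
 "smooth_drift d a b p q x y = p (smooth_max d x y) * ((1 - smooth_pos' d (y - x)) * b x + smooth_pos' d (y - x) * b y)
  + q (smooth_max d x y) * ((1 - smooth_pos' d (y - x)) * a x + smooth_pos' d (y - x) * a y)^2 / 2"

context brownian_space
begin

text \<open>Ito's formula combined with optional stopping. In the drift the second derivative of
  \<open>g\<close> multiplies a square, and that of the smoothing multiplies the squared difference
  of the two diffusion coefficients, which is the approximate local time.\<close>

lemma ito_smooth_max:
 fixes t :: real
 assumes X: "ito_process c X (\<lambda>s w. a (X s w)) (\<lambda>s w. b (X s w)) I" and Y: "ito_process c Y (\<lambda>s w. a (Y s w)) (\<lambda>s w. b (Y s w)) I'"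
  and d: "0 < d" and g: "\<And>x. (g has_real_derivative p x) (at x)" "\<And>x. (p has_real_derivative q x) (at x)"
  and pq: "bounded_modulus p" "bounded_modulus q" and t: "0 \<le> t"
  and \<tau>: "\<And>w. w \<in> space M ==> 0 \<le> \<tau> w" "\<And>w. w \<in> space M ==> \<tau> w \<le> t" "\<And>s. 0 < s ==> s \<le> t ==> {w\<in>space M. \<tau> w < s} \<in> sets (F s)"
 defines "L \<equiv> \<lambda>r w. smooth_drift d a b p q (X r w) (Y r w)
  + p (smooth_max d (X r w) (Y r w)) * (smooth_pos'' d (Y r w - X r w) * (a (Y r w) - a (X r w))^2 / 2)"
 shows "adapted L"
  "has_bochner_integral M (\<lambda>w. g (smooth_max d (X (\<tau> w) w) (Y (\<tau> w) w)) - g (smooth_max d (X 0 w) (Y 0 w))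
  - (LBINT r:{0..t}. if r < \<tau> w then L r w else 0)) 0"
proof -
 let ?m = "\<lambda>t w. g (smooth_max d (X t w) (Y t w)) - g (smooth_max d (X 0 w) (Y 0 w)) - (LBINT r:{0..t}. L r w)"
 have drift: "P * (1 + - \<phi>) * bx + P * \<phi> * bY + ((Q * ((1 + - \<phi>) * (1 + - \<phi>)) + P * \<phi>2) * (ax * ax)
   + 2 * (Q * (\<phi> * (1 + - \<phi>)) + - (P * \<phi>2)) * (ax * ay) + (Q * (\<phi> * \<phi>) + P * \<phi>2) * (ay * ay)) / 2
  = P * ((1 - \<phi>) * bx + \<phi> * bY) + Q * ((1 - \<phi>) * ax + \<phi> * ay)^2 / 2 + P * (\<phi>2 * (ay - ax)^2 / 2)"
  for P Q \<phi> \<phi>2 ax ay bx bY :: real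
  by (simp add: field_simps power2_eq_square)
 have m: "adapted L" "L2_martingale ?m"
  using ito_L2_martingale(1,3)[OF X Y someI_ex[OF uniform_C2_compose[OF g pq smooth_pos_deriv(1-4)[OF d]]]] by (simp_all only: ito_drift_def fst_conv snd_conv drift smooth_max_def smooth_drift_def L_def)
 show "adapted L" by (rule m(1))
 have mc: "adapted ?m" using m(2) by (simp add: L2_martingale_def)
 have "\<E> (\<lambda>w. ?m (\<tau> w) w) = \<E> (?m 0)" by (rule optional_stopping(3)[OF m(2) t \<tau>])
 then have "\<E> (\<lambda>w. ?m (\<tau> w) w) = 0" by (simp add: set_integral_singleton)
 moreover have "(\<lambda>w. ?m (\<tau> w) w) \<in> borel_measurable M" by (rule measurable_F[OF t], rule stopped_measurable(1)[OF mc t \<tau>])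
 moreover have "integrable M (\<lambda>w. (?m (\<tau> w) w)^2)" by (rule optional_stopping(1)[OF m(2) t \<tau>])
 ultimately have "has_bochner_integral M (\<lambda>w. ?m (\<tau> w) w) 0" by (simp add: has_bochner_integral_iff square_integrable_imp_integrable)
 moreover have "(LBINT r:{0..\<tau> w}. L r w) = (LBINT r:{0..t}. if r < \<tau> w then L r w else 0)" if "w \<in> space M" for w
  using m(1) that \<tau> by (intro set_integral_stopped continuous_path_integrable) (auto simp: continuous_adapted_def)
 ultimately show "has_bochner_integral M (\<lambda>w. g (smooth_max d (X (\<tau> w) w) (Y (\<tau> w) w)) - g (smooth_max d (X 0 w) (Y 0 w))
  - (LBINT r:{0..t}. if r < \<tau> w then L r w else 0)) 0" by (simp cong: has_bochner_integral_cong)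
qed

text \<open>Ito's formula with \<open>g\<close> the identity describes the smoothed maximum, (LT)
  the true one. In expectation their difference leaves the second order term on one side and, on the
  other, the smoothing error \<open>U\<close>, at most \<open>d n\<close>, and the drift error
  \<open>h\<close>; both tend to 0.\<close>

lemma smooth_second_order_tendsto:
 assumes LT: "LT_condition TYPE('a) a" and ab: "continuous_on UNIV a" "continuous_on UNIV b" "\<And>x. \<bar>a x\<bar> \<le> c" "\<And>x. \<bar>b x\<bar> \<le> c"
  and X: "ito_process c X (\<lambda>s w. a (X s w)) (\<lambda>s w. b (X s w)) I" and Y: "ito_process c Y (\<lambda>s w. a (Y s w)) (\<lambda>s w. b (Y s w)) I'"
  and t: "0 \<le> t" and d: "\<And>n. 0 < d n" "d \<longlonglongrightarrow> 0"
 shows "integrable M (\<lambda>w. LBINT r:{0..t}. smooth_pos'' (d n) (Y r w - X r w) * (a (Y r w) - a (X r w))^2 / 2)"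
  "w \<in> space M ==> set_integrable lborel {0..t} (\<lambda>r. smooth_pos'' (d n) (Y r w - X r w) * (a (Y r w) - a (X r w))^2 / 2)"
  "(\<lambda>n. \<E> (\<lambda>w. LBINT r:{0..t}. smooth_pos'' (d n) (Y r w - X r w) * (a (Y r w) - a (X r w))^2 / 2)) \<longlonglongrightarrow> 0"
proof -
 have BI: "bounded_integral c (\<lambda>s w. a (X s w)) I" and XY: "adapted X" "adapted Y" and c: "0 \<le> c"
  using X Y by (auto simp: ito_process_def bounded_integral_def)
 have [measurable]: "a \<in> borel_measurable borel" "b \<in> borel_measurable borel" using ab(1,2) by (auto intro: borel_measurable_continuous_onI)
 note [measurable] = smooth_pos_measurable[OF d(1)]
 define A where "A n r w = smooth_pos'' (d n) (Y r w - X r w) * (a (Y r w) - a (X r w))^2 / 2" for n r w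
 have A: "\<exists>K. bounded_process K (A n)" for n
 proof -
  obtain K where K: "\<And>z. \<bar>smooth_pos'' (d n) z\<bar> \<le> K" using smooth_pos_deriv(4)[OF d(1)] unfolding bounded_modulus_def by blast
  have "\<bar>smooth_pos'' (d n) (y - x) * (a y - a x)^2 / 2\<bar> \<le> K * (2 * c)^2" for x y
  proof -
   have "\<bar>a y - a x\<bar> \<le> 2 * c" using ab(3)[of x] ab(3)[of y] by linarith
   then have "(a y - a x)^2 \<le> (2 * c)^2" using power_mono[of "\<bar>a y - a x\<bar>" "2 * c" 2] by simp
   then have "\<bar>smooth_pos'' (d n) (y - x) * (a y - a x)^2\<bar> \<le> K * (2 * c)^2"
    unfolding abs_mult using K[of "y - x"] by (intro mult_mono) auto
   then show ?thesis by simp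
  qed
  then have "bounded_process (K * (2 * c)^2) (\<lambda>r w. smooth_pos'' (d n) (Y r w - X r w) * (a (Y r w) - a (X r w))^2 / 2)"
   by (intro bounded_process_compose[OF XY, where h="\<lambda>x y. smooth_pos'' (d n) (y - x) * (a y - a x)^2 / 2"]) measurable
  then show ?thesis unfolding A_def by blast
 qed
 then have Ai: "integrable M (\<lambda>w. LBINT r:{0..t}. A n r w)" for n
  using bounded_process_integral(3)[OF _ t] by blast
 show "integrable M (\<lambda>w. LBINT r:{0..t}. smooth_pos'' (d n) (Y r w - X r w) * (a (Y r w) - a (X r w))^2 / 2)"
  using Ai unfolding A_def .
 show Ap: "set_integrable lborel {0..t} (\<lambda>r. smooth_pos'' (d n) (Y r w - X r w) * (a (Y r w) - a (X r w))^2 / 2)" if "w \<in> space M" for n w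
  using A[of n] bounded_process_integral(1)[OF _ t that] unfolding A_def by blast
 let ?b = "\<lambda>r w. b (Y r w) - b (X r w)" and ?Z = "\<lambda>r w. Y r w - X r w"
 have bd: "\<bar>b y - b x\<bar> \<le> 2 * c" for x y using ab(4)[of x] ab(4)[of y] by linarith
 define h where "h n r w = (smooth_pos' (d n) (?Z r w) - (if 0 < ?Z r w then 1 else 0)) * ?b r w" for n r w
 have h: "bounded_process (1 * (2 * c)) (h n)" for n
 proof -
  have "\<bar>(smooth_pos' (d n) (y - x) - (if 0 < y - x then 1 else 0)) * (b y - b x)\<bar> \<le> 1 * (2 * c)" for x y
   unfolding abs_mult using bd smooth_pos_deriv(5,6)[OF d(1)[of n], of "y - x"] by (intro mult_mono) auto
  then have "bounded_process (1 * (2 * c)) (\<lambda>r w. (smooth_pos' (d n) (?Z r w) - (if 0 < ?Z r w then 1 else 0)) * ?b r w)"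
   by (intro bounded_process_compose[OF XY, where h="\<lambda>x y. (smooth_pos' (d n) (y - x) - (if 0 < y - x then 1 else 0)) * (b y - b x)"]) measurable
  then show ?thesis by (simp add: h_def[abs_def])
 qed
 have h0: "(\<lambda>n. \<E> (\<lambda>w. LBINT r:{0..t}. h n r w)) \<longlonglongrightarrow> \<E> (\<lambda>w. LBINT r:{0..t}. 0)"
 proof (rule bounded_process_tendsto[OF h _ t])
  show "bounded_process (1 * (2 * c)) (\<lambda>_ _. 0)" using c by (simp add: bounded_process_def)
  \<comment> \<open>On \<open>Z = 0\<close> the derivative of the smoothing stays at
    \<open>1/2\<close> and does not approach the indicator, but there the two drifts agree and
    \<open>h\<close> is 0.\<close>
  show "(\<lambda>n. h n r w) \<longlonglongrightarrow> 0" for r w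
  proof (cases "?Z r w = 0")
   case False
   then have "(\<lambda>n. (smooth_pos' (d n) (?Z r w) - (if 0 < ?Z r w then 1 else 0)) * ?b r w) \<longlonglongrightarrow> ((if 0 < ?Z r w then 1 else 0) - (if 0 < ?Z r w then 1 else 0)) * ?b r w"
    by (intro tendsto_mult tendsto_diff tendsto_const smooth_pos_tendsto(2) d)
   then show ?thesis by (simp add: h_def)
  qed (simp add: h_def)
 qed
 define U where "U n w = (smooth_pos (d n) (?Z t w) - max (?Z t w) 0) - (smooth_pos (d n) (?Z 0 w) - max (?Z 0 w) 0)" for n w
 have [measurable]: "X t \<in> borel_measurable M" "Y t \<in> borel_measurable M" "X 0 \<in> borel_measurable M" "Y 0 \<in> borel_measurable M"
  using continuous_adapted_measurable_M[OF XY(1)] continuous_adapted_measurable_M[OF XY(2)] t by auto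
 have Ub: "\<bar>U n w\<bar> \<le> d n" for n w
  using smooth_pos_deriv(8,9)[OF d(1)[of n], of "?Z t w"] smooth_pos_deriv(8,9)[OF d(1)[of n], of "?Z 0 w"] unfolding U_def by linarith
 have Um: "U n \<in> borel_measurable M" for n unfolding U_def by measurable
 have Ui: "integrable M (U n)" for n by (rule bounded_integrable[OF Um Ub])
 have U0: "(\<lambda>n. \<E> (U n)) \<longlonglongrightarrow> 0"
 proof (rule tendsto_rabs_zero_cancel, rule tendsto_sandwich[where f="\<lambda>_. 0"])
  show "\<forall>\<^sub>F n in sequentially. \<bar>\<E> (U n)\<bar> \<le> d n"
  proof (intro always_eventually allI)
   fix n
   have "\<bar>\<E> (U n)\<bar> \<le> \<E> (\<lambda>w. \<bar>U n w\<bar>)" by (rule integral_abs_bound)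
   also have "\<dots> \<le> \<E> (\<lambda>_. d n)" using Ui Ub by (intro integral_mono) auto
   finally show "\<bar>\<E> (U n)\<bar> \<le> d n" by (simp add: prob_space)
  qed
 qed (use d(2) in auto)
 have "\<E> (\<lambda>w. LBINT r:{0..t}. A n r w) = \<E> (U n) - \<E> (\<lambda>w. LBINT r:{0..t}. h n r w)" for n
 proof -
  let ?\<phi> = "\<lambda>r w. smooth_pos' (d n) (?Z r w)"
  let ?L = "\<lambda>r w. smooth_drift (d n) a b (\<lambda>_. 1) (\<lambda>_. 0) (X r w) (Y r w) + 1 * (smooth_pos'' (d n) (?Z r w) * (a (Y r w) - a (X r w))^2 / 2)"
  have 1: "has_bochner_integral M (\<lambda>w. smooth_max (d n) (X t w) (Y t w) - smooth_max (d n) (X 0 w) (Y 0 w)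
   - (LBINT r:{0..t}. if r < t then ?L r w else 0)) 0"
   by (rule ito_smooth_max(2)[OF X Y d(1), where g="\<lambda>x. x" and p="\<lambda>_. 1" and q="\<lambda>_. 0" and \<tau>="\<lambda>_. t"])
    (auto intro!: derivative_eq_intros bounded_modulus_const t)
  have 2: "has_bochner_integral M (\<lambda>w. I t w - I 0 w) 0" using bounded_integral_incr[OF BI order_refl t, of "\<lambda>_. 1" 1] by simp
  note 3 = LT_expectation[OF LT Y X t]
  \<comment> \<open>\<open>smooth_max\<close> contains \<open>X\<close> itself, while (LT) speaks of
    \<open>max (Y - X) 0\<close>; the martingale part of \<open>X\<close> is therefore subtracted as
    well.\<close>
  let ?D = "\<lambda>w. smooth_max (d n) (X t w) (Y t w) - smooth_max (d n) (X 0 w) (Y 0 w) - (LBINT r:{0..t}. if r < t then ?L r w else 0)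
   - (I t w - I 0 w) - (max (?Z t w) 0 - max (?Z 0 w) 0 - (LBINT r:{0..t}. (if ?Z r w > 0 then 1 else 0) * ?b r w))"
  have D: "has_bochner_integral M ?D 0" using has_bochner_integral_diff[OF has_bochner_integral_diff[OF 1 2] 3] by simp
  have "AE w in M. \<forall>t\<ge>0. X t w = X 0 w + I t w + (LBINT r:{0..t}. b (X r w))" using X by (simp add: ito_process_def)
  then have eq: "AE w in M. ?D w = U n w - (LBINT r:{0..t}. h n r w) - (LBINT r:{0..t}. A n r w)"
   using bounded_integral_0[OF BI] AE_space
  proof eventually_elim
   case (elim w)
   have hi: "set_integrable lborel {0..t} (\<lambda>r. h n r w)" by (rule bounded_process_integral(1)[OF h t elim(3)])
   have Ai': "set_integrable lborel {0..t} (\<lambda>r. A n r w)" using Ap[OF elim(3)] by (simp add: A_def)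
   have bi: "set_integrable lborel {0..t} (\<lambda>r. b (X r w))"
    using bounded_process_integral(1)[OF bounded_process_compose[OF XY, of "\<lambda>x y. b x" c] t elim(3)] ab(4) by simp
   have zi: "set_integrable lborel {0..t} (\<lambda>r. (if ?Z r w > 0 then 1 else 0) * ?b r w)"
    using bounded_process_integral(1)[OF bounded_process_compose[OF XY, of "\<lambda>x y. (if y - x > 0 then 1 else 0) * (b y - b x)" "2 * c"] t elim(3)] bd c by simp
   let ?S = "\<lambda>r. b (X r w) + h n r w + (if ?Z r w > 0 then 1 else 0) * ?b r w + A n r w"
   have "?L r w = ?S r" for r by (simp add: smooth_drift_def h_def A_def algebra_simps)
   then have "(LBINT r:{0..t}. if r < t then ?L r w else 0) = (LBINT r:{0..t}. if r < t then ?S r else 0)" by (simp only:)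
   also have "\<dots> = (LBINT r:{0..t}. ?S r)"
    by (rule set_integral_stopped[symmetric, OF _ t order_refl]) (intro set_integral_add bi hi zi Ai')
   also have "\<dots> = (LBINT r:{0..t}. b (X r w)) + (LBINT r:{0..t}. h n r w) + (LBINT r:{0..t}. (if ?Z r w > 0 then 1 else 0) * ?b r w) + (LBINT r:{0..t}. A n r w)"
    by (simp only: set_integral_add(2)[OF set_integral_add(1)[OF set_integral_add(1)[OF bi hi] zi] Ai']
     set_integral_add(2)[OF set_integral_add(1)[OF bi hi] zi] set_integral_add(2)[OF bi hi])
   finally show ?case using elim(1)[rule_format, OF t] elim(2) by (simp add: U_def smooth_max_def)
  qed
  have "\<E> ?D = \<E> (\<lambda>w. U n w - (LBINT r:{0..t}. h n r w) - (LBINT r:{0..t}. A n r w))"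
  proof (rule integral_cong_AE[OF _ _ eq])
   show "?D \<in> borel_measurable M" by (rule borel_measurable_integrable[OF integrable.intros[OF D]])
   show "(\<lambda>w. U n w - (LBINT r:{0..t}. h n r w) - (LBINT r:{0..t}. A n r w)) \<in> borel_measurable M"
    using borel_measurable_integrable[OF bounded_process_integral(3)[OF h t, of n]] borel_measurable_integrable[OF Ai[of n]] Um[of n] by simp
  qed
  also have "\<dots> = \<E> (U n) - \<E> (\<lambda>w. LBINT r:{0..t}. h n r w) - \<E> (\<lambda>w. LBINT r:{0..t}. A n r w)"
   using Ui bounded_process_integral(3)[OF h t] Ai by simp
  finally show ?thesis using has_bochner_integral_integral_eq[OF D] by linarith
 qed
 moreover have "(\<lambda>n. \<E> (U n) - \<E> (\<lambda>w. LBINT r:{0..t}. h n r w)) \<longlonglongrightarrow> 0"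
  using tendsto_diff[OF U0 h0] by simp
 ultimately have "(\<lambda>n. \<E> (\<lambda>w. LBINT r:{0..t}. A n r w)) \<longlonglongrightarrow> 0" by (simp only:)
 then show "(\<lambda>n. \<E> (\<lambda>w. LBINT r:{0..t}. smooth_pos'' (d n) (?Z r w) * (a (Y r w) - a (X r w))^2 / 2)) \<longlonglongrightarrow> 0"
  unfolding A_def .
qed

end

section \<open>Comparison of solutions\<close>

lemma set_integrable_stopped:
 fixes f :: "real => real"
 assumes "set_integrable lborel {0..t} f"
 shows "set_integrable lborel {0..t} (\<lambda>r. if r < s then f r else 0)"
proof -
 have "set_integrable lborel ({0..t} \<inter> {..<s}) f" by (rule set_integrable_subset[OF assms]) auto
 moreover have "(\<lambda>r. indicat_real ({0..t} \<inter> {..<s}) r *\<^sub>R f r) = (\<lambda>r. indicat_real {0..t} r *\<^sub>R (if r < s then f r else 0))"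
  by (auto simp: indicator_def fun_eq_iff)
 ultimately show ?thesis by (simp only: set_integrable_def)
qed

lemma smooth_drift_bound:
 assumes d: "0 < d" and ab: "\<And>x. \<bar>a x\<bar> \<le> c" "\<And>x. \<bar>b x\<bar> \<le> c" and pq: "\<And>x. \<bar>p x\<bar> \<le> K" "\<And>x. \<bar>q x\<bar> \<le> K"
 shows "\<bar>smooth_drift d a b p q x y\<bar> \<le> K * c + K * c^2"
proof -
 let ?\<phi> = "smooth_pos' d (y - x)"
 have \<phi>: "0 \<le> ?\<phi>" "?\<phi> \<le> 1" using smooth_pos_deriv(5,6)[OF d] by auto
 have conv: "\<bar>(1 - ?\<phi>) * u + ?\<phi> * v\<bar> \<le> c" if "\<bar>u\<bar> \<le> c" "\<bar>v\<bar> \<le> c" for u v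
 proof -
  have "\<bar>(1 - ?\<phi>) * u + ?\<phi> * v\<bar> \<le> (1 - ?\<phi>) * c + ?\<phi> * c"
   using \<phi> that by (intro order_trans[OF abs_triangle_ineq] add_mono) (auto simp: abs_mult intro!: mult_left_mono)
  then show ?thesis by (simp add: algebra_simps)
 qed
 have K: "0 \<le> K" using pq(1)[of 0] by linarith
 have 1: "\<bar>p (smooth_max d x y) * ((1 - ?\<phi>) * b x + ?\<phi> * b y)\<bar> \<le> K * c"
  unfolding abs_mult using K by (intro mult_mono pq conv ab) auto
 have "((1 - ?\<phi>) * a x + ?\<phi> * a y)^2 \<le> c^2"
  using power_mono[OF conv[OF ab(1)[of x] ab(1)[of y]] abs_ge_zero, of 2] by simp
 then have 2: "\<bar>q (smooth_max d x y) * ((1 - ?\<phi>) * a x + ?\<phi> * a y)^2\<bar> \<le> K * c^2"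
  unfolding abs_mult using K by (intro mult_mono pq) auto
 show ?thesis unfolding smooth_drift_def using 1 2 by linarith
qed

lemma smooth_drift_diagonal: "smooth_drift d a b p q x x = p (smooth_max d x x) * b x + q (smooth_max d x x) * (a x)^2 / 2"
 by (simp add: smooth_drift_def algebra_simps)

text \<open>For \<open>x > y\<close> both drifts have the same limit, and for \<open>x = y\<close>
  they coincide; so subtracting the diagonal value takes care of the point where
  \<open>smooth_pos'\<close> does not approach the indicator.\<close>

lemma smooth_drift_tendsto:
 assumes d: "\<And>n. 0 < d n" "d \<longlonglongrightarrow> 0" and pq: "continuous_on UNIV p" "continuous_on UNIV q"
 shows "(\<lambda>n. smooth_drift (d n) a b p q x y - smooth_drift (d n) a b p q x x) \<longlonglongrightarrow>
  (if x < y then ((a y)^2 * q y / 2 + b y * p y) - ((a x)^2 * q x / 2 + b x * p x) else 0)"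
proof (cases "x = y")
 case False
 have w: "(\<lambda>n. smooth_max (d n) x z) \<longlonglongrightarrow> max x z" for z
 proof -
  have "(\<lambda>n. x + smooth_pos (d n) (z - x)) \<longlonglongrightarrow> x + max (z - x) 0" by (intro tendsto_add tendsto_const smooth_pos_tendsto(1) d)
  moreover have "x + max (z - x) 0 = max x z" by linarith
  ultimately show ?thesis by (simp only: smooth_max_def)
 qed
 have lim: "(\<lambda>n. h (smooth_max (d n) x z)) \<longlonglongrightarrow> h (max x z)" if "continuous_on UNIV h" for h :: "real => real" and z
  using continuous_on_tendsto_compose[OF that w] by simp
 let ?\<phi> = "if 0 < y - x then 1 else 0 :: real"
 have "(\<lambda>n. smooth_drift (d n) a b p q x y) \<longlonglongrightarrow> p (max x y) * ((1 - ?\<phi>) * b x + ?\<phi> * b y) + q (max x y) * ((1 - ?\<phi>) * a x + ?\<phi> * a y)^2 / 2"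
  unfolding smooth_drift_def using False by (intro tendsto_intros lim pq smooth_pos_tendsto(2) d) auto
 moreover have "(\<lambda>n. smooth_drift (d n) a b p q x x) \<longlonglongrightarrow> p (max x x) * b x + q (max x x) * (a x)^2 / 2"
  unfolding smooth_drift_diagonal by (intro tendsto_intros lim pq) auto
 ultimately have "(\<lambda>n. smooth_drift (d n) a b p q x y - smooth_drift (d n) a b p q x x) \<longlonglongrightarrow>
  (p (max x y) * ((1 - ?\<phi>) * b x + ?\<phi> * b y) + q (max x y) * ((1 - ?\<phi>) * a x + ?\<phi> * a y)^2 / 2) - (p (max x x) * b x + q (max x x) * (a x)^2 / 2)"
  by (rule tendsto_diff)
 also have "(p (max x y) * ((1 - ?\<phi>) * b x + ?\<phi> * b y) + q (max x y) * ((1 - ?\<phi>) * a x + ?\<phi> * a y)^2 / 2) - (p (max x x) * b x + q (max x x) * (a x)^2 / 2)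
  = (if x < y then ((a y)^2 * q y / 2 + b y * p y) - ((a x)^2 * q x / 2 + b x * p x) else 0)"
  using False by (simp add: max_def mult.commute)
 finally show ?thesis .
qed simp

text \<open>The increment of \<open>smooth_max\<close> is at least
  \<open>max (y - x) 0 - d / 2\<close>. By the mean value theorem a derivative between
  \<open>m\<close> and \<open>C\<close> turns this into the bound, also if the increment is
  negative.\<close>

lemma smooth_max_increment:
 assumes d: "0 < d" and g: "\<And>x. (g has_real_derivative p x) (at x)" "\<And>x. m \<le> p x \<and> p x \<le> C" and m: "0 < m"
 shows "m * max (y - x) 0 - C * d \<le> g (smooth_max d x y) - g (smooth_max d x x)"
proof -
 let ?u = "smooth_max d x y" and ?v = "smooth_max d x x" and ?z = "max (y - x) 0"
 have "?z \<le> smooth_pos d (y - x)" "smooth_pos d 0 \<le> d / 2" using smooth_pos_deriv(8)[OF d] smooth_pos_deriv(9)[OF d, of 0] by simp_all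
 then have uv: "?z - d / 2 \<le> ?u - ?v" unfolding smooth_max_def diff_self by linarith
 have C: "m \<le> C" using g(2)[of 0] by linarith
 obtain s where s: "g ?u - g ?v = (?u - ?v) * p s"
 proof (cases ?u ?v rule: linorder_cases)
  case less
  then obtain s where "g ?v - g ?u = (?v - ?u) * p s" using MVT2[OF less, of g p] g(1) by blast
  then show ?thesis by (intro that[of s]) (simp add: algebra_simps)
 next
  case greater
  then show ?thesis using MVT2[OF greater, of g p] g(1) that by blast
 qed (use that[of 0] in simp)
 have p: "0 < p s" "m \<le> p s" "p s \<le> C" using g(2)[of s] m by auto
 have "m * ?z \<le> p s * ?z" using p by (intro mult_right_mono) auto
 moreover have "p s * (?z - d / 2) \<le> p s * (?u - ?v)" using uv p by (intro mult_left_mono) auto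
 moreover have "p s * (d / 2) \<le> C * d" using p d C m by (intro mult_mono) auto
 ultimately show ?thesis unfolding s by (simp add: algebra_simps)
qed

context brownian_space
begin

text \<open>The formula for the pair \<open>X\<close>, \<open>X\<close> is subtracted from that for
  \<open>X\<close>, \<open>Y\<close> with the same smoothing. The smoothing is removed for fixed
  \<open>e\<close>, and \<open>e\<close> tends to 0 only afterwards, because the bound on
  \<open>q\<close> depends on \<open>e\<close>.\<close>

lemma stopped_comparison:
 fixes t :: real
 assumes LT: "LT_condition TYPE('a) a" and ab: "continuous_on UNIV a" "continuous_on UNIV b" "\<And>x. \<bar>a x\<bar> \<le> c" "\<And>x. \<bar>b x\<bar> \<le> c"
  and a0: "a 0 = 0" "\<And>x. x \<noteq> 0 ==> a x \<noteq> 0" and b0: "b 0 \<noteq> 0"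
  and X: "ito_process c X (\<lambda>s w. a (X s w)) (\<lambda>s w. b (X s w)) I" and Y: "ito_process c Y (\<lambda>s w. a (Y s w)) (\<lambda>s w. b (Y s w)) I'"
  and eq0: "AE w in M. X 0 w = Y 0 w" and t: "0 \<le> t" and R: "0 < R"
 defines "\<tau> \<equiv> exit_time (\<lambda>s w. max \<bar>X s w\<bar> \<bar>Y s w\<bar>) R t"
 shows "AE w in M. Y (\<tau> w) w \<le> X (\<tau> w) w"
proof -
 have XY: "adapted X" "adapted Y" and c: "0 \<le> c"
  using X Y by (auto simp: ito_process_def bounded_integral_def)
 have [measurable]: "a \<in> borel_measurable borel" "b \<in> borel_measurable borel" using ab(1,2) by (auto intro: borel_measurable_continuous_onI)
 have "adapted (\<lambda>s w. max \<bar>X s w\<bar> \<bar>Y s w\<bar>)"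
  using continuous_adapted_compose2[OF XY, of "\<lambda>p. max \<bar>fst p\<bar> \<bar>snd p\<bar>"] by (simp add: continuous_on_max continuous_on_fst continuous_on_snd continuous_on_rabs)
 then have \<tau>: "\<And>w. w \<in> space M ==> 0 \<le> \<tau> w" "\<And>w. w \<in> space M ==> \<tau> w \<le> t" "\<And>s. 0 < s ==> s \<le> t ==> {w\<in>space M. \<tau> w < s} \<in> sets (F s)"
  unfolding \<tau>_def using exit_time_bounds[OF t] exit_time_optional[OF _ t] by auto
 have before: "\<bar>X r w\<bar> \<le> R" "\<bar>Y r w\<bar> \<le> R" if "0 \<le> r" "r < \<tau> w" for r w
  using before_exit_time[OF t that(1) that(2)[unfolded \<tau>_def]] by auto
 have Xm[measurable]: "(\<lambda>w. X (\<tau> w) w) \<in> borel_measurable M" by (rule measurable_F[OF t], rule stopped_measurable(1)[OF XY(1) t \<tau>])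
 have Ym[measurable]: "(\<lambda>w. Y (\<tau> w) w) \<in> borel_measurable M" by (rule measurable_F[OF t], rule stopped_measurable(1)[OF XY(2) t \<tau>])
 have "adapted (\<lambda>s w. s)" by (simp add: continuous_adapted_def continuous_on_id)
 then have \<tau>m: "\<tau> \<in> borel_measurable M" by (intro measurable_F[OF t]) (rule stopped_measurable(1)[OF _ t \<tau>, of "\<lambda>s w. s"])
 obtain m C k where m: "0 < m" and test: "\<And>e. 0 < e ==> \<exists>g p q. test_function a b R m C k e g p q"
  by (rule test_function[OF ab(1) a0(2) ab(2) _ _ b0 R, of "max 1 c"]) (use ab(4) in \<open>auto simp: le_max_iff_disj\<close>)
 define W where "W w = max (Y (\<tau> w) w - X (\<tau> w) w) 0" for w
 have Wm: "W \<in> borel_measurable M" unfolding W_def by measurable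
 have W0: "0 \<le> W w" for w by (simp add: W_def)
 \<comment> \<open>At least 1 as soon as one of the processes is within \<open>e\<close> of 0, where
   the equation for \<open>g\<close> is given up.\<close>
 define near where "near e r w = (if \<bar>X r w\<bar> < e then 1 else 0) + (if \<bar>Y r w\<bar> < e then 1 else 0 :: real)" for e r w
 have near: "bounded_process 2 (near e)" for e
  unfolding near_def[abs_def]
 proof (rule bounded_process_compose[OF XY, where h="\<lambda>x y. (if \<bar>x\<bar> < e then 1 else 0) + (if \<bar>y\<bar> < e then 1 else 0)"])
  show "\<bar>(if \<bar>x\<bar> < e then 1 else 0) + (if \<bar>y\<bar> < e then 1 else 0 :: real)\<bar> \<le> 2" for x y by (cases "\<bar>x\<bar> < e"; cases "\<bar>y\<bar> < e") simp_all
 qed measurable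
 have key: "integrable M W" "m * \<E> W \<le> 2 * C * \<E> (\<lambda>w. LBINT r:{0..t}. near e r w)" if e: "0 < e" for e
 proof -
  obtain g p q where g: "\<And>x. (g has_real_derivative p x) (at x)" "\<And>x. (p has_real_derivative q x) (at x)"
   and pq: "bounded_modulus p" "bounded_modulus q" and pb: "\<And>x. m \<le> p x \<and> p x \<le> C"
   and L: "\<And>x. \<bar>(a x)^2 * q x / 2 + b x * p x\<bar> \<le> C" "\<And>x. e \<le> \<bar>x\<bar> ==> \<bar>x\<bar> \<le> R ==> (a x)^2 * q x / 2 + b x * p x = k"
   using test[OF e] unfolding test_function_def by blast
  have C: "0 < C" using pb[of 0] m by linarith
  have pqc: "continuous_on UNIV p" "continuous_on UNIV q" using pq by (auto simp: bounded_modulus_def square_modulus_continuous)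
  then have [measurable]: "p \<in> borel_measurable borel" "q \<in> borel_measurable borel" by (auto intro: borel_measurable_continuous_onI)
  obtain K1 K2 where "\<And>x. \<bar>p x\<bar> \<le> K1" "\<And>x. \<bar>q x\<bar> \<le> K2" using pq by (auto simp: bounded_modulus_def)
  then have K: "\<bar>p x\<bar> \<le> max K1 K2" "\<bar>q x\<bar> \<le> max K1 K2" for x by (simp_all add: le_max_iff_disj)
  define d where "d n = inverse (real (Suc n))" for n
  have d: "0 < d n" "d \<longlonglongrightarrow> 0" for n unfolding d_def[abs_def] using LIMSEQ_inverse_real_of_nat by (simp_all del: of_nat_Suc)
  define N where "N = max K1 K2 * c + max K1 K2 * c^2"
  have sb: "\<bar>smooth_drift (d n) a b p q x y\<bar> \<le> N" for n x y unfolding N_def by (rule smooth_drift_bound[OF d(1) ab(3,4) K])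
  let ?l = "\<lambda>x. (a x)^2 * q x / 2 + b x * p x"
  define G where "G n r w = smooth_drift (d n) a b p q (X r w) (Y r w) - smooth_drift (d n) a b p q (X r w) (X r w)" for n r w
  define A where "A n r w = smooth_pos'' (d n) (Y r w - X r w) * (a (Y r w) - a (X r w))^2 / 2" for n r w
  define H where "H r w = (if X r w < Y r w then ?l (Y r w) - ?l (X r w) else 0)" for r w
  note [measurable] = smooth_pos_measurable[OF d(1)]
  \<comment> \<open>\<open>2 * N\<close> bounds \<open>G n\<close> and \<open>2 * C\<close> its
    limit \<open>H\<close>; the maximum is a common bound for dominated convergence.\<close>
  have G: "bounded_process (max (2 * N) (2 * C)) (G n)" for n
   unfolding G_def[abs_def]
  proof (rule bounded_process_compose[OF XY, where h="\<lambda>x y. smooth_drift (d n) a b p q x y - smooth_drift (d n) a b p q x x"])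
   show "\<bar>smooth_drift (d n) a b p q x y - smooth_drift (d n) a b p q x x\<bar> \<le> max (2 * N) (2 * C)" for x y
    using sb[of n x y] sb[of n x x] by linarith
  qed (unfold smooth_drift_def smooth_max_def, measurable)
  have H: "bounded_process (max (2 * N) (2 * C)) H"
   unfolding H_def[abs_def]
  proof (rule bounded_process_compose[OF XY, where h="\<lambda>x y. if x < y then ?l y - ?l x else 0"])
   show "\<bar>if x < y then ?l y - ?l x else 0\<bar> \<le> max (2 * N) (2 * C)" for x y
   proof -
    have "\<bar>?l y - ?l x\<bar> \<le> 2 * C" using L(1)[of x] L(1)[of y] by linarith
    then show ?thesis using C by (simp add: le_max_iff_disj)
   qed
  qed measurable
  have NC: "0 \<le> max (2 * N) (2 * C)" using C by simp
  note Gs = bounded_process_stopped[OF G \<tau>m NC] and Hs = bounded_process_stopped[OF H \<tau>m NC]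
  let ?st = "\<lambda>f w. LBINT r:{0..t}. if r < \<tau> w then f r w else (0 :: real)"
  note A2 = smooth_second_order_tendsto[OF LT ab X Y t d, folded A_def]
  have le: "integrable M W \<and> m * \<E> W \<le> C * d n + \<E> (?st (G n)) + C * \<E> (\<lambda>w. LBINT r:{0..t}. A n r w)" for n
  proof -
   let ?sm = "smooth_max (d n)" and ?sd = "smooth_drift (d n) a b p q"
   let ?L = "\<lambda>r w. ?sd (X r w) (Y r w) + p (?sm (X r w) (Y r w)) * A n r w" and ?L' = "\<lambda>r w. ?sd (X r w) (X r w)"
   have ix1: "adapted ?L" using ito_smooth_max(1)[OF X Y d(1)[of n] g pq t \<tau>] by (simp only: A_def)
   have ix2: "has_bochner_integral M (\<lambda>w. g (?sm (X (\<tau> w) w) (Y (\<tau> w) w)) - g (?sm (X 0 w) (Y 0 w)) - ?st ?L w) 0"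
    using ito_smooth_max(2)[OF X Y d(1)[of n] g pq t \<tau>] by (simp only: A_def)
   \<comment> \<open>On the diagonal the second order term is 0 because the diffusion coefficients
     coincide.\<close>
   have L': "?L' r w = ?sd (X r w) (X r w) + p (?sm (X r w) (X r w)) * (smooth_pos'' (d n) (X r w - X r w) * (a (X r w) - a (X r w))^2 / 2)" for r w by simp
   have ix1': "adapted ?L'" using ito_smooth_max(1)[OF X X d(1)[of n] g pq t \<tau>] by (simp only: L'[symmetric])
   have ix2': "has_bochner_integral M (\<lambda>w. g (?sm (X (\<tau> w) w) (X (\<tau> w) w)) - g (?sm (X 0 w) (X 0 w)) - ?st ?L' w) 0"
    using ito_smooth_max(2)[OF X X d(1)[of n] g pq t \<tau>] by (simp only: L'[symmetric])
   define P where "P w = g (?sm (X (\<tau> w) w) (Y (\<tau> w) w)) - g (?sm (X 0 w) (Y 0 w)) - ?st ?L w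
    - (g (?sm (X (\<tau> w) w) (X (\<tau> w) w)) - g (?sm (X 0 w) (X 0 w)) - ?st ?L' w)" for w
   have P: "integrable M P" "\<E> P = 0" using has_bochner_integral_diff[OF ix2 ix2'] by (simp_all add: has_bochner_integral_iff P_def[abs_def])
   define Q where "Q w = P w + C * d n + ?st (G n) w + C * (LBINT r:{0..t}. A n r w)" for w
   have Gi: "integrable M (?st (G n))" by (rule bounded_process_integral(3)[OF Gs t])
   have Q: "integrable M Q" unfolding Q_def using P(1) Gi A2(1)[of n] by simp
   have "AE w in M. m * W w \<le> Q w"
    using eq0 AE_space
   proof eventually_elim
    case (elim w)
    have i: "set_integrable lborel {0..t} (\<lambda>r. Z r w)" if "adapted Z" for Z
     using that elim(2) by (intro continuous_path_integrable) (auto simp: continuous_adapted_def)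
    note i1 = set_integrable_stopped[OF i[OF ix1], of "\<tau> w"] and i2 = set_integrable_stopped[OF i[OF ix1'], of "\<tau> w"]
    have Gw: "set_integrable lborel {0..t} (\<lambda>r. if r < \<tau> w then G n r w else 0)" by (rule bounded_process_integral(1)[OF Gs t elim(2)])
    have Aw: "set_integrable lborel {0..t} (\<lambda>r. C * A n r w)" using A2(2)[OF elim(2), of n] by simp
    have "?st ?L w - ?st ?L' w = (LBINT r:{0..t}. (if r < \<tau> w then ?L r w else 0) - (if r < \<tau> w then ?L' r w else 0))"
     by (rule set_integral_diff(2)[OF i1 i2, symmetric])
    also have "\<dots> \<le> (LBINT r:{0..t}. (if r < \<tau> w then G n r w else 0) + C * A n r w)"
    proof (rule set_integral_mono[OF set_integral_diff(1)[OF i1 i2] set_integral_add(1)[OF Gw Aw]])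
     fix r
     \<comment> \<open>Nonnegativity allows the weight \<open>p\<close> to be replaced by
       \<open>C\<close> and the restriction to \<open>r < \<tau> w\<close> to be dropped.\<close>
     have A0: "0 \<le> A n r w" unfolding A_def using smooth_pos_deriv(7)[OF d(1)] by simp
     then have "p (?sm (X r w) (Y r w)) * A n r w \<le> C * A n r w" using pb by (intro mult_right_mono) auto
     moreover have "0 \<le> C * A n r w" using A0 C by simp
     ultimately show "(if r < \<tau> w then ?L r w else 0) - (if r < \<tau> w then ?L' r w else 0) \<le> (if r < \<tau> w then G n r w else 0) + C * A n r w"
      by (simp add: G_def)
    qed
    also have "\<dots> = ?st (G n) w + C * (LBINT r:{0..t}. A n r w)" by (subst set_integral_add(2)[OF Gw Aw]) simp
    finally have "?st ?L w - ?st ?L' w \<le> ?st (G n) w + C * (LBINT r:{0..t}. A n r w)" .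
    moreover have "m * W w - C * d n \<le> g (?sm (X (\<tau> w) w) (Y (\<tau> w) w)) - g (?sm (X (\<tau> w) w) (X (\<tau> w) w))"
     unfolding W_def by (rule smooth_max_increment[OF d(1) g(1) pb m])
    ultimately show ?case using elim(1) unfolding Q_def P_def by simp
   qed
   note le = this
   have Wi: "integrable M W"
   proof (rule Bochner_Integration.integrable_bound[OF _ Wm])
    show "integrable M (\<lambda>w. Q w / m)" using Q by simp
    show "AE w in M. norm (W w) \<le> norm (Q w / m)"
     using le
    proof eventually_elim
     case (elim w)
     then have "W w \<le> Q w / m" using m by (simp add: field_simps)
     then show ?case unfolding real_norm_def using W0[of w] by linarith
    qed
   qed
   have "m * \<E> W = \<E> (\<lambda>w. m * W w)" by simp
   also have "\<dots> \<le> \<E> Q" using Wi Q le by (intro integral_mono_AE) auto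
   also have "\<dots> = C * d n + \<E> (?st (G n)) + C * \<E> (\<lambda>w. LBINT r:{0..t}. A n r w)"
    unfolding Q_def using P Gi A2(1)[of n] by (simp add: prob_space)
   finally show ?thesis using Wi by simp
  qed
  then show "integrable M W" by blast
  have "(\<lambda>n. C * d n + \<E> (?st (G n)) + C * \<E> (\<lambda>w. LBINT r:{0..t}. A n r w)) \<longlonglongrightarrow> C * 0 + \<E> (?st H) + C * 0"
  proof (intro tendsto_add tendsto_mult tendsto_const d(2) A2(3))
   show "(\<lambda>n. \<E> (?st (G n))) \<longlonglongrightarrow> \<E> (?st H)"
   proof (rule bounded_process_tendsto[OF Gs Hs t])
    show "(\<lambda>n. if r < \<tau> w then G n r w else 0) \<longlonglongrightarrow> (if r < \<tau> w then H r w else 0)" for r w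
     using smooth_drift_tendsto[OF d pqc, of a b "X r w" "Y r w"] by (simp add: G_def H_def)
   qed
  qed
  then have "m * \<E> W \<le> \<E> (?st H)" using le by (intro LIMSEQ_le_const[of _ _ "m * \<E> W"]) auto
  also have "\<dots> \<le> \<E> (\<lambda>w. 2 * C * (LBINT r:{0..t}. near e r w))"
  proof (rule integral_mono)
   show "integrable M (?st H)" by (rule bounded_process_integral(3)[OF Hs t])
   show "integrable M (\<lambda>w. 2 * C * (LBINT r:{0..t}. near e r w))" using bounded_process_integral(3)[OF near t] by simp
   fix w assume w: "w \<in> space M"
   have "?st H w \<le> (LBINT r:{0..t}. 2 * C * near e r w)"
   proof (rule set_integral_mono)
    show "set_integrable lborel {0..t} (\<lambda>r. if r < \<tau> w then H r w else 0)" by (rule bounded_process_integral(1)[OF Hs t w])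
    show "set_integrable lborel {0..t} (\<lambda>r. 2 * C * near e r w)" using bounded_process_integral(1)[OF near t w] by simp
    fix r assume r: "r \<in> {0..t}"
    show "(if r < \<tau> w then H r w else 0) \<le> 2 * C * near e r w"
    proof (cases "r < \<tau> w \<and> near e r w < 1")
     case True
     then have "e \<le> \<bar>X r w\<bar>" "e \<le> \<bar>Y r w\<bar>" by (auto simp: near_def split: if_splits)
     \<comment> \<open>Before \<open>\<tau>\<close> both processes lie in \<open>[-R, R]\<close>,
       and here both are outside \<open>(-e, e)\<close>, so both left-hand sides equal
       \<open>k\<close> and cancel.\<close>
     then have "H r w = 0" using L(2) before[of r w] True r by (simp add: H_def)
     then show ?thesis using C by (simp add: near_def)
    next
     case False
     have "?l (Y r w) - ?l (X r w) \<le> 2 * C * 1" using L(1)[of "X r w"] L(1)[of "Y r w"] by linarith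
     then have "H r w \<le> 2 * C * 1" using C by (simp add: H_def)
     moreover have "2 * C * 1 \<le> 2 * C * near e r w" if "1 \<le> near e r w" using that C by (intro mult_left_mono) auto
     moreover have "0 \<le> 2 * C * near e r w" using C by (simp add: near_def)
     ultimately show ?thesis using False by (auto simp: not_less)
    qed
   qed
   then show "?st H w \<le> 2 * C * (LBINT r:{0..t}. near e r w)" by simp
  qed
  finally show "m * \<E> W \<le> 2 * C * \<E> (\<lambda>w. LBINT r:{0..t}. near e r w)" by simp
 qed
 let ?z = "\<lambda>r w. (if X r w = 0 then 1 else 0) + (if Y r w = 0 then 1 else 0 :: real)"
 have zb: "bounded_process 1 (\<lambda>r w. if Z r w = 0 then 1 else 0)" if "adapted Z" for Z
  using bounded_process_compose[OF that that, of "\<lambda>x _. if x = 0 then 1 else 0" 1] by simp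
 have "(\<lambda>n. \<E> (\<lambda>w. LBINT r:{0..t}. near (inverse (real (Suc n))) r w)) \<longlonglongrightarrow> \<E> (\<lambda>w. LBINT r:{0..t}. ?z r w)"
 proof (rule bounded_process_tendsto[OF near _ t])
  show "bounded_process 2 ?z"
  proof (rule bounded_process_compose[OF XY, where h="\<lambda>x y. (if x = 0 then 1 else 0) + (if y = 0 then 1 else 0)"])
   show "\<bar>(if x = 0 then 1 else 0) + (if y = 0 then 1 else 0 :: real)\<bar> \<le> 2" for x y :: real by (cases "x = 0"; cases "y = 0") simp_all
  qed measurable
  have "(\<lambda>n. if \<bar>x\<bar> < inverse (real (Suc n)) then 1 else 0 :: real) \<longlonglongrightarrow> (if x = 0 then 1 else 0)" for x :: real
  proof (cases "x = 0")
   case False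
   have "\<forall>\<^sub>F n in sequentially. inverse (real (Suc n)) < \<bar>x\<bar>"
    using False LIMSEQ_inverse_real_of_nat by (intro order_tendstoD(2)) auto
   then have "\<forall>\<^sub>F n in sequentially. (if \<bar>x\<bar> < inverse (real (Suc n)) then 1 else 0 :: real) = 0" by eventually_elim simp
   then show ?thesis using False by (simp add: tendsto_eventually)
  qed simp
  then show "(\<lambda>n. near (inverse (real (Suc n))) r w) \<longlonglongrightarrow> ?z r w" for r w
   unfolding near_def by (intro tendsto_add)
 qed
 moreover have "\<E> (\<lambda>w. LBINT r:{0..t}. ?z r w) = 0"
 proof -
  have "\<E> (\<lambda>w. LBINT r:{0..t}. ?z r w) = \<E> (\<lambda>w. (LBINT r:{0..t}. if X r w = 0 then 1 else 0) + (LBINT r:{0..t}. if Y r w = 0 then 1 else 0))"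
   by (intro Bochner_Integration.integral_cong refl set_integral_add(2) bounded_process_integral(1)[OF zb t] XY)
  also have "\<dots> = 0" using bounded_process_integral(3)[OF zb[OF XY(1)] t] bounded_process_integral(3)[OF zb[OF XY(2)] t]
   occupation_of_zero[OF LT a0(1) b0 ab(2,4) X t] occupation_of_zero[OF LT a0(1) b0 ab(2,4) Y t] by simp
  finally show ?thesis .
 qed
 ultimately have "(\<lambda>n. 2 * C * \<E> (\<lambda>w. LBINT r:{0..t}. near (inverse (real (Suc n))) r w)) \<longlonglongrightarrow> 0" by (simp add: tendsto_mult_right_zero)
 then have "m * \<E> W \<le> 0" using key(2) by (intro LIMSEQ_le_const[of _ _ "m * \<E> W"]) (auto simp del: of_nat_Suc)
 then have "\<E> W \<le> 0" using m by (simp add: mult_le_0_iff)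
 moreover have "0 \<le> \<E> W" using W0 by (intro Bochner_Integration.integral_nonneg)
 ultimately have "AE w in M. W w = 0" using integral_nonneg_eq_0_iff_AE[OF key(1)[OF zero_less_one]] W0 by simp
 then show ?thesis by eventually_elim (simp add: W_def max_def split: if_splits)
qed

lemma sde_solution_ito_process:
 assumes sde: "sde_solution M F B a b X" and ab: "continuous_on UNIV a" "continuous_on UNIV b" "\<And>x. \<bar>a x\<bar> \<le> c" "\<And>x. \<bar>b x\<bar> \<le> c"
 obtains I where "ito_process c X (\<lambda>s w. a (X s w)) (\<lambda>s w. b (X s w)) I"
proof -
 obtain I where X: "adapted X" and I: "has_local_mart_integral M F B (\<lambda>s w. a (X s w)) I"
  and eq: "indistinguishable M X (\<lambda>t w. X 0 w + I t w + (LBINT s:{0..t}. b (X s w)))"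
  using sde unfolding sde_solution_def solves_def by blast
 have "0 \<le> c" using ab(3)[of 0] by linarith
 then have "ito_process c X (\<lambda>s w. a (X s w)) (\<lambda>s w. b (X s w)) I"
  unfolding ito_process_def bounded_integral_def
  using X I eq[unfolded indistinguishable_def] continuous_adapted_compose[OF X ab(1)] continuous_adapted_compose[OF X ab(2)] ab(3,4) by simp
 then show ?thesis by (rule that)
qed

text \<open>Every path is bounded on \<open>[0, t]\<close>, so for a large radius the exit time is
  \<open>t\<close>; \<open>Suc n\<close> makes all radii positive.\<close>

lemma comparison:
 assumes LT: "LT_condition TYPE('a) a" and ab: "continuous_on UNIV a" "continuous_on UNIV b" "\<And>x. \<bar>a x\<bar> \<le> c" "\<And>x. \<bar>b x\<bar> \<le> c"
  and a0: "a 0 = 0" "\<forall>x. x \<noteq> 0 \<longrightarrow> a x \<noteq> 0" and b0: "b 0 \<noteq> 0"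
  and X: "ito_process c X (\<lambda>s w. a (X s w)) (\<lambda>s w. b (X s w)) I" and Y: "ito_process c Y (\<lambda>s w. a (Y s w)) (\<lambda>s w. b (Y s w)) I'"
  and eq0: "AE w in M. X 0 w = Y 0 w" and t: "0 \<le> t"
 shows "AE w in M. Y t w \<le> X t w"
proof -
 let ?\<tau> = "\<lambda>n. exit_time (\<lambda>s w. max \<bar>X s w\<bar> \<bar>Y s w\<bar>) (real (Suc n)) t"
 have "AE w in M. \<forall>n. Y (?\<tau> n w) w \<le> X (?\<tau> n w) w"
  unfolding AE_all_countable using stopped_comparison[OF LT ab a0(1) a0(2)[rule_format] b0 X Y eq0 t] by simp
 then show ?thesis using AE_space
 proof eventually_elim
  case (elim w)
  have bd: "\<exists>K. \<forall>s\<in>{0..t}. \<bar>Z s w\<bar> \<le> K" if "adapted Z" for Z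
  proof -
   have "continuous_on {0..t} (\<lambda>s. Z s w)" using that elim(2) by (auto simp: continuous_adapted_def intro: continuous_on_subset)
   then have "bounded ((\<lambda>s. Z s w) ` {0..t})" by (intro compact_imp_bounded compact_continuous_image) auto
   then show ?thesis by (auto simp: bounded_iff)
  qed
  have XY: "adapted X" "adapted Y" using X Y by (simp_all add: ito_process_def)
  obtain K where K: "\<forall>s\<in>{0..t}. \<bar>X s w\<bar> \<le> K" using bd[OF XY(1)] ..
  obtain K' where K': "\<forall>s\<in>{0..t}. \<bar>Y s w\<bar> \<le> K'" using bd[OF XY(2)] ..
  obtain n where n: "max K K' \<le> real n" using real_arch_simple by blast
  have "max \<bar>X s w\<bar> \<bar>Y s w\<bar> \<le> real (Suc n)" if "0 \<le> s" "s < t" for s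
  proof -
   have "\<bar>X s w\<bar> \<le> K" "\<bar>Y s w\<bar> \<le> K'" using K K' that by auto
   then show ?thesis using n by simp
  qed
  then have "?\<tau> n w = t" by (rule exit_time_eq[OF t])
  then show ?case using elim(1)[rule_format, of n] by simp
 qed
qed

lemma sde_solutions_indistinguishable:
 assumes LT: "LT_condition TYPE('a) a" and ab: "continuous_on UNIV a" "continuous_on UNIV b" "\<And>x. \<bar>a x\<bar> \<le> c" "\<And>x. \<bar>b x\<bar> \<le> c"
  and a0: "a 0 = 0" "\<forall>x. x \<noteq> 0 \<longrightarrow> a x \<noteq> 0" and b0: "b 0 \<noteq> 0"
  and sde: "sde_solution M F B a b X" "sde_solution M F B a b Y" and eq0: "AE w in M. X 0 w = Y 0 w"
 shows "indistinguishable M X Y"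
proof -
 obtain I I' where X: "ito_process c X (\<lambda>s w. a (X s w)) (\<lambda>s w. b (X s w)) I" and Y: "ito_process c Y (\<lambda>s w. a (Y s w)) (\<lambda>s w. b (Y s w)) I'"
  using sde_solution_ito_process[OF sde(1) ab] sde_solution_ito_process[OF sde(2) ab] by metis
 have eq0': "AE w in M. Y 0 w = X 0 w" using eq0 by eventually_elim simp
 have "AE w in M. X t w = Y t w" if "0 \<le> t" for t
  using comparison[OF LT ab a0 b0 X Y eq0 that] comparison[OF LT ab a0 b0 Y X eq0' that] by eventually_elim simp
 then have "AE w in M. \<forall>t\<in>{q \<in> \<rat>. 0 < q}. X t w = Y t w"
  by (subst AE_ball_countable) (auto intro: countable_subset[OF _ countable_rat])
 then show ?thesis
  unfolding indistinguishable_def using AE_space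
 proof eventually_elim
  case (elim w)
  have "adapted (\<lambda>t w. X t w - Y t w)" using X Y by (intro continuous_adapted_diff) (auto simp: ito_process_def)
  then have "continuous_on {0..} (\<lambda>t. X t w - Y t w)" using elim(2) by (simp add: continuous_adapted_def)
  from continuous_zero_on_rationals[OF this] show ?case using elim(1) by simp
 qed
qed

end

theorem theorem4p3:
  fixes a b :: "real \<Rightarrow> real"
  assumes "bounded (range a)" "continuous_on UNIV a"
    and "bounded (range b)" "continuous_on UNIV b"
    and "LT_condition TYPE('w) a"
    and "a 0 = 0" "\<And>x. x \<noteq> 0 \<Longrightarrow> a x \<noteq> 0" "b 0 \<noteq> 0"
  shows "pathwise_uniqueness TYPE('w) a b"
proof -
 obtain ca cb where "\<And>x. \<bar>a x\<bar> \<le> ca" "\<And>x. \<bar>b x\<bar> \<le> cb" using assms(1,3) by (auto simp: bounded_iff)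
 then have c: "\<bar>a x\<bar> \<le> max ca cb" "\<bar>b x\<bar> \<le> max ca cb" for x by (simp_all add: le_max_iff_disj)
 show ?thesis
  unfolding pathwise_uniqueness_def
 proof (intro allI impI)
  fix M :: "'w measure" and F B X1 X2
  assume "filtered_prob_space M F" "brownian_motion M F B"
  then interpret brownian_space M F B by (intro brownian_space.intro brownian_space_axioms.intro)
  assume "sde_solution M F B a b X1" "sde_solution M F B a b X2" "AE w in M. X1 0 w = X2 0 w"
  then show "indistinguishable M X1 X2"
   using sde_solutions_indistinguishable[OF assms(5,2,4) c assms(6) _ assms(8)] assms(7) by blast
 qed
qed

end
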